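(* Let $k$ be a field, let $\epsilon\in k$ satisfy $\epsilon^2-\epsilon+1=0$, and assume that there is a nonzero $\Delta\in k$ with $\Delta^2=6\epsilon-3$. Let $\pi\colon L(6,3,2)\to L(2,2,2,2)$ be the group homomorphism given by $\pi(\vec{u}_1)=\vec{x}_4$, $\pi(\vec{u}_2)=\vec{c}$, $\pi(\vec{u}_3)=\vec{x}_1+\vec{x}_2+\vec{x}_3$, where $\vec{c}$ is the canonical element of $L(2,2,2,2)$, and let $\phi\colon S(6,3,2)\to S(2,2,2,2;\epsilon)$ be the (well-defined) $k$-algebra homomorphism given by $\phi(u_1)=x_4$, $\phi(u_2)=x_2^2+(\epsilon-1)x_1^2$, $\phi(u_3)=\Delta x_1x_2x_3$. Then $\pi$ is admissible, $\phi(S(6,3,2)_{\vec{u}})\subseteq S(2,2,2,2;\epsilon)_{\pi(\vec{u})}$ for each $\vec{u}\in L(6,3,2)$, and the induced homomorphism $\bar{\phi}\colon\pi_*S(6,3,2)\to S(2,2,2,2;\epsilon)_{{\rm Im}\,\pi}$ is surjective. Consequently, $\bar{\phi}$ is an isomorphism of ${\rm Im}\,\pi$-graded algebras $$\bar{\phi}\colon \pi_*S(6,3,2)\stackrel{\sim}{\longrightarrow}S(2,2,2,2;\epsilon)_{{\rm Im}\,\pi},$$ and there is an equivalence of abelian categories $$({\rm coh}\text{-}\mathbb{X}(6,3,2))^{\mathbb{Z}(2\vec{\omega})}\stackrel{\sim}{\longrightarrow}{\rm coh}\text{-}\mathbb{X}(2,2,2,2;\epsilon),$$ where $\vec{\omega}$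 is the dualizing element of $L(6,3,2)$ and $\mathbb{Z}(2\vec{\omega})$ acts by the degree-shift action.
   Context: String groups. For a weight sequence $\mathbf{p}=(p_1,\dots,p_t)$ of integers $p_i\geq2$, $L(\mathbf{p})$ is the abelian group generated by $\vec{x}_1,\dots,\vec{x}_t$ subject to $p_1\vec{x}_1=\cdots=p_t\vec{x}_t=:\vec{c}$ (the canonical element). Each $\vec{x}\in L(\mathbf{p})$ has a unique normal form $\vec{x}=l\vec{c}+\sum_i l_i\vec{x}_i$ with $l\in\mathbb{Z}$, $0\leq l_i\leq p_i-1$; set ${\rm mult}(\vec{x})=\max\{l+1,0\}$. Let $\pi_i\colon L(\mathbf{p})\to\mathbb{Z}/p_i\mathbb{Z}$ be the homomorphism with $\pi_i(\vec{x}_j)=\delta_{i,j}\bar1$. An infinite subgroup $H\subseteq L(\mathbf{p})$ is effective if $\pi_i(H)=\mathbb{Z}/p_i\mathbb{Z}$ for all $i$. The dualizing element is $\vec{\omega}=(t-2)\vec{c}-\sum_i\vec{x}_i$. The generators of $L(2,2,2,2)$ are written $\vec{x}_1,\dots,\vec{x}_4$, those of $L(6,3,2)$ are written $\vec{u}_1,\vec{u}_2,\vec{u}_3$. $\mathbb{Z}(2\vec{\omega})$ is the subgroup generated by $2\vec{\omega}$. A group homomorphism $\pi\colon L(\mathbf{q})\to L(\mathbf{p})$ is admissible if (AH1) ${\rm Im}\,\pi\subseteq L(\mathbf{p})$ is effective, and (AH2) $\sum_{\vec{y}\in\pi^{-1}(\vec{x})}{\rm mult}(\vec{y})={\rm mult}(\vec{x})$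 for each $\vec{x}\in{\rm Im}\,\pi$. Algebras. $S(2,2,2,2;\lambda)=k[X_1,X_2,X_3,X_4]/(X_3^2-(X_2^2-X_1^2),X_4^2-(X_2^2-\lambda X_1^2))$ (for $\lambda\in k$, $\lambda\ne0,1$) and $S(6,3,2)=k[U_1,U_2,U_3]/(U_3^2-(U_2^3-U_1^6))$ are the homogeneous coordinate algebras of the weighted projective lines $\mathbb{X}(2,2,2,2;\lambda)$ and $\mathbb{X}(6,3,2)$. Lower-case letters denote classes of the variables; the gradings by $L(2,2,2,2)$ and $L(6,3,2)$ are given by $\deg x_i=\vec{x}_i$, $\deg u_i=\vec{u}_i$. For a subgroup $H$ of the grading group of a graded algebra $S$, $S_H=\bigoplus_{\vec{x}\in H}S_{\vec{x}}$ ($H$-graded). $\pi_*S$ denotes $S$ with the coarser ${\rm Im}\,\pi$-grading $(\pi_*S)_{\vec{x}}=\bigoplus_{\vec{y}\in\pi^{-1}(\vec{x})}S_{\vec{y}}$. $\bar{\phi}$ is $\phi$ with codomain restricted to $S(2,2,2,2;\epsilon)_{{\rm Im}\,\pi}$. Coherent sheaves. For a homogeneous coordinate algebra $S$ with grading group $L$ and weighted projective line $\mathbb{X}$, let ${\rm mod}^L\text{-}S$ be the category of finitely generated $L$-graded $S$-modules, ${\rm mod}_0^L\text{-}S$ its Serre subcategory of finite dimensional modules; ${\rm coh}\text{-}\mathbb{X}$ is identified with the quotient abelian category ${\rm qmod}^L\text{-}S={\rm mod}^L\text{-}S/{\rm mod}_0^L\text{-}S$. Degree-shift action. For $\vec{x}\in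 L$, $(\vec{x})$ sends $M$ to $M(\vec{x})=M$ with $M(\vec{x})_{\vec{l}}=M_{\vec{l}+\vec{x}}$ and induces an automorphism of ${\rm coh}\text{-}\mathbb{X}$. A subgroup $N\subseteq L$ acts strictly on ${\rm coh}\text{-}\mathbb{X}$ by $\vec{x}\mapsto F_{\vec{x}}=(-\vec{x})$ (the degree-shift action). Equivariant objects. For a strict action $g\mapsto F_g$ of a group $G$ on $\mathcal{A}$ (a group homomorphism to the automorphism group of $\mathcal{A}$), $\mathcal{A}^G$ is the category of pairs $(X,\alpha)$ with $X\in\mathcal{A}$ and isomorphisms $\alpha_g\colon X\to F_g(X)$, $g\in G$, satisfying $\alpha_{gh}=F_g(\alpha_h)\circ\alpha_g$; morphisms $(X,\alpha)\to(Y,\beta)$ are morphisms $f\colon X\to Y$ with $\beta_g\circ f=F_g(f)\circ\alpha_g$ for all $g$. *)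

theory Defs
  imports "HOL-Algebra.Free_Abelian_Groups" "HOL-Algebra.Module" "HOL-Algebra.QuotRing"
begin

section \<open>String groups\<close>

text \<open>
  A weight sequence is a list \<open>p\<close>, with \<open>p\<^sub>i = p ! (i - 1)\<close> for \<open>i \<in> {1..length p}\<close>.
  Abelian groups follow the multiplicative notation of HOL-Algebra: the sum of the text is \<open>\<otimes>\<close>,
  the zero element is \<open>\<one>\<close>, and \<open>l x\<close> is \<open>x [^] l\<close>.
\<close>

abbreviation weight :: "nat list \<Rightarrow> nat \<Rightarrow> nat" where
  "weight p i \<equiv> p ! (i - 1)"

type_synonym str = "(nat \<Rightarrow>\<^sub>0 int) set"

definition str_relations :: "nat list \<Rightarrow> (nat \<Rightarrow>\<^sub>0 int) set" where
  "str_relations p = generate (free_Abelian_group {1..length p})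
     {frag_cmul (int (weight p i)) (frag_of i) - frag_cmul (int (weight p j)) (frag_of j) | i j.
        i \<in> {1..length p} \<and> j \<in> {1..length p}}"

definition string_group :: "nat list \<Rightarrow> str monoid" where
  "string_group p = free_Abelian_group {1..length p} Mod str_relations p"

definition str_gen :: "nat list \<Rightarrow> nat \<Rightarrow> str" where
  "str_gen p i = str_relations p #>\<^bsub>free_Abelian_group {1..length p}\<^esub> frag_of i"

definition canonical :: "nat list \<Rightarrow> str" where
  "canonical p = str_gen p 1 [^]\<^bsub>string_group p\<^esub> weight p 1"

definition dualizing :: "nat list \<Rightarrow> str" where
  "dualizing p = canonical p [^]\<^bsub>string_group p\<^esub> (int (length p) - 2)
     \<otimes>\<^bsub>string_group p\<^esub> inv\<^bsub>string_group p\<^esub> finprod (string_group p) (str_gen p) {1..length p}"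

definition normal_form_coeff :: "nat list \<Rightarrow> str \<Rightarrow> int" where
  "normal_form_coeff p x = (THE l. \<exists>a :: nat \<Rightarrow> nat. (\<forall>i \<in> {1..length p}. a i < weight p i) \<and>
     x = canonical p [^]\<^bsub>string_group p\<^esub> l \<otimes>\<^bsub>string_group p\<^esub>
         finprod (string_group p) (\<lambda>i. str_gen p i [^]\<^bsub>string_group p\<^esub> a i) {1..length p})"

definition str_mult :: "nat list \<Rightarrow> str \<Rightarrow> nat" where
  "str_mult p x = nat (max (normal_form_coeff p x + 1) 0)"

definition str_proj :: "nat list \<Rightarrow> nat \<Rightarrow> str \<Rightarrow> int" where
  "str_proj p i = (THE f. f \<in> hom (string_group p) (integer_mod_group (weight p i))
      \<and> f \<in> extensional (carrier (string_group p))
      \<and> (\<forall>j \<in> {1..length p}. f (str_gen p j) = (if i = j then 1 else 0)))"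

definition effective :: "nat list \<Rightarrow> str set \<Rightarrow> bool" where
  "effective p H \<longleftrightarrow> subgroup H (string_group p) \<and> infinite H \<and>
     (\<forall>i \<in> {1..length p}. str_proj p i ` H = carrier (integer_mod_group (weight p i)))"

text \<open>
  The sum in (AH2) ranges over a possibly infinite fibre. Its terms are natural numbers and it must
  equal a natural number, so only finitely many terms may be nonzero; HOL sums over infinite sets
  would silently be 0, hence the explicit finiteness.
\<close>

definition admissible :: "nat list \<Rightarrow> nat list \<Rightarrow> (str \<Rightarrow> str) \<Rightarrow> bool" where
  "admissible q p \<pi> \<longleftrightarrow> \<pi> \<in> hom (string_group q) (string_group p) \<and>
     effective p (\<pi> ` carrier (string_group q)) \<and>
     (\<forall>x \<in> \<pi> ` carrier (string_group q).
        let Y = {y \<in> carrier (string_group q). \<pi> y = x \<and> str_mult q y \<noteq> 0}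
        in finite Y \<and> (\<Sum>y\<in>Y. str_mult q y) = str_mult p x)"


section \<open>Graded algebras\<close>

text \<open>
  A commutative \<open>k\<close>-algebra with a grading; \<open>structure_map\<close> is the map from \<open>k\<close> to the algebra.
\<close>

record ('a, 'k, 'l) graded_algebra = "'a ring" +
  structure_map :: "'k \<Rightarrow> 'a"
  grading_group :: "'l monoid"
  component :: "'l \<Rightarrow> 'a set"

definition sum_of_components :: "('a, 'k, 'l) graded_algebra \<Rightarrow> 'l set \<Rightarrow> 'a set" where
  "sum_of_components S Y =
     {finsum S f Y' | f Y'. finite Y' \<and> Y' \<subseteq> Y \<and> (\<forall>y\<in>Y'. f y \<in> component S y)}"

text \<open>The algebra \<open>S\<^sub>H\<close>.\<close>

definition restrict_algebra ::
    "'l set \<Rightarrow> ('a, 'k, 'l) graded_algebra \<Rightarrow> ('a, 'k, 'l) graded_algebra" where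
  "restrict_algebra H S = S\<lparr>carrier := sum_of_components S H,
     grading_group := (grading_group S)\<lparr>carrier := H\<rparr>\<rparr>"

text \<open>The algebra \<open>\<pi>\<^sub>*S\<close> for a group homomorphism \<open>\<pi>\<close> from the grading group of \<open>S\<close> to \<open>L\<close>.\<close>

definition pushforward_algebra ::
    "'l monoid \<Rightarrow> ('l \<Rightarrow> 'l) \<Rightarrow> ('a, 'k, 'l) graded_algebra \<Rightarrow> ('a, 'k, 'l) graded_algebra" where
  "pushforward_algebra L \<pi> S = S\<lparr>
     grading_group := L\<lparr>carrier := \<pi> ` carrier (grading_group S)\<rparr>,
     component := (\<lambda>x. sum_of_components S {y \<in> carrier (grading_group S). \<pi> y = x})\<rparr>"

definition algebra_hom ::
    "('a, 'k, 'l) graded_algebra \<Rightarrow> ('b, 'k, 'm) graded_algebra \<Rightarrow> ('a \<Rightarrow> 'b) set" where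
  "algebra_hom S T = {f \<in> ring_hom S T. \<forall>c. f (structure_map S c) = structure_map T c}"

definition graded_algebra_iso ::
    "('a, 'k, 'l) graded_algebra \<Rightarrow> ('b, 'k, 'l) graded_algebra \<Rightarrow> ('a \<Rightarrow> 'b) set" where
  "graded_algebra_iso S T = {f \<in> algebra_hom S T.
     grading_group S = grading_group T \<and> bij_betw f (carrier S) (carrier T) \<and>
     (\<forall>x \<in> carrier (grading_group S). f ` component S x = component T x)}"


section \<open>Homogeneous coordinate algebras\<close>

type_synonym 'k mpoly = "(nat \<Rightarrow>\<^sub>0 nat) \<Rightarrow>\<^sub>0 'k"

definition Var :: "nat \<Rightarrow> 'k::field mpoly" where
  "Var i = Poly_Mapping.single (Poly_Mapping.single i 1) 1"

definition Const :: "'k::field \<Rightarrow> 'k mpoly" where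
  "Const c = Poly_Mapping.single 0 c"

text \<open>The polynomial ring \<open>k[X\<^sub>1,\<dots>,X\<^sub>t]\<close>.\<close>

definition poly_ring :: "nat \<Rightarrow> 'k::field mpoly ring" where
  "poly_ring t = \<lparr>carrier = {P. \<forall>m \<in> Poly_Mapping.keys P. Poly_Mapping.keys m \<subseteq> {1..t}},
     monoid.mult = (*), one = 1, ring.zero = 0, ring.add = (+)\<rparr>"

definition mon_degree :: "nat list \<Rightarrow> (nat \<Rightarrow>\<^sub>0 nat) \<Rightarrow> str" where
  "mon_degree p m = finprod (string_group p)
     (\<lambda>i. str_gen p i [^]\<^bsub>string_group p\<^esub> Poly_Mapping.lookup m i) {1..length p}"

definition poly_class :: "nat list \<Rightarrow> 'k::field mpoly set \<Rightarrow> 'k mpoly \<Rightarrow> 'k mpoly set" where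
  "poly_class p F P = Idl\<^bsub>poly_ring (length p)\<^esub> F +>\<^bsub>poly_ring (length p)\<^esub> P"

text \<open>
  \<open>k[X\<^sub>1,\<dots>,X\<^sub>t]/(F)\<close>, graded by the string group via \<open>deg X\<^sub>i = x\<^sub>i\<close>, for homogeneous relations \<open>F\<close>.
\<close>

definition coord_algebra ::
    "nat list \<Rightarrow> 'k::field mpoly set \<Rightarrow> ('k mpoly set, 'k, str) graded_algebra" where
  "coord_algebra p F = ring.extend (poly_ring (length p) Quot Idl\<^bsub>poly_ring (length p)\<^esub> F)
     (graded_algebra.fields
        (\<lambda>c. poly_class p F (Const c))
        (string_group p)
        (\<lambda>x. poly_class p F ` {P \<in> carrier (poly_ring (length p)).
               \<forall>m \<in> Poly_Mapping.keys P. mon_degree p m = x}))"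

abbreviation w2222 :: "nat list" where "w2222 \<equiv> [2, 2, 2, 2]"
abbreviation w632 :: "nat list" where "w632 \<equiv> [6, 3, 2]"

definition relations2222 :: "'k::field \<Rightarrow> 'k mpoly set" where
  "relations2222 lam = {Var 3 ^ 2 - (Var 2 ^ 2 - Var 1 ^ 2),
                        Var 4 ^ 2 - (Var 2 ^ 2 - Const lam * Var 1 ^ 2)}"

definition relations632 :: "'k::field mpoly set" where
  "relations632 = {Var 3 ^ 2 - (Var 2 ^ 3 - Var 1 ^ 6)}"

definition S2222 :: "'k::field \<Rightarrow> ('k mpoly set, 'k, str) graded_algebra" where
  "S2222 lam = coord_algebra w2222 (relations2222 lam)"

definition S632 :: "('k::field mpoly set, 'k, str) graded_algebra" where
  "S632 = coord_algebra w632 relations632"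

definition x2222 :: "'k::field \<Rightarrow> nat \<Rightarrow> 'k mpoly set" where
  "x2222 lam i = poly_class w2222 (relations2222 lam) (Var i)"

definition u632 :: "nat \<Rightarrow> 'k::field mpoly set" where
  "u632 i = poly_class w632 relations632 (Var i)"


section \<open>Categories\<close>

text \<open>
  Morphisms need not determine their domain and codomain, so composition and identities take the
  objects as arguments: \<open>Comp C X Y Z g f\<close> is \<open>g \<circ> f\<close> for \<open>f : X \<rightarrow> Y\<close> and \<open>g : Y \<rightarrow> Z\<close>.
\<close>

record ('o, 'm) cat =
  Ob :: "'o set"
  Hom :: "'o \<Rightarrow> 'o \<Rightarrow> 'm set"
  Comp :: "'o \<Rightarrow> 'o \<Rightarrow> 'o \<Rightarrow> 'm \<Rightarrow> 'm \<Rightarrow> 'm"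
  Ident :: "'o \<Rightarrow> 'm"

definition is_category :: "('o, 'm) cat \<Rightarrow> bool" where
  "is_category C \<longleftrightarrow>
     (\<forall>X \<in> Ob C. Ident C X \<in> Hom C X X) \<and>
     (\<forall>X \<in> Ob C. \<forall>Y \<in> Ob C. \<forall>Z \<in> Ob C. \<forall>f \<in> Hom C X Y. \<forall>g \<in> Hom C Y Z.
        Comp C X Y Z g f \<in> Hom C X Z) \<and>
     (\<forall>X \<in> Ob C. \<forall>Y \<in> Ob C. \<forall>f \<in> Hom C X Y.
        Comp C X X Y f (Ident C X) = f \<and> Comp C X Y Y (Ident C Y) f = f) \<and>
     (\<forall>W \<in> Ob C. \<forall>X \<in> Ob C. \<forall>Y \<in> Ob C. \<forall>Z \<in> Ob C.
      \<forall>f \<in> Hom C W X. \<forall>g \<in> Hom C X Y. \<forall>h \<in> Hom C Y Z.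
        Comp C W Y Z h (Comp C W X Y g f) = Comp C W X Z (Comp C X Y Z h g) f)"

definition Isos :: "('o, 'm) cat \<Rightarrow> 'o \<Rightarrow> 'o \<Rightarrow> 'm set" where
  "Isos C X Y = {f \<in> Hom C X Y. \<exists>g \<in> Hom C Y X.
     Comp C X Y X g f = Ident C X \<and> Comp C Y X Y f g = Ident C Y}"

record ('o, 'm, 'p, 'n) cfunctor =
  on_ob :: "'o \<Rightarrow> 'p"
  on_hom :: "'o \<Rightarrow> 'o \<Rightarrow> 'm \<Rightarrow> 'n"

definition is_functor :: "('o, 'm) cat \<Rightarrow> ('p, 'n) cat \<Rightarrow> ('o, 'm, 'p, 'n) cfunctor \<Rightarrow> bool" where
  "is_functor A B F \<longleftrightarrow>
     (\<forall>X \<in> Ob A. on_ob F X \<in> Ob B) \<and>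
     (\<forall>X \<in> Ob A. \<forall>Y \<in> Ob A. \<forall>f \<in> Hom A X Y. on_hom F X Y f \<in> Hom B (on_ob F X) (on_ob F Y)) \<and>
     (\<forall>X \<in> Ob A. on_hom F X X (Ident A X) = Ident B (on_ob F X)) \<and>
     (\<forall>X \<in> Ob A. \<forall>Y \<in> Ob A. \<forall>Z \<in> Ob A. \<forall>f \<in> Hom A X Y. \<forall>g \<in> Hom A Y Z.
        on_hom F X Z (Comp A X Y Z g f) =
        Comp B (on_ob F X) (on_ob F Y) (on_ob F Z) (on_hom F Y Z g) (on_hom F X Y f))"

definition comp_functor ::
    "('p, 'n, 'q, 'r) cfunctor \<Rightarrow> ('o, 'm, 'p, 'n) cfunctor \<Rightarrow> ('o, 'm, 'q, 'r) cfunctor" where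
  "comp_functor G F = \<lparr>on_ob = on_ob G \<circ> on_ob F,
     on_hom = (\<lambda>X Y f. on_hom G (on_ob F X) (on_ob F Y) (on_hom F X Y f))\<rparr>"

definition id_functor :: "('o, 'm, 'o, 'm) cfunctor" where
  "id_functor = \<lparr>on_ob = (\<lambda>X. X), on_hom = (\<lambda>X Y f. f)\<rparr>"

definition naturally_isomorphic ::
    "('o, 'm) cat \<Rightarrow> ('p, 'n) cat \<Rightarrow> ('o, 'm, 'p, 'n) cfunctor \<Rightarrow> ('o, 'm, 'p, 'n) cfunctor \<Rightarrow> bool"
where
  "naturally_isomorphic A B F G \<longleftrightarrow> (\<exists>\<eta>.
     (\<forall>X \<in> Ob A. \<eta> X \<in> Isos B (on_ob F X) (on_ob G X)) \<and>
     (\<forall>X \<in> Ob A. \<forall>Y \<in> Ob A. \<forall>f \<in> Hom A X Y.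
        Comp B (on_ob F X) (on_ob G X) (on_ob G Y) (on_hom G X Y f) (\<eta> X) =
        Comp B (on_ob F X) (on_ob F Y) (on_ob G Y) (\<eta> Y) (on_hom F X Y f)))"

text \<open>
  Between abelian categories an equivalence is automatically additive and exact, as the abelian
  structure is determined by the underlying category.
\<close>

definition is_equivalence ::
    "('o, 'm) cat \<Rightarrow> ('p, 'n) cat \<Rightarrow> ('o, 'm, 'p, 'n) cfunctor \<Rightarrow> bool" where
  "is_equivalence A B F \<longleftrightarrow> is_category A \<and> is_category B \<and> is_functor A B F \<and>
     (\<exists>G. is_functor B A G \<and>
        naturally_isomorphic A A (comp_functor G F) id_functor \<and>
        naturally_isomorphic B B (comp_functor F G) id_functor)"


section \<open>Serre quotients\<close>

definition zero_object :: "('o, 'm) cat \<Rightarrow> 'o \<Rightarrow> bool" where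
  "zero_object C Z \<longleftrightarrow> Z \<in> Ob C \<and>
     (\<forall>X \<in> Ob C. (\<exists>!f. f \<in> Hom C X Z) \<and> (\<exists>!f. f \<in> Hom C Z X))"

definition zero_morphism :: "('o, 'm) cat \<Rightarrow> 'o \<Rightarrow> 'o \<Rightarrow> 'm \<Rightarrow> bool" where
  "zero_morphism C X Y f \<longleftrightarrow>
     (\<exists>Z a b. zero_object C Z \<and> a \<in> Hom C X Z \<and> b \<in> Hom C Z Y \<and> f = Comp C X Z Y b a)"

definition is_kernel :: "('o, 'm) cat \<Rightarrow> 'o \<Rightarrow> 'o \<Rightarrow> 'm \<Rightarrow> 'o \<Rightarrow> 'm \<Rightarrow> bool" where
  "is_kernel C X Y f K k \<longleftrightarrow> K \<in> Ob C \<and> k \<in> Hom C K X \<and> zero_morphism C K Y (Comp C K X Y f k) \<and>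
     (\<forall>W \<in> Ob C. \<forall>g \<in> Hom C W X. zero_morphism C W Y (Comp C W X Y f g) \<longrightarrow>
        (\<exists>!h. h \<in> Hom C W K \<and> Comp C W K X k h = g))"

definition is_cokernel :: "('o, 'm) cat \<Rightarrow> 'o \<Rightarrow> 'o \<Rightarrow> 'm \<Rightarrow> 'o \<Rightarrow> 'm \<Rightarrow> bool" where
  "is_cokernel C X Y f Q q \<longleftrightarrow> Q \<in> Ob C \<and> q \<in> Hom C Y Q \<and> zero_morphism C X Q (Comp C X Y Q q f) \<and>
     (\<forall>W \<in> Ob C. \<forall>g \<in> Hom C Y W. zero_morphism C X W (Comp C X Y W g f) \<longrightarrow>
        (\<exists>!h. h \<in> Hom C Q W \<and> Comp C Y Q W h q = g))"

text \<open>
  The quotient of an abelian category \<open>C\<close> by a Serre subcategory \<open>T\<close> (given by its class of objects)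
  is the localization of \<open>C\<close> at the morphisms whose kernel and cokernel lie in \<open>T\<close>. These admit a
  calculus of fractions, so a morphism from \<open>X\<close> to \<open>Y\<close> is a class of roofs \<open>X \<leftarrow> Z \<rightarrow> Y\<close>.
\<close>

definition serre_isos :: "('o, 'm) cat \<Rightarrow> 'o set \<Rightarrow> 'o \<Rightarrow> 'o \<Rightarrow> 'm set" where
  "serre_isos C T X Y = {s \<in> Hom C X Y.
     (\<exists>K k. is_kernel C X Y s K k \<and> K \<in> T) \<and> (\<exists>Q q. is_cokernel C X Y s Q q \<and> Q \<in> T)}"

definition roofs :: "('o, 'm) cat \<Rightarrow> 'o set \<Rightarrow> 'o \<Rightarrow> 'o \<Rightarrow> ('o \<times> 'm \<times> 'm) set" where
  "roofs C T X Y = {(Z, s, f). Z \<in> Ob C \<and> s \<in> serre_isos C T Z X \<and> f \<in> Hom C Z Y}"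

definition roof_equiv ::
    "('o, 'm) cat \<Rightarrow> 'o set \<Rightarrow> 'o \<Rightarrow> 'o \<Rightarrow> 'o \<times> 'm \<times> 'm \<Rightarrow> 'o \<times> 'm \<times> 'm \<Rightarrow> bool" where
  "roof_equiv C T X Y = (\<lambda>(Z, s, f) (Z', s', f').
     \<exists>W \<in> Ob C. \<exists>u \<in> Hom C W Z. \<exists>u' \<in> Hom C W Z'.
       Comp C W Z X s u \<in> serre_isos C T W X \<and>
       Comp C W Z X s u = Comp C W Z' X s' u' \<and>
       Comp C W Z Y f u = Comp C W Z' Y f' u')"

definition roof_class ::
    "('o, 'm) cat \<Rightarrow> 'o set \<Rightarrow> 'o \<Rightarrow> 'o \<Rightarrow> 'o \<times> 'm \<times> 'm \<Rightarrow> ('o \<times> 'm \<times> 'm) set" where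
  "roof_class C T X Y r = {r' \<in> roofs C T X Y. roof_equiv C T X Y r r'}"

text \<open>
  In the composition, all choices of representatives and of completions to a commutative square
  give the same class, so the union is that class.
\<close>

definition serre_quotient :: "('o, 'm) cat \<Rightarrow> 'o set \<Rightarrow> ('o, ('o \<times> 'm \<times> 'm) set) cat" where
  "serre_quotient C T = \<lparr>
     Ob = Ob C,
     Hom = (\<lambda>X Y. roof_class C T X Y ` roofs C T X Y),
     Comp = (\<lambda>X Y V b a. \<Union>{roof_class C T X V (P, Comp C P Z X s u, Comp C P W V g h) |
        Z s f W t g P u h. (Z, s, f) \<in> a \<and> (W, t, g) \<in> b \<and>
          P \<in> Ob C \<and> u \<in> serre_isos C T P Z \<and> h \<in> Hom C P W \<and>
          Comp C P Z Y f u = Comp C P W Y t h}),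
     Ident = (\<lambda>X. roof_class C T X X (X, Ident C X, Ident C X))\<rparr>"

text \<open>
  The functor on quotients induced by an exact endofunctor that preserves \<open>T\<close>; again the union
  is a single class.
\<close>

definition quotient_functor :: "('o, 'm) cat \<Rightarrow> 'o set \<Rightarrow> ('o, 'm, 'o, 'm) cfunctor \<Rightarrow>
    ('o, ('o \<times> 'm \<times> 'm) set, 'o, ('o \<times> 'm \<times> 'm) set) cfunctor" where
  "quotient_functor C T F = \<lparr>
     on_ob = on_ob F,
     on_hom = (\<lambda>X Y a. \<Union>(Z, s, f) \<in> a.
        roof_class C T (on_ob F X) (on_ob F Y) (on_ob F Z, on_hom F Z X s, on_hom F Z Y f))\<rparr>"


section \<open>Equivariant objects\<close>

text \<open>For a strict action \<open>F\<close> of \<open>G\<close>, so that \<open>F\<^sub>g (F\<^sub>h X)\<close> is literally equal to \<open>F\<^sub>g\<^sub>h X\<close>.\<close>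

definition equivariant_objects :: "('o, 'm) cat \<Rightarrow> 'g monoid \<Rightarrow>
    ('g \<Rightarrow> ('o, 'm, 'o, 'm) cfunctor) \<Rightarrow> ('o \<times> ('g \<Rightarrow> 'm), 'm) cat" where
  "equivariant_objects C G F = \<lparr>
     Ob = {(X, \<alpha>). X \<in> Ob C \<and> \<alpha> \<in> extensional (carrier G) \<and>
        (\<forall>g \<in> carrier G. \<alpha> g \<in> Isos C X (on_ob (F g) X)) \<and>
        (\<forall>g \<in> carrier G. \<forall>h \<in> carrier G. \<alpha> (g \<otimes>\<^bsub>G\<^esub> h) =
           Comp C X (on_ob (F g) X) (on_ob (F (g \<otimes>\<^bsub>G\<^esub> h)) X)
             (on_hom (F g) X (on_ob (F h) X) (\<alpha> h)) (\<alpha> g))},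
     Hom = (\<lambda>(X, \<alpha>) (Y, \<beta>). {f \<in> Hom C X Y. \<forall>g \<in> carrier G.
        Comp C X Y (on_ob (F g) Y) (\<beta> g) f =
        Comp C X (on_ob (F g) X) (on_ob (F g) Y) (on_hom (F g) X Y f) (\<alpha> g)}),
     Comp = (\<lambda>(X, \<alpha>) (Y, \<beta>) (Z, \<gamma>). Comp C X Y Z),
     Ident = (\<lambda>(X, \<alpha>). Ident C X)\<rparr>"


section \<open>Graded modules and coherent sheaves\<close>

text \<open>
  Graded modules have their carrier in a fixed type \<open>'u\<close>, which serves as the universe of sets. A
  finitely generated module over one of the algebras above has countable dimension over \<open>k\<close>, so
  every such module has an isomorphic copy in \<open>'u\<close> as soon as \<open>nat \<times> k\<close> injects into \<open>'u\<close>.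
  The grading is extensional, so that shifting degrees is a strict action.
\<close>

record ('a, 'u, 'l) graded_module = "('a, 'u) module" +
  degree_part :: "'l \<Rightarrow> 'u set"

definition is_graded_module ::
    "('a, 'k, 'l) graded_algebra \<Rightarrow> ('a, 'u, 'l) graded_module \<Rightarrow> bool" where
  "is_graded_module S M \<longleftrightarrow> module S M \<and>
     degree_part M \<in> extensional (carrier (grading_group S)) \<and>
     (\<forall>l \<in> carrier (grading_group S). additive_subgroup (degree_part M l) M) \<and>
     (\<forall>a \<in> carrier (grading_group S). \<forall>l \<in> carrier (grading_group S).
        \<forall>s \<in> component S a. \<forall>m \<in> degree_part M l.
          s \<odot>\<^bsub>M\<^esub> m \<in> degree_part M (a \<otimes>\<^bsub>grading_group S\<^esub> l)) \<and>
     (\<forall>m \<in> carrier M. \<exists>!f. f \<in> (\<Pi>\<^sub>E l \<in> carrier (grading_group S). degree_part M l) \<and>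
        finite {l \<in> carrier (grading_group S). f l \<noteq> \<zero>\<^bsub>M\<^esub>} \<and>
        m = finsum M f {l \<in> carrier (grading_group S). f l \<noteq> \<zero>\<^bsub>M\<^esub>})"

definition finitely_spanned :: "'a set \<Rightarrow> ('a, 'u, 'l) graded_module \<Rightarrow> bool" where
  "finitely_spanned K M \<longleftrightarrow> (\<exists>B. finite B \<and> B \<subseteq> carrier M \<and>
     (\<forall>m \<in> carrier M. \<exists>c. c \<in> B \<rightarrow> K \<and> m = finsum M (\<lambda>b. c b \<odot>\<^bsub>M\<^esub> b) B))"

definition graded_module_hom :: "('a, 'k, 'l) graded_algebra \<Rightarrow>
    ('a, 'u, 'l) graded_module \<Rightarrow> ('a, 'u, 'l) graded_module \<Rightarrow> ('u \<Rightarrow> 'u) set" where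
  "graded_module_hom S M N = {f \<in> carrier M \<rightarrow>\<^sub>E carrier N.
     (\<forall>m \<in> carrier M. \<forall>n \<in> carrier M. f (m \<oplus>\<^bsub>M\<^esub> n) = f m \<oplus>\<^bsub>N\<^esub> f n) \<and>
     (\<forall>s \<in> carrier S. \<forall>m \<in> carrier M. f (s \<odot>\<^bsub>M\<^esub> m) = s \<odot>\<^bsub>N\<^esub> f m) \<and>
     (\<forall>l \<in> carrier (grading_group S). f ` degree_part M l \<subseteq> degree_part N l)}"

definition mod_cat ::
    "('a, 'k, 'l) graded_algebra \<Rightarrow> (('a, 'u, 'l) graded_module, 'u \<Rightarrow> 'u) cat" where
  "mod_cat S = \<lparr>
     Ob = {M. is_graded_module S M \<and> finitely_spanned (carrier S) M},
     Hom = graded_module_hom S,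
     Comp = (\<lambda>X Y Z g f. compose (carrier X) g f),
     Ident = (\<lambda>X. \<lambda>m \<in> carrier X. m)\<rparr>"

definition mod0 :: "('a, 'k, 'l) graded_algebra \<Rightarrow> ('a, 'u, 'l) graded_module set" where
  "mod0 S = {M \<in> Ob (mod_cat S). finitely_spanned (range (structure_map S)) M}"

type_synonym ('a, 'u, 'l) coh_mor = "(('a, 'u, 'l) graded_module \<times> ('u \<Rightarrow> 'u) \<times> ('u \<Rightarrow> 'u)) set"

definition coh :: "'u itself \<Rightarrow> ('a, 'k, 'l) graded_algebra \<Rightarrow>
    (('a, 'u, 'l) graded_module, ('a, 'u, 'l) coh_mor) cat" where
  "coh _ S = serre_quotient (mod_cat S) (mod0 S)"

definition degree_shift :: "'l monoid \<Rightarrow> 'l \<Rightarrow>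
    (('a, 'u, 'l) graded_module, 'm, ('a, 'u, 'l) graded_module, 'm) cfunctor" where
  "degree_shift L x = \<lparr>
     on_ob = (\<lambda>M. M\<lparr>degree_part := (\<lambda>l \<in> carrier L. degree_part M (l \<otimes>\<^bsub>L\<^esub> x))\<rparr>),
     on_hom = (\<lambda>M N f. f)\<rparr>"

definition degree_shift_action :: "'u itself \<Rightarrow> ('a, 'k, 'l) graded_algebra \<Rightarrow> 'l \<Rightarrow>
    (('a, 'u, 'l) graded_module, ('a, 'u, 'l) coh_mor,
     ('a, 'u, 'l) graded_module, ('a, 'u, 'l) coh_mor) cfunctor" where
  "degree_shift_action _ S x = quotient_functor (mod_cat S) (mod0 S)
     (degree_shift (grading_group S) (inv\<^bsub>grading_group S\<^esub> x))"

definition coh_equivariant :: "'u itself \<Rightarrow> ('a, 'k, 'l) graded_algebra \<Rightarrow> 'l set \<Rightarrow>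
    (('a, 'u, 'l) graded_module \<times> ('l \<Rightarrow> ('a, 'u, 'l) coh_mor), ('a, 'u, 'l) coh_mor) cat" where
  "coh_equivariant U S N =
     equivariant_objects (coh U S) ((grading_group S)\<lparr>carrier := N\<rparr>) (degree_shift_action U S)"


section \<open>The two homomorphisms\<close>

definition is_pi :: "(str \<Rightarrow> str) \<Rightarrow> bool" where
  "is_pi \<pi> \<longleftrightarrow> \<pi> \<in> hom (string_group w632) (string_group w2222) \<and>
     \<pi> (str_gen w632 1) = str_gen w2222 4 \<and>
     \<pi> (str_gen w632 2) = canonical w2222 \<and>
     \<pi> (str_gen w632 3) = str_gen w2222 1 \<otimes>\<^bsub>string_group w2222\<^esub> str_gen w2222 2
                            \<otimes>\<^bsub>string_group w2222\<^esub> str_gen w2222 3"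

definition is_phi :: "'k::field \<Rightarrow> 'k \<Rightarrow> ('k mpoly set \<Rightarrow> 'k mpoly set) \<Rightarrow> bool" where
  "is_phi \<epsilon> \<Delta> \<phi> \<longleftrightarrow> \<phi> \<in> algebra_hom S632 (S2222 \<epsilon>) \<and>
     \<phi> (u632 1) = x2222 \<epsilon> 4 \<and>
     \<phi> (u632 2) = x2222 \<epsilon> 2 [^]\<^bsub>S2222 \<epsilon>\<^esub> (2::nat) \<oplus>\<^bsub>S2222 \<epsilon>\<^esub>
        structure_map (S2222 \<epsilon>) (\<epsilon> - 1) \<otimes>\<^bsub>S2222 \<epsilon>\<^esub> x2222 \<epsilon> 1 [^]\<^bsub>S2222 \<epsilon>\<^esub> (2::nat) \<and>
     \<phi> (u632 3) = structure_map (S2222 \<epsilon>) \<Delta> \<otimes>\<^bsub>S2222 \<epsilon>\<^esub> x2222 \<epsilon> 1 \<otimes>\<^bsub>S2222 \<epsilon>\<^esub> x2222 \<epsilon> 2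
        \<otimes>\<^bsub>S2222 \<epsilon>\<^esub> x2222 \<epsilon> 3"

end

theory Submission
imports Defs
begin

abbreviation (input) mult_at ("_ *[_] _" [70, 0, 71] 70) where "x *[G] y \<equiv> x \<otimes>\<^bsub>G\<^esub> y"
abbreviation (input) add_at ("_ +[_] _" [65, 0, 66] 65) where "x +[R] y \<equiv> x \<oplus>\<^bsub>R\<^esub> y"
abbreviation (input) minus_at ("_ -[_] _" [65, 0, 66] 65) where "x -[R] y \<equiv> x \<ominus>\<^bsub>R\<^esub> y"
abbreviation (input) uminus_at ("-[_] _" [0, 81] 80) where "-[R] x \<equiv> \<ominus>\<^bsub>R\<^esub> x"
abbreviation (input) smult_at ("_ .[_] _" [70, 0, 71] 70) where "s .[M] x \<equiv> s \<odot>\<^bsub>M\<^esub> x"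
abbreviation (input) zero_at ("0[_]") where "0[R] \<equiv> \<zero>\<^bsub>R\<^esub>"
abbreviation (input) one_at ("1[_]") where "1[G] \<equiv> \<one>\<^bsub>G\<^esub>"
abbreviation (input) inv_at ("inv[_] _" [0, 81] 80) where "inv[G] x \<equiv> inv\<^bsub>G\<^esub> x"
abbreviation (input) pow_at ("_ ^[_] _" [76, 0, 75] 75) where "x ^[G] n \<equiv> x [^]\<^bsub>G\<^esub> n"
abbreviation "cmp \<equiv> component"
abbreviation "smap \<equiv> structure_map"
abbreviation "gg \<equiv> grading_group"
abbreviation (input) iff (infixr "<->" 25) where "P <-> Q \<equiv> P \<longleftrightarrow> Q"
abbreviation "gmhom \<equiv> graded_module_hom"
abbreviation "dpart \<equiv> degree_part"
abbreviation "keys \<equiv> Poly_Mapping.keys"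
abbreviation "lookup \<equiv> Poly_Mapping.lookup"
abbreviation "single \<equiv> Poly_Mapping.single"

text \<open>
  Write \<open>A\<close> for \<open>S(6,3,2)\<close> and \<open>B\<close> for \<open>S(2,2,2,2;\<epsilon>)\<close>. In \<open>B\<close> the squares of \<open>x\<^sub>1, x\<^sub>2, x\<^sub>3\<close> are linear combinations of
  \<open>\<phi>(u\<^sub>2)\<close> and \<open>\<phi>(u\<^sub>1)\<^sup>2\<close>, and the product of \<open>x\<^sub>1, x\<^sub>2, x\<^sub>3\<close> is a multiple of \<open>\<phi>(u\<^sub>3)\<close>. Hence every monomial whose degree lies in the image
  of \<open>\<pi>\<close> is in the image of \<open>\<phi>\<close>. Sending these monomials to preimages and all others to 0 gives an \<open>A\<close>-linear map
  \<open>\<psi> : B \<rightarrow> A\<close> with \<open>\<psi> \<circ> \<phi> = id\<close>, so \<open>\<phi>\<close> is injective.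

  For the equivalence, morphisms of the Serre quotients are described as germs of homogeneous maps that are defined in
  high degrees. The pull-back functor sends a \<open>B\<close>-module \<open>Y\<close> to the \<open>A\<close>-module with components \<open>Y\<^bsub>\<pi> u\<^esub>\<close>, on which the finite
  kernel \<open>N\<close> of \<open>\<pi>\<close> acts by identities. It is fully faithful since in high degrees \<open>B\<close> is generated by products of
  elements of degree in any prescribed coset of the image of \<open>\<pi>\<close>. For an equivariant \<open>X\<close>, the action becomes
  a strict one by homogeneous maps after truncation, and a preimage of \<open>X\<close> is a module of additive maps \<open>B \<rightarrow> X\<close> built from the trace of
  this action. Finally \<open>N\<close> has order 3 and is generated by \<open>2\<omega>\<close>.
\<close>

section \<open>Graded algebras and graded modules\<close>

text \<open>The constants come from a factorisation. The cube roots of unity are 1, -\<epsilon> and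
  \<epsilon> - 1, so \<open>u_2^3 - u_1^6\<close> is the product of the factors
  \<open>u_2 - z u_1^2\<close> over these \<open>z\<close>. Under \<phi> the factors become
  \<open>(2 \<epsilon> - 1) x_1^2\<close>, \<open>(1 + \<epsilon>) x_2^2\<close> and
  \<open>(2 - \<epsilon>) x_3^2\<close>. The product of the three coefficients is 6 \<epsilon> - 3,
  which explains the condition on the square of \<Delta> and the image of \<open>u_3\<close>. The
  difficulty of the equivalence is that an identity in the quotient category holds only from some
  degree on. Finiteness of \<open>N\<close> gives one bound for the whole action, and elements of
  \<open>N\<close> have integer degree 0, so truncation respects the action. The trace is not
  divided by the order of \<open>N\<close>: distinct translates lie in distinct degrees, and a
  projection recovers the element. A second difficulty is that all modules must have carriers in the
  fixed type \<open>'u\<close>. The pull-back and the preimage of an equivariant object are built in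
  types of functions, shown to be finitely generated, and then copied along an injection into
  \<open>'u\<close>.\<close>

inductive_set acl :: "('u, 'm) ring_scheme => 'u set => 'u set" for M :: "('u, 'm) ring_scheme" and Y :: "'u set" where
acl_zero: "0[M] : acl M Y"
| acl_add: "x : Y ==> y : acl M Y ==> x +[M] y : acl M Y"

text \<open>Generators enter one at a time on the left, so a membership proof needs only zero and
  one additive step. Negatives come from \<open>acl_minus\<close> when \<open>Y\<close> is closed
  under them.\<close>

lemma acl_least:
assumes "0[M] : V" "!!x y. x : Y ==> y : V ==> x +[M] y : V"
shows "acl M Y <= V"
proof
fix x assume "x : acl M Y" thus "x : V"
 by induction (use assms in auto)
qed

lemma acl_mono: "Y <= Z ==> acl M Y <= acl M Z"
by (rule acl_least) (auto intro: acl.intros)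

lemma acl_cong: "0[M] = 0[N] ==> add M = add N ==> acl M Y = acl N Y"
by (intro subset_antisym acl_least) (auto intro: acl.intros, metis acl_zero, metis acl_add)

context abelian_group
begin

lemma acl_closed: "Y <= carrier G ==> acl G Y <= carrier G"
by (rule acl_least) auto

lemma acl_base: "Y <= carrier G ==> x : Y ==> x : acl G Y"
using acl_add[of x Y \<zero> G, OF _ acl_zero] by (metis r_zero subsetD)

lemma acl_plus:
assumes "Y <= carrier G" "x : acl G Y" "y : acl G Y" shows "x \<oplus> y : acl G Y"
using assms(2)
proof induction
case acl_zero thus ?case using assms acl_closed by (metis l_zero subsetD)
next
case (acl_add a b)
have "a : carrier G" "b : carrier G" "y : carrier G" using acl_add assms acl_closed by blast+
hence "(a \<oplus> b) \<oplus> y = a \<oplus> (b \<oplus> y)" by (simp add: a_assoc)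
thus ?case using acl_add acl.acl_add by metis
qed

lemma acl_subI:
assumes "Y <= acl G Z" "Z <= carrier G" shows "acl G Y <= acl G Z"
by (rule acl_least) (use assms acl_plus in "auto intro: acl.acl_zero")

lemma acl_subgroup: "additive_subgroup V G ==> Y <= V ==> acl G Y <= V"
by (rule acl_least)
 (auto simp: additive_subgroup.zero_closed intro: additive_subgroup.a_closed)

lemma subgroupI':
assumes "V <= carrier G" "\<zero> : V" "!!x y. x : V ==> y : V ==> x \<oplus> y : V" "!!x. x : V ==> \<ominus> x : V"
shows "additive_subgroup V G"
using assms by (intro additive_subgroup.intro subgroup.intro) (auto simp: a_inv_def)

lemma subgroup_minus: "additive_subgroup V G ==> x : V ==> \<ominus> x : V"
using subgroup.m_inv_closed[of V "add_monoid G" x] by (simp add: additive_subgroup_def a_inv_def)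

lemma subgroup_facts:
assumes "additive_subgroup V G"
shows "V <= carrier G" "\<zero> : V" "!!x y. x : V ==> y : V ==> x \<oplus> y : V" "!!x. x : V ==> \<ominus> x : V"
using additive_subgroup.a_subset[OF assms] additive_subgroup.zero_closed[OF assms]
 additive_subgroup.a_closed[OF assms] subgroup_minus[OF assms] by auto

lemma acl_minus:
assumes Y: "Y <= carrier G" "!!y. y : Y ==> \<ominus> y : Y" and x: "x : acl G Y"
shows "\<ominus> x : acl G Y"
using x
proof induction
case acl_zero thus ?case by (metis minus_equality[OF r_zero[OF zero_closed] zero_closed zero_closed] acl.acl_zero)
next
case (acl_add a b)
have "a : carrier G" "b : carrier G" using acl_add Y acl_closed by blast+
hence "\<ominus> (a \<oplus> b) = \<ominus> a \<oplus> \<ominus> b" by (simp add: minus_add)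
thus ?case using acl_add Y by (metis acl.acl_add)
qed

lemma acl_additive_subgroup:
"Y <= carrier G ==> (!!y. y : Y ==> \<ominus> y : Y) ==> additive_subgroup (acl G Y) G"
by (rule subgroupI'[OF acl_closed acl_zero acl_plus acl_minus])

lemma finsum_supp:
"finite A ==> B <= A ==> f : A \<rightarrow> carrier G ==> (!!i. i : A - B ==> f i = \<zero>) ==> finsum G f A = finsum G f B"
by (rule add.finprod_mono_neutral_cong_right) auto

lemma finsum_acl: "finite A ==> Y <= carrier G ==> f : A \<rightarrow> acl G Y ==> finsum G f A : acl G Y"
proof (induction rule: finite_induct)
case (insert x A)
have "f : A \<rightarrow> carrier G" "f x : carrier G" using insert acl_closed by blast+
with insert show ?case by (auto intro!: acl_plus)
qed (simp add: acl_zero)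

lemma double_zero: "x : carrier G ==> x = x \<oplus> x ==> x = \<zero>"
by (metis add.r_cancel_one')

lemma acl_sum_of_components:
assumes "Y' <= Y" "finite Y'" "f : Y' \<rightarrow> carrier G" "!!y. y : Y' ==> f y : C y"
 "(UN y:Y. C y) <= carrier G"
shows "finsum G f Y' : acl G (UN y:Y. C y)"
using assms by (intro finsum_acl) (auto intro!: acl_base)

lemma diff_zero: "x : carrier G ==> y : carrier G ==> x \<ominus> y = \<zero> ==> x = y"
by (metis a_minus_def add.inv_closed minus_equality minus_minus)

lemma sub_add: "x : carrier G ==> y : carrier G ==> x \<ominus> y \<oplus> y = x"
by (simp add: a_minus_def a_assoc l_neg)

end

section \<open>Additive maps between abelian groups\<close>

definition addmap :: "('u, 'm) ring_scheme => ('v, 'n) ring_scheme => ('u => 'v) => bool" where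
"addmap M N f <-> f : carrier M \<rightarrow> carrier N &
  (ALL x:carrier M. ALL y:carrier M. f (x +[M] y) = f x +[N] f y)"

lemma addmap_closed: "addmap M N f ==> x : carrier M ==> f x : carrier N"
and addmap_add: "addmap M N f ==> x : carrier M ==> y : carrier M ==> f (x +[M] y) = f x +[N] f y"
by (auto simp: addmap_def)

lemma addmap_zero:
assumes "addmap M N f" "abelian_group M" "abelian_group N" shows "f 0[M] = 0[N]"
proof -
interpret M: abelian_group M by fact
interpret N: abelian_group N by fact
show ?thesis using addmap_add[OF assms(1), of "0[M]" "0[M]"] addmap_closed[OF assms(1), of "0[M]"]
 by (intro N.double_zero) auto
qed

lemma addmap_minus:
assumes "addmap M N f" "abelian_group M" "abelian_group N" "x : carrier M"
shows "f (-[M] x) = -[N] (f x)"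
proof -
interpret M: abelian_group M by fact
interpret N: abelian_group N by fact
have "f (-[M] x) +[N] f x = 0[N]"
 using addmap_add[OF assms(1), of "-[M] x" x] addmap_zero[OF assms(1-3)] assms(4) by (simp add: M.l_neg)
thus ?thesis using assms addmap_closed[OF assms(1)]
 by (metis M.a_inv_closed N.minus_equality)
qed

lemma addmap_diff:
assumes "addmap M N f" "abelian_group M" "abelian_group N" "x : carrier M" "y : carrier M"
shows "f (x -[M] y) = f x -[N] f y"
proof -
interpret M: abelian_group M by fact
show ?thesis using assms addmap_add[OF assms(1), of x "-[M] y"] addmap_minus[OF assms(1-3), of y]
 by (simp add: a_minus_def)
qed

lemma addmap_finsum:
assumes "addmap M N f" "abelian_group M" "abelian_group N" "finite A" "g : A \<rightarrow> carrier M"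
shows "f (finsum M g A) = finsum N (%i. f (g i)) A"
using assms(4,5)
proof (induction rule: finite_induct)
case empty
interpret M: abelian_group M by fact
interpret N: abelian_group N by fact
show ?case using addmap_zero[OF assms(1-3)] by simp
next
case (insert x A)
interpret M: abelian_group M by fact
interpret N: abelian_group N by fact
have "f (finsum M g (insert x A)) = f (g x +[M] finsum M g A)" using insert by (simp add: Pi_def)
also have "... = f (g x) +[N] f (finsum M g A)"
 using insert by (intro addmap_add[OF assms(1)]) (auto simp: Pi_def)
also have "... = finsum N (%i. f (g i)) (insert x A)"
 using insert addmap_closed[OF assms(1)] by (subst N.finsum_insert) (auto simp: Pi_def)
finally show ?case .
qed

lemma addmap_acl:
assumes f: "addmap M N f" "abelian_group M" "abelian_group N" and Y: "Y <= carrier M" and x: "x : acl M Y"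
shows "f x : acl N (f ` Y)"
using x
proof induction
case acl_zero thus ?case using addmap_zero[OF f] by (simp add: acl.acl_zero)
next
case (acl_add x y)
have "y : carrier M" using acl_add abelian_group.acl_closed[OF f(2) Y] by auto
moreover have "x : carrier M" using acl_add Y by blast
ultimately show ?case using acl_add acl.acl_add[of "f x" "f ` Y" "f y" N] by (simp add: addmap_add[OF f(1)])
qed

lemma addmap_eq_acl:
assumes "addmap M N f" "addmap M N g" "abelian_group M" "abelian_group N" "Y <= carrier M"
 "!!y. y : Y ==> f y = g y" and x: "x : acl M Y"
shows "f x = g x"
using x
proof induction
case acl_zero thus ?case using addmap_zero assms by metis
next
case (acl_add x y)
have "y : carrier M" using acl_add abelian_group.acl_closed[OF assms(3,5)] by auto
thus ?case using acl_add assms(5,6) addmap_add[OF assms(1), of x y] addmap_add[OF assms(2), of x y]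
 by (metis subsetD)
qed

section \<open>Graded algebras, graded modules and homogeneous components\<close>

lemma module_update:
assumes "module R M" "carrier N = carrier M" "add N = add M" "0[N] = 0[M]" "smult N = smult M"
shows "module R N"
proof -
interpret module R M by fact
show ?thesis
 using assms(2-)
 by (intro moduleI R.is_cring abelian_groupI)
  (auto simp: smult_l_distr smult_r_distr smult_assoc1 M.a_assoc M.a_comm M.a_lcomm intro!: M.l_neg bexI[of _ "-[M] _"])
qed

text \<open>Abstracts what the two coordinate algebras have in common. The integer degree
  \<open>dg\<close> is positive on the finitely many generators \<open>XS\<close>, and only scalars
  from \<open>k\<close> sit in the neutral degree, so inductions over \<open>dg\<close> end. The
  projections \<open>pr\<close> express directness of the grading by equations instead of a
  statement about sums.\<close>

locale galg =
fixes S :: "('a, 'k::field, 'l) graded_algebra" and dg :: "'l => int"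
 and pr :: "'l => 'a => 'a" and XS :: "('a \<times> 'l) set"
assumes cring: "cring S"
 and grp: "comm_group (gg S)"
 and comp_sub: "l : carrier (gg S) ==> additive_subgroup (cmp S l) S"
 and comp_mult: "a : carrier (gg S) ==> b : carrier (gg S) ==>
   s : cmp S a ==> t : cmp S b ==> s *[S] t : cmp S (a *[gg S] b)"
 and pr_in: "l : carrier (gg S) ==> s : carrier S ==> pr l s : cmp S l"
 and pr_add: "l : carrier (gg S) ==> s : carrier S ==> t : carrier S ==>
   pr l (s +[S] t) = pr l s +[S] pr l t"
 and pr_comp: "l : carrier (gg S) ==> a : carrier (gg S) ==> s : cmp S a ==>
   pr l s = (if l = a then s else 0[S])"
 and comp_gen: "carrier S <= acl S (UN l:carrier (gg S). cmp S l)"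
 and dg_add: "a : carrier (gg S) ==> b : carrier (gg S) ==>
   dg (a *[gg S] b) = dg a + dg b"
 and dg_neg: "l : carrier (gg S) ==> dg l < 0 ==> cmp S l = {0[S]}"
 and finX: "finite XS"
 and Xin: "(x, e) : XS ==> e : carrier (gg S) & x : cmp S e & 0 < dg e"
 and comp_X: "l : carrier (gg S) ==> l ~= 1[gg S] ==> cmp S l<=
   acl S {x *[S] s | x e s. (x, e) : XS & s : cmp S (inv[gg S] e *[gg S] l)}"
 and comp_one: "cmp S 1[gg S] = range (smap S)"
 and sm_one: "smap S 1 = 1[S]"
 and sm_add: "smap S (c + d) = smap S c +[S] smap S d"
 and sm_mult: "smap S (c * d) = smap S c *[S] smap S d"
begin

abbreviation "L == gg S"
abbreviation gmod where "gmod M == is_graded_module S M"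

sublocale SR: cring S by (rule cring)
sublocale LG: comm_group L by (rule grp)

lemma comp_carrier: "l : carrier L ==> s : cmp S l ==> s : carrier S"
using comp_sub additive_subgroup.a_subset by blast

lemma sm_closed [simp]: "smap S c : carrier S"
using comp_one comp_carrier[of "1[L]"] by auto

lemma sm_comp: "smap S c : cmp S 1[L]"
by (simp add: comp_one)

lemma one_comp: "1[S] : cmp S 1[L]"
using sm_comp[of 1] by (simp add: sm_one)

lemma dg_one [simp]: "dg 1[L] = 0"
using dg_add[of "1[L]" "1[L]"] by simp

lemma dg_inv: "a : carrier L ==> dg (inv[L] a) = - dg a"
using dg_add[of a "inv[L] a"] by simp

lemma pr_addmap: "l : carrier L ==> addmap S S (pr l)"
using pr_in pr_add comp_carrier by (auto simp: addmap_def)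

lemma pr_zero: "l : carrier L ==> pr l 0[S] = 0[S]"
using addmap_zero[OF pr_addmap] SR.abelian_group_axioms by blast

lemma scalar_induct [consumes 1, case_names zero add]:
assumes "s : carrier S" "P 0[S]"
 "!!a x y. a : carrier L ==> x : cmp S a ==> y : carrier S ==> P y ==> P (x +[S] y)"
shows "P s"
proof -
have "s : acl S (UN l:carrier L. cmp S l)" using comp_gen assms(1) by blast
hence "P s & s : carrier S"
 by induction (use assms(2,3) comp_carrier in auto)
thus ?thesis by simp
qed

lemma gmod_module: "gmod M ==> module S M"
and gmod_ext: "gmod M ==> dpart M : extensional (carrier L)"
and gmod_sub: "gmod M ==> l : carrier L ==> additive_subgroup (dpart M l) M"
and gmod_act: "gmod M ==> a : carrier L ==> l : carrier L ==> s : cmp S a ==> m : dpart M l ==>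
 s .[M] m : dpart M (a *[L] l)"
by (auto simp: is_graded_module_def)

lemma gmod_ab: "gmod M ==> abelian_group M"
using gmod_module by (auto simp: module_def)

lemma gmod_carrier: "gmod M ==> l : carrier L ==> m : dpart M l ==> m : carrier M"
using gmod_sub additive_subgroup.a_subset by blast

lemma gmod_parts: "gmod M ==> (UN l:carrier L. dpart M l) <= carrier M"
by (auto intro: gmod_carrier)

text \<open>Additive projections \<open>p l\<close> that are the identity on one component and zero
  on the others settle the unique decomposition: existence is an induction over sums of homogeneous
  elements, and applying \<open>p l\<close> to any decomposition returns its summand of degree
  \<open>l\<close>.\<close>

lemma gradedI:
assumes mod: "module S M"
 and ext: "dpart M : extensional (carrier L)"
 and sub: "!!l. l : carrier L ==> additive_subgroup (dpart M l) M"
 and act: "!!a l s m. a : carrier L ==> l : carrier L ==> s : cmp S a ==> m : dpart M l ==>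
  s .[M] m : dpart M (a *[L] l)"
 and p_in: "!!l m. l : carrier L ==> m : carrier M ==> p l m : dpart M l"
 and p_add: "!!l x y. l : carrier L ==> x : carrier M ==> y : carrier M ==> p l (x +[M] y) = p l x +[M] p l y"
 and p_comp: "!!l a m. l : carrier L ==> a : carrier L ==> m : dpart M a ==> p l m = (if l = a then m else 0[M])"
 and gen: "carrier M <= acl M (UN l:carrier L. dpart M l)"
shows "gmod M" and "!!m. m : carrier M ==> finite {l : carrier L. p l m ~= 0[M]}"
 "!!m A. m : carrier M ==> finite A ==> A <= carrier L ==> {l : carrier L. p l m ~= 0[M]} <= A ==>
   finsum M (%l. p l m) A = m"
proof -
interpret module S M by fact
have pc: "m : dpart M l ==> l : carrier L ==> m : carrier M" for m l
 using sub additive_subgroup.a_subset by blast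
have Ys: "(UN l:carrier L. dpart M l) <= carrier M" using pc by blast
have pmap: "addmap M M (p l)" if "l : carrier L" for l
 unfolding addmap_def using p_in[OF that] p_add[OF that] pc[OF _ that] by blast
have pcl: "p l m : carrier M" if "l : carrier L" "m : carrier M" for l m
 using pc[OF p_in[OF that] that(1)] .
have p0: "p l 0[M] = 0[M]" if "l : carrier L" for l
 using addmap_zero[OF pmap[OF that]] M.abelian_group_axioms by blast
have main: "finite {l : carrier L. p l m ~= 0[M]} & (ALL A. finite A --> A <= carrier L -->
  {l : carrier L. p l m ~= 0[M]} <= A --> finsum M (%l. p l m) A = m)" if "m : carrier M" for m
proof -
 have "m : acl M (UN l:carrier L. dpart M l)" using gen that by blast
 thus ?thesis
 proof induction
  case acl_zero
  have "finsum M (%l. p l 0[M]) A = 0[M]" if "A <= carrier L" for A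
   using that p0 by (intro M.add.finprod_one_eqI) auto
  moreover have "{l : carrier L. p l 0[M] ~= 0[M]} = {}" using p0 by auto
  ultimately show ?case by (metis finite.emptyI)
 next
  case (acl_add x y)
  then obtain a where a: "a : carrier L" "x : dpart M a" by blast
  have xy: "x : carrier M" "y : carrier M" using a pc acl_add M.acl_closed[OF Ys] by blast+
  have sup: "{l : carrier L. p l (x +[M] y) ~= 0[M]} <= insert a {l : carrier L. p l y ~= 0[M]}"
   using a p_comp p_add xy by auto
  have fin: "finite (insert a {l : carrier L. p l y ~= 0[M]})" using acl_add by auto
  moreover have "finsum M (%l. p l (x +[M] y)) A = x +[M] y"
   if A: "finite A" "A <= carrier L" "{l : carrier L. p l (x +[M] y) ~= 0[M]} <= A" for A
  proof -
   \<comment> \<open>The induction hypothesis needs an index set containing the support of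
     \<open>y\<close>. The set \<open>A\<close> may miss part of it, since terms of \<open>x\<close>
     and \<open>y\<close> can cancel.\<close>
   define A' where "A' = A Un insert a {l : carrier L. p l y ~= 0[M]}"
   have A': "finite A'" "A' <= carrier L" using A fin a by (auto simp: A'_def)
   have px: "p l x = (if l = a then x else 0[M])" if "l : carrier L" for l
    using p_comp[OF that a] .
   have "finsum M (%l. p l (x +[M] y)) A = finsum M (%l. p l (x +[M] y)) A'"
    using A A' xy pcl by (intro M.finsum_supp[symmetric]) (auto simp: A'_def)
   also have "... = finsum M (%l. p l x +[M] p l y) A'"
    using A' xy pcl p_add by (intro M.finsum_cong') auto
   also have "... = finsum M (%l. p l x) A' +[M] finsum M (%l. p l y) A'"
    using A' xy pcl by (intro M.finsum_addf) auto
   also have "finsum M (%l. p l x) A' = finsum M (%l. p l x) {a}"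
    using a(1) A' xy(1) px by (intro M.finsum_supp) (auto simp: A'_def)
   also have "... = x" using xy px[OF a(1)] by (subst M.finsum_insert) auto
   also have "finsum M (%l. p l y) A' = y"
    by (rule conjunct2[OF acl_add(3), rule_format, OF A']) (use a in "auto simp: A'_def")
   finally show ?thesis .
  qed
  ultimately show ?case using finite_subset[OF sup] by blast
 qed
qed
thus fin: "!!m. m : carrier M ==> finite {l : carrier L. p l m ~= 0[M]}"
 and sum: "!!m A. m : carrier M ==> finite A ==> A <= carrier L ==> {l : carrier L. p l m ~= 0[M]} <= A ==>
   finsum M (%l. p l m) A = m"
 by blast+
have "EX! f. f : (\<Pi>\<^sub>E l\<in>carrier L. dpart M l) & finite {l : carrier L. f l ~= 0[M]} &
   m = finsum M f {l : carrier L. f l ~= 0[M]}" if m: "m : carrier M" for m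
proof (rule ex1I)
 let ?f = "\<lambda>l\<in>carrier L. p l m"
 have eq: "{l : carrier L. ?f l ~= 0[M]} = {l : carrier L. p l m ~= 0[M]}" by auto
 have "finsum M ?f {l : carrier L. p l m ~= 0[M]} = finsum M (%l. p l m) {l : carrier L. p l m ~= 0[M]}"
  using m pcl by (intro M.finsum_cong') auto
 thus "?f : (\<Pi>\<^sub>E l\<in>carrier L. dpart M l) & finite {l : carrier L. ?f l ~= 0[M]} &
   m = finsum M ?f {l : carrier L. ?f l ~= 0[M]}"
  unfolding eq using sum[OF m fin[OF m]] fin[OF m] p_in m by auto
next
 fix f assume f: "f : (\<Pi>\<^sub>E l\<in>carrier L. dpart M l) & finite {l : carrier L. f l ~= 0[M]} &
   m = finsum M f {l : carrier L. f l ~= 0[M]}"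
 let ?A = "{l : carrier L. f l ~= 0[M]}"
 have fc: "f l : dpart M l" if "l : carrier L" for l using f that by auto
 have "p l m = f l" if l: "l : carrier L" for l
 proof -
  have fcar: "f i : carrier M" if "i : carrier L" for i using pc[OF fc[OF that] that] .
  have pf: "p l (f i) = (if l = i then f i else 0[M])" if "i : carrier L" for i
   using p_comp[OF l that fc[OF that]] .
  have pfc: "p l (f i) : carrier M" if "i : carrier L" for i using pf[OF that] fcar[OF that] by simp
  have "p l m = finsum M (%i. p l (f i)) ?A"
   using f addmap_finsum[OF pmap[OF l] M.abelian_group_axioms M.abelian_group_axioms, of ?A f] fcar by auto
  also have "... = finsum M (%i. p l (f i)) (insert l ?A)"
   using f l pfc p0[OF l] by (intro M.finsum_supp[symmetric]) auto
  also have "... = finsum M (%i. p l (f i)) {l}"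
   using f l fcar pf by (intro M.finsum_supp) auto
  also have "... = f l" using pf[OF l] fcar[OF l] by (subst M.finsum_insert) auto
  finally show ?thesis .
 qed
 thus "f = (\<lambda>l\<in>carrier L. p l m)" using f by (intro extensionalityI[of _ "carrier L"]) (auto simp: PiE_def)
qed
thus "gmod M" using mod ext sub act by (auto simp: is_graded_module_def)
qed

text \<open>The homogeneous component of \<open>m\<close> in degree \<open>l\<close>.\<close>

definition cp :: "('a, 'u, 'l) graded_module => 'l => 'u => 'u" where
"cp M l m = (THE f. f : (\<Pi>\<^sub>E l\<in>carrier L. dpart M l) &
   finite {l : carrier L. f l ~= 0[M]} & m = finsum M f {l : carrier L. f l ~= 0[M]}) l"

lemma
assumes "gmod M" "m : carrier M"
shows cp_in: "l : carrier L ==> cp M l m : dpart M l"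
 and cp_finite: "finite {l : carrier L. cp M l m ~= 0[M]}"
 and cp_sum: "m = finsum M (%l. cp M l m) {l : carrier L. cp M l m ~= 0[M]}"
proof -
let ?P = "%f. f : (\<Pi>\<^sub>E l\<in>carrier L. dpart M l) &
   finite {l : carrier L. f l ~= 0[M]} & m = finsum M f {l : carrier L. f l ~= 0[M]}"
have "EX! f. ?P f" using assms by (simp add: is_graded_module_def)
from theI'[OF this] have P: "?P (%l. cp M l m)" unfolding cp_def .
show "l : carrier L ==> cp M l m : dpart M l" using P by auto
show "finite {l : carrier L. cp M l m ~= 0[M]}" using P by auto
show "m = finsum M (%l. cp M l m) {l : carrier L. cp M l m ~= 0[M]}" using P by blast
qed

lemma cp_unique:
assumes M: "gmod M" and f: "!!l. l : carrier L ==> f l : dpart M l"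
 and A: "finite A" "A <= carrier L" "!!l. l : carrier L - A ==> f l = 0[M]"
 and m: "m = finsum M f A" and l: "l : carrier L"
shows "cp M l m = f l"
proof -
interpret module S M using M gmod_module by blast
let ?P = "%f. f : (\<Pi>\<^sub>E l\<in>carrier L. dpart M l) &
   finite {l : carrier L. f l ~= 0[M]} & m = finsum M f {l : carrier L. f l ~= 0[M]}"
let ?g = "\<lambda>l\<in>carrier L. f l"
have fc: "f l : carrier M" if "l : carrier L" for l using f gmod_carrier[OF M] that by blast
have sup: "{l : carrier L. ?g l ~= 0[M]} <= A" using A by auto
have "finsum M f A = finsum M ?g A" using A fc by (intro M.finsum_cong') auto
also have "... = finsum M ?g {l : carrier L. ?g l ~= 0[M]}"
 using A fc by (intro M.finsum_supp) auto
finally have P: "?P ?g" using f m finite_subset[OF sup A(1)] by auto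
have "m : carrier M" using m A fc by (auto intro!: M.finsum_closed)
hence "EX! f. ?P f" using M by (simp add: is_graded_module_def)
hence "(THE f. ?P f) = ?g" using the1_equality[of ?P ?g] P by blast
thus ?thesis using l by (simp add: cp_def)
qed

lemma cp_comp:
assumes M: "gmod M" and "l : carrier L" "a : carrier L" "m : dpart M a"
shows "cp M l m = (if l = a then m else 0[M])"
proof -
interpret module S M using M gmod_module by blast
have m: "m : carrier M" using gmod_carrier[OF assms(1,3,4)] .
show ?thesis
 by (rule cp_unique[OF M, where A = "{a}" and f = "%l. if l = a then m else 0[M]"])
  (use assms m additive_subgroup.zero_closed[OF gmod_sub[OF M]] in auto)
qed

lemma cp_add:
assumes M: "gmod M" and l: "l : carrier L" and x: "x : carrier M" and y: "y : carrier M"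
shows "cp M l (x +[M] y) = cp M l x +[M] cp M l y"
proof -
interpret module S M using M gmod_module by blast
let ?s = "%x. {l : carrier L. cp M l x ~= 0[M]}"
let ?A = "?s x Un ?s y"
have c: "cp M l x : carrier M" if "x : carrier M" "l : carrier L" for x l
 using that cp_in[OF M] gmod_carrier[OF M] by blast
have A: "finite ?A" using cp_finite[OF M] x y by blast
have e: "z = finsum M (%l. cp M l z) ?A" if "z = x | z = y" for z
proof -
 have z: "z : carrier M" using that x y by blast
 have "finsum M (%l. cp M l z) ?A = finsum M (%l. cp M l z) (?s z)"
  using A c[OF z] that by (intro M.finsum_supp) auto
 thus ?thesis using cp_sum[OF M z] by simp
qed
have "finsum M (%l. cp M l x +[M] cp M l y) ?A = finsum M (%l. cp M l x) ?A +[M] finsum M (%l. cp M l y) ?A"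
 using A c x y by (intro M.finsum_addf) auto
hence s: "x +[M] y = finsum M (%l. cp M l x +[M] cp M l y) ?A" using e by metis
show ?thesis
 by (rule cp_unique[OF M _ A _ _ s l])
  (use x y in "auto intro!: additive_subgroup.a_closed[OF gmod_sub[OF M]] cp_in[OF M]")
qed

lemma cp_addmap: "gmod M ==> l : carrier L ==> addmap M M (cp M l)"
unfolding addmap_def by (auto intro: cp_in gmod_carrier cp_add)

lemma cp_zero: "gmod M ==> l : carrier L ==> cp M l 0[M] = 0[M]"
using addmap_zero[OF cp_addmap] gmod_ab by blast

lemma homog_gen:
assumes M: "gmod M" shows "carrier M <= acl M (UN l:carrier L. dpart M l)"
proof
interpret module S M using M gmod_module by blast
fix m assume m: "m : carrier M"
have "finsum M (%l. cp M l m) {l : carrier L. cp M l m ~= 0[M]} : acl M (UN l:carrier L. dpart M l)"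
 using cp_finite[OF M m] cp_in[OF M m] gmod_carrier[OF M]
 by (intro M.acl_sum_of_components) auto
thus "m : acl M (UN l:carrier L. dpart M l)" using cp_sum[OF M m] by simp
qed

lemma homog_induct [consumes 2, case_names zero add]:
assumes M: "gmod M" and "m : carrier M" "P 0[M]"
 "!!a x y. a : carrier L ==> x : dpart M a ==> y : carrier M ==> P y ==> P (x +[M] y)"
shows "P m"
proof -
interpret module S M using M gmod_module by blast
have "m : acl M (UN l:carrier L. dpart M l)" using homog_gen M assms(2) by blast
hence "P m & m : carrier M"
 by induction (use assms(3,4) gmod_carrier[OF M] in auto)
thus ?thesis by simp
qed

lemma cp_smult:
assumes M: "gmod M" and al: "a : carrier L" "l : carrier L" and s: "s : cmp S a" and m: "m : carrier M"
shows "cp M l (s .[M] m) = s .[M] cp M (inv[L] a *[L] l) m"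
using M m
proof (induction rule: homog_induct)
case zero
interpret module S M using M gmod_module by blast
show ?case using al s comp_carrier cp_zero[OF M] by auto
next
case (add b x y)
interpret module S M using M gmod_module by blast
have c: "s : carrier S" "x : carrier M" "s .[M] x : carrier M"
 using s al comp_carrier gmod_carrier[OF M] add by auto
have il: "inv[L] a *[L] l : carrier L" using al by auto
have "cp M l (s .[M] x) = s .[M] cp M (inv[L] a *[L] l) x"
proof -
 have "l = a *[L] b <-> inv[L] a *[L] l = b"
  using al add(1) by (metis LG.inv_solve_left LG.m_closed LG.inv_closed)
 thus ?thesis
  using cp_comp[OF M al(2) _ gmod_act[OF M al(1) add(1) s add(2)]] cp_comp[OF M il add(1,2)] al add(1) c
  by (auto)
qed
thus ?case using add c al
 by (simp add: smult_r_distr cp_add[OF M] il addmap_closed[OF cp_addmap[OF M]])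
qed

end

section \<open>Ascending chains of subgroups stable under scalars\<close>

definition mul :: "('a, 'u, 'm) module_scheme => 'a set => 'u set => 'u set" where
"mul M K B = {s .[M] b | s b. s : K & b : B}"

text \<open>\<open>K\<close> is a bare set of scalars, not a subring, so that generators of the
  algebra can be adjoined to it one by one.\<close>

definition osub :: "'a set => ('a, 'u, 'm) module_scheme => 'u set => bool" where
"osub K M V <-> additive_subgroup V M & (ALL s:K. ALL v:V. s .[M] v : V)"

definition acc :: "'a set => ('a, 'u, 'm) module_scheme => 'u set => bool" where
"acc K M V <-> (ALL U :: nat => 'u set. (ALL i. osub K M (U i) & U i <= V & U i <= U (Suc i)) -->
  (EX n. ALL i>=n. U i = U n))"

lemma accD: "acc K M V ==> (!!i. osub K M (U i)) ==> (!!i. U i <= V) ==> (!!i. U i <= U (Suc i)) ==>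
 EX n. ALL i>=n. U i = U n"
unfolding acc_def by blast

context module
begin

lemma mul_carrier: "K <= carrier R ==> B <= carrier M ==> mul M K B <= carrier M"
by (auto simp: mul_def)

lemma osubD:
assumes "osub K M V"
shows "V <= carrier M" "0[M] : V" "!!x y. x : V ==> y : V ==> x +[M] y : V" "!!x. x : V ==> -[M] x : V"
 "!!x y. x : V ==> y : V ==> x -[M] y : V" "!!s x. s : K ==> x : V ==> s .[M] x : V"
using M.subgroup_facts[of V] assms by (auto simp: osub_def a_minus_def)

lemma osubI:
assumes "V <= carrier M" "0[M] : V" "!!x y. x : V ==> y : V ==> x +[M] y : V" "!!x. x : V ==> -[M] x : V"
 "!!s x. s : K ==> x : V ==> s .[M] x : V"
shows "osub K M V"
using assms by (auto simp: osub_def intro!: M.subgroupI')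

lemma osub_span:
assumes "B <= carrier M" shows "osub (carrier R) M (acl M (mul M (carrier R) B))"
proof (rule osubI)
have c: "mul M (carrier R) B <= carrier M" using mul_carrier assms by blast
show "acl M (mul M (carrier R) B) <= carrier M" using M.acl_closed[OF c] .
show "0[M] : acl M (mul M (carrier R) B)" by (rule acl_zero)
show "!!x y. x : acl M (mul M (carrier R) B) ==> y : acl M (mul M (carrier R) B) ==> x +[M] y : acl M (mul M (carrier R) B)"
 using M.acl_plus[OF c] .
have "-[M] y : mul M (carrier R) B" if yy: "y : mul M (carrier R) B" for y
proof -
 obtain s b where sb: "s : carrier R" "b : B" "y = s .[M] b" using yy by (auto simp: mul_def)
 hence "-[M] y = (\<ominus> s) .[M] b" using assms smult_l_minus[of s b] by auto
 thus ?thesis using sb R.a_inv_closed unfolding mul_def by blast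
qed
thus "!!x. x : acl M (mul M (carrier R) B) ==> -[M] x : acl M (mul M (carrier R) B)"
 using M.acl_minus[OF c] by blast
show "s .[M] x : acl M (mul M (carrier R) B)" if s: "s : carrier R" and x: "x : acl M (mul M (carrier R) B)" for s x
proof -
 have "addmap M M (%x. s .[M] x)" using s by (auto simp: addmap_def smult_r_distr)
 hence "s .[M] x : acl M ((%x. s .[M] x) ` mul M (carrier R) B)"
  using addmap_acl[OF _ _ _ c x] M.abelian_group_axioms by blast
 moreover have "(%x. s .[M] x) ` mul M (carrier R) B <= mul M (carrier R) B"
 proof
  fix y assume "y : (%x. s .[M] x) ` mul M (carrier R) B"
  then obtain t b where "t : carrier R" "b : B" "y = s .[M] (t .[M] b)" by (auto simp: mul_def)
  hence "y = (s \<otimes> t) .[M] b" using s assms by (auto simp: smult_assoc1)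
  thus "y : mul M (carrier R) B" using s \<open>t : carrier R\<close> \<open>b : B\<close> by (auto simp: mul_def)
 qed
 ultimately show ?thesis using acl_mono by blast
qed
qed

lemma span_base: "B <= carrier M ==> B <= acl M (mul M (carrier R) B)"
proof
fix b assume "B <= carrier M" "b : B"
hence "b = \<one> .[M] b" by auto
hence "b : mul M (carrier R) B" using \<open>b : B\<close> R.one_closed unfolding mul_def by blast
thus "b : acl M (mul M (carrier R) B)" using M.acl_base[OF mul_carrier[OF subset_refl \<open>B <= carrier M\<close>]] by blast
qed

lemma chain_mono: "(!!i. U i <= U (Suc i)) ==> i <= j ==> U i <= (U j :: 'z set)"
using lift_Suc_mono_le[of U] by blast

text \<open>A chain in the sum is controlled by two chains: its intersections with \<open>V1\<close>
  and the sets of \<open>V2\<close>-parts of its members. Once both are stationary, a member of a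
  later term and a member of the stationary term with the same \<open>V2\<close>-part differ by an
  element of the first chain.\<close>

lemma acc_sum:
assumes V: "osub K M V1" "osub K M V2" and K: "K <= carrier R" and a: "acc K M V1" "acc K M V2"
shows "osub K M {x +[M] y | x y. x : V1 & y : V2}" (is "osub K M ?V")
 and "acc K M {x +[M] y | x y. x : V1 & y : V2}"
proof -
note V1 = osubD[OF V(1)] and V2 = osubD[OF V(2)]
have c: "x : V1 ==> x : carrier M" "y : V2 ==> y : carrier M" for x y using V1 V2 by auto
show "osub K M ?V"
proof (rule osubI)
 show "?V <= carrier M" using c by auto
 show "0[M] : ?V" using V1(2) V2(2) by force
 show "x +[M] y : ?V" if xy: "x : ?V" "y : ?V" for x y
 proof -
  obtain a b a' b' where "a : V1" "b : V2" "a' : V1" "b' : V2" "x = a +[M] b" "y = a' +[M] b'" using xy by blast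
  moreover from this have "x +[M] y = (a +[M] a') +[M] (b +[M] b')" using c by (simp add: M.a_ac)
  ultimately show ?thesis using V1(3) V2(3) by blast
 qed
 show "-[M] x : ?V" if x: "x : ?V" for x
 proof -
  obtain a b where "a : V1" "b : V2" "x = a +[M] b" using x by blast
  thus ?thesis using c V1(4) V2(4) by (force simp: M.minus_add)
 qed
 show "s .[M] x : ?V" if s: "s : K" and x: "x : ?V" for s x
 proof -
  obtain a b where "a : V1" "b : V2" "x = a +[M] b" using x by blast
  thus ?thesis using c V1(6)[OF s] V2(6)[OF s] s K by (force simp: smult_r_distr)
 qed
qed
show "acc K M ?V" unfolding acc_def
proof (intro allI impI)
 fix U :: "nat => _ set" assume U: "ALL i. osub K M (U i) & U i <= ?V & U i <= U (Suc i)"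
 hence Uo: "osub K M (U i)" and UV: "U i <= ?V" and Us: "U i <= U (Suc i)" for i by auto
 note Ud = osubD[OF Uo]
 let ?A = "%i. U i Int V1" and ?C = "%i. {y : V2. EX x:V1. x +[M] y : U i}"
 have "osub K M (?A i)" for i
  using osubD[OF Uo[of i]] V1 Us[of i] by (auto intro!: osubI)
 then obtain n1 where n1: "!!i. i >= n1 ==> ?A i = ?A n1" using accD[OF a(1), of ?A] Us by blast
 have "osub K M (?C i)" for i
 proof (rule osubI)
  show "?C i <= carrier M" using c by auto
  show "0[M] : ?C i" using Ud(2)[of i] V1(2) V2(2) by (auto intro!: bexI[of _ "0[M]"])
  show "x +[M] y : ?C i" if asm: "x : ?C i" "y : ?C i" for x y
  proof -
   obtain a b where "a : V1" "b : V1" "a +[M] x : U i" "b +[M] y : U i" "x : V2" "y : V2" using asm by blast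
   moreover from this have "(a +[M] b) +[M] (x +[M] y) = (a +[M] x) +[M] (b +[M] y)" using c by (simp add: M.a_ac)
   ultimately show ?thesis using Ud(3)[of "a +[M] x" i "b +[M] y"] V1(3)[of a b] V2(3)[of x y] by (auto intro!: bexI[of _ "a +[M] b"])
  qed
  show "-[M] x : ?C i" if asm: "x : ?C i" for x
  proof -
   obtain a where "a : V1" "a +[M] x : U i" "x : V2" using asm by blast
   moreover from this have "-[M] a +[M] (-[M] x) = -[M] (a +[M] x)" using c by (simp add: M.minus_add)
   ultimately show ?thesis using Ud(4)[of "a +[M] x" i] V1(4)[of a] V2(4)[of x] by (auto intro!: bexI[of _ "-[M] a"])
  qed
  show "s .[M] x : ?C i" if s: "s : K" and asm: "x : ?C i" for s x
  proof -
   obtain a where "a : V1" "a +[M] x : U i" "x : V2" using asm by blast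
   moreover from this have "s .[M] a +[M] s .[M] x = s .[M] (a +[M] x)" using c s K by (auto simp: smult_r_distr)
   ultimately show ?thesis using Ud(6)[of s "a +[M] x" i] V1(6)[of s a] V2(6)[of s x] s by (auto intro!: bexI[of _ "s .[M] a"])
  qed
 qed
 then obtain n2 where n2: "!!i. i >= n2 ==> ?C i = ?C n2" using accD[OF a(2), of ?C] Us by blast
 have "U i = U (max n1 n2)" if i: "i >= max n1 n2" for i
 proof
  show "U (max n1 n2) <= U i" using chain_mono[of U, OF Us i] .
  show "U i <= U (max n1 n2)"
  proof
   fix u assume u: "u : U i"
   then obtain x y where xy: "x : V1" "y : V2" "u = x +[M] y" using UV by blast
   have "y : ?C i" using xy u by blast
   also have "?C i = ?C (max n1 n2)" using n2[of i] n2[of "max n1 n2"] i by simp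
   finally obtain x' where x': "x' : V1" "x' +[M] y : U (max n1 n2)" by blast
   have U': "x' +[M] y : U i" using x' chain_mono[of U, OF Us i] by blast
   have e: "u -[M] (x' +[M] y) = x -[M] x'"
   proof -
    have "u -[M] (x' +[M] y) = x -[M] x' +[M] (y -[M] y)"
     using xy x' c by (simp add: a_minus_def M.minus_add M.a_ac)
    thus ?thesis using xy x' c by (simp add: a_minus_def M.r_neg)
   qed
   hence "x -[M] x' : ?A i" using Ud(5)[OF u U'] V1(5) xy x' by simp
   also have "?A i = ?A (max n1 n2)" using n1[of i] n1[of "max n1 n2"] i by simp
   finally have "u -[M] (x' +[M] y) : U (max n1 n2)" using e by simp
   hence "(u -[M] (x' +[M] y)) +[M] (x' +[M] y) : U (max n1 n2)" using Ud(3) x' by blast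
   thus "u : U (max n1 n2)" using M.sub_add[of u "x' +[M] y"] c xy x' by simp
  qed
 qed
 thus "EX n. ALL i>=n. U i = U n" by blast
qed
qed

text \<open>The argument of Hilbert's basis theorem, with \<open>F j\<close> the polynomials in \<open>x\<close> of degree below \<open>j\<close>
and \<open>C j s\<close> the leading coefficients of degree \<open>j\<close> in \<open>U s\<close>.\<close>

lemma acc_step:
assumes V: "osub K M V" and K: "K <= carrier R" and x: "x : carrier R" and a: "acc K M V"
shows "EX V'. osub (insert x K) M V' & V <= V' & acc (insert x K) M V'"
proof -
note V = osubD[OF V]
have c: "v : V ==> v : carrier M" for v using V by auto
define F where "F = rec_nat {0[M]} (%j A. {b +[M] (x [^] j) .[M] m | b m. b : A & m : V})"
have F0: "F 0 = {0[M]}" and FS: "F (Suc j) = {b +[M] (x [^] j) .[M] m | b m. b : F j & m : V}" for j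
 by (simp_all add: F_def)
have xj: "x [^] (j::nat) : carrier R" for j using x by simp
have Fo: "osub K M (F j)" for j
proof (induction j)
 case 0 show ?case unfolding F0 by (rule osubI) (use K in auto)
next
 case (Suc j)
 note Fj = osubD[OF Suc]
 have Fc: "b : F j ==> b : carrier M" for b using Fj by auto
 show ?case
 proof (rule osubI)
  show "F (Suc j) <= carrier M" using Fc c xj by (auto simp: FS)
  show "0[M] : F (Suc j)" unfolding FS using Fj(2) V(2) xj by (force intro!: exI[of _ "0[M]"])
  show "y +[M] z : F (Suc j)" if yz: "y : F (Suc j)" "z : F (Suc j)" for y z
  proof -
   obtain b m b' m' where "b : F j" "m : V" "y = b +[M] (x [^] j) .[M] m" "b' : F j" "m' : V" "z = b' +[M] (x [^] j) .[M] m'"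
    using yz unfolding FS by blast
   moreover from this have "y +[M] z = (b +[M] b') +[M] (x [^] j) .[M] (m +[M] m')"
    using Fc c xj by (simp add: smult_r_distr M.a_ac)
   ultimately show ?thesis unfolding FS using Fj(3) V(3) by blast
  qed
  show "-[M] y : F (Suc j)" if y: "y : F (Suc j)" for y
  proof -
   obtain b m where "b : F j" "m : V" "y = b +[M] (x [^] j) .[M] m" using y unfolding FS by blast
   moreover from this have "-[M] y = (-[M] b) +[M] (x [^] j) .[M] (-[M] m)"
    using Fc c xj by (simp add: M.minus_add smult_r_minus)
   ultimately show ?thesis unfolding FS using Fj(4) V(4) by blast
  qed
  show "s .[M] y : F (Suc j)" if s: "s : K" and y: "y : F (Suc j)" for s y
  proof -
   obtain b m where bm: "b : F j" "m : V" "y = b +[M] (x [^] j) .[M] m" using y unfolding FS by blast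
   have sc: "s : carrier R" using s K by auto
   have "s .[M] y = s .[M] b +[M] (x [^] j) .[M] (s .[M] m)"
    using Fc c xj bm sc by (simp add: smult_r_distr smult_assoc1[symmetric] R.m_comm)
   thus ?thesis unfolding FS using Fj(6)[OF s] V(6)[OF s] bm by blast
  qed
 qed
qed
note Fd = osubD[OF Fo]
have Fc: "b : F j ==> b : carrier M" for b j using Fd by auto
have Fmono: "F j <= F (Suc j)" for j
proof
 fix b assume b: "b : F j"
 hence "b = b +[M] (x [^] j) .[M] 0[M]" using Fc xj by simp
 thus "b : F (Suc j)" unfolding FS using b V(2) by blast
qed
have Fx: "b : F j ==> x .[M] b : F (Suc j)" for b j
proof (induction j arbitrary: b)
 case 0 thus ?case using F0 Fd(2) x by simp
next
 case (Suc j)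
 then obtain d m where bm: "d : F j" "m : V" "b = d +[M] (x [^] j) .[M] m" unfolding FS by blast
 have "x .[M] b = x .[M] d +[M] (x [^] Suc j) .[M] m"
  using bm Fc c xj x by (simp add: smult_r_distr smult_assoc1[symmetric] R.m_comm)
 thus ?case using Suc.IH[OF bm(1)] bm unfolding FS[of "Suc j"] by blast
qed
define W where "W = (\<Union>j. F j)"
have Wo: "osub (insert x K) M W"
proof (rule osubI)
 show "W <= carrier M" using Fc by (auto simp: W_def)
 show "0[M] : W" using Fd(2) by (auto simp: W_def)
 show "y +[M] z : W" if yz: "y : W" "z : W" for y z
 proof -
  obtain i j where ij: "y : F i" "z : F j" using yz by (auto simp: W_def)
  have "y : F (max i j)" "z : F (max i j)"
   using ij chain_mono[of F i "max i j", OF Fmono] chain_mono[of F j "max i j", OF Fmono] by auto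
  thus ?thesis using Fd(3) by (auto simp: W_def)
 qed
 show "-[M] y : W" if "y : W" for y using that Fd(4) by (auto simp: W_def)
 show "s .[M] y : W" if "s : insert x K" "y : W" for s y using that Fd(6) Fx unfolding W_def by blast
qed
have VW: "V <= W"
proof
 fix v assume v: "v : V"
 hence "v = 0[M] +[M] (x [^] (0::nat)) .[M] v" using c by simp
 hence "v : F 1" using v F0 FS[of 0] by auto
 thus "v : W" by (auto simp: W_def)
qed
have "acc (insert x K) M W" unfolding acc_def
proof (intro allI impI)
 fix U :: "nat => _ set" assume U: "ALL i. osub (insert x K) M (U i) & U i <= W & U i <= U (Suc i)"
 hence Uo: "osub (insert x K) M (U i)" and UV: "U i <= W" and Us: "U i <= U (Suc i)" for i by auto
 note Ud = osubD[OF Uo]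
 have Uc: "u : U i ==> u : carrier M" for u i using Ud by auto
 define C where "C = (%j s. {m : V. EX b : F j. b +[M] (x [^] j) .[M] m : U s})"
 have Co: "osub K M (C j s)" for j s
 proof (rule osubI)
  show "C j s <= carrier M" using c by (auto simp: C_def)
  show "0[M] : C j s" using V(2) Fd(2)[of j] Ud(2)[of s] xj by (auto simp: C_def intro!: bexI[of _ "0[M]"])
  show "m +[M] m' : C j s" if asm: "m : C j s" "m' : C j s" for m m'
  proof -
   obtain b b' where b: "b : F j" "b' : F j" "b +[M] (x [^] j) .[M] m : U s" "b' +[M] (x [^] j) .[M] m' : U s"
    and m: "m : V" "m' : V" using asm unfolding C_def by blast
   have "(b +[M] b') +[M] (x [^] j) .[M] (m +[M] m') = (b +[M] (x [^] j) .[M] m) +[M] (b' +[M] (x [^] j) .[M] m')"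
    using b m Fc c xj by (simp add: smult_r_distr M.a_ac)
   thus ?thesis using Ud(3)[OF b(3,4)] Fd(3)[OF b(1,2)] V(3)[OF m] unfolding C_def
    by (metis (mono_tags, lifting) mem_Collect_eq)
  qed
  show "-[M] m : C j s" if asm: "m : C j s" for m
  proof -
   obtain b where b: "b : F j" "b +[M] (x [^] j) .[M] m : U s" and m: "m : V" using asm unfolding C_def by blast
   have "(-[M] b) +[M] (x [^] j) .[M] (-[M] m) = -[M] (b +[M] (x [^] j) .[M] m)"
    using b m Fc c xj by (simp add: M.minus_add smult_r_minus)
   thus ?thesis using Ud(4)[OF b(2)] Fd(4)[OF b(1)] V(4)[OF m] unfolding C_def
    by (metis (mono_tags, lifting) mem_Collect_eq)
  qed
  show "t .[M] m : C j s" if t: "t : K" and asm: "m : C j s" for t m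
  proof -
   obtain b where b: "b : F j" "b +[M] (x [^] j) .[M] m : U s" and m: "m : V" using asm unfolding C_def by blast
   have tc: "t : carrier R" using t K by auto
   have "t .[M] b +[M] (x [^] j) .[M] (t .[M] m) = t .[M] (b +[M] (x [^] j) .[M] m)"
    using b m Fc c xj tc by (simp add: smult_r_distr smult_assoc1[symmetric] R.m_comm)
   thus ?thesis using Ud(6)[OF _ b(2), of t] Fd(6)[OF t b(1)] V(6)[OF t m] t unfolding C_def
    by (metis (mono_tags, lifting) mem_Collect_eq insertI2)
  qed
 qed
 have Cs: "C j s <= C j (Suc s)" for j s using Us by (auto simp: C_def)
 have Cj: "C j s <= C (Suc j) s" for j s
 proof
  fix m assume "m : C j s"
  then obtain b where b: "b : F j" "b +[M] (x [^] j) .[M] m : U s" and m: "m : V" unfolding C_def by blast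
  have "x .[M] b +[M] (x [^] Suc j) .[M] m = x .[M] (b +[M] (x [^] j) .[M] m)"
   using b m Fc c xj x by (simp add: smult_r_distr smult_assoc1[symmetric] R.m_comm)
  thus "m : C (Suc j) s" using Ud(6)[OF insertI1 b(2)] Fx[OF b(1)] m unfolding C_def
   by (metis (mono_tags, lifting) mem_Collect_eq)
 qed
 have CV: "C j s <= V" for j s by (auto simp: C_def)
 have Cm: "C j s <= C j' s'" if "j <= j'" "s <= s'" for j j' s s'
  using chain_mono[of "%j. C j s" j j', OF Cj that(1)] chain_mono[of "C j'" s s', OF Cs that(2)] by blast
 \<comment> \<open>The diagonal is a single chain that controls all rows \<open>j\<close> beyond
   \<open>n0\<close>. Only the finitely many rows \<open>j <= n0\<close> remain, and
   \<open>n\<close> below also dominates their stopping points.\<close>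
 have "EX n. ALL i>=n. C i i = C n n"
  by (rule accD[of K M V "%i. C i i", OF a Co CV Cm]) auto
 then obtain n0 where n0: "!!i. i >= n0 ==> C i i = C n0 n0" by blast
 have "EX n. ALL i>=n. C j i = C j n" for j
  by (rule accD[of K M V "C j", OF a Co CV Cs])
 then obtain nj where nj: "!!j i. i >= nj j ==> C j i = C j (nj j)" by metis
 define n where "n = max n0 (Max (nj ` {..n0}))"
 have nn: "n0 <= n" "j <= n0 ==> nj j <= n" for j by (auto simp: n_def intro!: max.coboundedI2 Max_ge)
 have Cn: "C j s = C j n" if s: "s >= n" for j s
 proof (cases "j <= n0")
  case True thus ?thesis using nj[of j s] nj[of j n] nn(2)[of j] s by auto
 next
  case False
  have "C j t = C n0 n0" if t: "t >= n" for t
  proof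
   show "C j t <= C n0 n0" using Cm[of j "max j t" t "max j t"] n0[of "max j t"] False by auto
   show "C n0 n0 <= C j t" using Cm[of n0 j n0 t] False t nn by auto
  qed
  thus ?thesis using s by blast
 qed
 \<comment> \<open>Subtracting an element of \<open>U n\<close> with the same top coefficient lowers
   the degree in \<open>x\<close>. Top coefficients are not unique, as \<open>x\<close> may satisfy
   relations on \<open>V\<close>, but one common choice suffices.\<close>
 have key: "U s Int F j <= U n" if s: "s >= n" for s j
 proof (induction j)
  case 0 thus ?case using F0 Ud(2) by auto
 next
  case (Suc j)
  show ?case
  proof
   fix u assume u: "u : U s Int F (Suc j)"
   then obtain b m where bm: "b : F j" "m : V" "u = b +[M] (x [^] j) .[M] m" unfolding FS by blast
   hence "m : C j s" using u by (auto simp: C_def)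
   hence "m : C j n" using Cn s by blast
   then obtain b' where b': "b' : F j" "b' +[M] (x [^] j) .[M] m : U n" (is "?u' : _") unfolding C_def by blast
   have U': "?u' : U s" using b' chain_mono[of U, OF Us s] by blast
   have cc: "b : carrier M" "b' : carrier M" "(x [^] j) .[M] m : carrier M" using bm b' Fc c xj by auto
   have "u -[M] ?u' = b -[M] b' +[M] ((x [^] j) .[M] m -[M] (x [^] j) .[M] m)"
    using cc bm(3) by (simp add: a_minus_def M.minus_add M.a_ac)
   hence "u -[M] ?u' = b -[M] b'" using cc by (simp add: a_minus_def M.r_neg)
   hence "u -[M] ?u' : U s Int F j" using Ud(5)[OF _ U', of u] Fd(5)[OF bm(1) b'(1)] u by simp
   hence "(u -[M] ?u') +[M] ?u' : U n" using Suc Ud(3) b' by blast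
   thus "u : U n" using M.sub_add[of u ?u'] cc bm(3) by simp
  qed
 qed
 have "U s = U n" if s: "s >= n" for s
  using key[OF s] UV[of s] chain_mono[of U, OF Us s] unfolding W_def by blast
 thus "EX n. ALL i>=n. U i = U n" by blast
qed
with Wo VW show ?thesis by blast
qed

text \<open>Bridges \<open>finitely_spanned\<close>, which asks for one coefficient per generator,
  and sums of arbitrary products: coefficients of repeated generators are added up inside
  \<open>K\<close>.\<close>

lemma fs_iff:
assumes K: "K <= carrier R" "\<zero> : K" "!!x y. x : K ==> y : K ==> x \<oplus> y : K"
shows "(EX B. finite B & B <= carrier M & (ALL m : carrier M. EX c. c : B \<rightarrow> K & m = finsum M (%b. c b .[M] b) B)) <->
 (EX B. finite B & B <= carrier M & carrier M <= acl M (mul M K B))"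
proof (intro ex_cong1 conj_cong refl)
fix B assume B: "finite B" "B <= carrier M"
have mc: "mul M K B <= carrier M" using mul_carrier K B by blast
show "(ALL m : carrier M. EX c. c : B \<rightarrow> K & m = finsum M (%b. c b .[M] b) B) <-> carrier M <= acl M (mul M K B)"
proof
 assume l: "ALL m : carrier M. EX c. c : B \<rightarrow> K & m = finsum M (%b. c b .[M] b) B"
 show "carrier M <= acl M (mul M K B)"
 proof
  fix m assume "m : carrier M"
  then obtain c where cm: "c : B \<rightarrow> K" "m = finsum M (%b. c b .[M] b) B" using l by blast
  have "finsum M (%b. c b .[M] b) B : acl M (mul M K B)"
  proof (intro M.finsum_acl[OF B(1) mc] Pi_I)
   fix b assume "b : B"
   hence "c b .[M] b : mul M K B" using cm unfolding mul_def by blast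
   thus "c b .[M] b : acl M (mul M K B)" using M.acl_base[OF mc] by blast
  qed
  thus "m : acl M (mul M K B)" using cm by simp
 qed
next
 assume r: "carrier M <= acl M (mul M K B)"
 have "EX c. c : B \<rightarrow> K & m = finsum M (%b. c b .[M] b) B" if "m : acl M (mul M K B)" for m
  using that
 proof induction
  case acl_zero
  have "finsum M (%b. \<zero> .[M] b) B = 0[M]" using B by (intro M.add.finprod_one_eqI) auto
  thus ?case using K by (intro exI[of _ "%_. \<zero>"]) auto
 next
  case (acl_add x y)
  then obtain c where cm: "c : B \<rightarrow> K" "y = finsum M (%b. c b .[M] b) B" by blast
  obtain s b0 where sb: "s : K" "b0 : B" "x = s .[M] b0" using acl_add by (auto simp: mul_def)
  let ?d = "%b. if b = b0 then s else \<zero>"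
  have d: "?d b : carrier R" "c b : carrier R" "b : carrier M" "b : B ==> c b : K" if "b : B" for b using that sb K cm B by auto
  have "finsum M (%b. (?d b \<oplus> c b) .[M] b) B = finsum M (%b. ?d b .[M] b +[M] c b .[M] b) B"
   using d by (intro M.finsum_cong') (auto simp: smult_l_distr)
  also have "... = finsum M (%b. ?d b .[M] b) B +[M] y"
   using d cm(2) by (subst M.finsum_addf) auto
  also have "finsum M (%b. ?d b .[M] b) B = finsum M (%b. ?d b .[M] b) {b0}"
   using d sb B by (intro M.finsum_supp) auto
  also have "... = x" using sb d(1,3)[OF sb(2)] by (subst M.finsum_insert) auto
  finally show ?case using sb d cm K by (intro exI[of _ "%b. ?d b \<oplus> c b"]) auto
 qed
 thus "ALL m : carrier M. EX c. c : B \<rightarrow> K & m = finsum M (%b. c b .[M] b) B" using r by blast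
qed
qed

end

section \<open>Graded submodules, quotients and homomorphisms\<close>

context galg
begin

definition gsub :: "('a, 'u, 'l) graded_module => 'u set => bool" where
"gsub M U <-> osub (carrier S) M U & (ALL l:carrier L. ALL m:U. cp M l m : U)"

definition sub :: "'u set => ('a, 'u, 'l) graded_module => ('a, 'u, 'l) graded_module" where
"sub U M = M(|carrier := U, degree_part := (\<lambda>l\<in>carrier L. U Int dpart M l)|)"

lemma sub_sel [simp]: "carrier (sub U M) = U" "add (sub U M) = add M" "0[sub U M] = 0[M]"
"smult (sub U M) = smult M" "l : carrier L ==> dpart (sub U M) l = U Int dpart M l"
by (simp_all add: sub_def)

lemma cp_char:
assumes M: "gmod M" and l: "l : carrier L" and f: "addmap M M f"
 "!!a m. a : carrier L ==> m : dpart M a ==> f m = (if l = a then m else 0[M])"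
 and m: "m : carrier M"
shows "cp M l m = f m"
proof (rule addmap_eq_acl[OF cp_addmap[OF M l] f(1) gmod_ab[OF M] gmod_ab[OF M] gmod_parts[OF M]])
show "m : acl M (UN l:carrier L. dpart M l)" using homog_gen[OF M] m by blast
show "!!y. y : (UN l:carrier L. dpart M l) ==> cp M l y = f y"
 using f(2) cp_comp[OF M l] by auto
qed

lemma
assumes M: "gmod M" and U: "gsub M U"
shows sub_gmod: "gmod (sub U M)"
 and cp_sub: "l : carrier L ==> m : U ==> cp (sub U M) l m = cp M l m"
proof -
interpret module S M using M gmod_module by blast
have o: "osub (carrier S) M U" using U by (simp add: gsub_def)
note Ud = osubD[OF o]
have Uc: "x : U ==> x : carrier M" for x using Ud by auto
have "submodule U S M"
 using o by (auto simp: osub_def submodule_def submodule_axioms_def additive_subgroup_def)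
hence "module S (M(|carrier := U|))" using submodule.submodule_is_module module_axioms by blast
hence mod: "module S (sub U M)" by (rule module_update) simp_all
interpret N: module S "sub U M" by fact
have inv: "-[sub U M] x = -[M] x" if "x : U" for x
 using Ud(4)[OF that] Uc that by (intro N.M.minus_equality) (auto simp: M.l_neg)
have sg: "additive_subgroup (dpart (sub U M) l) (sub U M)" if l: "l : carrier L" for l
 using M.subgroup_facts[OF gmod_sub[OF M l]] Ud inv l
 by (intro N.M.subgroupI') auto
show 1: "gmod (sub U M)"
proof (rule gradedI[where p = "cp M"])
 show "dpart (sub U M) : extensional (carrier L)" by (simp add: sub_def)
 show "cp M l m : dpart (sub U M) l" if "l : carrier L" "m : carrier (sub U M)" for l m
  using that U cp_in[OF M Uc] by (auto simp: gsub_def)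
 show "carrier (sub U M) <= acl (sub U M) (UN l:carrier L. dpart (sub U M) l)"
 proof
  fix m assume m: "m : carrier (sub U M)"
  have "finsum M (%l. cp M l m) {l : carrier L. cp M l m ~= 0[M]} : acl M (UN l:carrier L. U Int dpart M l)"
   using cp_finite[OF M Uc, of m] cp_in[OF M Uc, of m] gmod_carrier[OF M] m U
   by (intro M.acl_sum_of_components) (auto simp: gsub_def Uc)
  hence "m : acl M (UN l:carrier L. U Int dpart M l)" using cp_sum[OF M Uc, of m] m by simp
  moreover have "(UN l:carrier L. U Int dpart M l) = (UN l:carrier L. dpart (sub U M) l)" by auto
  ultimately show "m : acl (sub U M) (UN l:carrier L. dpart (sub U M) l)"
   using acl_cong[of M "sub U M"] by simp
 qed
qed (use mod sg Ud gmod_act[OF M] cp_add[OF M] cp_comp[OF M] comp_carrier Uc in auto)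
show "cp (sub U M) l m = cp M l m" if "l : carrier L" "m : U"
 using that U cp_comp[OF M] cp_add[OF M] Uc by (intro cp_char[OF 1]) (auto simp: gsub_def addmap_def)
qed

text \<open>A quotient realised in an arbitrary type: a map \<open>q\<close> whose fibres are the
  cosets of a graded submodule transports the structure to its image. With the zero submodule and
  \<open>q\<close> injective this is an isomorphic copy, which is how modules are moved into the
  universe.\<close>

definition img :: "('u => 'y) => ('a, 'u, 'l) graded_module => ('a, 'y, 'l) graded_module" where
"img q M = (|carrier = q ` carrier M, monoid.mult = undefined, one = undefined, zero = q 0[M],
  add = (%a b. q (inv_into (carrier M) q a +[M] inv_into (carrier M) q b)),
  smult = (%s a. q (s .[M] inv_into (carrier M) q a)),
  degree_part = (\<lambda>l\<in>carrier L. q ` dpart M l)|)"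

lemma img_sel [simp]: "carrier (img q M) = q ` carrier M" "0[img q M] = q 0[M]"
"l : carrier L ==> dpart (img q M) l = q ` dpart M l"
by (simp_all add: img_def)

lemma
assumes M: "gmod M" and U: "gsub M U"
 and q: "!!x y. x : carrier M ==> y : carrier M ==> q x = q y <-> x -[M] y : U"
shows img_add: "x : carrier M ==> y : carrier M ==> q x +[img q M] q y = q (x +[M] y)"
 and img_smult: "s : carrier S ==> x : carrier M ==> s .[img q M] q x = q (s .[M] x)"
 and img_gmod: "gmod (img q M)"
 and cp_img: "l : carrier L ==> x : carrier M ==> cp (img q M) l (q x) = q (cp M l x)"
proof -
interpret module S M using M gmod_module by blast
have o: "osub (carrier S) M U" using U by (simp add: gsub_def)
note Ud = osubD[OF o]
let ?i = "inv_into (carrier M) q"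
have i: "?i (q x) : carrier M" "q (?i (q x)) = q x" if "x : carrier M" for x
 using that by (auto intro: inv_into_into f_inv_into_f)
have qadd: "q (x +[M] y) = q (x' +[M] y')"
 if "q x = q x'" "q y = q y'" "x : carrier M" "y : carrier M" "x' : carrier M" "y' : carrier M" for x y x' y'
proof -
 have "(x +[M] y) -[M] (x' +[M] y') = (x -[M] x') +[M] (y -[M] y')"
  using that by (simp add: a_minus_def M.minus_add M.a_ac)
 thus ?thesis using q[of x x'] q[of y y'] q[of "x +[M] y" "x' +[M] y'"] that Ud(3) by simp
qed
have qsm: "q (s .[M] x) = q (s .[M] x')" if "q x = q x'" "x : carrier M" "x' : carrier M" "s : carrier S" for s x x'
proof -
 have "s .[M] x -[M] s .[M] x' = s .[M] (x -[M] x')"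
  using that by (simp add: a_minus_def smult_r_distr smult_r_minus)
 thus ?thesis using q[of x x'] q[of "s .[M] x" "s .[M] x'"] that Ud(6) by simp
qed
have qcp: "q (cp M l x) = q (cp M l x')" if "q x = q x'" "x : carrier M" "x' : carrier M" "l : carrier L" for l x x'
proof -
 have "cp M l x -[M] cp M l x' = cp M l (x -[M] x')"
  using addmap_diff[OF cp_addmap[OF M that(4)] gmod_ab[OF M] gmod_ab[OF M] that(2,3)] by simp
 thus ?thesis using q[of x x'] q[of "cp M l x" "cp M l x'"] that U addmap_closed[OF cp_addmap[OF M that(4)]]
  by (simp add: gsub_def)
qed
have A: "q x +[img q M] q y = q (x +[M] y)" if "x : carrier M" "y : carrier M" for x y
 using qadd[OF i(2) i(2)] i that by (simp add: img_def)
have B: "s .[img q M] q x = q (s .[M] x)" if "s : carrier S" "x : carrier M" for s x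
 using qsm[OF i(2)] i that by (simp add: img_def)
show "x : carrier M ==> y : carrier M ==> q x +[img q M] q y = q (x +[M] y)" using A .
show "s : carrier S ==> x : carrier M ==> s .[img q M] q x = q (s .[M] x)" using B .
have ab: "abelian_group (img q M)"
proof (rule abelian_groupI)
 show "EX y:carrier (img q M). y +[img q M] x = 0[img q M]" if x: "x : carrier (img q M)" for x
 proof -
  obtain m where m: "m : carrier M" "x = q m" using x by auto
  have "q (-[M] m) +[img q M] x = 0[img q M]" using A[of "-[M] m" m] m by (simp add: M.l_neg)
  thus ?thesis using m by auto
 qed
qed (auto simp: A M.a_ac)
have mod: "module S (img q M)"
 by (rule moduleI) (auto simp: A B cring ab smult_l_distr smult_r_distr smult_assoc1)
interpret N: module S "img q M" by fact
have qm: "addmap M (img q M) q" using A by (auto simp: addmap_def)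
have sg: "additive_subgroup (dpart (img q M) l) (img q M)" if l: "l : carrier L" for l
proof (rule N.M.subgroupI')
 note s = M.subgroup_facts[OF gmod_sub[OF M l]]
 have sc: "x : dpart M l ==> x : carrier M" for x using s by auto
 show "-[img q M] x : dpart (img q M) l" if x: "x : dpart (img q M) l" for x
 proof -
  obtain m where m: "m : dpart M l" "x = q m" using x l by auto
  have "-[img q M] x = q (-[M] m)"
   using addmap_minus[OF qm gmod_ab[OF M] ab sc[OF m(1)]] m by simp
  thus ?thesis using m s l by auto
 qed
qed (use M.subgroup_facts[OF gmod_sub[OF M l]] l A gmod_carrier[OF M l] in auto)
have p: "q (cp M l (?i (q x))) = q (cp M l x)" if "l : carrier L" "x : carrier M" for l x
 using qcp[OF i(2)[OF that(2)] i(1)[OF that(2)] that(2,1)] .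
have gen: "carrier (img q M) <= acl (img q M) (UN l:carrier L. dpart (img q M) l)"
proof
 fix x assume "x : carrier (img q M)"
 then obtain m where m: "m : carrier M" "x = q m" by auto
 have "q m : acl (img q M) (q ` (UN l:carrier L. dpart M l))"
  using addmap_acl[OF qm gmod_ab[OF M] ab gmod_parts[OF M]] homog_gen[OF M] m by blast
 moreover have "q ` (UN l:carrier L. dpart M l) = (UN l:carrier L. dpart (img q M) l)" by auto
 ultimately show "x : acl (img q M) (UN l:carrier L. dpart (img q M) l)" using m by simp
qed
note cpc = addmap_closed[OF cp_addmap[OF M]]
show 1: "gmod (img q M)"
proof (rule gradedI[OF mod _ sg _ _ _ _ gen, where p = "%l x. q (cp M l (?i x))"])
 show "dpart (img q M) : extensional (carrier L)" by (simp add: img_def)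
next
 fix a l s m assume h: "a : carrier L" "l : carrier L" "s : cmp S a" "m : dpart (img q M) l"
 thus "s .[img q M] m : dpart (img q M) (a *[L] l)"
  using gmod_act[OF M h(1,2,3)] gmod_carrier[OF M h(2)] comp_carrier by (auto simp: B)
next
 fix l m assume "l : carrier L" "m : carrier (img q M)"
 thus "q (cp M l (?i m)) : dpart (img q M) l" using p cp_in[OF M] by auto
next
 fix l x y assume "l : carrier L" "x : carrier (img q M)" "y : carrier (img q M)"
 thus "q (cp M l (?i (x +[img q M] y))) = q (cp M l (?i x)) +[img q M] q (cp M l (?i y))"
  using p cpc by (auto simp: A cp_add[OF M])
next
 fix l a m assume h: "l : carrier L" "a : carrier L" "m : dpart (img q M) a"
 thus "q (cp M l (?i m)) = (if l = a then m else 0[img q M])"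
  using p gmod_carrier[OF M h(2)] cp_comp[OF M h(1,2)] by auto
qed
show "cp (img q M) l (q x) = q (cp M l x)" if l: "l : carrier L" and x: "x : carrier M"
proof -
 have "cp (img q M) l (q x) = q (cp M l (?i (q x)))"
 proof (rule cp_char[OF 1 l, where f = "%x. q (cp M l (?i x))"])
  show "addmap (img q M) (img q M) (%x. q (cp M l (?i x)))"
   using p l cpc by (auto simp: addmap_def A cp_add[OF M])
  show "q (cp M l (?i m)) = (if l = a then m else 0[img q M])" if h: "a : carrier L" "m : dpart (img q M) a" for a m
   using p gmod_carrier[OF M h(1)] cp_comp[OF M l h(1)] l h by auto
 qed (use x in auto)
 thus ?thesis using p l x by simp
qed
qed

definition fg :: "('a, 'u, 'l) graded_module => bool" where
"fg M <-> (EX B. finite B & B <= carrier M & carrier M <= acl M (mul M (carrier S) B))"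

lemma Ob_mod_cat: "M : Ob (mod_cat S) <-> gmod M & fg M"
proof -
have "finitely_spanned (carrier S) M <-> fg M" if "gmod M"
 unfolding finitely_spanned_def fg_def
 by (rule module.fs_iff[OF gmod_module[OF that]]) auto
thus ?thesis by (auto simp: mod_cat_def)
qed

lemma finitely_spanned_field:
assumes "gmod M"
shows "finitely_spanned (range (smap S)) M <->
 (EX B. finite B & B <= carrier M & carrier M <= acl M (mul M (range (smap S)) B))"
proof -
have z: "0[S] : range (smap S)"
 using comp_sub[of "1[L]"] SR.subgroup_facts(2)[of "cmp S 1[L]"] by (simp add: comp_one)
show ?thesis
 unfolding finitely_spanned_def
 by (rule module.fs_iff[OF gmod_module[OF assms]]) (use z sm_add[symmetric] in auto)
qed

lemma mod0_eq: "M : mod0 S <-> gmod M & fg M &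
 (EX B. finite B & B <= carrier M & carrier M <= acl M (mul M (range (smap S)) B))"
proof -
have "M : mod0 S <-> (gmod M & fg M) & finitely_spanned (range (smap S)) M"
 by (simp add: mod0_def Ob_mod_cat)
thus ?thesis using finitely_spanned_field[of M] by auto
qed

lemma LG_solve: "a : carrier L ==> l : carrier L ==> a *[L] (inv[L] a *[L] l) = l"
by (simp add: LG.m_assoc[symmetric])

text \<open>The homogeneous components of finitely many generators again generate. Taking the
  component of degree \<open>l\<close> of a combination leaves only coefficients of complementary
  degree, hence the shape of the spanning products.\<close>

lemma fg_homog:
assumes M: "gmod M" and f: "fg M"
obtains B where "finite B" "!!b c. (b, c) : B ==> c : carrier L & b : dpart M c"
 "!!l m. l : carrier L ==> m : dpart M l ==>
  m : acl M {s .[M] b | s b a c. (b, c) : B & a : carrier L & s : cmp S a & a *[L] c = l}"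
proof -
interpret module S M using M gmod_module by blast
obtain B0 where B0: "finite B0" "B0 <= carrier M" "carrier M <= acl M (mul M (carrier S) B0)"
 using f unfolding fg_def by blast
define B where "B = (UN b:B0. (%l. (cp M l b, l)) ` {l : carrier L. cp M l b ~= 0[M]})"
have Bin: "(b, c) : B ==> c : carrier L & b : dpart M c" for b c
 using cp_in[OF M] B0(2) by (auto simp: B_def)
have Bfin: "finite B" using B0 cp_finite[OF M] by (auto simp: B_def)
let ?Y = "%l. {s .[M] b | s b a c. (b, c) : B & a : carrier L & s : cmp S a & a *[L] c = l}"
have Yc: "?Y l <= carrier M" for l
 using Bin gmod_carrier[OF M] comp_carrier by blast
have "m : acl M (?Y l)" if l: "l : carrier L" and m: "m : dpart M l" for l m
proof -
 have "m : acl M (mul M (carrier S) B0)" using B0 gmod_carrier[OF M l m] by blast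
 hence "cp M l m : acl M (cp M l ` mul M (carrier S) B0)"
  using addmap_acl[OF cp_addmap[OF M l]] mul_carrier[OF _ B0(2)] M.abelian_group_axioms by blast
 moreover have "cp M l ` mul M (carrier S) B0 <= acl M (?Y l)"
 proof
  fix y assume "y : cp M l ` mul M (carrier S) B0"
  then obtain s b where sb: "s : carrier S" "b : B0" "y = cp M l (s .[M] b)" by (auto simp: mul_def)
  have b: "b : carrier M" using sb B0 by blast
  have "cp M l (s .[M] b) : acl M (?Y l)" using sb(1)
  proof (induction rule: scalar_induct)
   case zero thus ?case using b cp_zero[OF M l] by (simp add: acl_zero)
  next
   case (add a x y)
   have x: "x : carrier S" using add comp_carrier by blast
   have il: "inv[L] a *[L] l : carrier L" using add l by simp
   have "cp M l (x .[M] b) : acl M (?Y l)"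
   proof (cases "cp M (inv[L] a *[L] l) b = 0[M]")
    case True thus ?thesis using cp_smult[OF M add(1) l add(2) b] x by (simp add: acl_zero)
   next
    case False
    hence "(cp M (inv[L] a *[L] l) b, inv[L] a *[L] l) : B" using sb il by (auto simp: B_def)
    hence "x .[M] cp M (inv[L] a *[L] l) b : ?Y l"
     using add(1,2) LG_solve[OF add(1) l] by blast
    thus ?thesis using M.acl_base[OF Yc] cp_smult[OF M add(1) l add(2) b] by simp
   qed
   thus ?case using add x b cp_add[OF M l, of "x .[M] b" "y .[M] b"] M.acl_plus[OF Yc]
    by (simp add: smult_l_distr)
  qed
  thus "y : acl M (?Y l)" using sb by simp
 qed
 ultimately have "cp M l m : acl M (?Y l)" using M.acl_subI[OF _ Yc] by blast
 thus ?thesis using cp_comp[OF M l l m] by simp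
qed
thus thesis using that[OF Bfin Bin] by blast
qed

lemma fg_homogI:
assumes M: "gmod M" and B: "finite B" "B <= carrier M"
 and g: "!!l m. l : carrier L ==> m : dpart M l ==> m : acl M (mul M (carrier S) B)"
shows "fg M"
proof -
interpret module S M using M gmod_module by blast
have "acl M (UN l:carrier L. dpart M l) <= acl M (mul M (carrier S) B)"
 using g by (intro M.acl_subI mul_carrier B) auto
thus ?thesis unfolding fg_def using B homog_gen[OF M] by blast
qed

lemma hom_addmap: "f : gmhom S M N ==> addmap M N f"
and hom_smult: "f : gmhom S M N ==> s : carrier S ==> m : carrier M ==> f (s .[M] m) = s .[N] f m"
and hom_part: "f : gmhom S M N ==> l : carrier L ==> m : dpart M l ==> f m : dpart N l"
and hom_ext: "f : gmhom S M N ==> f : extensional (carrier M)"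
unfolding graded_module_hom_def addmap_def PiE_def by blast+

lemma cp_hom:
assumes M: "gmod M" and N: "gmod N" and f: "f : gmhom S M N" and l: "l : carrier L" and m: "m : carrier M"
shows "cp N l (f m) = f (cp M l m)"
proof -
note fa = hom_addmap[OF f]
have z: "f 0[M] = 0[N]" using addmap_zero[OF fa] gmod_ab M N by blast
show ?thesis
proof (rule addmap_eq_acl[where Y = "UN l:carrier L. dpart M l" and M = M and N = N
  and f = "%m. cp N l (f m)" and g = "%m. f (cp M l m)" and x = m])
 show "addmap M N (%m. cp N l (f m))" "addmap M N (%m. f (cp M l m))"
  using fa cp_addmap[OF N l] cp_addmap[OF M l] unfolding addmap_def Pi_def by auto
 show "m : acl M (UN l:carrier L. dpart M l)" using homog_gen[OF M] m by blast
 show "cp N l (f y) = f (cp M l y)" if y: "y : (UN l:carrier L. dpart M l)" for y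
 proof -
  obtain a where "a : carrier L" "y : dpart M a" using y by blast
  thus ?thesis using cp_comp[OF M l, of a y] cp_comp[OF N l, of a "f y"] hom_part[OF f, of a y] z by simp
 qed
qed (rule gmod_ab[OF M] gmod_ab[OF N] gmod_parts[OF M])+
qed

lemma hom_eqI:
assumes M: "gmod M" and N: "gmod N" and f: "f : gmhom S M N" and g: "g : gmhom S M N"
 and eq: "!!l m. l : carrier L ==> m : dpart M l ==> f m = g m"
shows "f = g"
proof (rule extensionalityI[OF hom_ext[OF f] hom_ext[OF g]])
fix m assume "m : carrier M"
thus "f m = g m"
 using addmap_eq_acl[OF hom_addmap[OF f] hom_addmap[OF g] gmod_ab[OF M] gmod_ab[OF N] gmod_parts[OF M]] eq homog_gen[OF M]
 by blast
qed

lemma homI: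
assumes M: "gmod M" and N: "gmod N" and e: "f : extensional (carrier M)" and a: "addmap M N f"
 and p: "!!l m. l : carrier L ==> m : dpart M l ==> f m : dpart N l"
 and s: "!!a l s m. a : carrier L ==> l : carrier L ==> s : cmp S a ==> m : dpart M l ==> f (s .[M] m) = s .[N] f m"
shows "f : gmhom S M N"
proof -
interpret M: module S M using M gmod_module by blast
interpret N: module S N using N gmod_module by blast
have z: "f 0[M] = 0[N]" using addmap_zero[OF a] M.M.abelian_group_axioms N.M.abelian_group_axioms by blast
have 1: "f (s .[M] m) = s .[N] f m" if "s : cmp S b" "b : carrier L" "m : carrier M" for s b m
 using M that(3)
proof (induction rule: homog_induct)
 case zero thus ?case using z that comp_carrier by auto
next
 case (add d x y)
 have "s : carrier S" "x : carrier M" using that comp_carrier gmod_carrier[OF M] add by auto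
 thus ?case using add s[OF that(2) add(1) that(1) add(2)] addmap_add[OF a] addmap_closed[OF a]
  by (simp add: M.smult_r_distr N.smult_r_distr)
qed
have "f (s .[M] m) = s .[N] f m" if "s : carrier S" "m : carrier M" for s m
 using that(1)
proof (induction rule: scalar_induct)
 case zero thus ?case using z that addmap_closed[OF a] by simp
next
 case (add b x y)
 have "x : carrier S" using add comp_carrier by auto
 thus ?case using add 1[OF add(2,1) that(2)] addmap_add[OF a] addmap_closed[OF a] that(2)
  by (simp add: M.smult_l_distr N.smult_l_distr)
qed
thus ?thesis using a e p by (auto simp: graded_module_hom_def addmap_def PiE_def)
qed

text \<open>One function \<open>h\<close> serves all degrees. This is unambiguous because distinct
  components meet only in zero, where the additivity required in \<open>ext_hom\<close> forces
  \<open>h\<close> to vanish.\<close>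

definition ext :: "('a, 'u, 'l) graded_module => ('a, 'v, 'l) graded_module => ('u => 'v) => 'u => 'v" where
"ext M N h = (\<lambda>m\<in>carrier M. finsum N (%l. h (cp M l m)) {l : carrier L. cp M l m ~= 0[M]})"

lemma
assumes M: "gmod M" and N: "gmod N"
 and h: "!!l m. l : carrier L ==> m : dpart M l ==> h m : dpart N l"
 and ha: "!!l m m'. l : carrier L ==> m : dpart M l ==> m' : dpart M l ==> h (m +[M] m') = h m +[N] h m'"
 and hs: "!!a l s m. a : carrier L ==> l : carrier L ==> s : cmp S a ==> m : dpart M l ==> h (s .[M] m) = s .[N] h m"
shows ext_hom: "ext M N h : gmhom S M N"
 and ext_homog: "l : carrier L ==> m : dpart M l ==> ext M N h m = h m"
proof -
interpret M: module S M using M gmod_module by blast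
interpret N: module S N using N gmod_module by blast
have zl: "0[M] : dpart M l" if "l : carrier L" for l
 using M.M.subgroup_facts(2)[OF gmod_sub[OF M that]] .
have hc: "h m : carrier N" if "l : carrier L" "m : dpart M l" for l m
 using h[OF that] gmod_carrier[OF N that(1)] by blast
have h0: "h 0[M] = 0[N]"
 using ha[of "1[L]" "0[M]" "0[M]"] zl hc[of "1[L]" "0[M]"] by (intro N.M.double_zero) auto
have hcp: "h (cp M l m) : carrier N" if "l : carrier L" "m : carrier M" for l m
 using hc[OF that(1) cp_in[OF M that(2,1)]] .
have eqA: "ext M N h m = finsum N (%l. h (cp M l m)) A"
 if m: "m : carrier M" and A: "finite A" "A <= carrier L" "{l : carrier L. cp M l m ~= 0[M]} <= A" for m A
proof -
 have "finsum N (%l. h (cp M l m)) A = finsum N (%l. h (cp M l m)) {l : carrier L. cp M l m ~= 0[M]}"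
  using A m hcp h0 by (intro N.M.finsum_supp) auto
 thus ?thesis using m by (simp add: ext_def)
qed
show homog: "ext M N h m = h m" if l: "l : carrier L" and m: "m : dpart M l" for l m
proof -
 have "ext M N h m = finsum N (%l. h (cp M l m)) {l}"
  using cp_comp[OF M _ l m] l gmod_carrier[OF M l m] by (intro eqA) (auto split: if_splits)
 also have "... = h m" using cp_comp[OF M l l m] hc[OF l m] by (subst N.M.finsum_insert) auto
 finally show ?thesis .
qed
have add: "addmap M N (ext M N h)"
 unfolding addmap_def
proof (intro conjI ballI)
 show "ext M N h : carrier M \<rightarrow> carrier N" using hcp by (auto simp: ext_def intro!: N.M.finsum_closed)
 fix x y assume xy: "x : carrier M" "y : carrier M"
 let ?A = "{l : carrier L. cp M l x ~= 0[M]} Un {l : carrier L. cp M l y ~= 0[M]}"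
 have A: "finite ?A" "?A <= carrier L" using cp_finite[OF M] xy by auto
 have "ext M N h (x +[M] y) = finsum N (%l. h (cp M l (x +[M] y))) ?A"
  using A xy cp_add[OF M] by (intro eqA) auto
 also have "... = finsum N (%l. h (cp M l x) +[N] h (cp M l y)) ?A"
  using A xy cp_add[OF M] hcp ha[OF _ cp_in[OF M xy(1)] cp_in[OF M xy(2)]] by (intro N.M.finsum_cong') auto
 also have "... = finsum N (%l. h (cp M l x)) ?A +[N] finsum N (%l. h (cp M l y)) ?A"
  using A xy hcp by (intro N.M.finsum_addf) auto
 finally show "ext M N h (x +[M] y) = ext M N h x +[N] ext M N h y" using eqA[OF _ A] xy by auto
qed
show "ext M N h : gmhom S M N"
proof (rule homI[OF M N _ add])
 show "ext M N h : extensional (carrier M)" by (simp add: ext_def)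
 show "ext M N h m : dpart N l" if "l : carrier L" "m : dpart M l" for l m
  using homog[OF that] h[OF that] by simp
 show "ext M N h (s .[M] m) = s .[N] ext M N h m"
  if "a : carrier L" "l : carrier L" "s : cmp S a" "m : dpart M l" for a l s m
  using homog[OF that(2,4)] hs[OF that] homog[OF _ gmod_act[OF M that]] that by simp
qed
qed

end

section \<open>The Noetherian property and finite-dimensional modules\<close>

lemma acc_mono: "acc K M V ==> K <= K' ==> acc K' M V"
unfolding acc_def by (meson osub_def subsetD)

text \<open>Serves as a cardinality bound: a closure is no larger than the set of lists over its
  generators, which an infinite universe absorbs.\<close>

lemma acl_lists: "acl M Y <= (%ys. foldr (add M) ys 0[M]) ` lists Y"
proof
fix x assume "x : acl M Y" thus "x : (%ys. foldr (add M) ys 0[M]) ` lists Y"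
proof induction
 case acl_zero thus ?case by (auto intro!: image_eqI[of _ _ "[]"])
next
 case (acl_add x y)
 then obtain ys where "ys : lists Y" "y = foldr (add M) ys 0[M]" by auto
 thus ?case using acl_add(1) by (auto intro!: image_eqI[of _ _ "x # ys"])
qed
qed

context galg
begin

lemma X_carrier: "z : XS ==> fst z : carrier S"
using Xin[of "fst z" "snd z"] comp_carrier by auto

lemma XY_carrier:
assumes "l : carrier L"
shows "{x *[S] s | x e s. (x, e) : XS & s : cmp S (inv[L] e *[L] l)} <= carrier S"
proof clarify
fix x e s assume h: "(x, e) : XS" "s : cmp S (inv[L] e *[L] l)"
hence "s : carrier S" using Xin[OF h(1)] assms comp_carrier[OF _ h(2)] by simp
thus "x *[S] s : carrier S" using X_carrier[OF h(1)] by simp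
qed

text \<open>Induction on the degree: by \<open>comp_X\<close> a homogeneous scalar is a constant or
  a sum of products \<open>x * s\<close> with \<open>x\<close> a generator and \<open>s\<close> of
  smaller degree, and such a product acts as \<open>s\<close> followed by \<open>x\<close>.\<close>

lemma osub_full:
assumes mod: "module S M" and o: "osub (range (smap S) Un fst ` XS) M V"
shows "osub (carrier S) M V"
proof -
interpret module S M by fact
note V = osubD[OF o]
have c: "v : carrier M" if "v : V" for v using V(1) that by blast
have hom: "l : carrier L ==> s : cmp S l ==> v : V ==> nat (dg l + 1) = n ==> s .[M] v : V" for n l s v
proof (induction n arbitrary: l s v rule: less_induct)
 case (less n)
 consider "dg l < 0" | "l = 1[L]" | "0 <= dg l" "l ~= 1[L]" by linarith
 thus ?case
 proof cases
  case 1 thus ?thesis using less dg_neg V(2) c by auto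
 next
  case 2 thus ?thesis using less V(6) by (auto simp: comp_one)
 next
  case 3
  let ?Y = "{x *[S] s | x e s. (x, e) : XS & s : cmp S (inv[L] e *[L] l)}"
  have Yc: "?Y <= carrier S" by (rule XY_carrier[OF less.prems(1)])
  have "s : acl S ?Y" using comp_X[OF less.prems(1) 3(2)] less.prems(2) by blast
  thus ?thesis
  proof induction
   case acl_zero thus ?case using c less.prems V(2) by simp
  next
   case (acl_add z y)
   have yc: "y : carrier S" using acl_add(2) SR.acl_closed[OF Yc] by blast
   obtain x e t where xt: "(x, e) : XS" "t : cmp S (inv[L] e *[L] l)" "z = x *[S] t"
    using acl_add(1) by blast
   have e: "e : carrier L" "x : cmp S e" "0 < dg e" using Xin xt(1) by auto
   have el: "inv[L] e *[L] l : carrier L" "dg (inv[L] e *[L] l) = dg l - dg e"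
    using e less.prems(1) dg_add dg_inv by auto
   have "t .[M] v : V"
    using less.IH[OF _ el(1) xt(2) less.prems(3) refl] el(2) e(3) less.prems(4) 3(1) by simp
   moreover have "x : fst ` XS" using xt(1) by force
   ultimately have "x .[M] (t .[M] v) : V" using V(6) by blast
   moreover have tc: "x : carrier S" "t : carrier S" using comp_carrier e el xt by blast+
   ultimately have "z .[M] v : V" using xt(3) c less.prems(3) by (simp add: smult_assoc1)
   thus ?case using acl_add tc yc V(3) c less.prems(3) xt(3) by (simp add: smult_l_distr)
  qed
 qed
qed
have "s .[M] v : V" if "s : carrier S" "v : V" for s v
 using that(1)
proof (induction rule: scalar_induct)
 case zero thus ?case using V(2) c that by simp
next
 case (add a x y)
 thus ?case using hom[OF add(1,2) that(2) refl] V(3) c that(2) comp_carrier by (simp add: smult_l_distr)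
qed
thus ?thesis using o by (auto simp: osub_def)
qed

text \<open>A line over the field has no proper nonzero stable subgroup: dividing by the coefficient
  of a nonzero member yields the whole line.\<close>

lemma acc_line:
assumes mod: "module S M" and g: "g : carrier M"
shows "osub (range (smap S)) M {smap S c .[M] g | c. True}" (is "osub ?K M ?V")
 and "acc (range (smap S)) M {smap S c .[M] g | c. True}"
proof -
interpret module S M by fact
have add: "smap S c .[M] g +[M] smap S d .[M] g = smap S (c + d) .[M] g" for c d
 using g by (simp add: sm_add smult_l_distr)
have mult: "smap S d .[M] (smap S c .[M] g) = smap S (d * c) .[M] g" for c d
 using g by (simp add: sm_mult smult_assoc1)
have zero: "smap S 0 .[M] g = 0[M]"
 using add[of 0 0] g by (intro M.double_zero) auto
have neg: "-[M] (smap S c .[M] g) = smap S (- c) .[M] g" for c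
 using add[of "- c" c] zero g by (intro M.minus_equality) auto
show "osub ?K M ?V"
proof (rule osubI)
 show "?V <= carrier M" using g by auto
 show "0[M] : ?V" using zero by (metis (mono_tags, lifting) mem_Collect_eq)
 show "!!x y. x : ?V ==> y : ?V ==> x +[M] y : ?V" using add by auto
 show "!!x. x : ?V ==> -[M] x : ?V" using neg by auto
 show "!!s x. s : ?K ==> x : ?V ==> s .[M] x : ?V" using mult by auto
qed
show "acc ?K M ?V" unfolding acc_def
proof (intro allI impI)
 fix U :: "nat => _ set" assume U: "ALL i. osub ?K M (U i) & U i <= ?V & U i <= U (Suc i)"
 hence Uo: "osub ?K M (U i)" and UV: "U i <= ?V" and Us: "U i <= U (Suc i)" for i by auto
 have full: "U i = ?V" if x: "x : U i" "x ~= 0[M]" for i x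
 proof -
  obtain c where c: "x = smap S c .[M] g" using x UV[of i] by blast
  have "c ~= 0" using c x zero by auto
  have "smap S d .[M] g : U i" for d
  proof -
   have "smap S (d / c) .[M] x : U i" using osubD(6)[OF Uo _ x(1)] by blast
   thus ?thesis using c mult \<open>c ~= 0\<close> by simp
  qed
  thus ?thesis using UV by blast
 qed
 show "EX n. ALL i>=n. U i = U n"
 proof (cases "EX i x. x : U i & x ~= 0[M]")
  case True
  then obtain n x where x: "x : U n" "x ~= 0[M]" by blast
  have "U i = U n" if "i >= n" for i using full[OF x] full[of x i] x chain_mono[of U, OF Us that] by blast
  thus ?thesis by blast
 next
  case False
  hence "U i = {0[M]}" for i using osubD(2)[OF Uo] by blast
  thus ?thesis by blast
 qed
qed
qed

text \<open>Start with the \<open>k\<close>-span of the module generators, a finite sum of lines,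
  and adjoin the algebra generators one at a time by \<open>acc_step\<close>. The result contains
  the module generators and is stable under all of \<open>S\<close>, hence is everything.\<close>

lemma noetherian:
assumes M: "gmod M" and f: "fg M"
shows "acc (carrier S) M (carrier M)"
proof -
have mod: "module S M" using M gmod_module by blast
interpret module S M by fact
obtain B where B: "finite B" "B <= carrier M" "carrier M <= acl M (mul M (carrier S) B)" using f unfolding fg_def by blast
let ?K = "range (smap S)"
have K: "?K <= carrier S" by auto
have "EX V. osub ?K M V & B <= V & acc ?K M V" using B(1,2)
proof (induction rule: finite_induct)
 case empty
 have "osub ?K M {0[M]}" using K by (intro osubI) auto
 moreover have "acc ?K M {0[M]}" unfolding acc_def
 proof (intro allI impI)
  fix U :: "nat => _ set" assume U: "ALL i. osub ?K M (U i) & U i <= {0[M]} & U i <= U (Suc i)"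
  have "U i = {0[M]}" for i using U osubD(2)[of ?K "U i"] by blast
  thus "EX n. ALL i>=n. U i = U n" by blast
 qed
 ultimately show ?case by blast
next
 case (insert g B)
 then obtain V where V: "osub ?K M V" "B <= V" "acc ?K M V" by blast
 have g: "g : carrier M" using insert by simp
 let ?V = "{smap S c .[M] g | c. True}"
 note l = acc_line[OF mod g]
 note s = acc_sum[OF l(1) V(1) K l(2) V(3)]
 have "g : {x +[M] y |x y. x : ?V & y : V}"
 proof -
  have "g = smap S 1 .[M] g +[M] 0[M]" using g by (simp add: sm_one)
  thus ?thesis using osubD(2)[OF V(1)] by blast
 qed
 moreover have "V <= {x +[M] y |x y. x : ?V & y : V}"
 proof
  fix v assume v: "v : V"
  hence "v = 0[M] +[M] v" using osubD(1)[OF V(1)] by auto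
  thus "v : {x +[M] y |x y. x : ?V & y : V}" using v osubD(2)[OF l(1)] by blast
 qed
 ultimately show ?case using s V(2) by (intro exI[of _ "{x +[M] y |x y. x : ?V & y : V}"]) blast
qed
then obtain V0 where V0: "osub ?K M V0" "B <= V0" "acc ?K M V0" by blast
have "EX V. osub (?K Un Y) M V & B <= V & acc (?K Un Y) M V" if "finite Y" "Y <= carrier S" for Y
 using that
proof (induction rule: finite_induct)
 case empty thus ?case using V0 by auto
next
 case (insert x Y)
 then obtain V where V: "osub (?K Un Y) M V" "B <= V" "acc (?K Un Y) M V" by blast
 have "EX V'. osub (insert x (?K Un Y)) M V' & V <= V' & acc (insert x (?K Un Y)) M V'"
  by (rule acc_step[OF V(1) _ _ V(3)]) (use insert.prems K in auto)
 thus ?case using V(2) by auto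
qed
moreover have "fst ` XS <= carrier S" using X_carrier by auto
ultimately obtain V where V: "osub (?K Un fst ` XS) M V" "B <= V" "acc (?K Un fst ` XS) M V"
 using finX by blast
have Vo: "osub (carrier S) M V" by (rule osub_full[OF mod V(1)])
have "mul M (carrier S) B <= V" using osubD(6)[OF Vo] V(2) by (auto simp: mul_def)
hence "acl M (mul M (carrier S) B) <= V" using osubD[OF Vo] by (intro acl_least) auto
hence "V = carrier M" using B osubD(1)[OF Vo] by blast
moreover have "?K Un fst ` XS <= carrier S" using K \<open>fst ` XS <= carrier S\<close> by blast
ultimately show ?thesis using acc_mono[OF V(3)] by blast
qed

lemma fg_sub:
assumes M: "gmod M" and f: "fg M" and U: "gsub M U"
shows "fg (sub U M)"
proof -
interpret module S M using M gmod_module by blast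
have Uo: "osub (carrier S) M U" using U by (simp add: gsub_def)
have Uc: "U <= carrier M" using osubD(1)[OF Uo] .
let ?sp = "%B. acl M (mul M (carrier S) B)"
have spU: "?sp B <= U" if "B <= U" for B
 using osubD[OF Uo] that by (intro acl_least) (auto simp: mul_def)
have "EX B. finite B & B <= U & U <= ?sp B"
proof (rule ccontr)
 assume "~ ?thesis"
 hence ex: "EX u. u : U - ?sp B" if "finite B" "B <= U" for B using that by blast
 \<comment> \<open>If no finite set spans \<open>U\<close>, an element outside the span so far can
   always be added, and the spans increase strictly forever.\<close>
 define W where "W = rec_nat {} (%_ B. insert (SOME u. u : U - ?sp B) B)"
 have W0: "W 0 = {}" and WS: "W (Suc n) = insert (SOME u. u : U - ?sp (W n)) (W n)" for n
  by (simp_all add: W_def)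
 have W: "finite (W n) & W n <= U" for n
  by (induction n) (use W0 WS someI_ex[OF ex] in auto)
 have new: "(SOME u. u : U - ?sp (W n)) : U - ?sp (W n)" for n using someI_ex[OF ex] W by blast
 have mono: "?sp (W i) <= ?sp (W (Suc i))" for i
  by (rule acl_mono) (auto simp: mul_def WS)
 have "EX n. ALL i>=n. ?sp (W i) = ?sp (W n)"
 proof (rule accD[OF noetherian[OF M f]])
  show "osub (carrier S) M (?sp (W i))" for i using osub_span W Uc by blast
  show "?sp (W i) <= carrier M" for i using spU W Uc by blast
 qed (rule mono)
 then obtain n where "?sp (W (Suc n)) = ?sp (W n)" by (metis le_Suc_eq order_refl)
 moreover have "(SOME u. u : U - ?sp (W n)) : ?sp (W (Suc n))"
  using span_base[of "W (Suc n)"] W Uc WS by blast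
 ultimately show False using new by blast
qed
then obtain B where B: "finite B" "B <= U" "U <= ?sp B" by blast
have "mul (sub U M) (carrier S) B = mul M (carrier S) B" by (simp add: mul_def)
hence "acl (sub U M) (mul (sub U M) (carrier S) B) = ?sp B" using acl_cong[of M "sub U M"] by simp
thus ?thesis unfolding fg_def using B by auto
qed

text \<open>The submodules \<open>V i\<close> grow with \<open>i\<close> and become stationary at
  some \<open>n\<close>. An element of degree at least \<open>n\<close> killed by all scalars of
  high degree lies in a later \<open>V i\<close>, hence in \<open>V n\<close>, where already the
  scalar 1 kills it.\<close>

lemma torsion_bounded:
assumes M: "gmod M" and f: "fg M"
obtains n where "!!l m k. l : carrier L ==> n <= dg l ==> m : dpart M l ==>
 (!!a s. a : carrier L ==> k <= dg a ==> s : cmp S a ==> s .[M] m = 0[M]) ==> m = 0[M]"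
proof -
interpret module S M using M gmod_module by blast
define V where "V = (%i::nat. {m : carrier M. ALL l a s. l : carrier L --> a : carrier L --> s : cmp S a -->
 0 <= dg a --> int i <= dg l + dg a --> s .[M] cp M l m = 0[M]})"
have VI: "m : V i <-> m : carrier M & (ALL l a s. l : carrier L --> a : carrier L --> s : cmp S a -->
 0 <= dg a --> int i <= dg l + dg a --> s .[M] cp M l m = 0[M])" for m i by (auto simp: V_def)
note cpc = addmap_closed[OF cp_addmap[OF M]]
have Vo: "osub (carrier S) M (V i)" for i
proof (rule osubI)
 show "V i <= carrier M" by (auto simp: V_def)
 show z: "0[M] : V i" using cp_zero[OF M] comp_carrier by (auto simp: V_def)
 show ad: "x +[M] y : V i" if "x : V i" "y : V i" for x y
  using that cpc comp_carrier unfolding VI by (auto simp: cp_add[OF M] smult_r_distr)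
 show "-[M] x : V i" if "x : V i" for x
  using that cpc comp_carrier addmap_minus[OF cp_addmap[OF M] M.abelian_group_axioms M.abelian_group_axioms]
  unfolding VI by (auto simp: smult_r_minus)
 show "t .[M] m : V i" if "t : carrier S" and m: "m : V i" for t m
  using that(1)
 proof (induction rule: scalar_induct)
  case zero thus ?case using m z by (simp add: VI)
 next
  case (add b x y)
  have mc: "m : carrier M" using m by (simp add: VI)
  have xc: "x : carrier S" using add comp_carrier by blast
  have "x .[M] m : V i" unfolding VI
  proof (intro conjI allI impI)
   show "x .[M] m : carrier M" using mc xc by simp
   fix l a s assume h: "l : carrier L" "a : carrier L" "s : cmp S a" "0 <= dg a" "int i <= dg l + dg a"
   have sc: "s : carrier S" using h comp_carrier by blast
   have bl: "inv[L] b *[L] l : carrier L" "dg (inv[L] b *[L] l) = dg l - dg b"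
    using add(1) h(1) dg_add dg_inv by auto
   show "s .[M] cp M l (x .[M] m) = 0[M]"
   proof (cases "dg b < 0")
    case True
    hence "x = 0[S]" using add dg_neg by blast
    thus ?thesis using mc sc h(1) cp_zero[OF M] by simp
   next
    case False
    have "(s *[S] x) .[M] cp M (inv[L] b *[L] l) m = 0[M]"
     using m[unfolded VI, THEN conjunct2, rule_format, OF bl(1) _ comp_mult[OF h(2) add(1) h(3) add(2)]]
      bl(2) h add(1) False dg_add[OF h(2) add(1)] by simp
    thus ?thesis using cp_smult[OF M add(1) h(1) add(2) mc] sc xc cpc[OF bl(1) mc]
     by (simp add: smult_assoc1)
   qed
  qed
  thus ?case using ad add xc mc by (simp add: smult_l_distr)
 qed
qed
have "EX n. ALL i>=n. V i = V n"
 by (rule accD[OF noetherian[OF M f] Vo]) (auto simp: V_def)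
then obtain n where n: "!!i. i >= n ==> V i = V n" by blast
have "m = 0[M]" if h: "l : carrier L" "int n <= dg l" "m : dpart M l"
 and k: "!!a s. a : carrier L ==> k <= dg a ==> s : cmp S a ==> s .[M] m = 0[M]" for l m k
proof -
 have mc: "m : carrier M" using h gmod_carrier[OF M] by blast
 \<comment> \<open>Large enough that \<open>i <= dg l + dg a\<close> forces
   \<open>k <= dg a\<close>.\<close>
 define i where "i = max n (nat (dg l + k))"
 have "m : V i" unfolding VI
 proof (intro conjI allI impI)
  show "m : carrier M" by fact
  fix l' a s assume h': "l' : carrier L" "a : carrier L" "s : cmp S a" "0 <= dg a" "int i <= dg l' + dg a"
  have "s : carrier S" using h' comp_carrier by blast
  moreover have "l' = l ==> k <= dg a" using h'(5) by (auto simp: i_def)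
  ultimately show "s .[M] cp M l' m = 0[M]" using cp_comp[OF M h'(1) h(1,3)] k h' by auto
 qed
 hence "m : V n" using n[of i] by (simp add: i_def)
 hence "1[S] .[M] cp M l m = 0[M]" using h(1,2) one_comp unfolding VI by (metis LG.one_closed add_0_right dg_one order_refl)
 thus ?thesis using cp_comp[OF M h(1,1,3)] mc by simp
qed
thus thesis using that by blast
qed

text \<open>A finite spanning set over \<open>k\<close> involves only finitely many degrees.
  Conversely, if high degrees vanish, induction from the top bounds the \<open>S\<close>-span of a
  homogeneous \<open>m\<close>: it is spanned by \<open>m\<close> and by the spans of the finitely
  many \<open>x m\<close> with \<open>x\<close> a generator, which have larger degree.\<close>

lemma mod0_iff:
assumes M: "gmod M" and f: "fg M"
shows "M : mod0 S <-> (EX n. ALL l:carrier L. n <= dg l --> dpart M l = {0[M]})"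
proof
interpret module S M using M gmod_module by blast
let ?K = "range (smap S)"
have K: "?K <= carrier S" by auto
note cpc = addmap_closed[OF cp_addmap[OF M]]
{
 assume "M : mod0 S"
 then obtain B where B: "finite B" "B <= carrier M" "carrier M <= acl M (mul M ?K B)" unfolding mod0_eq by blast
 define A where "A = (UN b:B. {l : carrier L. cp M l b ~= 0[M]})"
 have A: "finite A" using B cp_finite[OF M] by (auto simp: A_def)
 \<comment> \<open>One above the largest degree in \<open>A\<close>; the 0 keeps the maximum defined
   when \<open>A\<close> is empty.\<close>
 define n where "n = Max (insert 0 (dg ` A)) + 1"
 have nA: "dg l < n" if "l : A" for l
  using that A Max_ge[of "insert 0 (dg ` A)" "dg l"] by (auto simp: n_def)
 have "dpart M l = {0[M]}" if l: "l : carrier L" "n <= dg l" for l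
 proof -
  have "cp M l m = 0[M]" if "m : acl M (mul M ?K B)" for m using that
  proof induction
   case acl_zero thus ?case using cp_zero[OF M] l by simp
  next
   case (acl_add x y)
   obtain c b where cb: "b : B" "x = smap S c .[M] b" using acl_add(1) by (auto simp: mul_def)
   have bc: "b : carrier M" using cb B by blast
   have "cp M l b = 0[M]" using nA[of l] l cb by (auto simp: A_def)
   hence "cp M l x = 0[M]"
    using cp_smult[OF M _ l(1) sm_comp bc] cb l(1) by simp
   moreover have "y : carrier M" using acl_add M.acl_closed[OF mul_carrier[OF K B(2)]] by blast
   ultimately show ?case using acl_add cp_add[OF M l(1)] cb bc by simp
  qed
  hence "m = 0[M]" if "m : dpart M l" for m
   using cp_comp[OF M l(1,1) that] B gmod_carrier[OF M l(1) that] by auto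
  thus ?thesis using M.subgroup_facts(2)[OF gmod_sub[OF M l(1)]] by blast
 qed
 thus "EX n. ALL l:carrier L. n <= dg l --> dpart M l = {0[M]}" by blast
}
assume "EX n. ALL l:carrier L. n <= dg l --> dpart M l = {0[M]}"
then obtain n where n: "!!l. l : carrier L ==> n <= dg l ==> dpart M l = {0[M]}" by blast
have ind: "l : carrier L ==> m : dpart M l ==> nat (n - dg l) = k ==>
 EX E. finite E & E <= carrier M & (ALL s:carrier S. s .[M] m : acl M (mul M ?K E))" for k l m
proof (induction k arbitrary: l m rule: less_induct)
 case (less k)
 have mc: "m : carrier M" using less gmod_carrier[OF M] by blast
 show ?case
 proof (cases "n <= dg l")
  case True
  hence "m = 0[M]" using n less by blast
  thus ?thesis by (intro exI[of _ "{}"]) (auto simp: acl_zero)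
 next
  case False
  have "EX E. finite E & E <= carrier M & (ALL s:carrier S. s .[M] (fst z .[M] m) : acl M (mul M ?K E))"
   if z: "z : XS" for z
  proof -
   obtain x e where xe: "z = (x, e)" by force
   hence e: "e : carrier L" "x : cmp S e" "0 < dg e" using Xin z by auto
   have el: "e *[L] l : carrier L" "dg (e *[L] l) = dg e + dg l" using e less.prems dg_add by auto
   show ?thesis
    using less.IH[OF _ el(1) gmod_act[OF M e(1) less.prems(1) e(2) less.prems(2)] refl] el(2) e False less.prems(3) xe
    by simp
  qed
  then obtain E where E: "!!z. z : XS ==> finite (E z) & E z <= carrier M &
    (ALL s:carrier S. s .[M] (fst z .[M] m) : acl M (mul M ?K (E z)))" by metis
  define E' where "E' = insert m (UN z:XS. E z)"
  have E': "finite E'" "E' <= carrier M" using E finX mc by (auto simp: E'_def)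
  note mc' = mul_carrier[OF K E'(2)]
  have sub: "acl M (mul M ?K (E z)) <= acl M (mul M ?K E')" if "z : XS" for z
   using that by (intro acl_mono) (auto simp: mul_def E'_def)
  have "s .[M] m : acl M (mul M ?K E')" if "s : carrier S" for s
   using that
  proof (induction rule: scalar_induct)
   case zero thus ?case using mc by (simp add: acl_zero)
  next
   case (add a x y)
   have xc: "x : carrier S" using add comp_carrier by blast
   have "x .[M] m : acl M (mul M ?K E')"
   proof (cases "a = 1[L]")
    case True
    then obtain c where "x = smap S c" using add by (auto simp: comp_one)
    hence "x .[M] m : mul M ?K E'" unfolding mul_def E'_def by blast
    thus ?thesis using M.acl_base[OF mc'] by blast
   next
    case False
    let ?Y = "{x *[S] s | x e s. (x, e) : XS & s : cmp S (inv[L] e *[L] a)}"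
    have Yc: "?Y <= carrier S" by (rule XY_carrier[OF add(1)])
    have "x : acl S ?Y" using comp_X[OF add(1) False] add(2) by blast
    thus ?thesis
    proof induction
     case acl_zero thus ?case using mc by (simp add: acl.acl_zero)
    next
     case (acl_add w y)
     have yc: "y : carrier S" using acl_add(2) SR.acl_closed[OF Yc] by blast
     obtain x e t where xt: "(x, e) : XS" "t : cmp S (inv[L] e *[L] a)" "w = x *[S] t"
      using acl_add(1) by blast
     have tc: "x : carrier S" "t : carrier S" using X_carrier[OF xt(1)] comp_carrier[OF _ xt(2)] Xin[OF xt(1)] add(1) by auto
     have "t .[M] (x .[M] m) : acl M (mul M ?K (E (x, e)))" using E[OF xt(1)] tc by simp
     hence "t .[M] (x .[M] m) : acl M (mul M ?K E')" using sub[OF xt(1)] by blast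
     hence "w .[M] m : acl M (mul M ?K E')" using tc xt mc by (simp add: smult_assoc1[symmetric] SR.m_comm)
     thus ?case using acl_add M.acl_plus[OF mc'] tc xt yc mc by (simp add: smult_l_distr)
    qed
   qed
   thus ?case using add xc mc M.acl_plus[OF mc'] by (simp add: smult_l_distr)
  qed
  thus ?thesis using E' by blast
 qed
qed
obtain B where B: "finite B" "!!b c. (b, c) : B ==> c : carrier L & b : dpart M c"
 "!!l m. l : carrier L ==> m : dpart M l ==>
  m : acl M {s .[M] b | s b a c. (b, c) : B & a : carrier L & s : cmp S a & a *[L] c = l}"
 using fg_homog[OF M f] by blast
have "EX E. finite E & E <= carrier M & (ALL s:carrier S. s .[M] fst z : acl M (mul M ?K E))" if "z : B" for z
 using ind[of "snd z" "fst z", OF _ _ refl] B(2)[of "fst z" "snd z"] that by simp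
then obtain E where E: "!!z. z : B ==> finite (E z) & E z <= carrier M &
    (ALL s:carrier S. s .[M] fst z : acl M (mul M ?K (E z)))" by metis
define E' where "E' = (UN z:B. E z)"
have E': "finite E'" "E' <= carrier M" using E B by (auto simp: E'_def)
note mc' = mul_carrier[OF K E'(2)]
have "m : acl M (mul M ?K E')" if l: "l : carrier L" "m : dpart M l" for l m
proof -
 have "{s .[M] b | s b a c. (b, c) : B & a : carrier L & s : cmp S a & a *[L] c = l} <= acl M (mul M ?K E')"
 proof
  fix y assume "y : {s .[M] b | s b a c. (b, c) : B & a : carrier L & s : cmp S a & a *[L] c = l}"
  then obtain s b a c where y: "y = s .[M] b" "(b, c) : B" "a : carrier L" "s : cmp S a" by blast
  hence "y : acl M (mul M ?K (E (b, c)))" using E[OF y(2)] comp_carrier by auto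
  thus "y : acl M (mul M ?K E')"
   using acl_mono[of "mul M ?K (E (b, c))" "mul M ?K E'"] y(2) by (auto simp: mul_def E'_def)
 qed
 thus ?thesis using B(3)[OF l] M.acl_subI[OF _ mc'] by blast
qed
hence "(UN l:carrier L. dpart M l) <= acl M (mul M ?K E')" by blast
hence "carrier M <= acl M (mul M ?K E')" using homog_gen[OF M] M.acl_subI[OF _ mc'] by blast
thus "M : mod0 S" using mod0_eq M f E' by blast
qed

text \<open>Elements are sums of lists of products of a scalar with one of finitely many generators,
  and lists over an infinite type are no more numerous than the type itself.\<close>

lemma fg_inj:
fixes M :: "('a, 'y, 'l) graded_module"
assumes M: "gmod M" and f: "fg M" and inf: "infinite (UNIV :: 'w set)" and S: "carrier S \<lesssim> (UNIV :: 'w set)"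
obtains q :: "'y => 'w" where "inj_on q (carrier M)"
proof -
obtain B where B: "finite B" "B <= carrier M" "carrier M <= acl M (mul M (carrier S) B)" using f unfolding fg_def by blast
have "mul M (carrier S) B = (%(s, b). s .[M] b) ` (carrier S \<times> B)" by (auto simp: mul_def)
hence "mul M (carrier S) B \<lesssim> carrier S \<times> B" by (metis image_lepoll)
also have "carrier S \<times> B \<lesssim> (UNIV :: 'w set) \<times> (UNIV :: 'w set)"
 using S finite_lepoll_infinite[OF inf B(1)] by (rule times_lepoll_mono)
also have "(UNIV :: 'w set) \<times> (UNIV :: 'w set) \<lesssim> (UNIV :: 'w set)"
 using Times_same_infinite_bij_betw[OF inf] by (metis bij_betw_imp_inj_on lepoll_def subset_UNIV)
finally have m: "mul M (carrier S) B \<lesssim> (UNIV :: 'w set)" .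
have "carrier M \<lesssim> (%ys. foldr (add M) ys 0[M]) ` lists (mul M (carrier S) B)"
 by (rule subset_imp_lepoll[OF subset_trans[OF B(3) acl_lists]])
also have "... \<lesssim> lists (mul M (carrier S) B)" by (rule image_lepoll)
also have "... \<lesssim> lists (UNIV :: 'w set)" by (rule lists_lepoll_mono[OF m])
also have "... \<lesssim> (UNIV :: 'w set)"
 using lists_infinite_bij_betw[OF inf] by (metis bij_betw_imp_inj_on lepoll_def subset_UNIV)
finally obtain q :: "'y => 'w" where "inj_on q (carrier M)" unfolding lepoll_def by auto
thus thesis by (rule that)
qed

end

section \<open>External direct sums of subgroups of a module\<close>

locale dsum = galg S dg pr XS
for S :: "('a, 'k::field, 'l) graded_algebra" and dg pr XS +
fixes M :: "('a, 'y, 'm) module_scheme" and P :: "'l => 'y set"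
assumes mod: "module S M"
 and P_sub: "l : carrier (gg S) ==> additive_subgroup (P l) M"
 and P_act: "a : carrier (gg S) ==> l : carrier (gg S) ==> s : cmp S a ==> y : P l ==>
  s .[M] y : P (a *[gg S] l)"
begin

sublocale MM: module S M by (rule mod)

text \<open>The sum has to be external: the subgroups \<open>P l\<close> may overlap inside
  \<open>M\<close>, and for the pull-back those over one fibre of \<pi> coincide. The action is
  convolution with the components \<open>pr a s\<close>.\<close>

definition DS :: "('a, 'l => 'y, 'l) graded_module" where
"DS = (|carrier = {f. (ALL l. if l : carrier L then f l : P l else f l = 0[M]) & finite {l. f l ~= 0[M]}},
  monoid.mult = undefined, one = undefined, zero = (%_. 0[M]), add = (%f g l. f l +[M] g l),
  smult = (%s f l. if l : carrier L
   then finsum M (%a. pr a s .[M] f (inv[L] a *[L] l)) {a : carrier L. pr a s ~= 0[S]} else 0[M]),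
  degree_part = (\<lambda>l\<in>carrier L. {f. f l : P l & (ALL l'. l' ~= l --> f l' = 0[M])})|)"

definition sgl :: "'l => 'y => 'l => 'y" where
"sgl l y = (%l'. if l' = l then y else 0[M])"

lemma P_facts:
assumes "l : carrier L"
shows "P l <= carrier M" "0[M] : P l" "!!x y. x : P l ==> y : P l ==> x +[M] y : P l" "!!x. x : P l ==> -[M] x : P l"
by (rule MM.M.subgroup_facts[OF P_sub[OF assms]]; assumption)+

lemma DS_carrier: "f : carrier DS <-> (ALL l:carrier L. f l : P l) & (ALL l. l ~: carrier L --> f l = 0[M]) & finite {l. f l ~= 0[M]}"
by (auto simp: DS_def)

lemma DS_sel: "0[DS] = (%_. 0[M])" "f +[DS] g = (%l. f l +[M] g l)"
"l : carrier L ==> dpart DS l = {f. f l : P l & (ALL l'. l' ~= l --> f l' = 0[M])}"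
by (simp_all add: DS_def)

lemma DS_val: "f : carrier DS ==> f l : carrier M"
using P_facts(1) by (cases "l : carrier L") (auto simp: DS_carrier)

lemma DS_part: "l : carrier L ==> dpart DS l = sgl l ` P l"
by (fastforce simp: DS_sel sgl_def fun_eq_iff)

lemma sgl_carrier: "l : carrier L ==> y : P l ==> sgl l y : carrier DS"
proof -
assume h: "l : carrier L" "y : P l"
have "{l'. sgl l y l' ~= 0[M]} <= {l}" by (auto simp: sgl_def)
thus ?thesis using h P_facts(2) finite_subset unfolding DS_carrier by (auto simp: sgl_def)
qed

lemma pr_finite: "s : carrier S ==> finite {a : carrier L. pr a s ~= 0[S]}"
proof (induction rule: scalar_induct)
case zero
have "{a : carrier L. pr a 0[S] ~= 0[S]} = {}" using pr_zero by auto
thus ?case by (simp only: finite.emptyI)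
next
case (add a x y)
have "{b : carrier L. pr b (x +[S] y) ~= 0[S]} <= insert a {b : carrier L. pr b y ~= 0[S]}"
 using add pr_comp[OF _ add(1,2)] pr_add[OF _ comp_carrier[OF add(1,2)] add(3)] by auto
thus ?case by (rule finite_subset) (use add in auto)
qed

lemma pr_carrier: "l : carrier L ==> s : carrier S ==> pr l s : carrier S"
using pr_in comp_carrier by blast

lemma DS_smult_A:
assumes "s : carrier S" "f : carrier DS" "l : carrier L" "finite A" "A <= carrier L"
 "{a : carrier L. pr a s ~= 0[S]} <= A"
shows "(s .[DS] f) l = finsum M (%a. pr a s .[M] f (inv[L] a *[L] l)) A"
proof -
have "finsum M (%a. pr a s .[M] f (inv[L] a *[L] l)) A =
  finsum M (%a. pr a s .[M] f (inv[L] a *[L] l)) {a : carrier L. pr a s ~= 0[S]}"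
 using assms DS_val[OF assms(2)] pr_carrier by (intro MM.M.finsum_supp) auto
thus ?thesis using assms(3) by (simp add: DS_def)
qed

lemma DS_smult_homog:
assumes a: "a : carrier L" "s : cmp S a" and f: "f : carrier DS"
shows "s .[DS] f = (%l. if l : carrier L then s .[M] f (inv[L] a *[L] l) else 0[M])"
proof
fix l
have s: "s : carrier S" using comp_carrier[OF a] .
show "(s .[DS] f) l = (if l : carrier L then s .[M] f (inv[L] a *[L] l) else 0[M])"
proof (cases "l : carrier L")
 case True
 have "(s .[DS] f) l = finsum M (%b. pr b s .[M] f (inv[L] b *[L] l)) {a}"
  using a pr_comp[OF _ a] by (intro DS_smult_A s f True) (auto split: if_splits)
 also have "... = s .[M] f (inv[L] a *[L] l)"
  using a s pr_comp[OF a(1) a] DS_val[OF f] by (subst MM.M.finsum_insert) auto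
 finally show ?thesis using True by simp
qed (simp add: DS_def)
qed

lemma DS_smult_add:
assumes s: "s : carrier S" and t: "t : carrier S" and f: "f : carrier DS"
shows "(s +[S] t) .[DS] f = s .[DS] f +[DS] t .[DS] f"
proof
fix l
show "((s +[S] t) .[DS] f) l = (s .[DS] f +[DS] t .[DS] f) l"
proof (cases "l : carrier L")
 case True
 let ?A = "{a : carrier L. pr a s ~= 0[S]} Un {a : carrier L. pr a t ~= 0[S]}"
 have A: "finite ?A" "?A <= carrier L" using pr_finite s t by auto
 let ?g = "%s a. pr a s .[M] f (inv[L] a *[L] l)"
 have "((s +[S] t) .[DS] f) l = finsum M (?g (s +[S] t)) ?A"
  using A s t pr_add by (intro DS_smult_A f True) auto
 also have "... = finsum M (%a. ?g s a +[M] ?g t a) ?A"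
  using A s t pr_add pr_carrier DS_val[OF f] by (intro MM.M.finsum_cong') (auto simp: MM.smult_l_distr)
 also have "... = finsum M (?g s) ?A +[M] finsum M (?g t) ?A"
  using A s t pr_carrier DS_val[OF f] by (intro MM.M.finsum_addf) auto
 also have "finsum M (?g s) ?A = (s .[DS] f) l" using A by (intro DS_smult_A[symmetric] s f True) auto
 also have "finsum M (?g t) ?A = (t .[DS] f) l" using A by (intro DS_smult_A[symmetric] t f True) auto
 finally show ?thesis by (simp add: DS_sel)
qed (simp add: DS_def)
qed

lemma DS_ab: "abelian_group DS"
proof (rule abelian_groupI)
show "x +[DS] y : carrier DS" if "x : carrier DS" "y : carrier DS" for x y
proof -
 have "{l. x l +[M] y l ~= 0[M]} <= {l. x l ~= 0[M]} Un {l. y l ~= 0[M]}" by auto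
 hence "finite {l. x l +[M] y l ~= 0[M]}"
  using that finite_subset[OF _ finite_UnI] by (auto simp: DS_carrier)
 thus ?thesis using that P_facts(3) unfolding DS_carrier DS_sel by auto
qed
show "0[DS] : carrier DS" using P_facts(2) by (auto simp: DS_carrier DS_sel)
show "EX y:carrier DS. y +[DS] x = 0[DS]" if x: "x : carrier DS" for x
proof (rule bexI)
 show "(%l. -[M] x l) +[DS] x = 0[DS]" using DS_val[OF x] by (auto simp: DS_sel MM.M.l_neg)
 have "{l. -[M] x l ~= 0[M]} <= {l. x l ~= 0[M]}" by auto
 thus "(%l. -[M] x l) : carrier DS" using x P_facts(4) finite_subset unfolding DS_carrier by auto
qed
qed (auto simp: DS_sel MM.M.a_ac DS_val)

lemma DS_homog_closed:
assumes a: "a : carrier L" "s : cmp S a" and f: "f : carrier DS"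
shows "s .[DS] f : carrier DS"
proof -
have s: "s : carrier S" using comp_carrier[OF a] .
have "{l. (if l : carrier L then s .[M] f (inv[L] a *[L] l) else 0[M]) ~= 0[M]} <= (%l. a *[L] l) ` {l. f l ~= 0[M]}"
proof
 fix l assume "l : {l. (if l : carrier L then s .[M] f (inv[L] a *[L] l) else 0[M]) ~= 0[M]}"
 hence l: "l : carrier L" "s .[M] f (inv[L] a *[L] l) ~= 0[M]" by (auto split: if_splits)
 hence "f (inv[L] a *[L] l) ~= 0[M]" using s by auto
 thus "l : (%l. a *[L] l) ` {l. f l ~= 0[M]}" using LG_solve[OF a(1) l(1)] by force
qed
moreover have "s .[M] f (inv[L] a *[L] l) : P l" if "l : carrier L" for l
 using P_act[OF a(1) _ a(2), of "inv[L] a *[L] l" "f (inv[L] a *[L] l)"] f a that LG_solve[OF a(1) that]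
 by (auto simp: DS_carrier)
moreover have "finite ((%l. a *[L] l) ` {l. f l ~= 0[M]})" using f by (auto simp: DS_carrier)
ultimately show ?thesis
 unfolding DS_smult_homog[OF a f] DS_carrier using finite_subset by (intro conjI) (force, force, blast)
qed

text \<open>For homogeneous scalars the action is multiplication after a shift of the argument, so
  the module laws are visible there; \<open>scalar_induct\<close> extends them, first in one scalar
  and then in the other for associativity.\<close>

lemma DS_module: "module S DS"
proof -
interpret D: abelian_group DS by (rule DS_ab)
have zr: "0[S] .[DS] f = 0[DS]" if f: "f : carrier DS" for f
proof -
 have "0[S] : cmp S 1[L]" using SR.subgroup_facts(2)[OF comp_sub] by simp
 thus ?thesis using DS_smult_homog[OF LG.one_closed _ f] DS_val[OF f] by (auto simp: DS_sel fun_eq_iff)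
qed
have closed: "s .[DS] f : carrier DS" if "s : carrier S" and f: "f : carrier DS" for s f
 using that(1)
proof (induction rule: scalar_induct)
 case (add a x y)
 thus ?case using DS_smult_add[OF comp_carrier[OF add(1,2)] add(3) f] DS_homog_closed[OF add(1,2) f] by simp
qed (simp add: zr f)
have rd: "s .[DS] (f +[DS] g) = s .[DS] f +[DS] s .[DS] g"
 if "s : carrier S" and f: "f : carrier DS" and g: "g : carrier DS" for s f g
 using that(1)
proof (induction rule: scalar_induct)
 case (add a x y)
 have fg: "f +[DS] g : carrier DS" using f g by simp
 have xc: "x : carrier S" using comp_carrier[OF add(1,2)] .
 have "x .[DS] (f +[DS] g) = x .[DS] f +[DS] x .[DS] g"
  unfolding DS_smult_homog[OF add(1,2) f] DS_smult_homog[OF add(1,2) g] DS_smult_homog[OF add(1,2) fg]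
  using xc DS_val f g by (auto simp: DS_sel MM.smult_r_distr)
 thus ?case
  using DS_smult_add[OF xc add(3)] f g fg add closed[OF xc] closed[OF add(3)] by (simp add: D.a_ac)
qed (use zr f g in simp)
have as1: "(x *[S] y) .[DS] f = x .[DS] (y .[DS] f)"
 if a: "a : carrier L" "x : cmp S a" and b: "b : carrier L" "y : cmp S b" and f: "f : carrier DS" for a b x y f
proof -
 have xy: "x : carrier S" "y : carrier S" using comp_carrier a b by auto
 have ab: "a *[L] b : carrier L" using a b by simp
 have i: "inv[L] (a *[L] b) *[L] l = inv[L] b *[L] (inv[L] a *[L] l)" if "l : carrier L" for l
  using a b that by (simp add: LG.inv_mult_group LG.m_assoc)
 show ?thesis
  unfolding DS_smult_homog[OF ab comp_mult[OF a(1) b(1) a(2) b(2)] f]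
   DS_smult_homog[OF a DS_homog_closed[OF b f]]
  unfolding DS_smult_homog[OF b f]
  using a b i xy DS_val[OF f] by (auto simp: MM.smult_assoc1 fun_eq_iff)
qed
have as2: "(x *[S] t) .[DS] f = x .[DS] (t .[DS] f)"
 if a: "a : carrier L" "x : cmp S a" and t: "t : carrier S" and f: "f : carrier DS" for a x t f
 using t
proof (induction rule: scalar_induct)
 case zero
 have "x .[DS] 0[DS] +[DS] x .[DS] 0[DS] = x .[DS] 0[DS]"
  using rd[OF comp_carrier[OF a], of "0[DS]" "0[DS]"] by simp
 hence "x .[DS] 0[DS] = 0[DS]" using closed[OF comp_carrier[OF a], of "0[DS]"] by (intro D.double_zero) auto
 thus ?case using zr f comp_carrier[OF a] by simp
next
 case (add b z y)
 have c: "x : carrier S" "z : carrier S" using comp_carrier a add by auto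
 show ?case
  using as1[OF a add(1,2) f] add c f DS_smult_add[of "x *[S] z" "x *[S] y" f] DS_smult_add[of z y f]
   rd[of x "z .[DS] f" "y .[DS] f"] closed by (simp add: SR.r_distr)
qed
have as: "(s *[S] t) .[DS] f = s .[DS] (t .[DS] f)"
 if "s : carrier S" and t: "t : carrier S" and f: "f : carrier DS" for s t f
 using that(1)
proof (induction rule: scalar_induct)
 case zero thus ?case using zr f t closed by simp
next
 case (add a x y)
 have c: "x : carrier S" using comp_carrier add by auto
 show ?case using as2[OF add(1,2) t f] add c f t DS_smult_add[of "x *[S] t" "y *[S] t" f]
   DS_smult_add[of x y "t .[DS] f"] closed by (simp add: SR.l_distr)
qed
have one: "1[S] .[DS] f = f" if f: "f : carrier DS" for f
 unfolding DS_smult_homog[OF LG.one_closed one_comp f] using f DS_val[OF f] by (auto simp: DS_carrier fun_eq_iff)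
show ?thesis
 by (rule moduleI[OF cring DS_ab]) (use closed DS_smult_add rd as one in auto)
qed

lemma DS_smult_sgl:
assumes a: "a : carrier L" "s : cmp S a" and l: "l : carrier L" "y : P l"
shows "s .[DS] sgl l y = sgl (a *[L] l) (s .[M] y)"
proof -
have "inv[L] a *[L] l' = l <-> l' = a *[L] l" if "l' : carrier L" for l'
 using a l that by (metis LG.inv_solve_left LG.m_closed LG.inv_closed)
thus ?thesis unfolding DS_smult_homog[OF a sgl_carrier[OF l]]
 using a l comp_carrier[OF a] by (auto simp: sgl_def fun_eq_iff)
qed

lemma DS_add_sgl: "y : carrier M ==> z : carrier M ==> sgl l y +[DS] sgl l z = sgl l (y +[M] z)"
by (auto simp: DS_sel sgl_def)

lemma sgl_eq: "sgl l y = sgl l z <-> y = z"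
by (auto simp: sgl_def fun_eq_iff)

lemma sgl_zero: "sgl l 0[M] = 0[DS]"
by (auto simp: sgl_def DS_sel)

lemma DS_gmod: "gmod DS"
proof -
interpret D: module S DS by (rule DS_module)
have gen: "f : acl DS (UN l:carrier L. dpart DS l)" if "finite A" "f : carrier DS" "{l. f l ~= 0[M]} <= A" for f A
 using that
proof (induction arbitrary: f rule: finite_induct)
 case empty
 hence "f = 0[DS]" by (auto simp: DS_sel)
 thus ?case by (simp add: acl_zero)
next
 case (insert a A)
 show ?case
 proof (cases "a : carrier L")
  case False
  hence "f a = 0[M]" using insert by (auto simp: DS_carrier)
  thus ?thesis using insert by blast
 next
  case True
  define g where "g = f(a := 0[M])"
  have "{l. g l ~= 0[M]} <= {l. f l ~= 0[M]}" by (auto simp: g_def)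
  hence "finite {l. g l ~= 0[M]}" using insert.prems(1) finite_subset by (auto simp: DS_carrier)
  hence g: "g : carrier DS" using insert.prems(1) P_facts(2) by (auto simp: DS_carrier g_def)
  have "{l. g l ~= 0[M]} <= A" using insert.prems by (auto simp: g_def)
  hence "g : acl DS (UN l:carrier L. dpart DS l)" using insert.IH g by blast
  moreover have "sgl a (f a) : (UN l:carrier L. dpart DS l)"
   using True insert.prems(1) DS_part[OF True] by (intro UN_I[OF True]) (auto simp: DS_carrier)
  moreover have "f = sgl a (f a) +[DS] g"
   using DS_val[OF insert.prems(1)] by (auto simp: DS_sel sgl_def g_def fun_eq_iff)
  ultimately show ?thesis by (metis acl_add)
 qed
qed
show ?thesis
proof (rule gradedI[OF DS_module, where p = "%l f. sgl l (f l)"])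
 show "dpart DS : extensional (carrier L)" by (simp add: DS_def)
 show "additive_subgroup (dpart DS l) DS" if l: "l : carrier L" for l
 proof (rule D.M.subgroupI')
  show "dpart DS l <= carrier DS" using DS_part l sgl_carrier by auto
  show "0[DS] : dpart DS l" using DS_part l P_facts(2) sgl_zero by (metis imageI)
  show "x +[DS] y : dpart DS l" if xy: "x : dpart DS l" "y : dpart DS l" for x y
  proof -
   obtain u v where "u : P l" "x = sgl l u" "v : P l" "y = sgl l v" using xy DS_part[OF l] by auto
   thus ?thesis using DS_part[OF l] DS_add_sgl[of u v l] P_facts(3)[OF l, of u v] subsetD[OF P_facts(1)[OF l]] by auto
  qed
  show "-[DS] x : dpart DS l" if x: "x : dpart DS l" for x
  proof -
   obtain y where y: "y : P l" "x = sgl l y" using x DS_part[OF l] by auto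
   have yc: "y : carrier M" using y P_facts(1)[OF l] by blast
   have "sgl l (-[M] y) +[DS] x = 0[DS]" using DS_add_sgl[of "-[M] y" y l] y yc sgl_zero by (simp add: MM.M.l_neg)
   hence "-[DS] x = sgl l (-[M] y)"
    using sgl_carrier[OF l] y P_facts(4)[OF l] by (intro D.M.minus_equality) auto
   thus ?thesis using y P_facts(4)[OF l] DS_part[OF l] by auto
  qed
 qed
 show "s .[DS] m : dpart DS (a *[L] l)"
  if "a : carrier L" "l : carrier L" "s : cmp S a" "m : dpart DS l" for a l s m
  using that DS_part DS_smult_sgl P_act by auto
 show "sgl l (m l) : dpart DS l" if "l : carrier L" "m : carrier DS" for l m
  using that DS_part by (auto simp: DS_carrier)
 show "sgl l ((x +[DS] y) l) = sgl l (x l) +[DS] sgl l (y l)" if "l : carrier L" "x : carrier DS" "y : carrier DS" for l x y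
  using DS_add_sgl[OF DS_val[OF that(2)] DS_val[OF that(3)]] by (simp add: DS_sel)
 show "sgl l (m l) = (if l = a then m else 0[DS])" if "l : carrier L" "a : carrier L" "m : dpart DS a" for l a m
  using that DS_part sgl_zero by (auto simp: sgl_def DS_sel fun_eq_iff)
 show "carrier DS <= acl DS (UN l:carrier L. dpart DS l)"
  using gen by (auto simp: DS_carrier)
qed
qed

end

section \<open>Morphisms of the quotient category as germs in high degree\<close>

context galg
begin

abbreviation "MC == mod_cat S"

lemma MC_sel [simp]: "Hom MC = gmhom S" "Comp MC X Y Z g f = compose (carrier X) g f"
"Ident MC X = (\<lambda>m\<in>carrier X. m)"
by (simp_all add: mod_cat_def)

lemma gsubI:
assumes M: "gmod M" and U: "U <= carrier M" "0[M] : U" "!!x y. x : U ==> y : U ==> x +[M] y : U"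
 and s: "!!a s x. a : carrier L ==> s : cmp S a ==> x : U ==> s .[M] x : U"
 and c: "!!l x. l : carrier L ==> x : U ==> cp M l x : U"
shows "gsub M U"
proof -
interpret module S M using M gmod_module by blast
have 1: "s .[M] x : U" if "s : carrier S" "x : U" for s x
 using that(1)
proof (induction rule: scalar_induct)
 case zero thus ?case using U that by (simp add: subsetD)
next
 case (add a y z)
 thus ?case using s[OF add(1,2) that(2)] U(1,3) comp_carrier that by (simp add: smult_l_distr subsetD)
qed
have "-[M] x : U" if "x : U" for x
 using 1[of "-[S] 1[S]" x] that U(1) by (simp add: smult_l_minus subsetD)
hence "osub (carrier S) M U" using U 1 by (intro osubI) auto
thus ?thesis using c by (simp add: gsub_def)
qed

lemma part_facts:
assumes X: "gmod X" and l: "l : carrier L"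
shows "dpart X l <= carrier X" "0[X] : dpart X l"
 "!!x y. x : dpart X l ==> y : dpart X l ==> x +[X] y : dpart X l"
 "!!x. x : dpart X l ==> -[X] x : dpart X l"
by (rule abelian_group.subgroup_facts[OF gmod_ab[OF X] gmod_sub[OF X l]]; assumption)+

lemma sub_Ob: "M : Ob MC ==> gsub M U ==> sub U M : Ob MC"
using sub_gmod fg_sub by (auto simp: Ob_mod_cat)

lemma incl_hom:
assumes M: "gmod M" and U: "gsub M U"
shows "(\<lambda>x\<in>U. x) : gmhom S (sub U M) M"
proof -
have o: "osub (carrier S) M U" using U by (simp add: gsub_def)
note module.osubD[OF gmod_module[OF M] o]
thus ?thesis
 using comp_carrier by (intro homI[OF sub_gmod[OF M U] M]) (auto simp: addmap_def)
qed

lemma comp_hom: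
assumes "f : gmhom S X Y" "g : gmhom S Y Z" "gmod X"
shows "compose (carrier X) g f : gmhom S X Z"
proof -
interpret module S X using assms gmod_module by blast
note fa = hom_addmap[OF assms(1)] and ga = hom_addmap[OF assms(2)]
have c: "!!l m. l : carrier L ==> m : dpart X l ==> m : carrier X" using gmod_carrier[OF assms(3)] .
show ?thesis
 unfolding graded_module_hom_def
 using addmap_closed[OF fa] addmap_closed[OF ga] addmap_add[OF fa] addmap_add[OF ga]
  hom_smult[OF assms(1)] hom_smult[OF assms(2)] hom_part[OF assms(1)] hom_part[OF assms(2)] c
 by (auto simp: compose_def)
qed

lemma id_hom: "gmod X ==> (\<lambda>m\<in>carrier X. m) : gmhom S X X"
proof -
assume X: "gmod X"
interpret module S X using X gmod_module by blast
show ?thesis using gmod_carrier[OF X] by (auto simp: graded_module_hom_def)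
qed

lemma zero_hom:
assumes "gmod X" "gmod Y" shows "(\<lambda>m\<in>carrier X. 0[Y]) : gmhom S X Y"
proof -
interpret X: module S X using assms gmod_module by blast
interpret Y: module S Y using assms gmod_module by blast
show ?thesis
 using gmod_carrier[OF assms(1)] Y.M.subgroup_facts(2)[OF gmod_sub[OF assms(2)]]
 by (auto simp: graded_module_hom_def)
qed

lemma hom_zero: "gmod X ==> gmod Y ==> f : gmhom S X Y ==> f 0[X] = 0[Y]"
using addmap_zero[OF hom_addmap] gmod_ab by blast

lemma zero_object_carrier:
assumes "zero_object MC Z" shows "Z : Ob MC" "carrier Z = {0[Z]}"
proof -
show Z: "Z : Ob MC" using assms by (simp add: zero_object_def)
hence g: "gmod Z" by (simp add: Ob_mod_cat)
have "EX! f. f : gmhom S Z Z" using assms by (simp add: zero_object_def)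
hence "(\<lambda>m\<in>carrier Z. m) = (\<lambda>m\<in>carrier Z. 0[Z])" using id_hom[OF g] zero_hom[OF g g] by blast
hence "m = 0[Z]" if "m : carrier Z" for m using that by (metis restrict_apply')
moreover have "0[Z] : carrier Z" using gmod_ab[OF g] by (simp add: abelian_group_def abelian_monoid.zero_closed)
ultimately show "carrier Z = {0[Z]}" by blast
qed

lemma zero_gsub: "gmod M ==> gsub M {0[M]}"
proof -
assume M: "gmod M"
interpret module S M using M gmod_module by blast
show ?thesis using cp_zero[OF M] comp_carrier by (intro gsubI[OF M]) auto
qed

lemma zero_object_zero:
assumes X: "X : Ob MC" shows "zero_object MC (sub {0[X]} X)"
proof -
have g: "gmod X" using X by (simp add: Ob_mod_cat)
let ?Z = "sub {0[X]} X"
have Z: "gmod ?Z" using sub_gmod[OF g zero_gsub[OF g]] .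
have "EX! f. f : gmhom S W ?Z" if "gmod W" for W
proof (rule ex1I[where P = "%f. f : gmhom S W ?Z", OF zero_hom[OF that Z]])
 fix f assume "f : gmhom S W ?Z"
 hence "f : carrier W \<rightarrow>\<^sub>E {0[X]}" by (simp add: graded_module_hom_def)
 thus "f = (\<lambda>m\<in>carrier W. 0[?Z])" by (auto simp: PiE_def extensional_def fun_eq_iff)
qed
moreover have "EX! f. f : gmhom S ?Z W" if "gmod W" for W
proof (rule ex1I[where P = "%f. f : gmhom S ?Z W", OF zero_hom[OF Z that]])
 fix f assume f: "f : gmhom S ?Z W"
 show "f = (\<lambda>m\<in>carrier ?Z. 0[W])"
  using hom_zero[OF Z that f] hom_ext[OF f] by (auto simp: extensional_def fun_eq_iff)
qed
ultimately show ?thesis using sub_Ob[OF X zero_gsub[OF g]] by (simp add: zero_object_def Ob_mod_cat)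
qed

text \<open>A zero morphism factors through some zero object; for the converse the zero submodule of
  \<open>X\<close> is taken, which has its carrier in the universe.\<close>

lemma zero_morphism_iff:
assumes X: "X : Ob MC" and Y: "Y : Ob MC" and f: "f : gmhom S X Y"
shows "zero_morphism MC X Y f <-> (ALL x:carrier X. f x = 0[Y])"
proof
have g: "gmod X" "gmod Y" using X Y by (auto simp: Ob_mod_cat)
{
 assume "zero_morphism MC X Y f"
 then obtain Z a b where z: "zero_object MC Z" "a : gmhom S X Z" "b : gmhom S Z Y" "f = compose (carrier X) b a"
  by (auto simp: zero_morphism_def)
 note zc = zero_object_carrier[OF z(1)]
 have "gmod Z" using zc by (simp add: Ob_mod_cat)
 thus "ALL x:carrier X. f x = 0[Y]"
  using z(4) zc(2) addmap_closed[OF hom_addmap[OF z(2)]] hom_zero[OF _ g(2) z(3)] by (auto simp: compose_def)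
}
assume 0: "ALL x:carrier X. f x = 0[Y]"
let ?Z = "sub {0[X]} X"
have Z: "gmod ?Z" using sub_gmod[OF g(1) zero_gsub[OF g(1)]] .
have "f = compose (carrier X) (\<lambda>m\<in>carrier ?Z. 0[Y]) (\<lambda>m\<in>carrier X. 0[?Z])"
 using 0 hom_ext[OF f] by (auto simp: compose_def extensional_def fun_eq_iff)
thus "zero_morphism MC X Y f"
 unfolding zero_morphism_def using zero_object_zero[OF X] zero_hom[OF g(1) Z] zero_hom[OF Z g(2)] by auto
qed

lemma ker_gsub:
assumes Z: "gmod Z" and X: "gmod X" and s: "s : gmhom S Z X"
shows "gsub Z {z : carrier Z. s z = 0[X]}"
proof -
interpret Z: module S Z using Z gmod_module by blast
interpret X: module S X using X gmod_module by blast
note sa = hom_addmap[OF s]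
show ?thesis
 using hom_zero[OF Z X s] addmap_add[OF sa] hom_smult[OF s] cp_hom[OF Z X s] cp_zero[OF X]
  addmap_closed[OF cp_addmap[OF Z]] comp_carrier
 by (intro gsubI[OF Z]) (auto simp: cp_hom[OF Z X s, symmetric])
qed

lemma im_gsub:
assumes Z: "gmod Z" and X: "gmod X" and s: "s : gmhom S Z X"
shows "gsub X (s ` carrier Z)"
proof -
interpret Z: module S Z using Z gmod_module by blast
note sa = hom_addmap[OF s]
show ?thesis
proof (rule gsubI[OF X])
 show "s ` carrier Z <= carrier X" using addmap_closed[OF sa] by blast
 show "0[X] : s ` carrier Z" using hom_zero[OF Z X s] Z.M.zero_closed by (metis imageI)
 show "x +[X] y : s ` carrier Z" if "x : s ` carrier Z" "y : s ` carrier Z" for x y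
  using that addmap_add[OF sa, symmetric] by auto
 show "t .[X] x : s ` carrier Z" if "a : carrier L" "t : cmp S a" "x : s ` carrier Z" for a t x
  using that hom_smult[OF s, symmetric] comp_carrier by auto
 show "cp X l x : s ` carrier Z" if "l : carrier L" "x : s ` carrier Z" for l x
  using that cp_hom[OF Z X s] addmap_closed[OF cp_addmap[OF Z]] by auto
qed
qed

lemma hom_img:
assumes M: "gmod M" and U: "gsub M U"
 and q: "!!x y. x : carrier M ==> y : carrier M ==> q x = q y <-> x -[M] y : U"
shows "addmap M (img q M) q" and "fg M ==> fg (img q M)"
proof -
interpret M: module S M using M gmod_module by blast
have I: "gmod (img q M)" by (rule img_gmod[OF M U q])
interpret I: module S "img q M" using I gmod_module by blast
show a: "addmap M (img q M) q" using img_add[OF M U q] by (auto simp: addmap_def)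
assume "fg M"
then obtain B where B: "finite B" "B <= carrier M" "carrier M <= acl M (mul M (carrier S) B)" unfolding fg_def by blast
have "q ` mul M (carrier S) B <= mul (img q M) (carrier S) (q ` B)"
proof
 fix y assume "y : q ` mul M (carrier S) B"
 then obtain s b where "s : carrier S" "b : B" "y = q (s .[M] b)" unfolding mul_def by auto
 moreover from this have "y = s .[img q M] q b" using img_smult[OF M U q] B(2) by auto
 ultimately show "y : mul (img q M) (carrier S) (q ` B)" unfolding mul_def by blast
qed
hence "q m : acl (img q M) (mul (img q M) (carrier S) (q ` B))" if "m : carrier M" for m
proof -
 have "q m : acl (img q M) (q ` mul M (carrier S) B)"
  using that B(3) by (intro addmap_acl[OF a M.M.abelian_group_axioms I.M.abelian_group_axioms M.mul_carrier[OF subset_refl B(2)]]) blast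
 thus ?thesis using acl_mono[OF \<open>q ` mul M (carrier S) B <= _\<close>] by blast
qed
thus "fg (img q M)" unfolding fg_def using B by (intro exI[of _ "q ` B"]) auto
qed

text \<open>Chosen representatives replace cosets, so that a cokernel is again a module with carrier
  in \<open>'u\<close>.\<close>

definition coset_rep :: "('a, 'u, 'l) graded_module => 'u set => 'u => 'u" where
"coset_rep M U x = (SOME y. y : carrier M & x -[M] y : U)"

lemma coset_rep:
assumes M: "gmod M" and U: "gsub M U" and x: "x : carrier M" and y: "y : carrier M"
shows "coset_rep M U x = coset_rep M U y <-> x -[M] y : U"
proof -
interpret M: module S M using M gmod_module by blast
have o: "osub (carrier S) M U" using U by (simp add: gsub_def)
note U = M.osubD[OF o]
have r: "coset_rep M U z : carrier M & z -[M] coset_rep M U z : U" if "z : carrier M" for z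
 unfolding coset_rep_def
 by (rule someI[of _ z]) (use that U(2) in "auto simp: a_minus_def M.M.r_neg")
have e: "(u -[M] v) +[M] (v -[M] w) = u -[M] w" if "u : carrier M" "v : carrier M" "w : carrier M" for u v w
proof -
 have "(u -[M] v) +[M] (v -[M] w) = u +[M] ((-[M] v +[M] v) +[M] -[M] w)"
  using that by (simp add: a_minus_def M.M.a_assoc)
 thus ?thesis using that by (simp add: a_minus_def M.M.l_neg)
qed
have m: "u -[M] v : U ==> v -[M] u : U" if "u : carrier M" "v : carrier M" for u v
 using U(4)[of "u -[M] v"] that by (simp add: a_minus_def M.M.minus_add M.M.a_comm)
show ?thesis
proof
 assume eq: "coset_rep M U x = coset_rep M U y"
 show "x -[M] y : U"
  using U(3)[of "x -[M] coset_rep M U x" "coset_rep M U x -[M] y"] r[OF x] r[OF y] m[of y "coset_rep M U y"] eq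
   e[OF x _ y, of "coset_rep M U x"] y by simp
next
 assume d: "x -[M] y : U"
 have "x -[M] z : U <-> y -[M] z : U" if "z : carrier M" for z
  using U(3)[OF d, of "y -[M] z"] U(3)[OF m[OF x y d], of "x -[M] z"] e[OF x y that] e[OF y x that] by auto
 thus "coset_rep M U x = coset_rep M U y" unfolding coset_rep_def by meson
qed
qed

definition bijhi :: "int => ('a, 'u, 'l) graded_module => ('a, 'u, 'l) graded_module => ('u => 'u) => bool" where
"bijhi n Z X s <-> (ALL l:carrier L. n <= dg l --> bij_betw s (dpart Z l) (dpart X l))"

text \<open>The definition speaks of some kernel and some cokernel. The concrete ones,
  \<open>?K\<close> and \<open>?Q\<close>, are compared with them by universal properties, and
  \<open>mod0_iff\<close> turns membership in \<open>mod0\<close> into vanishing in high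
  degrees.\<close>

lemma serre_iso_iff:
assumes Z: "Z : Ob MC" and X: "X : Ob MC" and s: "s : gmhom S Z X"
shows "s : serre_isos MC (mod0 S) Z X <-> (EX n. bijhi n Z X s)"
proof -
have gZ: "gmod Z" "fg Z" and gX: "gmod X" "fg X" using Z X by (auto simp: Ob_mod_cat)
interpret Z: module S Z using gZ gmod_module by blast
interpret X: module S X using gX gmod_module by blast
note sa = hom_addmap[OF s]
define U where "U = {z : carrier Z. s z = 0[X]}"
define V where "V = s ` carrier Z"
have U: "gsub Z U" unfolding U_def by (rule ker_gsub[OF gZ(1) gX(1) s])
have V: "gsub X V" unfolding V_def by (rule im_gsub[OF gZ(1) gX(1) s])
have oV: "osub (carrier S) X V" using V by (simp add: gsub_def)
note Vd = X.osubD[OF oV]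
let ?K = "sub U Z" and ?k = "\<lambda>x\<in>U. x"
let ?q = "coset_rep X V"
let ?Q = "img ?q X"
note q = coset_rep[OF gX(1) V]
have gK: "gmod ?K" "fg ?K" "?K : Ob MC" using sub_gmod[OF gZ(1) U] fg_sub[OF gZ U] by (auto simp: Ob_mod_cat)
have gQ: "gmod ?Q" "fg ?Q" "?Q : Ob MC"
 using img_gmod[OF gX(1) V q] hom_img(2)[OF gX(1) V q gX(2)] by (auto simp: Ob_mod_cat)
have k: "?k : gmhom S ?K Z" by (rule incl_hom[OF gZ(1) U])
let ?p = "\<lambda>x\<in>carrier X. ?q x"
have qp: "?q x : dpart ?Q l" if "l : carrier L" "x : dpart X l" for x l using that by simp
have pa: "addmap X ?Q ?p" using hom_img(1)[OF gX(1) V q] by (auto simp: addmap_def)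
have p: "?p : gmhom S X ?Q"
proof (rule homI[OF gX(1) gQ(1) restrict_extensional pa])
 show "!!l m. l : carrier L ==> m : dpart X l ==> ?p m : dpart ?Q l"
  using gmod_carrier[OF gX(1)] by auto
 show "?p (t .[X] m) = t .[?Q] ?p m" if "a : carrier L" "l : carrier L" "t : cmp S a" "m : dpart X l" for a l t m
  using gmod_carrier[OF gX(1) that(2,4)] comp_carrier[OF that(1,3)] img_smult[OF gX(1) V q] by simp
qed
have q0: "?q x = ?q 0[X] <-> x : V" if "x : carrier X" for x using q[OF that X.zero_closed] that
  X.M.minus_equality[OF X.M.r_zero[OF X.zero_closed] X.zero_closed X.zero_closed] by (simp add: a_minus_def)
have sk: "zero_morphism MC ?K X (compose (carrier ?K) s ?k)"
 using comp_hom[OF k s gK(1)] by (subst zero_morphism_iff[OF gK(3) X]) (auto simp: compose_def U_def)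
have ps: "zero_morphism MC Z ?Q (compose (carrier Z) ?p s)"
 using comp_hom[OF s p gZ(1)] addmap_closed[OF sa] q0
 by (subst zero_morphism_iff[OF Z gQ(3)]) (auto simp: compose_def V_def)
have sl: "s z : dpart X l" if "l : carrier L" "z : dpart Z l" for l z using hom_part[OF s that] .
show ?thesis
proof
 assume "s : serre_isos MC (mod0 S) Z X"
 then obtain K k' Q q' where K: "is_kernel MC Z X s K k'" "K : mod0 S" and Q: "is_cokernel MC Z X s Q q'" "Q : mod0 S"
  by (auto simp: serre_isos_def)
 have mK: "gmod K" "fg K" "gmod Q" "fg Q" using K(2) Q(2) by (auto simp: mod0_eq)
 obtain n1 where n1: "!!l. l : carrier L ==> n1 <= dg l ==> dpart K l = {0[K]}" using mod0_iff[OF mK(1,2)] K(2) by blast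
 obtain n2 where n2: "!!l. l : carrier L ==> n2 <= dg l ==> dpart Q l = {0[Q]}" using mod0_iff[OF mK(3,4)] Q(2) by blast
 have kh: "k' : gmhom S K Z" and qh: "q' : gmhom S X Q" using K Q by (auto simp: is_kernel_def is_cokernel_def)
 \<comment> \<open>The inclusion of \<open>?K\<close> factors through \<open>K\<close>, so a kernel
   element of high degree is the image of zero. Dually, \<open>j\<close> makes the class of an
   element of high degree in \<open>?Q\<close> vanish, so the element lies in the image of
   \<open>s\<close>.\<close>
 obtain h where h: "h : gmhom S ?K K" "compose (carrier ?K) k' h = ?k"
  using K(1) gK(3) k sk unfolding is_kernel_def by (metis MC_sel(1,2))
 obtain j where j: "j : gmhom S Q ?Q" "compose (carrier X) j q' = ?p"
  using Q(1) gQ(3) p ps unfolding is_cokernel_def by (metis MC_sel(1,2))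
 have "bijhi (max n1 n2) Z X s" unfolding bijhi_def
 proof (intro ballI impI)
  fix l assume l: "l : carrier L" "max n1 n2 <= dg l"
  note sub = gmod_sub[OF gZ(1) l(1)]
  have ker: "z = 0[Z]" if z: "z : dpart Z l" "s z = 0[X]" for z
  proof -
   have zU: "z : U" "z : dpart ?K l" using z l gmod_carrier[OF gZ(1) l(1)] by (auto simp: U_def)
   have "h z = 0[K]" using hom_part[OF h(1) l(1) zU(2)] n1[OF l(1)] l(2) by auto
   moreover have "k' (h z) = z" using fun_cong[OF h(2), of z] zU by (simp add: compose_def)
   ultimately show ?thesis using hom_zero[OF mK(1) gZ(1) kh] by simp
  qed
  have "inj_on s (dpart Z l)"
  proof (rule inj_onI)
   fix x y assume xy: "x : dpart Z l" "y : dpart Z l" "s x = s y"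
   have c: "x : carrier Z" "y : carrier Z" using gmod_carrier[OF gZ(1) l(1)] xy by auto
   have "s (x -[Z] y) = 0[X]"
    using addmap_diff[OF sa gmod_ab gmod_ab c] gZ gX xy(3) addmap_closed[OF sa] c by (simp add: a_minus_def X.M.r_neg)
   moreover have "x -[Z] y : dpart Z l" using Z.M.subgroup_facts(3,4)[OF sub] xy by (simp add: a_minus_def)
   ultimately show "x = y" using ker Z.M.diff_zero c by blast
  qed
  moreover have "s ` dpart Z l = dpart X l"
  proof
   show "s ` dpart Z l <= dpart X l" using sl l by blast
   show "dpart X l <= s ` dpart Z l"
   proof
    fix x assume x: "x : dpart X l"
    have xc: "x : carrier X" using gmod_carrier[OF gX(1) l(1) x] .
    have "q' x = 0[Q]" using hom_part[OF qh l(1) x] n2[OF l(1)] l(2) by auto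
    hence "?q x = ?q 0[X]" using fun_cong[OF j(2), of x] xc hom_zero[OF mK(3) gQ(1) j(1)] by (simp add: compose_def)
    then obtain z where z: "z : carrier Z" "x = s z" using q0[OF xc] by (auto simp: V_def)
    have "x = s (cp Z l z)" using cp_hom[OF gZ(1) gX(1) s l(1) z(1)] cp_comp[OF gX(1) l(1,1) x] z by simp
    thus "x : s ` dpart Z l" using cp_in[OF gZ(1) z(1) l(1)] by blast
   qed
  qed
  ultimately show "bij_betw s (dpart Z l) (dpart X l)" by (simp add: bij_betw_def)
 qed
 thus "EX n. bijhi n Z X s" by blast
next
 assume "EX n. bijhi n Z X s"
 then obtain n where n: "!!l. l : carrier L ==> n <= dg l ==> bij_betw s (dpart Z l) (dpart X l)" by (auto simp: bijhi_def)
 have z0: "0[Z] : dpart Z l" "0[X] : dpart X l" if "l : carrier L" for l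
  using Z.M.subgroup_facts(2)[OF gmod_sub[OF gZ(1) that]] X.M.subgroup_facts(2)[OF gmod_sub[OF gX(1) that]] by auto
 have "dpart ?K l = {0[?K]}" if l: "l : carrier L" "n <= dg l" for l
 proof -
  have "z = 0[Z]" if "z : dpart Z l" "s z = 0[X]" for z
   using n[OF l] that z0[OF l(1)] hom_zero[OF gZ(1) gX(1) s] by (metis bij_betw_inv_into_left)
  hence "U Int dpart Z l = {0[Z]}"
   using z0(1)[OF l(1)] hom_zero[OF gZ(1) gX(1) s] Z.zero_closed unfolding U_def by blast
  thus ?thesis using l by simp
 qed
 hence 1: "?K : mod0 S" using mod0_iff[OF gK(1,2)] by blast
 have "dpart ?Q l = {0[?Q]}" if l: "l : carrier L" "n <= dg l" for l
 proof -
  have "dpart X l <= V" using bij_betw_imp_surj_on[OF n[OF l]] part_facts[OF gZ(1) l(1)] unfolding V_def by blast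
  hence "?q x = ?q 0[X]" if "x : dpart X l" for x using q0[of x] that Vd(1) by blast
  hence "?q ` dpart X l = {?q 0[X]}" using z0(2)[OF l(1)] by blast
  thus ?thesis using l by simp
 qed
 hence 2: "?Q : mod0 S" using mod0_iff[OF gQ(1,2)] by blast
 have 3: "is_kernel MC Z X s ?K ?k" unfolding is_kernel_def
 proof (intro conjI ballI impI)
  fix W g assume W: "W : Ob MC" and "g : Hom MC W Z" and zm: "zero_morphism MC W X (Comp MC W Z X s g)"
  hence g: "g : gmhom S W Z" by simp
  have gW: "gmod W" using W by (simp add: Ob_mod_cat)
  have "ALL x:carrier W. s (g x) = 0[X]" using zm zero_morphism_iff[OF W X comp_hom[OF g s gW]] by (simp add: compose_def)
  hence gU: "g x : U" if "x : carrier W" for x using addmap_closed[OF hom_addmap[OF g]] that by (simp add: U_def)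
  have gK': "g : gmhom S W ?K"
   using g gU gmod_carrier[OF gW] unfolding graded_module_hom_def by (auto simp: PiE_def)
  show "EX! h. h : Hom MC W ?K & Comp MC W ?K Z ?k h = g"
  proof (rule ex1I[of _ g])
   show "g : Hom MC W ?K & Comp MC W ?K Z ?k g = g"
    using gK' gU hom_ext[OF g] by (auto simp: compose_def extensional_def fun_eq_iff)
   fix h assume "h : Hom MC W ?K & Comp MC W ?K Z ?k h = g"
   hence h: "h : gmhom S W ?K" "compose (carrier W) ?k h = g" by auto
   show "h = g"
   proof (rule extensionalityI[OF hom_ext[OF h(1)] hom_ext[OF g]])
    fix x assume x: "x : carrier W"
    hence "h x : U" using addmap_closed[OF hom_addmap[OF h(1)]] by auto
    thus "h x = g x" using fun_cong[OF h(2), of x] x by (simp add: compose_def)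
   qed
  qed
 qed (use gK k sk in auto)
 have 4: "is_cokernel MC Z X s ?Q ?p" unfolding is_cokernel_def
 proof (intro conjI ballI impI)
  fix W g assume W: "W : Ob MC" and "g : Hom MC X W" and zm: "zero_morphism MC Z W (Comp MC Z X W g s)"
  hence g: "g : gmhom S X W" by simp
  note ga = hom_addmap[OF g]
  have gW: "gmod W" using W by (simp add: Ob_mod_cat)
  interpret W: module S W using gW gmod_module by blast
  have "ALL x:carrier Z. g (s x) = 0[W]" using zm zero_morphism_iff[OF Z W comp_hom[OF s g gZ(1)]] by (simp add: compose_def)
  hence gV: "g x = 0[W]" if "x : V" for x using that by (auto simp: V_def)
  have gq: "g x = g y" if xy: "x : carrier X" "y : carrier X" "?q x = ?q y" for x y
   using q[OF xy(1,2)] xy(3) gV addmap_diff[OF ga gmod_ab gmod_ab xy(1,2)] gX gW addmap_closed[OF ga] xy W.M.diff_zero by metis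
  let ?i = "inv_into (carrier X) ?q"
  have i: "?i (?q x) : carrier X" "?q (?i (?q x)) = ?q x" if "x : carrier X" for x
   using that by (auto intro: inv_into_into f_inv_into_f)
  define hh where "hh = (\<lambda>a\<in>carrier ?Q. g (?i a))"
  have he: "hh : extensional (carrier ?Q)" by (simp add: hh_def)
  have hq: "hh (?q x) = g x" if "x : carrier X" for x using gq[OF i(1)[OF that] that i(2)[OF that]] that by (simp add: hh_def)
  have ha: "addmap ?Q W hh" unfolding addmap_def
  proof (intro conjI ballI)
   show "hh : carrier ?Q \<rightarrow> carrier W" using addmap_closed[OF ga] hq by auto
   fix a b assume "a : carrier ?Q" "b : carrier ?Q"
   then obtain x y where "x : carrier X" "y : carrier X" "a = ?q x" "b = ?q y" by auto
   thus "hh (a +[?Q] b) = hh a +[W] hh b"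
    using img_add[OF gX(1) V q] hq addmap_add[OF ga] by simp
  qed
  have h: "hh : gmhom S ?Q W"
  proof (rule homI[OF gQ(1) gW he ha])
   fix l m assume l: "l : carrier L" "m : dpart ?Q l"
   then obtain x where "x : dpart X l" "m = ?q x" by auto
   thus "hh m : dpart W l" using hq gmod_carrier[OF gX(1) l(1)] hom_part[OF g l(1)] by simp
  next
   fix a l t m assume l: "a : carrier L" "l : carrier L" "t : cmp S a" "m : dpart ?Q l"
   then obtain x where x: "x : dpart X l" "m = ?q x" by auto
   have xc: "x : carrier X" "t : carrier S" using gmod_carrier[OF gX(1) l(2) x(1)] comp_carrier[OF l(1,3)] by auto
   thus "hh (t .[?Q] m) = t .[W] hh m"
    using img_smult[OF gX(1) V q xc(2,1)] hq[of "t .[X] x"] hq[OF xc(1)] hom_smult[OF g] x(2) by simp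
  qed
  show "EX! h. h : Hom MC ?Q W & Comp MC X ?Q W h ?p = g"
  proof (rule ex1I[of _ hh])
   have "compose (carrier X) hh ?p x = g x" for x
    using hq[of x] hom_ext[OF g] by (cases "x : carrier X") (simp_all add: compose_def extensional_def)
   thus "hh : Hom MC ?Q W & Comp MC X ?Q W hh ?p = g" using h by (auto simp: fun_eq_iff)
   fix h assume "h : Hom MC ?Q W & Comp MC X ?Q W h ?p = g"
   hence h': "h : gmhom S ?Q W" "compose (carrier X) h ?p = g" by auto
   show "h = hh"
   proof (rule extensionalityI[OF hom_ext[OF h'(1)] he])
    fix a assume "a : carrier ?Q"
    then obtain x where x: "x : carrier X" "a = ?q x" by auto
    thus "h a = hh a" using fun_cong[OF h'(2), of x] hq[OF x(1)] by (simp add: compose_def)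
   qed
  qed
 qed (use gQ p ps in auto)
 show "s : serre_isos MC (mod0 S) Z X" unfolding serre_isos_def using s 1 2 3 4 by auto
qed
qed

end

section \<open>Germs, truncations and the roofs they represent\<close>

context galg
begin

text \<open>A bare function on the carrier type, constrained only in degrees at least
  \<open>n\<close>. Scalars are restricted to nonnegative degree so that products stay in this
  range; components of negative degree are zero by \<open>dg_neg\<close>.\<close>

definition germ :: "('a, 'u, 'l) graded_module => ('a, 'v, 'l) graded_module => int => ('u => 'v) => bool" where
"germ X Y n h <-> (ALL l:carrier L. n <= dg l --> (ALL x:dpart X l. h x : dpart Y l) &
  (ALL x:dpart X l. ALL y:dpart X l. h (x +[X] y) = h x +[Y] h y) &
  (ALL a:carrier L. 0 <= dg a --> (ALL s:cmp S a. ALL x:dpart X l. h (s .[X] x) = s .[Y] h x)))"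

definition geq :: "('a, 'u, 'l) graded_module => int => ('u => 'v) => ('u => 'v) => bool" where
"geq X n h k <-> (ALL l:carrier L. n <= dg l --> (ALL x:dpart X l. h x = k x))"

lemma germI:
assumes "!!l x. l : carrier L ==> n <= dg l ==> x : dpart X l ==> h x : dpart Y l"
 "!!l x y. l : carrier L ==> n <= dg l ==> x : dpart X l ==> y : dpart X l ==> h (x +[X] y) = h x +[Y] h y"
 "!!a l s x. a : carrier L ==> 0 <= dg a ==> l : carrier L ==> n <= dg l ==> s : cmp S a ==> x : dpart X l ==>
  h (s .[X] x) = s .[Y] h x"
shows "germ X Y n h"
using assms unfolding germ_def by blast

lemma germD:
assumes "germ X Y n h" "l : carrier L" "n <= dg l"
shows "x : dpart X l ==> h x : dpart Y l"
 "x : dpart X l ==> y : dpart X l ==> h (x +[X] y) = h x +[Y] h y"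
 "a : carrier L ==> 0 <= dg a ==> s : cmp S a ==> x : dpart X l ==> h (s .[X] x) = s .[Y] h x"
using assms unfolding germ_def by blast+

lemma germ_mono: "germ X Y n h ==> n <= m ==> germ X Y m h"
unfolding germ_def by (meson order_trans)

lemma geq_mono: "geq X n h k ==> n <= m ==> geq X m h k"
unfolding geq_def by (meson order_trans)

lemma geqD: "geq X n h k ==> l : carrier L ==> n <= dg l ==> x : dpart X l ==> h x = k x"
unfolding geq_def by blast

lemma hom_germ: "gmod X ==> f : gmhom S X Y ==> germ X Y n f"
by (rule germI) (auto intro: hom_part simp: addmap_add[OF hom_addmap] hom_smult gmod_carrier comp_carrier)

lemma germ_comp: "gmod X ==> germ X Y n h ==> germ Y Z n k ==> germ X Z n (%x. k (h x))"
by (rule germI) (simp_all add: germD)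

lemma germ_zero:
assumes "gmod X" "gmod Y" "germ X Y n h" "l : carrier L" "n <= dg l"
shows "h 0[X] = 0[Y]"
proof -
interpret X: module S X using assms gmod_module by blast
interpret Y: module S Y using assms gmod_module by blast
have "h 0[X] : dpart Y l" using germD(1)[OF assms(3-5)] part_facts(2)[OF assms(1,4)] by blast
thus ?thesis
 using germD(2)[OF assms(3-5), of "0[X]" "0[X]"] part_facts(2)[OF assms(1,4)] part_facts(1)[OF assms(2,4)]
 by (intro Y.M.double_zero) auto
qed

definition tr :: "int => ('a, 'u, 'l) graded_module => ('a, 'u, 'l) graded_module" where
"tr n X = sub {x : carrier X. ALL l:carrier L. dg l < n --> cp X l x = 0[X]} X"

lemma tr_gsub:
assumes X: "gmod X" shows "gsub X {x : carrier X. ALL l:carrier L. dg l < n --> cp X l x = 0[X]}"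
proof -
interpret X: module S X using X gmod_module by blast
note cpc = addmap_closed[OF cp_addmap[OF X]]
show ?thesis
proof (rule gsubI[OF X])
 fix a s x assume a: "a : carrier L" "s : cmp S a" and x: "x : {x : carrier X. ALL l:carrier L. dg l < n --> cp X l x = 0[X]}"
 have s: "s : carrier S" using comp_carrier[OF a] .
 have "cp X l (s .[X] x) = 0[X]" if l: "l : carrier L" "dg l < n" for l
 proof (cases "dg a < 0")
  case True thus ?thesis using dg_neg a x l cp_zero[OF X] by simp
 next
  case False
  thus ?thesis using cp_smult[OF X a(1) l(1) a(2)] x l s dg_add[of "inv[L] a" l] dg_inv[OF a(1)] a by simp
 qed
 thus "s .[X] x : {x : carrier X. ALL l:carrier L. dg l < n --> cp X l x = 0[X]}" using s x by simp
next
 fix l x assume "l : carrier L" "x : {x : carrier X. ALL l:carrier L. dg l < n --> cp X l x = 0[X]}"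
 thus "cp X l x : {x : carrier X. ALL l:carrier L. dg l < n --> cp X l x = 0[X]}"
  using cpc cp_comp[OF X _ _ cp_in[OF X]] by auto
qed (use cp_zero[OF X] cp_add[OF X] in auto)
qed

lemma tr_Ob: "X : Ob MC ==> tr n X : Ob MC"
unfolding tr_def by (rule sub_Ob) (auto simp: Ob_mod_cat tr_gsub)

lemma tr_gmod: "gmod X ==> gmod (tr n X)"
unfolding tr_def by (rule sub_gmod[OF _ tr_gsub])

lemma tr_part:
assumes X: "gmod X" and l: "l : carrier L"
shows "dpart (tr n X) l = (if n <= dg l then dpart X l else {0[X]})"
proof -
have "{x : carrier X. ALL l:carrier L. dg l < n --> cp X l x = 0[X]} Int dpart X l = (if n <= dg l then dpart X l else {0[X]})"
proof (cases "n <= dg l")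
 case True thus ?thesis using gmod_carrier[OF X l] cp_comp[OF X _ l] by auto
next
 case False
 have "x = 0[X]" if "x : dpart X l" "cp X l x = 0[X]" for x using that cp_comp[OF X l l] by simp
 thus ?thesis using False l part_facts(1,2)[OF X l] cp_zero[OF X] by auto
qed
thus ?thesis using l by (simp add: tr_def)
qed

lemma tr_sel: "add (tr n X) = add X" "0[tr n X] = 0[X]" "smult (tr n X) = smult X"
by (simp_all add: tr_def)

lemma tr_incl: "gmod X ==> (\<lambda>x\<in>carrier (tr n X). x) : gmhom S (tr n X) X"
using incl_hom[OF _ tr_gsub] by (simp add: tr_def)

lemma tr_carrier: "gmod X ==> l : carrier L ==> n <= dg l ==> x : dpart X l ==> x : carrier (tr n X)"
using gmod_carrier[OF tr_gmod] tr_part by metis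

lemma tr_incl_iso: "X : Ob MC ==> (\<lambda>x\<in>carrier (tr n X). x) : serre_isos MC (mod0 S) (tr n X) X"
proof -
assume X: "X : Ob MC"
hence g: "gmod X" by (simp add: Ob_mod_cat)
have "bijhi n (tr n X) X (\<lambda>x\<in>carrier (tr n X). x)"
 using tr_part[OF g] tr_carrier[OF g] unfolding bijhi_def by (auto simp: bij_betw_def inj_on_def)
thus ?thesis using serre_iso_iff[OF tr_Ob[OF X] X tr_incl[OF g]] by blast
qed

text \<open>On the truncation \<open>tr n X\<close> a germ becomes an honest homomorphism, because
  below \<open>n\<close> only zero is left.\<close>

lemma germ_ext:
assumes X: "gmod X" and Y: "gmod Y" and h: "germ X Y n h"
obtains e where "e : gmhom S (tr n X) Y" "geq X n e h"
proof -
interpret X: module S X using X gmod_module by blast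
interpret Y: module S Y using Y gmod_module by blast
\<comment> \<open>The components below \<open>n\<close> still contain zero, and nothing there
  constrains \<open>h\<close>; this default fixes the value.\<close>
let ?h = "%x. if x = 0[X] then 0[Y] else h x"
have eq: "?h x = h x" if "l : carrier L" "n <= dg l" for l x using germ_zero[OF X Y h that] by simp
let ?e = "ext (tr n X) Y ?h"
note T = tr_gmod[OF X]
have 1: "?h m : dpart Y l" if "l : carrier L" "m : dpart (tr n X) l" for l m
 using that tr_part[OF X that(1)] germD(1)[OF h] part_facts(2)[OF Y that(1)] by (auto split: if_splits)
have 2: "?h (m +[tr n X] m') = ?h m +[Y] ?h m'"
 if l: "l : carrier L" "m : dpart (tr n X) l" "m' : dpart (tr n X) l" for l m m'
proof (cases "n <= dg l")
 case True thus ?thesis unfolding eq[OF l(1) True] using germD(2)[OF h l(1) True] l tr_part[OF X l(1)] by (simp add: tr_sel)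
next
 case False thus ?thesis using l tr_part[OF X l(1)] by (simp add: tr_sel)
qed
have 3: "?h (s .[tr n X] m) = s .[Y] ?h m"
 if l: "a : carrier L" "l : carrier L" "s : cmp S a" "m : dpart (tr n X) l" for a l s m
proof -
 have s: "s : carrier S" using comp_carrier l by blast
 have m: "m : carrier X" using l tr_part[OF X l(2)] gmod_carrier[OF X l(2)] by (auto split: if_splits)
 consider "n <= dg l" "0 <= dg a" | "dg a < 0" | "~ n <= dg l" by linarith
 thus ?thesis
 proof cases
  case 1
  have al: "a *[L] l : carrier L" "n <= dg (a *[L] l)" using 1 l dg_add by auto
  show ?thesis unfolding tr_sel eq[OF l(2) 1(1)] using germD(3)[OF h l(2) 1(1) l(1) 1(2) l(3)] l(4) tr_part[OF X l(2)] 1 by simp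
 next
  case 2
  hence "s = 0[S]" using dg_neg l by blast
  moreover have "?h m : carrier Y" using 1[OF l(2,4)] gmod_carrier[OF Y l(2)] by blast
  ultimately show ?thesis using m by (simp add: tr_sel)
 next
  case 3 thus ?thesis using l tr_part[OF X l(2)] s by (simp add: tr_sel)
 qed
qed
show thesis
proof (rule that)
 show "?e : gmhom S (tr n X) Y" by (rule ext_hom[OF T Y 1 2 3])
 show "geq X n ?e h" unfolding geq_def
 proof (intro ballI impI)
  fix l x assume l: "l : carrier L" "n <= dg l" "x : dpart X l"
  have "?e x = ?h x" by (rule ext_homog[OF T Y 1 2 3 l(1)]) (use l tr_part[OF X l(1)] in auto)
  thus "?e x = h x" using eq[OF l(1,2)] by simp
 qed
qed
qed

text \<open>The inverse has to guess the degree of its argument. Two degrees are possible only for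
  the zero element, and there injectivity forces the value zero.\<close>

lemma inverse_germ:
assumes Z: "gmod Z" and X: "gmod X" and s: "germ Z X n s" and b: "bijhi n Z X s"
obtains g where "germ X Z n g" "!!l z. l : carrier L ==> n <= dg l ==> z : dpart Z l ==> g (s z) = z"
 "!!l x. l : carrier L ==> n <= dg l ==> x : dpart X l ==> g x : dpart Z l & s (g x) = x"
proof -
interpret X: module S X using X gmod_module by blast
interpret Z: module S Z using Z gmod_module by blast
have b': "bij_betw s (dpart Z l) (dpart X l)" if "l : carrier L" "n <= dg l" for l
 using b that by (simp add: bijhi_def)
define g where "g = (%x. SOME z. EX l:carrier L. n <= dg l & z : dpart Z l & s z = x)"
have gs: "g (s z) = z" if l: "l : carrier L" "n <= dg l" and z: "z : dpart Z l" for l z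
proof -
 have "EX l':carrier L. n <= dg l' & g (s z) : dpart Z l' & s (g (s z)) = s z"
  unfolding g_def by (rule someI[of _ z]) (use l z in blast)
 then obtain l' where l': "l' : carrier L" "n <= dg l'" "g (s z) : dpart Z l'" "s (g (s z)) = s z" by blast
 have "s z : dpart X l" "s z : dpart X l'" using germD(1)[OF s l z] germD(1)[OF s l'(1,2,3)] l'(4) by auto
 hence "l = l' | s z = 0[X]" using cp_comp[OF X l(1) l(1)] cp_comp[OF X l(1) l'(1)] by metis
 thus ?thesis
 proof
  assume "l = l'" thus ?thesis using b'[OF l] z l' by (auto simp: bij_betw_def inj_on_def)
 next
  assume 0: "s z = 0[X]"
  have s0: "s 0[Z] = 0[X]" using germ_zero[OF Z X s l] .
  have "z = 0[Z]" using b'[OF l] z 0 s0 part_facts(2)[OF Z l(1)] unfolding bij_betw_def inj_on_def by metis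
  moreover have "g (s z) = 0[Z]" using b'[OF l'(1,2)] l'(3,4) 0 s0 part_facts(2)[OF Z l'(1)] unfolding bij_betw_def inj_on_def by metis
  ultimately show ?thesis by simp
 qed
qed
have sg: "g x : dpart Z l & s (g x) = x" if l: "l : carrier L" "n <= dg l" and x: "x : dpart X l" for l x
proof -
 have "x : s ` dpart Z l" using bij_betw_imp_surj_on[OF b'[OF l]] x by simp
 then obtain z where "z : dpart Z l" "s z = x" by (elim imageE) simp
 thus ?thesis using gs[OF l] by auto
qed
have "germ X Z n g"
proof (rule germI)
 fix l x y assume l: "l : carrier L" "n <= dg l" "x : dpart X l" "y : dpart X l"
 have "s (g x +[Z] g y) = x +[X] y" using germD(2)[OF s l(1,2)] sg[OF l(1,2)] l by simp
 thus "g (x +[X] y) = g x +[Z] g y" using gs[OF l(1,2), of "g x +[Z] g y"] part_facts(3)[OF Z l(1)] sg[OF l(1,2)] l by simp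
next
 fix a l t x assume l: "a : carrier L" "0 <= dg a" "l : carrier L" "n <= dg l" "t : cmp S a" "x : dpart X l"
 have al: "a *[L] l : carrier L" "n <= dg (a *[L] l)" using l dg_add by auto
 note gx = sg[OF l(3,4,6)]
 have "s (t .[Z] g x) = t .[X] x" using germD(3)[OF s l(3,4,1,2,5)] gx by simp
 thus "g (t .[X] x) = t .[Z] g x" using gs[OF al, of "t .[Z] g x"] gmod_act[OF Z l(1,3,5)] gx by simp
qed (use sg in blast)
thus thesis using that gs sg by blast
qed

abbreviation "RC X Y == roofs MC (mod0 S) X Y"

text \<open>The roofs whose right leg is \<open>h\<close> after the left leg in high degrees. For a
  germ \<open>h\<close> this is exactly one equivalence class, by
  \<open>roof_class_R\<close>.\<close>

definition R :: "('a, 'u, 'l) graded_module => ('a, 'u, 'l) graded_module => ('u => 'u) => ('a, 'u, 'l) coh_mor" where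
"R X Y h = {(Z, s, f) : RC X Y. EX n. geq Z n f (%z. h (s z))}"

lemma RC_D:
assumes "X : Ob MC" "(Z, s, f) : RC X Y"
shows "Z : Ob MC" "gmod Z" "s : gmhom S Z X" "f : gmhom S Z Y" "EX n. bijhi n Z X s"
 "s : serre_isos MC (mod0 S) Z X"
proof -
show 1: "Z : Ob MC" and s: "s : serre_isos MC (mod0 S) Z X" and "f : gmhom S Z Y"
 using assms by (auto simp: roofs_def)
thus "gmod Z" by (simp add: Ob_mod_cat)
show 2: "s : gmhom S Z X" using s by (simp add: serre_isos_def)
show "EX n. bijhi n Z X s" using serre_iso_iff[OF 1 assms(1) 2] s by blast
qed

lemma bijhi_mono: "bijhi n Z X s ==> n <= m ==> bijhi m Z X s"
unfolding bijhi_def by (meson order_trans)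

lemma roof_germ:
assumes X: "X : Ob MC" and r: "(Z, s, f) : RC X Y"
obtains n h where "germ X Y n h" "(Z, s, f) : R X Y h"
proof -
note d = RC_D[OF X r]
have gX: "gmod X" using X by (simp add: Ob_mod_cat)
obtain n where n: "bijhi n Z X s" using d(5) by blast
obtain g where g: "germ X Z n g" "!!l z. l : carrier L ==> n <= dg l ==> z : dpart Z l ==> g (s z) = z"
 by (rule inverse_germ[OF d(2) gX hom_germ[OF d(2,3)] n], rule that)
have "germ X Y n (%x. f (g x))" by (rule germ_comp[OF gX g(1) hom_germ[OF d(2,4)]])
moreover have "geq Z n f (%z. f (g (s z)))" using g(2) by (simp add: geq_def)
ultimately show thesis using that r unfolding R_def by blast
qed

lemma R_nonempty:
assumes X: "X : Ob MC" and Y: "Y : Ob MC" and h: "germ X Y n h"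
obtains e where "e : gmhom S (tr n X) Y" "geq X n e h" "(tr n X, (\<lambda>x\<in>carrier (tr n X). x), e) : R X Y h"
proof -
have g: "gmod X" "gmod Y" using X Y by (auto simp: Ob_mod_cat)
obtain e where e: "e : gmhom S (tr n X) Y" "geq X n e h" using germ_ext[OF g h] by blast
have "geq (tr n X) n e (%z. h ((\<lambda>x\<in>carrier (tr n X). x) z))"
 using e(2) tr_part[OF g(1)] tr_carrier[OF g(1)] unfolding geq_def by simp
hence "(tr n X, (\<lambda>x\<in>carrier (tr n X). x), e) : R X Y h"
 unfolding R_def roofs_def using tr_Ob[OF X] tr_incl_iso[OF X] e(1) by auto
thus thesis using that e by blast
qed

lemma comp_iso:
assumes "Z : Ob MC" "Y : Ob MC" "X : Ob MC" "s : gmhom S Z Y" "t : gmhom S Y X" "bijhi n Z Y s" "bijhi n Y X t"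
shows "compose (carrier Z) t s : serre_isos MC (mod0 S) Z X"
proof -
have g: "gmod Z" using assms by (simp add: Ob_mod_cat)
have "bijhi n Z X (compose (carrier Z) t s)" unfolding bijhi_def
proof (intro ballI impI)
 fix l assume l: "l : carrier L" "n <= dg l"
 have "bij_betw (t \<circ> s) (dpart Z l) (dpart X l)"
  using assms(6,7) l by (auto simp: bijhi_def intro: bij_betw_trans)
 moreover have "(t \<circ> s) z = compose (carrier Z) t s z" if "z : dpart Z l" for z
  using gmod_carrier[OF g l(1) that] by (simp add: compose_def)
 ultimately show "bij_betw (compose (carrier Z) t s) (dpart Z l) (dpart X l)" using bij_betw_cong by blast
qed
thus ?thesis using serre_iso_iff[OF assms(1,3) comp_hom[OF assms(4,5) g]] by blast
qed

lemma R_unique: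
assumes X: "X : Ob MC" and r: "(Z, s, f) : R X Y h" "(Z, s, f) : R X Y k"
shows "EX n. geq X n h k"
proof -
have rc: "(Z, s, f) : RC X Y" using r by (simp add: R_def)
obtain n1 n2 where n: "geq Z n1 f (%z. h (s z))" "geq Z n2 f (%z. k (s z))" using r by (auto simp: R_def)
obtain n3 where b: "bijhi n3 Z X s" using RC_D(5)[OF X rc] by blast
have "geq X (max n3 (max n1 n2)) h k" unfolding geq_def
proof (intro ballI impI)
 fix l x assume l: "l : carrier L" "max n3 (max n1 n2) <= dg l" "x : dpart X l"
 then obtain z where "z : dpart Z l" "x = s z" using b by (auto simp: bijhi_def bij_betw_def)
 thus "h x = k x" using geqD[OF n(1) l(1)] geqD[OF n(2) l(1)] l(2) by force
qed
thus ?thesis by blast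
qed

lemma geq_R:
assumes X: "X : Ob MC" and e: "geq X n h k" shows "R X Y h = R X Y k"
proof -
have "(Z, s, f) : R X Y k'" if r: "(Z, s, f) : R X Y h'" and e: "geq X n h' k'" for Z s f h' k'
proof -
 have rc: "(Z, s, f) : RC X Y" using r by (simp add: R_def)
 obtain m where m: "geq Z m f (%z. h' (s z))" using r by (auto simp: R_def)
 have "geq Z (max m n) f (%z. k' (s z))"
  using m e hom_part[OF RC_D(3)[OF X rc]] unfolding geq_def by simp
 thus ?thesis using rc by (auto simp: R_def)
qed
thus ?thesis using e by (auto simp: geq_def)
qed

text \<open>Equality of morphisms in the quotient category becomes eventual equality of functions;
  later identities between morphisms are checked in this form.\<close>

lemma R_eq_iff:
assumes X: "X : Ob MC" and Y: "Y : Ob MC" and h: "germ X Y n h"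
shows "R X Y h = R X Y k <-> (EX m. geq X m h k)"
using R_nonempty[OF X Y h] R_unique[OF X] geq_R[OF X] by metis

text \<open>Two roofs over the same germ have the truncation of \<open>X\<close> as a common
  refinement: in high degrees both left legs are invertible, and the inverse germs extend to
  homomorphisms on the truncation. Conversely, the surjectivity of the refined left leg in high
  degrees transfers the germ from one roof to the other.\<close>

lemma roof_class_R:
assumes X: "X : Ob MC" and Y: "Y : Ob MC" and h: "germ X Y n h" and r: "(Z, s, f) : R X Y h"
shows "roof_class MC (mod0 S) X Y (Z, s, f) = R X Y h"
proof -
have gX: "gmod X" using X by (simp add: Ob_mod_cat)
have rc: "(Z, s, f) : RC X Y" using r by (simp add: R_def)
obtain n1 where n1: "geq Z n1 f (%z. h (s z))" using r by (auto simp: R_def)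
note d = RC_D[OF X rc]
have "(Z', s', f') : roof_class MC (mod0 S) X Y (Z, s, f) <-> (Z', s', f') : R X Y h" for Z' s' f'
proof
 assume "(Z', s', f') : roof_class MC (mod0 S) X Y (Z, s, f)"
 hence rc': "(Z', s', f') : RC X Y" and "roof_equiv MC (mod0 S) X Y (Z, s, f) (Z', s', f')"
  by (auto simp: roof_class_def)
 then obtain W u u' where W: "W : Ob MC" "u : gmhom S W Z" "u' : gmhom S W Z'"
   "compose (carrier W) s u : serre_isos MC (mod0 S) W X" "compose (carrier W) s u = compose (carrier W) s' u'"
   "compose (carrier W) f u = compose (carrier W) f' u'"
  by (auto simp: roof_equiv_def)
 have gW: "gmod W" using W by (simp add: Ob_mod_cat)
 obtain h' m where h': "germ X Y m h'" "(Z', s', f') : R X Y h'" using roof_germ[OF X rc'] by blast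
 obtain n2 where n2: "geq Z' n2 f' (%z. h' (s' z))" using h'(2) by (auto simp: R_def)
 obtain n3 where n3: "bijhi n3 W X (compose (carrier W) s u)"
  using serre_iso_iff[OF W(1) X comp_hom[OF W(2) d(3) gW]] W(4) by blast
 have "geq X (max n3 (max n1 n2)) h' h" unfolding geq_def
 proof (intro ballI impI)
  fix l x assume l: "l : carrier L" "max n3 (max n1 n2) <= dg l" "x : dpart X l"
  then obtain w where w: "w : dpart W l" "x = compose (carrier W) s u w" using n3 by (auto simp: bijhi_def bij_betw_def)
  have wc: "w : carrier W" using gmod_carrier[OF gW l(1) w(1)] .
  have "x = s (u w)" "x = s' (u' w)" "f (u w) = f' (u' w)"
   using w(2) wc fun_cong[OF W(5), of w] fun_cong[OF W(6), of w] by (auto simp: compose_def)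
  thus "h' x = h x"
   using geqD[OF n1 l(1), of "u w"] geqD[OF n2 l(1), of "u' w"] l(2) hom_part[OF W(2) l(1) w(1)] hom_part[OF W(3) l(1) w(1)] by simp
 qed
 thus "(Z', s', f') : R X Y h" using geq_R[OF X] h'(2) by blast
next
 assume r': "(Z', s', f') : R X Y h"
 hence rc': "(Z', s', f') : RC X Y" by (simp add: R_def)
 note d' = RC_D[OF X rc']
 obtain n2 where n2: "geq Z' n2 f' (%z. h (s' z))" using r' by (auto simp: R_def)
 obtain n3 n4 where b: "bijhi n3 Z X s" "bijhi n4 Z' X s'" using d(5) d'(5) by blast
 define m where "m = max n1 (max n2 (max n3 n4))"
 have m: "n1 <= m" "n2 <= m" "n3 <= m" "n4 <= m" by (auto simp: m_def)
 let ?W = "tr m X"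
 have WO: "?W : Ob MC" and gW: "gmod ?W" using tr_Ob[OF X] tr_gmod[OF gX] by auto
 obtain g where g: "germ X Z m g" "!!l x. l : carrier L ==> m <= dg l ==> x : dpart X l ==> g x : dpart Z l & s (g x) = x"
  by (rule inverse_germ[OF d(2) gX hom_germ[OF d(2,3)] bijhi_mono[OF b(1) m(3)]], rule that)
 obtain g' where g': "germ X Z' m g'" "!!l x. l : carrier L ==> m <= dg l ==> x : dpart X l ==> g' x : dpart Z' l & s' (g' x) = x"
  by (rule inverse_germ[OF d'(2) gX hom_germ[OF d'(2,3)] bijhi_mono[OF b(2) m(4)]], rule that)
 obtain u where u: "u : gmhom S ?W Z" "geq X m u g" using germ_ext[OF gX d(2) g(1)] by blast
 obtain u' where u': "u' : gmhom S ?W Z'" "geq X m u' g'" using germ_ext[OF gX d'(2) g'(1)] by blast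
 have gY: "gmod Y" using Y by (simp add: Ob_mod_cat)
 have agree: "s (u x) = x & s' (u' x) = x & f (u x) = f' (u' x)" if l: "l : carrier L" "m <= dg l" "x : dpart X l" for l x
  using geqD[OF u(2) l] geqD[OF u'(2) l] g(2)[OF l] g'(2)[OF l] geqD[OF n1 l(1)] geqD[OF n2 l(1)] m l(2) by (metis order_trans)
 have zz: "s (u 0[X]) = 0[X]" "s' (u' 0[X]) = 0[X]" "f (u 0[X]) = 0[Y]" "f' (u' 0[X]) = 0[Y]"
  using hom_zero[OF gW d(2) u(1)] hom_zero[OF gW d'(2) u'(1)] hom_zero[OF d(2) gX d(3)] hom_zero[OF d'(2) gX d'(3)]
   hom_zero[OF d(2) gY d(4)] hom_zero[OF d'(2) gY d'(4)] by (auto simp: tr_sel)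
 have all: "s (u x) = x & s' (u' x) = x & f (u x) = f' (u' x)" if l: "l : carrier L" "x : dpart ?W l" for l x
  using agree[OF l(1)] l(2) zz tr_part[OF gX l(1)] by (auto split: if_splits)
 have e1: "compose (carrier ?W) s u = (\<lambda>x\<in>carrier ?W. x)"
  by (rule hom_eqI[OF gW gX comp_hom[OF u(1) d(3) gW] tr_incl[OF gX]]) (use all gmod_carrier[OF gW] in "simp add: compose_def")
 have e2: "compose (carrier ?W) s' u' = (\<lambda>x\<in>carrier ?W. x)"
  by (rule hom_eqI[OF gW gX comp_hom[OF u'(1) d'(3) gW] tr_incl[OF gX]]) (use all gmod_carrier[OF gW] in "simp add: compose_def")
 have e3: "compose (carrier ?W) f u = compose (carrier ?W) f' u'"
  by (rule hom_eqI[OF gW gY comp_hom[OF u(1) d(4) gW] comp_hom[OF u'(1) d'(4) gW]]) (use all gmod_carrier[OF gW] in "simp add: compose_def")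
 have "roof_equiv MC (mod0 S) X Y (Z, s, f) (Z', s', f')"
  unfolding roof_equiv_def prod.case using WO u(1) u'(1) e1 e2 e3 tr_incl_iso[OF X, of m]
  by (intro bexI[of _ ?W] bexI[of _ u] bexI[of _ u']) auto
 thus "(Z', s', f') : roof_class MC (mod0 S) X Y (Z, s, f)" using rc' by (simp add: roof_class_def)
qed
thus ?thesis by auto
qed

abbreviation "QC == serre_quotient MC (mod0 S)"

lemma QC_Ob [simp]: "Ob QC = Ob MC"
by (simp add: serre_quotient_def)

lemma QC_Hom:
assumes X: "X : Ob MC" and Y: "Y : Ob MC"
shows "Hom QC X Y = {R X Y h | n h. germ X Y n h}"
proof
show "Hom QC X Y <= {R X Y h | n h. germ X Y n h}"
proof
 fix a assume "a : Hom QC X Y"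
 then obtain Z s f where r: "(Z, s, f) : RC X Y" "a = roof_class MC (mod0 S) X Y (Z, s, f)"
  by (auto simp: serre_quotient_def)
 obtain n h where "germ X Y n h" "(Z, s, f) : R X Y h" using roof_germ[OF X r(1)] by blast
 thus "a : {R X Y h | n h. germ X Y n h}" using roof_class_R[OF X Y] r(2) by blast
qed
show "{R X Y h | n h. germ X Y n h} <= Hom QC X Y"
proof clarify
 fix n h assume h: "germ X Y n h"
 obtain e where e: "(tr n X, (\<lambda>x\<in>carrier (tr n X). x), e) : R X Y h" using R_nonempty[OF X Y h] by blast
 hence "(tr n X, (\<lambda>x\<in>carrier (tr n X). x), e) : RC X Y" by (simp add: R_def)
 thus "R X Y h : Hom QC X Y"
  unfolding serre_quotient_def using roof_class_R[OF X Y h e] by (auto intro!: image_eqI[of _ _ "(tr n X, (\<lambda>x\<in>carrier (tr n X). x), e)"])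
qed
qed

text \<open>Every completed square yields a roof over \<open>k\<close> after \<open>h\<close>, so
  the union in \<open>serre_quotient\<close> runs over copies of a single class. One square must be
  exhibited, since the union over no squares would be empty.\<close>

lemma QC_Comp:
assumes X: "X : Ob MC" and Y: "Y : Ob MC" and V: "V : Ob MC" and h: "germ X Y n h" and k: "germ Y V m k"
shows "Comp QC X Y V (R Y V k) (R X Y h) = R X V (%x. k (h x))"
proof -
have gX: "gmod X" and gY: "gmod Y" using X Y by (auto simp: Ob_mod_cat)
define N where "N = max n m"
have hN: "germ X Y N h" and kN: "germ Y V N k" using germ_mono[OF h] germ_mono[OF k] by (auto simp: N_def)
note kh = germ_comp[OF gX hN kN]
let ?M = "{roof_class MC (mod0 S) X V (P, Comp MC P Z X s u, Comp MC P W V g j) |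
   Z s f W t g P u j. (Z, s, f) : R X Y h & (W, t, g) : R Y V k &
    P : Ob MC & u : serre_isos MC (mod0 S) P Z & j : Hom MC P W &
    Comp MC P Z Y f u = Comp MC P W Y t j}"
have mem: "c = R X V (%x. k (h x))" if c: "c : ?M" for c
proof -
 obtain Z s f W t g P u h' where *: "c = roof_class MC (mod0 S) X V (P, compose (carrier P) s u, compose (carrier P) g h')"
  "(Z, s, f) : R X Y h" "(W, t, g) : R Y V k" "P : Ob MC" "u : serre_isos MC (mod0 S) P Z" "h' : gmhom S P W"
  "compose (carrier P) f u = compose (carrier P) t h'" using c by auto
 have r1: "(Z, s, f) : RC X Y" "(W, t, g) : RC Y V" using * by (auto simp: R_def)
 note d1 = RC_D[OF X r1(1)] and d2 = RC_D[OF Y r1(2)]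
 have gP: "gmod P" using * by (simp add: Ob_mod_cat)
 have u: "u : gmhom S P Z" using *(5) by (simp add: serre_isos_def)
 obtain n1 n2 where n12: "bijhi n1 P Z u" "bijhi n2 Z X s" using serre_iso_iff[OF *(4) d1(1) u] *(5) d1(5) by blast
 have su: "compose (carrier P) s u : serre_isos MC (mod0 S) P X"
  using comp_iso[OF *(4) d1(1) X u d1(3) bijhi_mono[OF n12(1), of "max n1 n2"] bijhi_mono[OF n12(2)]] by simp
 have gh: "compose (carrier P) g h' : gmhom S P V" by (rule comp_hom[OF *(6) d2(4) gP])
 obtain n3 n4 where n34: "geq Z n3 f (%z. h (s z))" "geq W n4 g (%z. k (t z))" using * by (auto simp: R_def)
 have "geq P (max n3 n4) (compose (carrier P) g h') (%z. k (h (compose (carrier P) s u z)))" unfolding geq_def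
 proof (intro ballI impI)
  fix l x assume l: "l : carrier L" "max n3 n4 <= dg l" "x : dpart P l"
  have xc: "x : carrier P" using gmod_carrier[OF gP l(1,3)] .
  have "f (u x) = t (h' x)" using fun_cong[OF *(7), of x] xc by (simp add: compose_def)
  thus "compose (carrier P) g h' x = k (h (compose (carrier P) s u x))"
   using geqD[OF n34(1) l(1), of "u x"] geqD[OF n34(2) l(1), of "h' x"] l hom_part[OF u l(1,3)] hom_part[OF *(6) l(1,3)] xc
   by (simp add: compose_def)
 qed
 hence "(P, compose (carrier P) s u, compose (carrier P) g h') : R X V (%x. k (h x))"
  unfolding R_def roofs_def using *(4) su gh by auto
 thus ?thesis using *(1) roof_class_R[OF X V kh] by simp
qed
have "?M ~= {}"
proof -
 obtain e where e: "e : gmhom S (tr N X) Y" "(tr N X, (\<lambda>x\<in>carrier (tr N X). x), e) : R X Y h"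
  and eg: "geq X N e h" using R_nonempty[OF X Y hN] by blast
 obtain d where d: "(tr N Y, (\<lambda>x\<in>carrier (tr N Y). x), d) : R Y V k" using R_nonempty[OF Y V kN] by blast
 let ?P = "tr N X"
 note gP = tr_gmod[OF gX] and PO = tr_Ob[OF X]
 have id: "(\<lambda>m\<in>carrier ?P. m) : serre_isos MC (mod0 S) ?P ?P"
 proof -
  have "bijhi 0 ?P ?P (\<lambda>m\<in>carrier ?P. m)"
   unfolding bijhi_def using gmod_carrier[OF gP] by (auto simp: bij_betw_def inj_on_def)
  thus ?thesis using serre_iso_iff[OF PO PO id_hom[OF gP]] by blast
 qed
 \<comment> \<open>In the degrees where \<open>h\<close> is constrained, the truncation of
   \<open>Y\<close> agrees with \<open>Y\<close>, so \<open>h\<close> also lifts to a map into it,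
   and this lift closes the square.\<close>
 have te: "dpart (tr N Y) l = dpart Y l" if "l : carrier L" "N <= dg l" for l using tr_part[OF gY that(1)] that by simp
 have ge: "germ X (tr N Y) N h"
  using germD[OF hN] te by (intro germI) (simp_all add: tr_sel)
 obtain e' where e': "e' : gmhom S ?P (tr N Y)" "geq X N e' h"
  using germ_ext[OF gX tr_gmod[OF gY] ge] by blast
 have "compose (carrier ?P) e (\<lambda>m\<in>carrier ?P. m) = compose (carrier ?P) (\<lambda>x\<in>carrier (tr N Y). x) e'"
 proof (rule hom_eqI[OF gP gY comp_hom[OF id_hom[OF gP] e(1) gP] comp_hom[OF e'(1) tr_incl[OF gY] gP]])
  fix l x assume l: "l : carrier L" "x : dpart ?P l"
  have xc: "x : carrier ?P" using gmod_carrier[OF gP l] .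
  have "e x = e' x"
  proof (cases "N <= dg l")
   case True thus ?thesis using geqD[OF eg l(1)] geqD[OF e'(2) l(1)] l tr_part[OF gX l(1)] by simp
  next
   case False
   hence "x = 0[?P]" using l tr_part[OF gX l(1)] by (simp add: tr_sel)
   thus ?thesis using hom_zero[OF gP gY e(1)] hom_zero[OF gP tr_gmod[OF gY] e'(1)] by (simp add: tr_sel)
  qed
  thus "compose (carrier ?P) e (\<lambda>m\<in>carrier ?P. m) x = compose (carrier ?P) (\<lambda>x\<in>carrier (tr N Y). x) e' x"
   using xc addmap_closed[OF hom_addmap[OF e'(1)] xc] by (simp add: compose_def)
 qed
 hence "roof_class MC (mod0 S) X V (?P, Comp MC ?P ?P X (\<lambda>x\<in>carrier ?P. x) (\<lambda>m\<in>carrier ?P. m), Comp MC ?P (tr N Y) V d e') : ?M"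
  using e(2) d PO id e'(1) by simp blast
 thus ?thesis by blast
qed
hence "\<Union> ?M = R X V (%x. k (h x))" using mem by blast
thus ?thesis by (simp add: serre_quotient_def)
qed

lemma QC_Ident:
assumes X: "X : Ob MC" shows "Ident QC X = R X X (%x. x)"
proof -
have gX: "gmod X" using X by (simp add: Ob_mod_cat)
have b: "bijhi 0 X X (\<lambda>m\<in>carrier X. m)"
 unfolding bijhi_def using gmod_carrier[OF gX] by (auto simp: bij_betw_def inj_on_def)
have g: "germ X X 0 (%x. x)" by (rule germI) auto
have "(X, (\<lambda>m\<in>carrier X. m), (\<lambda>m\<in>carrier X. m)) : RC X X"
 unfolding roofs_def using serre_iso_iff[OF X X id_hom[OF gX]] b id_hom[OF gX] X by auto
moreover have "EX n. geq X n (\<lambda>m\<in>carrier X. m) (\<lambda>m\<in>carrier X. m)" by (simp add: geq_def)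
ultimately have "(X, (\<lambda>m\<in>carrier X. m), (\<lambda>m\<in>carrier X. m)) : R X X (%x. x)" by (simp add: R_def)
thus ?thesis using roof_class_R[OF X X g] by (simp add: serre_quotient_def)
qed

lemma germ_id: "gmod X ==> germ X X n (%x. x)"
by (rule germI) auto

lemma QC_category: "is_category QC"
unfolding is_category_def
proof (intro conjI ballI)
fix X assume X: "X : Ob QC"
thus "Ident QC X : Hom QC X X" using QC_Hom[of X X] QC_Ident[of X] germ_id[of X 0] by (auto simp: Ob_mod_cat)
next
fix X Y Z f g assume O: "X : Ob QC" "Y : Ob QC" "Z : Ob QC" and "f : Hom QC X Y" "g : Hom QC Y Z"
then obtain h k n m where h: "germ X Y n h" "germ Y Z m k" "f = R X Y h" "g = R Y Z k" using QC_Hom[of X Y] QC_Hom[of Y Z] by auto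
hence "germ X Y (max n m) h" "germ Y Z (max n m) k" using germ_mono[OF h(1)] germ_mono[OF h(2)] by auto
thus "Comp QC X Y Z g f : Hom QC X Z"
 using QC_Comp[of X Y Z n h m k] QC_Hom[of X Z] h O germ_comp[of X Y "max n m" h Z k] by (auto simp: Ob_mod_cat)
next
fix X Y f assume O: "X : Ob QC" "Y : Ob QC" and "f : Hom QC X Y"
then obtain h n where h: "germ X Y n h" "f = R X Y h" using QC_Hom[of X Y] by auto
show "Comp QC X X Y f (Ident QC X) = f" "Comp QC X Y Y (Ident QC Y) f = f"
 using QC_Comp[of X X Y n "%x. x" n h] QC_Comp[of X Y Y n h n "%x. x"] h O QC_Ident[of X] QC_Ident[of Y]
  germ_id[of X n] germ_id[of Y n] by (simp_all add: Ob_mod_cat)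
next
fix W X Y Z f g h assume O: "W : Ob QC" "X : Ob QC" "Y : Ob QC" "Z : Ob QC" and f: "f : Hom QC W X" and g: "g : Hom QC X Y" and h: "h : Hom QC Y Z"
obtain f' n1 where f': "germ W X n1 f'" "f = R W X f'" using f QC_Hom[of W X] O by auto
obtain g' n2 where g': "germ X Y n2 g'" "g = R X Y g'" using g QC_Hom[of X Y] O by auto
obtain h' n3 where h': "germ Y Z n3 h'" "h = R Y Z h'" using h QC_Hom[of Y Z] O by auto
define n where "n = max n1 (max n2 n3)"
have "germ W X n f'" "germ X Y n g'" "germ Y Z n h'" using germ_mono[OF f'(1)] germ_mono[OF g'(1)] germ_mono[OF h'(1)] by (auto simp: n_def)
thus "Comp QC W Y Z h (Comp QC W X Y g f) = Comp QC W X Z (Comp QC X Y Z h g) f"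
 using f' g' h' O QC_Comp[of W X Y n f' n g'] QC_Comp[of X Y Z n g' n h']
  QC_Comp[of W Y Z n "%x. g' (f' x)" n h'] QC_Comp[of W X Z n f' n "%x. h' (g' x)"]
  germ_comp[of W X n f' Y g'] germ_comp[of X Y n g' Z h'] by (auto simp: Ob_mod_cat)
qed

section \<open>Degree shifts of modules and germs\<close>

abbreviation shift :: "'l => ('a, 'u, 'l) graded_module => ('a, 'u, 'l) graded_module" where
"shift x M == M(|degree_part := (\<lambda>l\<in>carrier L. dpart M (l *[L] x))|)"

lemma shift_gmod:
assumes M: "gmod M" and x: "x : carrier L" shows "gmod (shift x M)"
proof (rule gradedI[where p = "%l. cp M (l *[L] x)"])
show mod: "module S (shift x M)" by (rule module_update[OF gmod_module[OF M]]) simp_all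
interpret M: module S M using M gmod_module by blast
interpret N: module S "shift x M" by (rule mod)
have inv: "-[shift x M] y = -[M] y" if "y : carrier M" for y
 using that by (intro N.M.minus_equality) (auto simp: M.M.l_neg)
show "additive_subgroup (dpart (shift x M) l) (shift x M)" if "l : carrier L" for l
 using part_facts[OF M, of "l *[L] x"] x that inv by (intro N.M.subgroupI') (auto simp: subsetD)
show "s .[shift x M] m : dpart (shift x M) (a *[L] l)"
 if "a : carrier L" "l : carrier L" "s : cmp S a" "m : dpart (shift x M) l" for a l s m
 using gmod_act[OF M that(1) _ that(3), of "l *[L] x" m] that x by (simp add: LG.m_assoc)
show "cp M (l *[L] x) m = (if l = a then m else 0[shift x M])"
 if "l : carrier L" "a : carrier L" "m : dpart (shift x M) a" for l a m
 using cp_comp[OF M, of "l *[L] x" "a *[L] x" m] that x by simp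
show "carrier (shift x M) <= acl (shift x M) (UN l:carrier L. dpart (shift x M) l)"
proof -
 have "dpart M l <= (UN l:carrier L. dpart (shift x M) l)" if "l : carrier L" for l
 proof -
  have "dpart M l = dpart (shift x M) (l *[L] inv[L] x)" using that x by (simp add: LG.m_assoc)
  thus ?thesis using that x by blast
 qed
 hence "acl M (UN l:carrier L. dpart M l) <= acl M (UN l:carrier L. dpart (shift x M) l)" by (intro acl_mono) blast
 moreover have "acl (shift x M) Y = acl M Y" for Y by (rule acl_cong) simp_all
 ultimately show ?thesis using homog_gen[OF M] by auto
qed
qed (use x cp_in[OF M] cp_add[OF M] in auto)

lemma shift_Ob: "M : Ob MC ==> x : carrier L ==> shift x M : Ob MC"
proof -
assume M: "M : Ob MC" and x: "x : carrier L"
have "mul (shift x M) K B = mul M K B" for K B by (simp add: mul_def)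
moreover have "acl (shift x M) Y = acl M Y" for Y by (rule acl_cong) simp_all
ultimately have "fg (shift x M) = fg M" by (simp add: fg_def)
thus ?thesis using M x shift_gmod by (auto simp: Ob_mod_cat)
qed

lemma shift_hom: "x : carrier L ==> f : gmhom S M N ==> f : gmhom S (shift x M) (shift x N)"
by (auto simp: graded_module_hom_def PiE_def)

text \<open>The bound moves by \<open>dg x\<close>. For elements of the kernel of \<pi> this is
  zero, so one bound survives the whole action.\<close>

lemma shift_germ: "x : carrier L ==> germ X Y n h ==> germ (shift x X) (shift x Y) (n - dg x) h"
proof (rule germI)
assume x: "x : carrier L" and h: "germ X Y n h"
{ fix l assume l: "l : carrier L" "n - dg x <= dg l"
 hence l': "l *[L] x : carrier L" "n <= dg (l *[L] x)" using x dg_add by auto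
 show "y : dpart (shift x X) l ==> h y : dpart (shift x Y) l" for y using germD(1)[OF h l'] l by simp
 show "y : dpart (shift x X) l ==> z : dpart (shift x X) l ==> h (y +[shift x X] z) = h y +[shift x Y] h z" for y z
  using germD(2)[OF h l'] l by simp
 show "h (s .[shift x X] y) = s .[shift x Y] h y"
  if "a : carrier L" "0 <= dg a" "s : cmp S a" "y : dpart (shift x X) l" for a s y
  using germD(3)[OF h l' that(1,2,3)] that(4) l by simp }
qed

lemma shift_R:
assumes X: "X : Ob MC" and Y: "Y : Ob MC" and h: "germ X Y n h" and x: "x : carrier L"
shows "on_hom (quotient_functor MC (mod0 S) (degree_shift L x)) X Y (R X Y h) = R (shift x X) (shift x Y) h"
proof -
have gX: "gmod X" using X by (simp add: Ob_mod_cat)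
note O = shift_Ob[OF X x] shift_Ob[OF Y x]
have mem: "roof_class MC (mod0 S) (shift x X) (shift x Y) (shift x Z, s, f) = R (shift x X) (shift x Y) h"
 if r: "(Z, s, f) : R X Y h" for Z s f
proof -
 have rc: "(Z, s, f) : RC X Y" using r by (simp add: R_def)
 note d = RC_D[OF X rc]
 obtain m where m: "bijhi m Z X s" using d(5) by blast
 have "bijhi (m - dg x) (shift x Z) (shift x X) s" unfolding bijhi_def
 proof (intro ballI impI)
  fix l assume l: "l : carrier L" "m - dg x <= dg l"
  hence "l *[L] x : carrier L" "m <= dg (l *[L] x)" using x dg_add by auto
  thus "bij_betw s (dpart (shift x Z) l) (dpart (shift x X) l)" using m l by (simp add: bijhi_def)
 qed
 hence s: "s : serre_isos MC (mod0 S) (shift x Z) (shift x X)"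
  using serre_iso_iff[OF shift_Ob[OF d(1) x] O(1) shift_hom[OF x d(3)]] by blast
 obtain k where k: "geq Z k f (%z. h (s z))" using r by (auto simp: R_def)
 have "geq (shift x Z) (k - dg x) f (%z. h (s z))" unfolding geq_def
 proof (intro ballI impI)
  fix l z assume l: "l : carrier L" "k - dg x <= dg l" "z : dpart (shift x Z) l"
  thus "f z = h (s z)" using geqD[OF k, of "l *[L] x" z] x dg_add[OF l(1) x] by simp
 qed
 hence "(shift x Z, s, f) : R (shift x X) (shift x Y) h"
  unfolding R_def roofs_def using s shift_Ob[OF d(1) x] shift_hom[OF x d(4)] by auto
 thus ?thesis by (rule roof_class_R[OF O shift_germ[OF x h]])
qed
obtain e where "(tr n X, (\<lambda>x\<in>carrier (tr n X). x), e) : R X Y h" using R_nonempty[OF X Y h] by blast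
hence "(\<Union>(Z, s, f)\<in>R X Y h. roof_class MC (mod0 S) (shift x X) (shift x Y) (shift x Z, s, f)) = R (shift x X) (shift x Y) h"
 using mem by fastforce
thus ?thesis by (simp add: quotient_functor_def degree_shift_def)
qed

end

section \<open>Equivalences and equivariant objects\<close>

lemma IsosI:
"f : Hom C X Y ==> g : Hom C Y X ==> Comp C X Y X g f = Ident C X ==> Comp C Y X Y f g = Ident C Y ==> f : Isos C X Y"
by (auto simp: Isos_def)

locale category =
fixes C :: "('o, 'm) cat"
assumes cat: "is_category C"
begin

lemma id: "X : Ob C ==> Ident C X : Hom C X X"
and comp: "X : Ob C ==> Y : Ob C ==> Z : Ob C ==> f : Hom C X Y ==> g : Hom C Y Z ==> Comp C X Y Z g f : Hom C X Z"
and id_right: "X : Ob C ==> Y : Ob C ==> f : Hom C X Y ==> Comp C X X Y f (Ident C X) = f"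
and id_left: "X : Ob C ==> Y : Ob C ==> f : Hom C X Y ==> Comp C X Y Y (Ident C Y) f = f"
and assoc: "W : Ob C ==> X : Ob C ==> Y : Ob C ==> Z : Ob C ==> f : Hom C W X ==> g : Hom C X Y ==> h : Hom C Y Z ==>
 Comp C W Y Z h (Comp C W X Y g f) = Comp C W X Z (Comp C X Y Z h g) f"
using cat by (auto simp: is_category_def)

definition iv :: "'o => 'o => 'm => 'm" where
"iv X Y f = (SOME g. g : Hom C Y X & Comp C X Y X g f = Ident C X & Comp C Y X Y f g = Ident C Y)"

lemma iv:
assumes "f : Isos C X Y"
shows "f : Hom C X Y" "iv X Y f : Hom C Y X" "Comp C X Y X (iv X Y f) f = Ident C X" "Comp C Y X Y f (iv X Y f) = Ident C Y"
proof -
have "EX g. g : Hom C Y X & Comp C X Y X g f = Ident C X & Comp C Y X Y f g = Ident C Y"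
 using assms by (auto simp: Isos_def)
from someI_ex[OF this] show "f : Hom C X Y" "iv X Y f : Hom C Y X" "Comp C X Y X (iv X Y f) f = Ident C X" "Comp C Y X Y f (iv X Y f) = Ident C Y"
 using assms by (simp_all add: iv_def Isos_def)
qed

lemma inv_iso: "f : Isos C X Y ==> iv X Y f : Isos C Y X"
using iv[of f X Y] by (intro IsosI) auto

lemma cancel_iv:
assumes "W : Ob C" "X : Ob C" "Y : Ob C" "f : Isos C X Y"
shows "g : Hom C W X ==> Comp C W Y X (iv X Y f) (Comp C W X Y f g) = g"
 "g : Hom C W Y ==> Comp C W X Y f (Comp C W Y X (iv X Y f) g) = g"
 "g : Hom C Y W ==> Comp C Y X W (Comp C X Y W g f) (iv X Y f) = g"
 "g : Hom C X W ==> Comp C X Y W (Comp C Y X W g (iv X Y f)) f = g"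
using assms iv[OF assms(4)] by (simp_all add: assoc id_left) (simp_all add: id_right flip: assoc)
 
end

text \<open>The pull-back runs opposite to the asserted equivalence, so a functor from
  \<open>A\<close> to \<open>B\<close> is built as its quasi-inverse: choose isomorphisms
  \<open>i X\<close> from \<open>G (Fo X)\<close> to \<open>X\<close>, conjugate a morphism by them,
  and take the preimage under the bijection that \<open>G\<close> gives on morphisms.\<close>

lemma equivalence_criterion:
assumes A: "is_category A" and B: "is_category B" and G: "is_functor B A G"
 and ff: "!!Y Y'. Y : Ob B ==> Y' : Ob B ==> bij_betw (on_hom G Y Y') (Hom B Y Y') (Hom A (on_ob G Y) (on_ob G Y'))"
 and es: "!!X. X : Ob A ==> EX Y:Ob B. Isos A (on_ob G Y) X ~= {}"
shows "EX F. is_equivalence A B F"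
proof -
interpret A: category A by standard (fact A)
interpret B: category B by standard (fact B)
have "ALL X. EX Y i. X : Ob A --> Y : Ob B & i : Isos A (on_ob G Y) X" using es by blast
then obtain Fo i where F: "!!X. X : Ob A ==> Fo X : Ob B" and i: "!!X. X : Ob A ==> i X : Isos A (on_ob G (Fo X)) X"
 by metis
define j where "j X = A.iv (on_ob G (Fo X)) X (i X)" for X
have Go: "on_ob G Y : Ob A" if "Y : Ob B" for Y using G that by (auto simp: is_functor_def)
have Gid: "on_hom G Y Y (Ident B Y) = Ident A (on_ob G Y)" if "Y : Ob B" for Y
 using G that by (auto simp: is_functor_def)
have Gc: "on_hom G X Z (Comp B X Y Z g f) = Comp A (on_ob G X) (on_ob G Y) (on_ob G Z) (on_hom G Y Z g) (on_hom G X Y f)"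
 if "X : Ob B" "Y : Ob B" "Z : Ob B" "f : Hom B X Y" "g : Hom B Y Z" for X Y Z f g
 using G that by (auto simp: is_functor_def)
have Gh: "on_hom G X Y f : Hom A (on_ob G X) (on_ob G Y)" if "X : Ob B" "Y : Ob B" "f : Hom B X Y" for X Y f
 using G that by (auto simp: is_functor_def)
have Ginj: "f = g" if "X : Ob B" "Y : Ob B" "f : Hom B X Y" "g : Hom B X Y" "on_hom G X Y f = on_hom G X Y g" for X Y f g
 using ff[OF that(1,2)] that(3-) by (auto simp: bij_betw_def inj_on_def)
define H where "H Y Y' f = inv_into (Hom B Y Y') (on_hom G Y Y') f" for Y Y' f
have H: "H Y Y' f : Hom B Y Y'" "on_hom G Y Y' (H Y Y' f) = f"
 if "Y : Ob B" "Y' : Ob B" "f : Hom A (on_ob G Y) (on_ob G Y')" for Y Y' f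
 using ff[OF that(1,2)] that(3) unfolding H_def bij_betw_def by (auto intro: inv_into_into f_inv_into_f)
have j: "j X : Isos A X (on_ob G (Fo X))" if "X : Ob A" for X unfolding j_def by (rule A.inv_iso[OF i[OF that]])
note iH = A.iv(1)[OF i] and jH = A.iv(1)[OF j]
note ij = A.iv(3)[OF i, folded j_def] and ji = A.iv(4)[OF i, folded j_def]
define t where "t X X' f = Comp A (on_ob G (Fo X)) X (on_ob G (Fo X')) (Comp A X X' (on_ob G (Fo X')) (j X') f) (i X)" for X X' f
have t: "t X X' f : Hom A (on_ob G (Fo X)) (on_ob G (Fo X'))" if "X : Ob A" "X' : Ob A" "f : Hom A X X'" for X X' f
 unfolding t_def using that iH jH Go F by (intro A.comp) auto
define FF where "FF = (|on_ob = Fo, on_hom = (%X X' f. H (Fo X) (Fo X') (t X X' f))|)"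
have Fsel: "on_ob FF = Fo" "on_hom FF X X' f = H (Fo X) (Fo X') (t X X' f)" for X X' f
 by (auto simp: FF_def)
have GF: "on_hom G (Fo X) (Fo X') (on_hom FF X X' f) = t X X' f" if "X : Ob A" "X' : Ob A" "f : Hom A X X'" for X X' f
 unfolding Fsel using that by (intro H F t)
have Fh: "on_hom FF X X' f : Hom B (Fo X) (Fo X')" if "X : Ob A" "X' : Ob A" "f : Hom A X X'" for X X' f
 unfolding Fsel using that by (intro H F t)
have tid: "t X X (Ident A X) = Ident A (on_ob G (Fo X))" if X: "X : Ob A" for X
 unfolding t_def using X jH[OF X] ij[OF X] Go[OF F[OF X]] by (simp add: A.id_right)
have tc: "t X Z (Comp A X Y Z g f) = Comp A (on_ob G (Fo X)) (on_ob G (Fo Y)) (on_ob G (Fo Z)) (t Y Z g) (t X Y f)"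
 if "X : Ob A" "Y : Ob A" "Z : Ob A" "f : Hom A X Y" "g : Hom A Y Z" for X Y Z f g
proof -
 note o = that(1-3) Go[OF F[OF that(1)]] Go[OF F[OF that(2)]] Go[OF F[OF that(3)]]
 note h = that(4,5) iH[OF that(1)] iH[OF that(2)] jH[OF that(2)] jH[OF that(3)]
 let ?G = "%X. on_ob G (Fo X)"
 have "Comp A (?G X) (?G Y) (?G Z) (t Y Z g) (t X Y f)
  = Comp A (?G X) Y (?G Z) (Comp A Y Z (?G Z) (j Z) g) (Comp A (?G X) (?G Y) Y (i Y) (t X Y f))"
  unfolding t_def by (intro A.assoc[symmetric] A.comp o h)
 also have "Comp A (?G X) (?G Y) Y (i Y) (t X Y f) = Comp A (?G X) (?G Y) Y (i Y) (Comp A (?G X) Y (?G Y) (j Y) (Comp A (?G X) X Y f (i X)))"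
  unfolding t_def by (subst A.assoc[of "?G X" X Y "?G Y"]) (intro o h refl)+
 also have "... = Comp A (?G X) X Y f (i X)"
  unfolding j_def by (intro A.cancel_iv(2) i that A.comp[OF o(4,1,2)] o h)
 also have "Comp A (?G X) Y (?G Z) (Comp A Y Z (?G Z) (j Z) g) (Comp A (?G X) X Y f (i X)) =
   Comp A (?G X) X (?G Z) (Comp A X Y (?G Z) (Comp A Y Z (?G Z) (j Z) g) f) (i X)"
  by (intro A.assoc A.comp o h)
 also have "Comp A X Y (?G Z) (Comp A Y Z (?G Z) (j Z) g) f = Comp A X Z (?G Z) (j Z) (Comp A X Y Z g f)"
  by (intro A.assoc[symmetric] A.comp o h)
 finally show ?thesis unfolding t_def by simp
qed
have Ff: "is_functor A B FF"
proof -
 have "on_hom FF X X (Ident A X) = Ident B (Fo X)" if X: "X : Ob A" for X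
  using X tid[OF X] Fh[OF X X A.id[OF X]] GF[OF X X A.id[OF X]]
  by (intro Ginj[OF F F _ B.id]) (auto simp: Gid F)
 moreover have "on_hom FF X Z (Comp A X Y Z g f) = Comp B (Fo X) (Fo Y) (Fo Z) (on_hom FF Y Z g) (on_hom FF X Y f)"
  if "X : Ob A" "Y : Ob A" "Z : Ob A" "f : Hom A X Y" "g : Hom A Y Z" for X Y Z f g
 proof (rule Ginj[OF F F])
  show "on_hom G (Fo X) (Fo Z) (on_hom FF X Z (Comp A X Y Z g f)) =
   on_hom G (Fo X) (Fo Z) (Comp B (Fo X) (Fo Y) (Fo Z) (on_hom FF Y Z g) (on_hom FF X Y f))"
   using that A.comp[OF that(1-5)]
   by (subst Gc) (auto simp: GF tc intro: F Fh)
 qed (use that A.comp[OF that(1-5)] in "auto intro!: Fh B.comp F")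
 ultimately show ?thesis using F Fh by (auto simp: is_functor_def Fsel(1))
qed
have n1: "naturally_isomorphic A A (comp_functor G FF) id_functor"
 unfolding naturally_isomorphic_def
proof (intro exI[of _ i] conjI ballI)
 fix X X' f assume X: "X : Ob A" "X' : Ob A" "f : Hom A X X'"
 note o = X(1,2) Go[OF F[OF X(1)]] Go[OF F[OF X(2)]]
 note h = X(3) iH[OF X(1)] iH[OF X(2)] jH[OF X(2)]
 have "Comp A (on_ob G (Fo X)) (on_ob G (Fo X')) X' (i X') (t X X' f) =
   Comp A (on_ob G (Fo X)) (on_ob G (Fo X')) X' (i X') (Comp A (on_ob G (Fo X)) X' (on_ob G (Fo X')) (j X') (Comp A (on_ob G (Fo X)) X X' f (i X)))"
  unfolding t_def by (subst A.assoc[of "on_ob G (Fo X)" X X' "on_ob G (Fo X')"]) (intro o h refl)+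
 also have "... = Comp A (on_ob G (Fo X)) X X' f (i X)"
  unfolding j_def by (intro A.cancel_iv(2) i X A.comp[OF o(3,1,2)] o h)
 finally show "Comp A (on_ob (comp_functor G FF) X) (on_ob id_functor X) (on_ob id_functor X') (on_hom id_functor X X' f) (i X)
   = Comp A (on_ob (comp_functor G FF) X) (on_ob (comp_functor G FF) X') (on_ob id_functor X') (i X') (on_hom (comp_functor G FF) X X' f)"
  by (simp add: comp_functor_def id_functor_def Fsel(1) GF X)
qed (use i in "auto simp: comp_functor_def id_functor_def Fsel(1)")
\<comment> \<open>The preimage of \<open>i (G Y)\<close> under \<open>G\<close>. It is an
  isomorphism because \<open>G\<close> is injective on morphisms, which reflects the two identities
  of an inverse.\<close>
let ?k = "%Y. H (Fo (on_ob G Y)) Y (i (on_ob G Y))"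
have n2: "naturally_isomorphic B B (comp_functor FF G) id_functor"
 unfolding naturally_isomorphic_def
proof (intro exI[of _ ?k] conjI ballI)
 fix Y assume Y: "Y : Ob B"
 let ?X = "on_ob G Y"
 note X = Go[OF Y]
 note k = H[OF F[OF X] Y iH[OF X]] and l = H[OF Y F[OF X] jH[OF X]]
 have "?k Y : Isos B (Fo ?X) Y"
 proof (rule IsosI[OF k(1) l(1)])
  show "Comp B (Fo ?X) Y (Fo ?X) (H Y (Fo ?X) (j ?X)) (?k Y) = Ident B (Fo ?X)"
   by (rule Ginj[OF F F B.comp[OF F Y F] B.id]) (auto intro: X k l F Y simp: Gc[OF F[OF X] Y F[OF X] k(1) l(1)] k l Gid F X ij)
  show "Comp B Y (Fo ?X) Y (?k Y) (H Y (Fo ?X) (j ?X)) = Ident B Y"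
   by (rule Ginj[OF Y Y B.comp[OF Y F Y] B.id]) (auto intro: X k l F Y simp: Gc[OF Y F[OF X] Y l(1) k(1)] k l Gid F X ji Y)
 qed
 thus "?k Y : Isos B (on_ob (comp_functor FF G) Y) (on_ob id_functor Y)"
  by (simp add: comp_functor_def id_functor_def Fsel(1))
next
 fix Y Y' f assume Y: "Y : Ob B" "Y' : Ob B" "f : Hom B Y Y'"
 let ?X = "on_ob G Y" and ?X' = "on_ob G Y'" and ?g = "on_hom G Y Y' f"
 note X = Go[OF Y(1)] and X' = Go[OF Y(2)] and g = Gh[OF Y]
 note k = H[OF F[OF X] Y(1) iH[OF X]] and k' = H[OF F[OF X'] Y(2) iH[OF X']] and fh = Fh[OF X X' g]
 note GG = Go[OF F[OF X]] Go[OF F[OF X']]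
 have "Comp A (on_ob G (Fo ?X)) (on_ob G (Fo ?X')) ?X' (i ?X') (t ?X ?X' ?g) =
   Comp A (on_ob G (Fo ?X)) (on_ob G (Fo ?X')) ?X' (i ?X') (Comp A (on_ob G (Fo ?X)) ?X' (on_ob G (Fo ?X')) (j ?X') (Comp A (on_ob G (Fo ?X)) ?X ?X' ?g (i ?X)))"
  unfolding t_def by (subst A.assoc[of "on_ob G (Fo ?X)" ?X ?X' "on_ob G (Fo ?X')"]) (intro GG X X' g iH jH refl)+
 also have "... = Comp A (on_ob G (Fo ?X)) ?X ?X' ?g (i ?X)"
  unfolding j_def by (intro A.cancel_iv(2) i X X' A.comp[OF GG(1) X X'] GG g iH)
 finally have e: "Comp A (on_ob G (Fo ?X)) (on_ob G (Fo ?X')) ?X' (i ?X') (t ?X ?X' ?g) = Comp A (on_ob G (Fo ?X)) ?X ?X' ?g (i ?X)" .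
 have "Comp B (Fo ?X) Y Y' f (?k Y) = Comp B (Fo ?X) (Fo ?X') Y' (?k Y') (on_hom FF ?X ?X' ?g)"
  by (rule Ginj[OF F Y(2) B.comp[OF F Y(1,2)] B.comp[OF F F Y(2)]])
   (use X X' Y k k' fh g in "auto intro: F simp: Gc F GF e")
 thus "Comp B (on_ob (comp_functor FF G) Y) (on_ob id_functor Y) (on_ob id_functor Y') (on_hom id_functor Y Y' f) (?k Y) =
   Comp B (on_ob (comp_functor FF G) Y) (on_ob (comp_functor FF G) Y') (on_ob id_functor Y') (?k Y') (on_hom (comp_functor FF G) Y Y' f)"
  by (simp add: comp_functor_def id_functor_def Fsel(1))
qed
show ?thesis unfolding is_equivalence_def using A B Ff G n1 n2 by blast
qed

section \<open>The category of equivariant objects\<close>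

locale category_action = category C for C :: "('o, 'm) cat" +
fixes G :: "'g monoid" and F :: "'g => ('o, 'm, 'o, 'm) cfunctor"
assumes F: "g : carrier G ==> is_functor C C (F g)"
begin

abbreviation "EC == equivariant_objects C G F"

lemma EC_Ob: "(X, \<alpha>) : Ob EC ==> X : Ob C"
and EC_Hom: "f : Hom EC (X, \<alpha>) (Y, \<beta>) <-> f : Hom C X Y & (ALL g : carrier G.
   Comp C X Y (on_ob (F g) Y) (\<beta> g) f =
   Comp C X (on_ob (F g) X) (on_ob (F g) Y) (on_hom (F g) X Y f) (\<alpha> g))"
and EC_Comp: "Comp EC (X, \<alpha>) (Y, \<beta>) (Z, \<gamma>) = Comp C X Y Z"
and EC_Ident: "Ident EC (X, \<alpha>) = Ident C X"
by (auto simp: equivariant_objects_def)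

lemma EC_iso: "(X, \<alpha>) : Ob EC ==> g : carrier G ==> \<alpha> g : Hom C X (on_ob (F g) X)"
by (auto simp: equivariant_objects_def Isos_def)

lemma FO: "g : carrier G ==> X : Ob C ==> on_ob (F g) X : Ob C"
and FH: "g : carrier G ==> X : Ob C ==> Y : Ob C ==> f : Hom C X Y ==> on_hom (F g) X Y f : Hom C (on_ob (F g) X) (on_ob (F g) Y)"
and FI: "g : carrier G ==> X : Ob C ==> on_hom (F g) X X (Ident C X) = Ident C (on_ob (F g) X)"
and FC: "g : carrier G ==> X : Ob C ==> Y : Ob C ==> Z : Ob C ==> f : Hom C X Y ==> h : Hom C Y Z ==>
 on_hom (F g) X Z (Comp C X Y Z h f) = Comp C (on_ob (F g) X) (on_ob (F g) Y) (on_ob (F g) Z) (on_hom (F g) Y Z h) (on_hom (F g) X Y f)"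
using F by (auto simp: is_functor_def)

lemma EC_comp:
assumes X: "(X, \<alpha>) : Ob EC" and Y: "(Y, \<beta>) : Ob EC" and Z: "(Z, \<gamma>) : Ob EC"
 and f: "f : Hom EC (X, \<alpha>) (Y, \<beta>)" and h: "h : Hom EC (Y, \<beta>) (Z, \<gamma>)"
shows "Comp C X Y Z h f : Hom EC (X, \<alpha>) (Z, \<gamma>)"
proof -
note o = EC_Ob[OF X] EC_Ob[OF Y] EC_Ob[OF Z]
have hh: "f : Hom C X Y" "h : Hom C Y Z" using f h EC_Hom by auto
have "Comp C X Z (on_ob (F g) Z) (\<gamma> g) (Comp C X Y Z h f) =
   Comp C X (on_ob (F g) X) (on_ob (F g) Z) (on_hom (F g) X Z (Comp C X Y Z h f)) (\<alpha> g)" if g: "g : carrier G" for g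
proof -
 note i = EC_iso[OF X g] EC_iso[OF Y g] EC_iso[OF Z g] and oo = FO[OF g o(1)] FO[OF g o(2)] FO[OF g o(3)]
 note fh = FH[OF g o(1,2) hh(1)] FH[OF g o(2,3) hh(2)]
 have ef: "Comp C X Y (on_ob (F g) Y) (\<beta> g) f = Comp C X (on_ob (F g) X) (on_ob (F g) Y) (on_hom (F g) X Y f) (\<alpha> g)"
  using f g EC_Hom by auto
 have eh: "Comp C Y Z (on_ob (F g) Z) (\<gamma> g) h = Comp C Y (on_ob (F g) Y) (on_ob (F g) Z) (on_hom (F g) Y Z h) (\<beta> g)"
  using h g EC_Hom by auto
 show ?thesis
  by (simp add: FC[OF g o hh] assoc[OF o oo(3) hh i(3)] eh assoc[OF o(1,2) oo(2,3) hh(1) i(2) fh(2), symmetric] ef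
   assoc[OF o(1) oo i(1) fh])
qed
thus ?thesis using comp[OF o hh] by (simp add: EC_Hom)
qed

lemma EC_category: "is_category EC"
proof -
have "Ident C X : Hom EC (X, \<alpha>) (X, \<alpha>)" if X: "(X, \<alpha>) : Ob EC" for X \<alpha>
 using EC_Ob[OF X] EC_iso[OF X] id FO by (auto simp: EC_Hom FI id_left id_right)
moreover have "Comp C X X Y f (Ident C X) = f & Comp C X Y Y (Ident C Y) f = f"
 if "(X, \<alpha>) : Ob EC" "(Y, \<beta>) : Ob EC" "f : Hom EC (X, \<alpha>) (Y, \<beta>)" for X \<alpha> Y \<beta> f
 using that EC_Hom EC_Ob by (auto simp: id_left id_right)
moreover have "Comp C W Y Z h (Comp C W X Y g f) = Comp C W X Z (Comp C X Y Z h g) f"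
 if "(W, \<delta>) : Ob EC" "(X, \<alpha>) : Ob EC" "(Y, \<beta>) : Ob EC" "(Z, \<gamma>) : Ob EC"
  "f : Hom EC (W, \<delta>) (X, \<alpha>)" "g : Hom EC (X, \<alpha>) (Y, \<beta>)" "h : Hom EC (Y, \<beta>) (Z, \<gamma>)" for W \<delta> X \<alpha> Y \<beta> Z \<gamma> f g h
 using that EC_Hom EC_Ob by (intro assoc) auto
ultimately show ?thesis
 unfolding is_category_def by (auto simp: EC_Ident EC_Comp EC_comp)
qed

text \<open>Equivariance of the inverse is automatic: compose the relation for \<open>f\<close> with
  the inverse on one side and with its image under \<open>F g\<close> on the other.\<close>

lemma EC_IsosI:
assumes X: "(X, \<alpha>) : Ob EC" and Y: "(Y, \<beta>) : Ob EC"
 and f: "f : Hom EC (X, \<alpha>) (Y, \<beta>)" and i: "f : Isos C X Y"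
shows "f : Isos EC (X, \<alpha>) (Y, \<beta>)"
proof -
note o = EC_Ob[OF X] EC_Ob[OF Y] and vv = iv[OF i]
let ?k = "iv X Y f"
have "?k : Hom EC (Y, \<beta>) (X, \<alpha>)"
 unfolding EC_Hom
proof (intro conjI ballI)
 fix g assume g: "g : carrier G"
 note a = EC_iso[OF X g] EC_iso[OF Y g] and oo = FO[OF g o(1)] FO[OF g o(2)]
 note fh = FH[OF g o vv(1)] FH[OF g o(2,1) vv(2)]
 let ?X = "on_ob (F g) X" and ?Y = "on_ob (F g) Y"
 have ef: "Comp C X Y ?Y (\<beta> g) f = Comp C X ?X ?Y (on_hom (F g) X Y f) (\<alpha> g)"
  using f g EC_Hom by auto
 have kf: "Comp C ?X ?Y ?X (on_hom (F g) Y X ?k) (on_hom (F g) X Y f) = Ident C ?X"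
  using FC[OF g o(1,2,1) vv(1,2)] FI[OF g o(1)] vv(3) by simp
 have "Comp C Y ?Y ?X (on_hom (F g) Y X ?k) (\<beta> g) = Comp C Y ?Y ?X (on_hom (F g) Y X ?k) (Comp C Y X ?Y (Comp C X Y ?Y (\<beta> g) f) ?k)"
  using cancel_iv(3)[OF oo(2) o i a(2)] by simp
 also have "... = Comp C Y ?Y ?X (on_hom (F g) Y X ?k) (Comp C Y ?X ?Y (on_hom (F g) X Y f) (Comp C Y X ?X (\<alpha> g) ?k))"
  unfolding ef by (simp only: assoc[OF o(2,1) oo vv(2) a(1) fh(1)])
 also have "... = Comp C Y ?X ?X (Ident C ?X) (Comp C Y X ?X (\<alpha> g) ?k)"
  unfolding kf[symmetric] by (intro assoc o oo comp[OF o(2,1) oo(1)] a vv fh)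
 also have "... = Comp C Y X ?X (\<alpha> g) ?k" by (intro id_left comp[OF o(2,1) oo(1)] o oo a vv)
 finally show "Comp C Y X ?X (\<alpha> g) ?k = Comp C Y ?Y ?X (on_hom (F g) Y X ?k) (\<beta> g)" by simp
qed (rule vv)
thus ?thesis using f vv by (intro IsosI[of _ _ _ _ ?k]) (auto simp: EC_Comp EC_Ident)
qed

end

section \<open>Realization of modules and glueing of homogeneous maps\<close>

context galg
begin

text \<open>Joins maps given degree by degree into one function. Zero lies in every component and is
  treated apart; any other homogeneous element determines its degree.\<close>

definition glue :: "('a, 'u, 'l) graded_module => ('a, 'v, 'l) graded_module => ('l => 'u => 'v) => 'u => 'v" where
"glue X Y k z = (if z = 0[X] then 0[Y] else k (THE l. l : carrier L & z : dpart X l) z)"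

lemma part_unique:
assumes X: "gmod X" and "l : carrier L" "l' : carrier L" "z : dpart X l" "z : dpart X l'" "z ~= 0[X]"
shows "l = l'"
using cp_comp[OF X, of l l z] cp_comp[OF X, of l l' z] assms(2-) by (metis (full_types))

lemma glue:
assumes X: "gmod X" and l: "l : carrier L" "z : dpart X l" and k: "k l 0[X] = 0[Y]"
shows "glue X Y k z = k l z"
proof (cases "z = 0[X]")
case False
hence "(THE l. l : carrier L & z : dpart X l) = l"
 using part_unique[OF X] l by (intro the_equality) auto
thus ?thesis using False by (simp add: glue_def)
qed (simp add: glue_def k)

lemma QC_iso:
assumes X: "X : Ob MC" and Y: "Y : Ob MC" and h: "germ X Y n h" and b: "bijhi n X Y h"
shows "R X Y h : Isos QC X Y"
proof -
have g: "gmod X" "gmod Y" using X Y Ob_mod_cat by auto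
obtain k where k: "germ Y X n k" "!!l z. l : carrier L ==> n <= dg l ==> z : dpart X l ==> k (h z) = z"
 "!!l x. l : carrier L ==> n <= dg l ==> x : dpart Y l ==> k x : dpart X l & h (k x) = x"
 using inverse_germ[OF g h b] by blast
show ?thesis
proof (rule IsosI)
 show "R X Y h : Hom QC X Y" "R Y X k : Hom QC Y X" using QC_Hom X Y h k by blast+
 show "Comp QC X Y X (R Y X k) (R X Y h) = Ident QC X"
  unfolding QC_Comp[OF X Y X h k(1)] QC_Ident[OF X] using k by (intro geq_R[OF X, of n]) (auto simp: geq_def)
 show "Comp QC Y X Y (R X Y h) (R Y X k) = Ident QC Y"
  unfolding QC_Comp[OF Y X Y k(1) h] QC_Ident[OF Y] using k by (intro geq_R[OF Y, of n]) (auto simp: geq_def)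
qed
qed

text \<open>The inverse morphism is represented by a germ too, and both composites are the identity
  in high degrees.\<close>

lemma Isos_bijhi:
assumes X: "X : Ob MC" and Y: "Y : Ob MC" and h: "germ X Y n h" and i: "R X Y h : Isos QC X Y"
obtains m where "bijhi m X Y h"
proof -
have g: "gmod X" "gmod Y" using X Y Ob_mod_cat by auto
obtain r where r: "r : Hom QC Y X" "Comp QC X Y X r (R X Y h) = Ident QC X" "Comp QC Y X Y (R X Y h) r = Ident QC Y"
 using i by (auto simp: Isos_def)
then obtain n' k where k: "germ Y X n' k" "r = R Y X k" using QC_Hom[OF Y X] by blast
have "R X X (%x. x) = R X X (%x. k (h x))" "R Y Y (%x. x) = R Y Y (%x. h (k x))"
 using r(2,3) by (simp_all add: k(2) QC_Comp[OF X Y X h k(1)] QC_Ident[OF X] QC_Comp[OF Y X Y k(1) h] QC_Ident[OF Y])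
then obtain a b where ab: "geq X a (%x. x) (%x. k (h x))" "geq Y b (%x. x) (%x. h (k x))"
 using R_eq_iff[OF X X germ_id[OF g(1)]] R_eq_iff[OF Y Y germ_id[OF g(2)]] by blast
define m where "m = max (max a b) (max n n')"
have "bij_betw h (dpart X l) (dpart Y l)" if l: "l : carrier L" "m <= dg l" for l
proof (rule bij_betw_byWitness[where f' = k])
 show "ALL x:dpart X l. k (h x) = x" "ALL x:dpart Y l. h (k x) = x"
  using geqD[OF ab(1) l(1)] geqD[OF ab(2) l(1)] l by (auto simp: m_def)
 show "h ` dpart X l <= dpart Y l" "k ` dpart Y l <= dpart X l"
  using germD(1)[OF h l(1)] germD(1)[OF k(1) l(1)] l by (auto simp: m_def)
qed
thus ?thesis using that by (auto simp: bijhi_def)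
qed

end

context dsum
begin

text \<open>The direct sum lives in a type of functions. Being finitely generated, it injects into
  the universe, and \<open>img\<close> with the zero submodule makes the isomorphic copy
  there.\<close>

lemma realize:
assumes fin: "finite G" "!!y c. (y, c) : G ==> c : carrier L & y : P c"
 and gen: "!!l y. l : carrier L ==> y : P l ==>
  y : acl M {s .[M] b | s b a c. (b, c) : G & a : carrier L & s : cmp S a & a *[L] c = l}"
 and inf: "infinite (UNIV :: 'w set)" and le: "carrier S \<lesssim> (UNIV :: 'w set)"
obtains Y :: "('a, 'w, 'l) graded_module" and K where "Y : Ob MC"
 "!!l. l : carrier L ==> bij_betw (K l) (P l) (dpart Y l)"
 "!!l x y. l : carrier L ==> x : P l ==> y : P l ==> K l (x +[M] y) = K l x +[Y] K l y"
 "!!a l s y. a : carrier L ==> l : carrier L ==> s : cmp S a ==> y : P l ==>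
  K (a *[L] l) (s .[M] y) = s .[Y] K l y"
proof -
let ?B = "(%(y, c). sgl c y) ` G"
have B: "?B <= carrier DS" using fin sgl_carrier by auto
have fg: "fg DS"
proof (rule fg_homogI[OF DS_gmod])
 show "finite ?B" "?B <= carrier DS" using fin B by auto
 fix l m assume l: "l : carrier L" and "m : dpart DS l"
 then obtain y where y: "y : P l" "m = sgl l y" using DS_part by auto
 let ?Z = "{s .[M] b | s b a c. (b, c) : G & a : carrier L & s : cmp S a & a *[L] c = l}"
 have "s .[M] b : carrier M" if "(b, c) : G" "a : carrier L" "s : cmp S a" for s b a c
  using fin(2)[OF that(1)] P_facts(1)[of c] comp_carrier[OF that(2,3)] by auto
 hence Z: "?Z <= carrier M" by blast
 have "y : acl M ?Z" using gen[OF l y(1)] .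
 hence "sgl l y : acl DS (mul DS (carrier S) ?B)"
 proof induction
  case acl_zero thus ?case by (simp add: sgl_zero acl.acl_zero)
 next
  case (acl_add x y)
  then obtain s b a c where x: "x = s .[M] b" "(b, c) : G" "a : carrier L" "s : cmp S a" "a *[L] c = l" by blast
  have "x : carrier M" "y : carrier M" using acl_add Z MM.M.acl_closed[OF Z] by blast+
  hence "sgl l (x +[M] y) = s .[DS] sgl c b +[DS] sgl l y"
   using DS_smult_sgl[OF x(3,4)] x fin(2)[OF x(2)] by (simp add: DS_add_sgl)
  moreover have "s .[DS] sgl c b : mul DS (carrier S) ?B"
   unfolding mul_def
   by (rule CollectI, rule exI[of _ s], rule exI[of _ "sgl c b"])
    (use imageI[OF x(2), of "%(y, c). sgl c y"] comp_carrier[OF x(3,4)] in simp)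
  ultimately show ?case using acl.acl_add[of _ "mul DS (carrier S) ?B" "sgl l y" DS] acl_add.IH by simp
 qed
 thus "m : acl DS (mul DS (carrier S) ?B)" using y by simp
qed
obtain q :: "('l => 'y) => 'w" where q: "inj_on q (carrier DS)"
 using fg_inj[OF DS_gmod fg inf le] by blast
interpret D: module S DS by (rule DS_module)
have q': "q x = q y <-> x -[DS] y : {0[DS]}" if "x : carrier DS" "y : carrier DS" for x y
 using q that D.M.diff_zero[OF that] by (auto simp: inj_on_def a_minus_def D.M.r_neg)
note i = DS_gmod zero_gsub[OF DS_gmod] q'
show ?thesis
proof (rule that[of "img q DS" "%l y. q (sgl l y)"])
 show "img q DS : Ob MC" unfolding Ob_mod_cat using img_gmod[OF i] hom_img(2)[OF i fg] by simp
 fix l assume l: "l : carrier L"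
 show "bij_betw (%y. q (sgl l y)) (P l) (dpart (img q DS) l)"
  unfolding bij_betw_def
 proof
  show "inj_on (%y. q (sgl l y)) (P l)"
   using inj_onD[OF q _ sgl_carrier[OF l] sgl_carrier[OF l]] by (intro inj_onI) (auto simp: sgl_eq)
 qed (use l in "auto simp: DS_part")
 fix x y assume xy: "x : P l" "y : P l"
 hence c: "x : carrier M" "y : carrier M" using P_facts l by auto
 show "q (sgl l (x +[M] y)) = q (sgl l x) +[img q DS] q (sgl l y)"
  using img_add[OF i, of "sgl l x" "sgl l y"] sgl_carrier[OF l] xy c by (simp add: DS_add_sgl)
next
 fix a l s y assume l: "a : carrier L" "l : carrier L" "s : cmp S a" "y : P l"
 show "q (sgl (a *[L] l) (s .[M] y)) = s .[img q DS] q (sgl l y)"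
  using img_smult[OF i, of s "sgl l y"] sgl_carrier l comp_carrier by (simp add: DS_smult_sgl)
qed
qed

end

section \<open>Pairs of graded algebras and the pull-back of modules\<close>

lemma (in module) smult_acl:
assumes s: "s : acl R Z" and Z: "Z <= carrier R" and m: "m : carrier M" and W: "W <= carrier M"
 and z: "!!z. z : Z ==> z .[M] m : acl M W"
shows "s .[M] m : acl M W"
using s
proof induction
case acl_zero thus ?case using smult_l_null[OF m] by (simp add: acl.acl_zero)
next
case (acl_add x y)
have "x : carrier R" "y : carrier R" using acl_add Z R.acl_closed[OF Z] by blast+
thus ?case using M.acl_plus[OF W z acl_add.IH] acl_add m by (simp add: smult_l_distr)
qed

text \<open>The situation of the theorem without its polynomials. \<open>dec\<close> says that the
  components of \<open>B\<close> over the image of \<pi> are spanned by \<phi>, \<open>finB\<close>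
  that \<open>B\<close> is finite over them, and \<open>ideal\<close> that scalars of high degree
  factor through elements of large degree in a prescribed coset of the image.
  \<open>psi_mult\<close> and \<open>psi_one\<close> describe the \<open>A\<close>-linear
  retraction.\<close>

locale gpair = A: galg A dA prA XA + B: galg B dB prB XB
for A :: "('a, 'k::field, 'l) graded_algebra" and dA prA XA
 and B :: "('b, 'h::field, 'm) graded_algebra" and dB prB XB +
fixes \<pi> :: "'l => 'm" and \<phi> :: "'a => 'b" and \<psi> :: "'b => 'a" and U :: "'u itself"
assumes pi_hom: "\<pi> : hom (gg A) (gg B)"
 and dpi: "u : carrier (gg A) ==> dB (\<pi> u) = dA u"
 and phi_hom: "\<phi> : ring_hom A B"
 and phi_comp: "u : carrier (gg A) ==> a : cmp A u ==> \<phi> a : cmp B (\<pi> u)"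
 and psi_add: "addmap B A \<psi>"
 and psi_mult: "a : carrier A ==> c : carrier B ==> \<psi> (\<phi> a *[B] c) = a *[A] \<psi> c"
 and psi_one: "\<psi> 1[B] = 1[A]"
 and dec: "u : carrier (gg A) ==> cmp B (\<pi> u)<=
  acl B {\<phi> a | a v. v : carrier (gg A) & \<pi> v = \<pi> u & a : cmp A v}"
 and finite_ker: "finite {u : carrier (gg A). \<pi> u = 1[gg B]}"
 and ideal: "l : carrier (gg B) ==> EX k. ALL a:carrier (gg B). k <= dB a --> cmp B a<=
  acl B {s *[B] t | s t c d. c : carrier (gg B) & d : carrier (gg B) &
   c *[gg B] l : \<pi> ` carrier (gg A) & m <= dB c & 0 <= dB d &
   d *[gg B] c = a & s : cmp B d & t : cmp B c}"
 and finB: "EX G. finite G & (ALL (g, d):G. d : carrier (gg B) & g : cmp B d) &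
  (ALL a:carrier (gg B). cmp B a <= acl B {s *[B] g | s g d u. (g, d) : G &
   u : carrier (gg A) & \<pi> u *[gg B] d = a & s : cmp B (\<pi> u)})"
 and inf: "infinite (UNIV :: 'u set)"
 and univ: "carrier A \<lesssim> (UNIV :: 'u set)" "carrier B \<lesssim> (UNIV :: 'u set)"
begin

abbreviation "LA == gg A"
abbreviation "LB == gg B"

sublocale pi: group_hom LA LB \<pi>
using pi_hom by unfold_locales

definition N :: "'l set" where "N = {u : carrier LA. \<pi> u = 1[LB]}"

lemma N: "g : N ==> g : carrier LA" "g : N ==> \<pi> g = 1[LB]"
and N_I: "g : carrier LA ==> \<pi> g = 1[LB] ==> g : N"
by (auto simp: N_def)

lemma N_subgroup: "subgroup N LA"
using pi.subgroup_kernel by (simp add: kernel_def N_def)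

lemma N_dA: "g : N ==> dA g = 0"
using N dpi[of g] by auto

lemma phi_closed: "a : carrier A ==> \<phi> a : carrier B"
and phi_mult: "a : carrier A ==> b : carrier A ==> \<phi> (a *[A] b) = \<phi> a *[B] \<phi> b"
and phi_add: "a : carrier A ==> b : carrier A ==> \<phi> (a +[A] b) = \<phi> a +[B] \<phi> b"
and phi_one: "\<phi> 1[A] = 1[B]"
using phi_hom by (auto simp: ring_hom_def)

lemma psi_closed: "c : carrier B ==> \<psi> c : carrier A"
using psi_add addmap_closed by metis

lemma fibre_finite: "finite {w : carrier LA. \<pi> w = e}"
proof (cases "EX w0:carrier LA. \<pi> w0 = e")
case True
then obtain w0 where w0: "w0 : carrier LA" "\<pi> w0 = e" by blast
have "{w : carrier LA. \<pi> w = e} <= (%n. w0 *[LA] n) ` {u : carrier LA. \<pi> u = 1[LB]}"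
proof
 fix w assume w: "w : {w : carrier LA. \<pi> w = e}"
 hence "w = w0 *[LA] (inv[LA] w0 *[LA] w)" "inv[LA] w0 *[LA] w : {u : carrier LA. \<pi> u = 1[LB]}"
  using w0 A.LG_solve by (auto simp: pi.hom_inv)
 thus "w : (%n. w0 *[LA] n) ` {u : carrier LA. \<pi> u = 1[LB]}" by blast
qed
thus ?thesis using finite_ker finite_subset by blast
next
case False thus ?thesis by (simp add: Collect_empty_eq[THEN iffD2])
qed

text \<open>\<open>X\<close> is a copy in the universe of the module with components \<open>Y\<^bsub>\<pi> u\<^esub>\<close>, and \<open>J u\<close> identifies its component of degree \<open>u\<close>.\<close>

definition pull :: "('b, 'u, 'm) graded_module => ('a, 'u, 'l) graded_module => ('l => 'u => 'u) => bool" where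
"pull Y X J <-> X : Ob A.MC & (ALL u:carrier LA. bij_betw (J u) (dpart Y (\<pi> u)) (dpart X u) &
 (ALL x:dpart Y (\<pi> u). ALL y:dpart Y (\<pi> u). J u (x +[Y] y) = J u x +[X] J u y) &
 (ALL v:carrier LA. ALL a:cmp A v. ALL y:dpart Y (\<pi> u). J (v *[LA] u) (\<phi> a .[Y] y) = a .[X] J u y))"

text \<open>\<open>Y\<close> is an \<open>A\<close>-module along \<phi>. For finite generation,
  products \<open>g b\<close> of generators of \<open>B\<close> and of \<open>Y\<close> are placed
  once in each degree over \<open>d c\<close>; finiteness of the kernel keeps this list
  finite.\<close>

lemma pull_ex:
assumes Y: "Y : Ob B.MC" shows "EX X J. pull Y X J"
proof -
have g: "B.gmod Y" "B.fg Y" using Y B.Ob_mod_cat by auto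
interpret Y: module B Y using g B.gmod_module by blast
define M :: "('a, 'u) module" where "M = (|carrier = carrier Y, monoid.mult = undefined, one = undefined,
  zero = 0[Y], add = add Y, smult = (%a y. \<phi> a .[Y] y)|)"
have Ms: "carrier M = carrier Y" "0[M] = 0[Y]" "add M = add Y" "a .[M] y = \<phi> a .[Y] y" for a y
 by (auto simp: M_def)
have mod: "module A M"
 by (intro moduleI A.SR.is_cring abelian_groupI)
  (auto simp: Ms phi_closed phi_mult phi_add phi_one Y.smult_l_distr Y.smult_r_distr Y.smult_assoc1 Y.M.a_ac
   intro!: bexI[of _ "-[Y] _"] Y.M.l_neg)
interpret MM: module A M by (rule mod)
interpret D: dsum A dA prA XA M "%u. dpart Y (\<pi> u)"
proof (rule dsum.intro[OF A.galg_axioms dsum_axioms.intro[OF mod]])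
 fix l assume l: "l : carrier LA"
 show "additive_subgroup (dpart Y (\<pi> l)) M"
 proof (rule MM.M.subgroupI')
  note pf = B.part_facts[OF g(1), of "\<pi> l", OF pi.hom_closed[OF l]]
  show "dpart Y (\<pi> l) <= carrier M" "0[M] : dpart Y (\<pi> l)" using pf by (auto simp: Ms)
  fix x assume x: "x : dpart Y (\<pi> l)"
  hence "x : carrier Y" using pf by blast
  hence "-[M] x = -[Y] x" by (intro MM.M.minus_equality) (auto simp: Ms Y.M.l_neg)
  thus "-[M] x : dpart Y (\<pi> l)" using pf x by simp
  fix y assume "y : dpart Y (\<pi> l)"
  thus "x +[M] y : dpart Y (\<pi> l)" using pf x by (simp add: Ms)
 qed
 fix a s y assume "a : carrier LA" "s : cmp A a" "y : dpart Y (\<pi> l)"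
 thus "s .[M] y : dpart Y (\<pi> (a *[LA] l))"
  using B.gmod_act[OF g(1)] l phi_comp by (simp add: Ms)
qed
obtain B0 where B0: "finite B0" "!!b c. (b, c) : B0 ==> c : carrier LB & b : dpart Y c"
 "!!l m. l : carrier LB ==> m : dpart Y l ==>
  m : acl Y {s .[Y] b | s b a c. (b, c) : B0 & a : carrier LB & s : cmp B a & a *[LB] c = l}"
 using B.fg_homog[OF g] by blast
obtain G where G: "finite G" "!!g d. (g, d) : G ==> d : carrier LB & g : cmp B d"
 "!!a. a : carrier LB ==> cmp B a <= acl B {s *[B] g | s g d u. (g, d) : G &
   u : carrier LA & \<pi> u *[LB] d = a & s : cmp B (\<pi> u)}"
 using finB by blast
define H where "H = (\<Union>(g, d)\<in>G. \<Union>(b, c)\<in>B0. (%w. (g .[Y] b, w)) ` {w : carrier LA. \<pi> w = d *[LB] c})"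
have H: "finite H" unfolding H_def using G(1) B0(1) fibre_finite by auto
have H2: "c : carrier LA & y : dpart Y (\<pi> c)" if "(y, c) : H" for y c
 using that G(2) B0(2) B.gmod_act[OF g(1)] unfolding H_def by auto
obtain X :: "('a, 'u, 'l) graded_module" and J where "X : Ob A.MC"
 "!!l. l : carrier LA ==> bij_betw (J l) (dpart Y (\<pi> l)) (dpart X l)"
 "!!l x y. l : carrier LA ==> x : dpart Y (\<pi> l) ==> y : dpart Y (\<pi> l) ==> J l (x +[M] y) = J l x +[X] J l y"
 "!!a l s y. a : carrier LA ==> l : carrier LA ==> s : cmp A a ==> y : dpart Y (\<pi> l) ==>
  J (a *[LA] l) (s .[M] y) = s .[X] J l y"
proof (rule D.realize[OF H H2 _ inf univ(1)])
 fix u y assume u: "u : carrier LA" and y: "y : dpart Y (\<pi> u)"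
 let ?W = "{s .[M] b | s b a c. (b, c) : H & a : carrier LA & s : cmp A a & a *[LA] c = u}"
 have "s .[M] b : carrier Y" if "(b, c) : H" "a : carrier LA" "s : cmp A a" for s b a c
  using H2[OF that(1)] A.comp_carrier[OF that(2,3)] B.gmod_carrier[OF g(1), of "\<pi> c" b] by (auto simp: Ms phi_closed)
 hence W: "?W <= carrier Y" by blast
 have "acl Y {s .[Y] b | s b a c. (b, c) : B0 & a : carrier LB & s : cmp B a & a *[LB] c = \<pi> u} <= acl Y ?W"
 proof (rule Y.M.acl_subI[OF _ W], clarify)
  fix s b a c assume b: "(b, c) : B0" and a: "a : carrier LB" "s : cmp B a" "a *[LB] c = \<pi> u"
  note bc = B0(2)[OF b]
  hence bY: "b : carrier Y" using B.gmod_carrier[OF g(1)] by blast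
  let ?Z = "{s *[B] g | s g d u. (g, d) : G & u : carrier LA & \<pi> u *[LB] d = a & s : cmp B (\<pi> u)}"
  have sg: "s : carrier B & g : carrier B" if "(g, d) : G" "u : carrier LA" "s : cmp B (\<pi> u)" for s g d u
   using G(2)[OF that(1)] that B.comp_carrier by (meson pi.hom_closed)
  show "s .[Y] b : acl Y ?W"
  proof (rule Y.smult_acl[OF _ _ bY W])
   show "s : acl B ?Z" using G(3)[OF a(1)] a(2) by blast
   show "?Z <= carrier B" using sg B.SR.m_closed by blast
   fix z assume "z : ?Z"
   then obtain s g d v where z: "z = s *[B] g" "(g, d) : G" "v : carrier LA" "\<pi> v *[LB] d = a" "s : cmp B (\<pi> v)"
    by blast
   note c = sg[OF z(2,3,5)]
   have d: "d : carrier LB" using G(2)[OF z(2)] by blast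
   have "s .[Y] (g .[Y] b) : acl Y ?W"
   proof (rule Y.smult_acl[OF subsetD[OF dec[OF z(3)] z(5)] _ _ W])
    show "{\<phi> a |a va. va : carrier LA & \<pi> va = \<pi> v & a : cmp A va} <= carrier B"
     using A.comp_carrier phi_closed by blast
    show "g .[Y] b : carrier Y" using c bY by simp
    fix t assume "t : {\<phi> a |a va. va : carrier LA & \<pi> va = \<pi> v & a : cmp A va}"
    then obtain \<alpha> x where t: "t = \<phi> \<alpha>" "x : carrier LA" "\<pi> x = \<pi> v" "\<alpha> : cmp A x" by blast
    \<comment> \<open>A scalar of degree \<open>x\<close> brings the copy of \<open>g b\<close> in
      degree \<open>inv x * u\<close> to degree \<open>u\<close>, so there must be a copy in that
      degree, which means that it lies over \<open>d c\<close>.\<close>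
    have "\<pi> (inv[LA] x *[LA] u) = d *[LB] c"
     using u t d bc z(3) a(3) z(4) by (simp add: pi.hom_inv B.LG.m_assoc flip: a(3))
      (metis B.LG.inv_solve_left' B.LG.m_assoc B.LG.m_closed pi.hom_closed)
    hence "(g .[Y] b, inv[LA] x *[LA] u) : H"
     unfolding H_def using z(2) b u t(2) by force
    hence "t .[Y] (g .[Y] b) : ?W" using A.LG_solve[OF t(2) u] t by (auto simp: Ms)
    thus "t .[Y] (g .[Y] b) : acl Y ?W" by (rule Y.M.acl_base[OF W])
   qed
   thus "z .[Y] b : acl Y ?W" using z(1) c bY by (simp add: Y.smult_assoc1)
  qed
 qed
 hence "y : acl Y ?W" using B0(3)[OF _ y] u by auto
 thus "y : acl M ?W" using acl_cong[of M Y] Ms by auto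
qed (assumption, rule that, assumption+)
thus ?thesis unfolding pull_def by (intro exI[of _ X] exI[of _ J]) (auto simp: Ms)
qed

end

section \<open>The shift functors on the quotient category\<close>

context galg
begin

text \<open>Literal equality of records, which makes the action strict; degree parts are cut off
  outside the grading group, so they agree as functions.\<close>

lemma shift_shift: "x : carrier L ==> y : carrier L ==> shift x (shift y M) = shift (x *[L] y) M"
by (auto intro!: graded_module.equality restrict_ext simp: LG.m_assoc)

abbreviation "SF x == quotient_functor MC (mod0 S) (degree_shift L x)"

lemma SF_ob: "on_ob (SF x) M = shift x M"
by (simp add: quotient_functor_def degree_shift_def)

lemma SF_functor:
assumes x: "x : carrier L"
shows "is_functor QC QC (SF x)"
unfolding is_functor_def SF_ob
proof (intro conjI ballI)
fix X Y f assume X: "X : Ob QC" and Y: "Y : Ob QC" and f: "f : Hom QC X Y"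
then obtain n h where h: "germ X Y n h" "f = R X Y h" using QC_Hom[of X Y] by auto
have oX: "X : Ob MC" and oY: "Y : Ob MC" using X Y by auto
show "on_hom (SF x) X Y f : Hom QC (shift x X) (shift x Y)"
 unfolding h(2) QC_Hom[OF shift_Ob[OF oX x] shift_Ob[OF oY x]] shift_R[OF oX oY h(1) x] using shift_germ[OF x h(1)] by blast
fix Z g assume Z: "Z : Ob QC" and g: "g : Hom QC Y Z"
then obtain m k where k: "germ Y Z m k" "g = R Y Z k" using QC_Hom[of Y Z] Y by auto
have o: "X : Ob MC" "Y : Ob MC" "Z : Ob MC" "gmod X" using X Y Z Ob_mod_cat by auto
have "germ X Y (max n m) h" "germ Y Z (max n m) k" using h k germ_mono by (meson max.cobounded1 max.cobounded2)+
hence c: "germ X Z (max n m) (%x. k (h x))" using germ_comp o by blast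
show "on_hom (SF x) X Z (Comp QC X Y Z g f) =
  Comp QC (shift x X) (shift x Y) (shift x Z) (on_hom (SF x) Y Z g) (on_hom (SF x) X Y f)"
 unfolding h(2) k(2) QC_Comp[OF o(1-3) h(1) k(1)] shift_R[OF o(1,2) h(1) x] shift_R[OF o(2,3) k(1) x] shift_R[OF o(1,3) c x]
 by (rule QC_Comp[symmetric]) (use o x shift_Ob shift_germ h k in auto)
next
fix X assume X: "X : Ob QC"
hence o: "X : Ob MC" "gmod X" using Ob_mod_cat by auto
show "on_hom (SF x) X X (Ident QC X) = Ident QC (shift x X)"
 using shift_R[OF o(1,1) germ_id[OF o(2)] x] QC_Ident[OF o(1)] QC_Ident[OF shift_Ob[OF o(1) x]] by simp
qed (use x shift_Ob in auto)

end

section \<open>The pull-back as a functor to equivariant objects\<close>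

context gpair
begin

text \<open>One pull-back is chosen for each \<open>Y\<close>, so that \<open>Psi\<close> is a
  function on objects; \<open>PJ\<close> uses the same choice.\<close>

definition PX :: "('b, 'u, 'm) graded_module => ('a, 'u, 'l) graded_module" where
"PX Y = fst (SOME (X, J). pull Y X J)"

definition PJ :: "('b, 'u, 'm) graded_module => 'l => 'u => 'u" where
"PJ Y = snd (SOME (X, J). pull Y X J)"

lemma
assumes Y: "Y : Ob B.MC"
shows PX_Ob: "PX Y : Ob A.MC"
 and J_bij: "u : carrier LA ==> bij_betw (PJ Y u) (dpart Y (\<pi> u)) (dpart (PX Y) u)"
 and J_in: "u : carrier LA ==> y : dpart Y (\<pi> u) ==> PJ Y u y : dpart (PX Y) u"
 and J_add: "u : carrier LA ==> x : dpart Y (\<pi> u) ==> y : dpart Y (\<pi> u) ==>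
  PJ Y u (x +[Y] y) = PJ Y u x +[PX Y] PJ Y u y"
 and J_smult: "v : carrier LA ==> u : carrier LA ==> a : cmp A v ==> y : dpart Y (\<pi> u) ==>
  PJ Y (v *[LA] u) (\<phi> a .[Y] y) = a .[PX Y] PJ Y u y"
proof -
have "pull Y (PX Y) (PJ Y)"
 using someI_ex[of "%(X, J). pull Y X J"] pull_ex[OF Y] by (auto simp: PX_def PJ_def split: prod.splits)
thus "PX Y : Ob A.MC"
 "u : carrier LA ==> bij_betw (PJ Y u) (dpart Y (\<pi> u)) (dpart (PX Y) u)"
 "u : carrier LA ==> y : dpart Y (\<pi> u) ==> PJ Y u y : dpart (PX Y) u"
 "u : carrier LA ==> x : dpart Y (\<pi> u) ==> y : dpart Y (\<pi> u) ==>
  PJ Y u (x +[Y] y) = PJ Y u x +[PX Y] PJ Y u y"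
 "v : carrier LA ==> u : carrier LA ==> a : cmp A v ==> y : dpart Y (\<pi> u) ==>
  PJ Y (v *[LA] u) (\<phi> a .[Y] y) = a .[PX Y] PJ Y u y"
 by (auto simp: pull_def intro: bij_betw_apply)
qed

lemma PX_gmod: "Y : Ob B.MC ==> A.gmod (PX Y)" and ObB_gmod: "Y : Ob B.MC ==> B.gmod Y"
and ObA_gmod: "X : Ob A.MC ==> A.gmod X"
using PX_Ob A.Ob_mod_cat B.Ob_mod_cat by auto

lemma J_surj:
assumes "Y : Ob B.MC" "u : carrier LA" "x : dpart (PX Y) u"
obtains y where "y : dpart Y (\<pi> u)" "x = PJ Y u y"
using J_bij[OF assms(1,2)] assms(3) by (auto simp: bij_betw_def)

lemma J_zero:
assumes Y: "Y : Ob B.MC" and u: "u : carrier LA"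
shows "PJ Y u 0[Y] = 0[PX Y]"
proof -
interpret X: module A "PX Y" using PX_gmod[OF Y] A.gmod_module by blast
interpret Y: module B Y using ObB_gmod[OF Y] B.gmod_module by blast
have z: "0[Y] : dpart Y (\<pi> u)" using B.part_facts(2)[OF ObB_gmod[OF Y]] u by simp
show ?thesis using J_add[OF Y u z z] J_in[OF Y u z] A.part_facts(1)[OF PX_gmod[OF Y] u]
 by (intro X.M.double_zero) auto
qed

text \<open>Turns a family of maps \<open>k u\<close> on the components \<open>Y_(\<pi> u)\<close>
  into one function on the pull-back. Both \<open>Ph\<close> and \<open>T\<close> are of this
  form.\<close>

definition lift :: "('b, 'u, 'm) graded_module => ('a, 'u, 'l) graded_module => ('l => 'u => 'u) => 'u => 'u" where
"lift Y X k = A.glue (PX Y) X (%u x. k u (inv_into (dpart Y (\<pi> u)) (PJ Y u) x))"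

lemma lift:
assumes Y: "Y : Ob B.MC" and u: "u : carrier LA" and y: "y : dpart Y (\<pi> u)" and k: "k u 0[Y] = 0[X]"
shows "lift Y X k (PJ Y u y) = k u y"
proof -
have i: "inv_into (dpart Y (\<pi> u)) (PJ Y u) (PJ Y u y) = y" if "y : dpart Y (\<pi> u)" for y
 using J_bij[OF Y u] that by (auto simp: bij_betw_def)
have z: "0[Y] : dpart Y (\<pi> u)" using B.part_facts(2)[OF ObB_gmod[OF Y]] u by simp
show ?thesis unfolding lift_def
 by (subst A.glue[OF PX_gmod[OF Y] u J_in[OF Y u y]]) (use i[OF y] i[OF z] J_zero[OF Y u] k in auto)
qed

lemma lift_germ:
assumes Y: "Y : Ob B.MC" and X: "A.gmod X"
 and k_in: "!!u y. u : carrier LA ==> n <= dA u ==> y : dpart Y (\<pi> u) ==> k u y : dpart X u"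
 and k_add: "!!u x y. u : carrier LA ==> n <= dA u ==> x : dpart Y (\<pi> u) ==> y : dpart Y (\<pi> u) ==>
  k u (x +[Y] y) = k u x +[X] k u y"
 and k_smult: "!!v u a y. v : carrier LA ==> 0 <= dA v ==> u : carrier LA ==> n <= dA u ==> a : cmp A v ==>
  y : dpart Y (\<pi> u) ==> k (v *[LA] u) (\<phi> a .[Y] y) = a .[X] k u y"
shows "A.germ (PX Y) X n (lift Y X k)"
 and "u : carrier LA ==> n <= dA u ==> y : dpart Y (\<pi> u) ==> lift Y X k (PJ Y u y) = k u y"
proof -
interpret X: module A X using X A.gmod_module by blast
interpret Y: module B Y using ObB_gmod[OF Y] B.gmod_module by blast
note gY = ObB_gmod[OF Y]
have k0: "k u 0[Y] = 0[X]" if u: "u : carrier LA" "n <= dA u" for u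
proof -
 have z: "0[Y] : dpart Y (\<pi> u)" using B.part_facts(2)[OF gY] u by simp
 show ?thesis using k_add[OF u z z] k_in[OF u z] A.part_facts(1)[OF X u(1)] by (intro X.M.double_zero) auto
qed
have l: "lift Y X k (PJ Y u y) = k u y" if "u : carrier LA" "n <= dA u" "y : dpart Y (\<pi> u)" for u y
 using lift[where k = k and X = X, OF Y that(1,3) k0[OF that(1,2)]] .
thus "u : carrier LA ==> n <= dA u ==> y : dpart Y (\<pi> u) ==> lift Y X k (PJ Y u y) = k u y" .
show "A.germ (PX Y) X n (lift Y X k)"
proof (rule A.germI)
 fix u x assume u: "u : carrier LA" "n <= dA u" "x : dpart (PX Y) u"
 obtain y where y: "y : dpart Y (\<pi> u)" "x = PJ Y u y" using J_surj[OF Y u(1,3)] .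
 thus "lift Y X k x : dpart X u" using l k_in u by simp
 { fix x' assume "x' : dpart (PX Y) u"
  then obtain y' where y': "y' : dpart Y (\<pi> u)" "x' = PJ Y u y'" using J_surj[OF Y u(1)] by blast
  have "y +[Y] y' : dpart Y (\<pi> u)" using B.part_facts(3)[OF gY _ y(1) y'(1)] u by simp
  hence "lift Y X k (PJ Y u (y +[Y] y')) = lift Y X k x +[X] lift Y X k x'"
   using y y' u by (simp add: l k_add)
  thus "lift Y X k (x +[PX Y] x') = lift Y X k x +[X] lift Y X k x'"
   using J_add[OF Y u(1) y(1) y'(1)] y y' by simp }
 { fix v a assume v: "v : carrier LA" "0 <= dA v" "a : cmp A v"
  have "\<phi> a .[Y] y : dpart Y (\<pi> (v *[LA] u))"
   using B.gmod_act[OF gY, of "\<pi> v" "\<pi> u" "\<phi> a" y] v u y phi_comp by simp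
  hence "lift Y X k (PJ Y (v *[LA] u) (\<phi> a .[Y] y)) = a .[X] lift Y X k x"
   using v u y by (simp add: l k_smult A.dg_add)
  thus "lift Y X k (a .[PX Y] x) = a .[X] lift Y X k x"
   using J_smult[OF Y v(1) u(1) v(3) y(1)] y by simp }
qed
qed

definition Ph :: "('b, 'u, 'm) graded_module => ('b, 'u, 'm) graded_module => ('u => 'u) => 'u => 'u" where
"Ph Y Y' h = lift Y (PX Y') (%u y. PJ Y' u (h y))"

lemma Ph:
assumes Y: "Y : Ob B.MC" and Y': "Y' : Ob B.MC" and h: "B.germ Y Y' n h"
shows Ph_germ: "A.germ (PX Y) (PX Y') n (Ph Y Y' h)"
 and Ph_J: "u : carrier LA ==> n <= dA u ==> y : dpart Y (\<pi> u) ==> Ph Y Y' h (PJ Y u y) = PJ Y' u (h y)"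
proof -
have g: "h y : dpart Y' (\<pi> u)" "z : dpart Y (\<pi> u) ==> h (y +[Y] z) = h y +[Y'] h z"
 "v : carrier LA ==> 0 <= dA v ==> a : cmp A v ==> h (\<phi> a .[Y] y) = \<phi> a .[Y'] h y"
 if "u : carrier LA" "n <= dA u" "y : dpart Y (\<pi> u)" for u v a y z
 using B.germD(1,2)[OF h, of "\<pi> u"] B.germD(3)[OF h, of "\<pi> u" "\<pi> v" "\<phi> a" y] that phi_comp by (simp_all add: dpi)
show "A.germ (PX Y) (PX Y') n (Ph Y Y' h)"
 unfolding Ph_def by (rule lift_germ(1)[OF Y PX_gmod[OF Y']]) (auto intro!: J_in[OF Y'] simp: g J_add[OF Y'] J_smult[OF Y'])
show "u : carrier LA ==> n <= dA u ==> y : dpart Y (\<pi> u) ==> Ph Y Y' h (PJ Y u y) = PJ Y' u (h y)"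
 unfolding Ph_def by (rule lift_germ(2)[OF Y PX_gmod[OF Y']]) (auto intro!: J_in[OF Y'] simp: g J_add[OF Y'] J_smult[OF Y'])
qed

abbreviation sh :: "'l => ('a, 'u, 'l) graded_module => ('a, 'u, 'l) graded_module" where "sh g X == A.shift (inv[LA] g) X"

text \<open>The identity of \<open>Y_(\<pi> u)\<close>, read as a map from degree \<open>u\<close>
  to degree \<open>u * inv g\<close> of the pull-back. These maps form the equivariant
  structure.\<close>

definition T :: "('b, 'u, 'm) graded_module => 'l => 'u => 'u" where
"T Y g = lift Y (PX Y) (%u y. PJ Y (u *[LA] inv[LA] g) y)"

lemma pi_shift: "g : N ==> u : carrier LA ==> \<pi> (u *[LA] inv[LA] g) = \<pi> u"
using N by (simp add: pi.hom_inv)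

lemma T:
assumes Y: "Y : Ob B.MC" and g: "g : N"
shows T_germ: "A.germ (PX Y) (sh g (PX Y)) n (T Y g)"
 and T_J: "u : carrier LA ==> y : dpart Y (\<pi> u) ==> T Y g (PJ Y u y) = PJ Y (u *[LA] inv[LA] g) y"
 and T_bij: "A.bijhi n (PX Y) (sh g (PX Y)) (T Y g)"
proof -
have gc: "inv[LA] g : carrier LA" using N[OF g] by simp
show Tj: "T Y g (PJ Y u y) = PJ Y (u *[LA] inv[LA] g) y" if "u : carrier LA" "y : dpart Y (\<pi> u)" for u y
 unfolding T_def using that J_zero[OF Y] gc by (intro lift[OF Y]) auto
\<comment> \<open>Only the zero of the target enters \<open>lift\<close>, and a shift leaves it
  unchanged.\<close>
have eq: "lift Y (PX Y) k = lift Y (sh g (PX Y)) k" for k unfolding lift_def A.glue_def by (simp cong: if_cong)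
show "A.germ (PX Y) (sh g (PX Y)) n (T Y g)"
 unfolding T_def eq
proof (rule lift_germ[OF Y])
 show "A.gmod (sh g (PX Y))" by (rule A.shift_gmod[OF PX_gmod[OF Y] gc])
next
 fix v u a y assume *: "v : carrier LA" "u : carrier LA" "a : cmp A v" "y : dpart Y (\<pi> u)"
 have "v *[LA] u *[LA] inv[LA] g = v *[LA] (u *[LA] inv[LA] g)" using * gc by (simp add: A.LG.m_assoc)
 thus "PJ Y (v *[LA] u *[LA] inv[LA] g) (\<phi> a .[Y] y) = a .[sh g (PX Y)] PJ Y (u *[LA] inv[LA] g) y"
  using * J_smult[OF Y, of v "u *[LA] inv[LA] g" a y] gc pi_shift[OF g] by simp
qed (use gc pi_shift[OF g] in "auto intro!: J_in[OF Y] simp: J_add[OF Y]")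
show "A.bijhi n (PX Y) (sh g (PX Y)) (T Y g)"
 unfolding A.bijhi_def
proof (intro ballI impI)
 fix u assume u: "u : carrier LA"
 have "bij_betw (%x. PJ Y (u *[LA] inv[LA] g) (inv_into (dpart Y (\<pi> u)) (PJ Y u) x)) (dpart (PX Y) u) (dpart (sh g (PX Y)) u)"
  using bij_betw_trans[OF bij_betw_inv_into[OF J_bij[OF Y u]], of "PJ Y (u *[LA] inv[LA] g)" "dpart (sh g (PX Y)) u"]
   J_bij[OF Y, of "u *[LA] inv[LA] g"] u gc pi_shift[OF g] by (simp add: comp_def)
 moreover have "T Y g x = PJ Y (u *[LA] inv[LA] g) (inv_into (dpart Y (\<pi> u)) (PJ Y u) x)" if "x : dpart (PX Y) u" for x
  using J_surj[OF Y u that] Tj[OF u] J_bij[OF Y u] by (metis bij_betw_def inv_into_f_eq)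
 ultimately show "bij_betw (T Y g) (dpart (PX Y) u) (dpart (sh g (PX Y)) u)"
  by (subst bij_betw_cong) auto
qed
qed

sublocale act: category_action A.QC "LA(|carrier := N|)" "degree_shift_action U A"
using A.QC_category by (intro category_action.intro category.intro category_action_axioms.intro)
 (auto simp: degree_shift_action_def intro!: A.SF_functor A.LG.inv_closed dest: N(1))

lemma act_ob: "on_ob (degree_shift_action U A g) X = sh g X"
by (simp add: degree_shift_action_def A.SF_ob)

lemma act_hom:
assumes "g : N" "X : Ob A.MC" "Y : Ob A.MC" "A.germ X Y n h"
shows "on_hom (degree_shift_action U A g) X Y (A.R X Y h) = A.R (sh g X) (sh g Y) h"
unfolding degree_shift_action_def by (rule A.shift_R[OF assms(2-)]) (use N[OF assms(1)] in simp)

lemma sh_Ob: "g : N ==> X : Ob A.MC ==> sh g X : Ob A.MC"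
using A.shift_Ob[of X "inv[LA] g"] N(1)[of g] by simp

lemma sh_germ: "g : N ==> A.germ X Y n h ==> A.germ (sh g X) (sh g Y) n h"
using A.shift_germ[of "inv[LA] g" X Y n h] N[of g] N_dA[of g] by (simp add: A.dg_inv)

lemma sh_sh: "g : N ==> h : N ==> sh g (sh h X) = sh (g *[LA] h) X"
using N[of g] N[of h] A.shift_shift[of "inv[LA] g" "inv[LA] h" X] by (simp add: A.LG.inv_mult)

text \<open>Shift functors do not change the underlying functions, so equivariance of a morphism is
  eventual commutation of germs.\<close>

lemma EC_Hom_iff:
assumes X: "X : Ob A.MC" and X': "X' : Ob A.MC" and h: "A.germ X X' n h"
 and a: "!!g. g : N ==> A.germ X (sh g X) n (a g) & \<alpha> g = A.R X (sh g X) (a g)"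
 and b: "!!g. g : N ==> A.germ X' (sh g X') n (b g) & \<beta> g = A.R X' (sh g X') (b g)"
shows "A.R X X' h : Hom act.EC (X, \<alpha>) (X', \<beta>) <-> (ALL g:N. EX m. A.geq X m (%x. b g (h x)) (%x. h (a g x)))"
proof -
have "A.R X X' h : Hom A.QC X X'" using A.QC_Hom[OF X X'] h by blast
moreover have "Comp A.QC X X' (on_ob (degree_shift_action U A g) X') (\<beta> g) (A.R X X' h) =
  Comp A.QC X (on_ob (degree_shift_action U A g) X) (on_ob (degree_shift_action U A g) X')
   (on_hom (degree_shift_action U A g) X X' (A.R X X' h)) (\<alpha> g) <->
  (EX m. A.geq X m (%x. b g (h x)) (%x. h (a g x)))" if g: "g : N" for g
proof -
 have c: "A.germ X (sh g X') n (%x. b g (h x))" using A.germ_comp[OF ObA_gmod[OF X] h] b[OF g] by blast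
 show ?thesis
  unfolding act_ob act_hom[OF g X X' h] conjunct2[OF a[OF g]] conjunct2[OF b[OF g]]
   A.QC_Comp[OF X X' sh_Ob[OF g X'] h conjunct1[OF b[OF g]]]
   A.QC_Comp[OF X sh_Ob[OF g X] sh_Ob[OF g X'] conjunct1[OF a[OF g]] sh_germ[OF g h]]
  by (rule A.R_eq_iff[OF X sh_Ob[OF g X'] c])
qed
ultimately show ?thesis by (simp add: act.EC_Hom)
qed

text \<open>The functor in the cocycle condition acts on germs as the identity, so the condition
  becomes a composition of germs in which \<open>a g\<close> is applied first.\<close>

lemma EC_Ob_iff:
assumes X: "X : Ob A.MC" and a: "!!g. g : N ==> A.germ X (sh g X) n (a g) & \<alpha> g = A.R X (sh g X) (a g)"
shows "(X, \<alpha>) : Ob act.EC <-> \<alpha> : extensional N & (ALL g:N. \<alpha> g : Isos A.QC X (sh g X)) &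
 (ALL g:N. ALL h:N. EX m. A.geq X m (a (g *[LA] h)) (%x. a h (a g x)))"
proof -
have "\<alpha> (g *[LA] h) = Comp A.QC X (sh g X) (sh (g *[LA] h) X)
  (on_hom (degree_shift_action U A g) X (sh h X) (\<alpha> h)) (\<alpha> g) <->
  (EX m. A.geq X m (a (g *[LA] h)) (%x. a h (a g x)))" if g: "g : N" and h: "h : N" for g h
proof -
 have gh: "g *[LA] h : N" using N[OF g] N[OF h] N_I[of "g *[LA] h"] by auto
 have k: "A.germ (sh g X) (sh (g *[LA] h) X) n (a h)" using sh_germ[OF g conjunct1[OF a[OF h]]] sh_sh[OF g h] by simp
 have e: "on_hom (degree_shift_action U A g) X (sh h X) (\<alpha> h) = A.R (sh g X) (sh (g *[LA] h) X) (a h)"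
  using act_hom[OF g X sh_Ob[OF h X] conjunct1[OF a[OF h]]] a[OF h] sh_sh[OF g h] by simp
 show ?thesis
  unfolding e conjunct2[OF a[OF g]] conjunct2[OF a[OF gh]]
   A.QC_Comp[OF X sh_Ob[OF g X] sh_Ob[OF gh X] conjunct1[OF a[OF g]] k]
  by (rule A.R_eq_iff[OF X sh_Ob[OF gh X] conjunct1[OF a[OF gh]]])
qed
thus ?thesis using X by (auto simp: equivariant_objects_def act_ob)
qed

text \<open>A morphism is a class of germs, from which a representative is chosen;
  \<open>Psi_hom\<close> shows that every representative gives the same value.\<close>

definition Psi :: "(('b, 'u, 'm) graded_module, ('b, 'u, 'm) coh_mor,
 ('a, 'u, 'l) graded_module \<times> ('l => ('a, 'u, 'l) coh_mor), ('a, 'u, 'l) coh_mor) cfunctor" where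
"Psi = (|on_ob = (%Y. (PX Y, \<lambda>g\<in>N. A.R (PX Y) (sh g (PX Y)) (T Y g))),
  on_hom = (%Y Y' f. A.R (PX Y) (PX Y') (Ph Y Y' (SOME h. (EX n. B.germ Y Y' n h) & f = B.R Y Y' h)))|)"

lemma Psi_ob: "on_ob Psi Y = (PX Y, \<lambda>g\<in>N. A.R (PX Y) (sh g (PX Y)) (T Y g))"
by (simp add: Psi_def)

lemma Psi_hom:
assumes Y: "Y : Ob B.MC" and Y': "Y' : Ob B.MC" and h: "B.germ Y Y' n h"
shows "on_hom Psi Y Y' (B.R Y Y' h) = A.R (PX Y) (PX Y') (Ph Y Y' h)"
proof -
let ?k = "SOME k. (EX n. B.germ Y Y' n k) & B.R Y Y' h = B.R Y Y' k"
have "(EX n. B.germ Y Y' n ?k) & B.R Y Y' h = B.R Y Y' ?k"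
 using someI[of "%k. (EX n. B.germ Y Y' n k) & B.R Y Y' h = B.R Y Y' k" h] h by blast
then obtain m where m: "B.germ Y Y' m ?k" "B.R Y Y' h = B.R Y Y' ?k" by blast
then obtain r where r: "B.geq Y r h ?k" using B.R_eq_iff[OF Y Y' h] by blast
have "A.geq (PX Y) (max r (max n m)) (Ph Y Y' ?k) (Ph Y Y' h)"
 unfolding A.geq_def
proof (intro ballI impI)
 fix u x assume u: "u : carrier LA" "max r (max n m) <= dA u" "x : dpart (PX Y) u"
 obtain y where "y : dpart Y (\<pi> u)" "x = PJ Y u y" using J_surj[OF Y u(1,3)] .
 thus "Ph Y Y' ?k x = Ph Y Y' h x"
  using B.geqD[OF r, of "\<pi> u" y] u dpi Ph_J[OF Y Y' h, of u y] Ph_J[OF Y Y' m(1), of u y] by simp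
qed
thus ?thesis using A.geq_R[OF PX_Ob[OF Y]] by (simp add: Psi_def)
qed

lemma Psi_Ob: assumes Y: "Y : Ob B.MC" shows "on_ob Psi Y : Ob act.EC"
proof -
have a: "A.germ (PX Y) (sh g (PX Y)) 0 (T Y g) & (\<lambda>g\<in>N. A.R (PX Y) (sh g (PX Y)) (T Y g)) g = A.R (PX Y) (sh g (PX Y)) (T Y g)"
 if "g : N" for g using T_germ[OF Y that] that by simp
have "A.geq (PX Y) 0 (T Y (g *[LA] h)) (%x. T Y h (T Y g x))" if g: "g : N" and h: "h : N" for g h
 unfolding A.geq_def
proof (intro ballI impI)
 fix u x assume u: "u : carrier LA" "x : dpart (PX Y) u"
 have gh: "g *[LA] h : N" and c: "g : carrier LA" "h : carrier LA" using N[OF g] N[OF h] N_I[of "g *[LA] h"] by auto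
 have "u *[LA] inv[LA] (g *[LA] h) = u *[LA] inv[LA] g *[LA] inv[LA] h"
  using c u by (simp add: A.LG.inv_mult A.LG.m_assoc)
 moreover obtain y where "y : dpart Y (\<pi> u)" "x = PJ Y u y" using J_surj[OF Y u(1,2)] .
 ultimately show "T Y (g *[LA] h) x = T Y h (T Y g x)"
  using u c T_J[OF Y g, of u y] T_J[OF Y gh, of u y] T_J[OF Y h, of "u *[LA] inv[LA] g" y] pi_shift[OF g] by simp
qed
moreover have "A.R (PX Y) (sh g (PX Y)) (T Y g) : Isos A.QC (PX Y) (sh g (PX Y))" if g: "g : N" for g
 by (rule A.QC_iso[OF PX_Ob[OF Y] sh_Ob[OF g PX_Ob[OF Y]] T_germ[OF Y g] T_bij[OF Y g]])
ultimately show ?thesis unfolding Psi_ob by (subst EC_Ob_iff[OF PX_Ob[OF Y] a]) auto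
qed

lemma Psi_Hom_iff:
assumes Y: "Y : Ob B.MC" and Y': "Y' : Ob B.MC" and h: "A.germ (PX Y) (PX Y') n h"
shows "A.R (PX Y) (PX Y') h : Hom act.EC (on_ob Psi Y) (on_ob Psi Y') <->
 (ALL g:N. EX m. A.geq (PX Y) m (%x. T Y' g (h x)) (%x. h (T Y g x)))"
unfolding Psi_ob by (rule EC_Hom_iff[OF PX_Ob[OF Y] PX_Ob[OF Y'] h]) (auto simp: T_germ[OF Y] T_germ[OF Y'])

lemma Psi_functor: "is_functor B.QC act.EC Psi"
unfolding is_functor_def
proof (intro conjI ballI)
fix Y Y' :: "('b, 'u, 'm) graded_module" and f assume Y: "Y : Ob B.QC" and Y': "Y' : Ob B.QC" and f: "f : Hom B.QC Y Y'"
hence o: "Y : Ob B.MC" "Y' : Ob B.MC" by auto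
obtain n h where h: "B.germ Y Y' n h" "f = B.R Y Y' h" using f B.QC_Hom[OF o] by blast
have "A.geq (PX Y) n (%x. T Y' g (Ph Y Y' h x)) (%x. Ph Y Y' h (T Y g x))" if g: "g : N" for g
 unfolding A.geq_def
proof (intro ballI impI)
 fix u x assume u: "u : carrier LA" "n <= dA u" "x : dpart (PX Y) u"
 obtain y where y: "y : dpart Y (\<pi> u)" "x = PJ Y u y" using J_surj[OF o(1) u(1,3)] .
 have gc: "inv[LA] g : carrier LA" "dA (inv[LA] g) = 0" using N[OF g] N_dA[OF g] by (auto simp: A.dg_inv)
 have "h y : dpart Y' (\<pi> u)" using B.germD(1)[OF h(1), of "\<pi> u" y] y u dpi by simp
 thus "T Y' g (Ph Y Y' h x) = Ph Y Y' h (T Y g x)"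
  using y u gc pi_shift[OF g u(1)] Ph_J[OF o h(1), of "u *[LA] inv[LA] g" y]
  by (simp add: Ph_J[OF o h(1)] T_J[OF o(1) g] T_J[OF o(2) g] A.dg_add)
qed
thus "on_hom Psi Y Y' f : Hom act.EC (on_ob Psi Y) (on_ob Psi Y')"
 unfolding h(2) Psi_hom[OF o h(1)] Psi_Hom_iff[OF o Ph_germ[OF o h(1)]] by blast
fix Y'' :: "('b, 'u, 'm) graded_module" and f' assume "Y'' : Ob B.QC" and f': "f' : Hom B.QC Y' Y''"
hence o': "Y'' : Ob B.MC" by auto
obtain m k where k: "B.germ Y' Y'' m k" "f' = B.R Y' Y'' k" using f' B.QC_Hom[OF o(2) o'] by blast
have c: "B.germ Y Y'' (max n m) (%x. k (h x))"
 by (rule B.germ_comp[OF ObB_gmod[OF o(1)] B.germ_mono[OF h(1)] B.germ_mono[OF k(1)]]) auto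
have "A.geq (PX Y) (max n m) (Ph Y Y'' (%x. k (h x))) (%x. Ph Y' Y'' k (Ph Y Y' h x))"
 unfolding A.geq_def
proof (intro ballI impI)
 fix u x assume u: "u : carrier LA" "max n m <= dA u" "x : dpart (PX Y) u"
 obtain y where y: "y : dpart Y (\<pi> u)" "x = PJ Y u y" using J_surj[OF o(1) u(1,3)] .
 have "h y : dpart Y' (\<pi> u)" using B.germD(1)[OF h(1), of "\<pi> u" y] y u dpi by simp
 thus "Ph Y Y'' (%x. k (h x)) x = Ph Y' Y'' k (Ph Y Y' h x)"
  using y u by (simp add: Ph_J[OF o h(1)] Ph_J[OF o(2) o' k(1)] Ph_J[OF o(1) o' c])
qed
thus "on_hom Psi Y Y'' (Comp B.QC Y Y' Y'' f' f) = Comp act.EC (on_ob Psi Y) (on_ob Psi Y') (on_ob Psi Y'') (on_hom Psi Y' Y'' f') (on_hom Psi Y Y' f)"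
 unfolding h(2) k(2) B.QC_Comp[OF o o' h(1) k(1)] Psi_hom[OF o h(1)] Psi_hom[OF o(2) o' k(1)] Psi_hom[OF o(1) o' c] Psi_ob act.EC_Comp
  A.QC_Comp[OF PX_Ob[OF o(1)] PX_Ob[OF o(2)] PX_Ob[OF o'] Ph_germ[OF o h(1)] Ph_germ[OF o(2) o' k(1)]]
 by (rule A.geq_R[OF PX_Ob[OF o(1)]])
next
fix Y :: "('b, 'u, 'm) graded_module" assume "Y : Ob B.QC"
hence o: "Y : Ob B.MC" by simp
note i = B.germ_id[OF ObB_gmod[OF o], of 0]
have "A.geq (PX Y) 0 (Ph Y Y (%x. x)) (%x. x)"
 unfolding A.geq_def
proof (intro ballI impI)
 fix u x assume u: "u : carrier LA" "0 <= dA u" "x : dpart (PX Y) u"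
 thus "Ph Y Y (%x. x) x = x" using J_surj[OF o u(1,3)] Ph_J[OF o o i u(1,2)] by metis
qed
thus "on_hom Psi Y Y (Ident B.QC Y) = Ident act.EC (on_ob Psi Y)"
 unfolding B.QC_Ident[OF o] Psi_hom[OF o o i] Psi_ob act.EC_Ident A.QC_Ident[OF PX_Ob[OF o]]
 by (rule A.geq_R[OF PX_Ob[OF o]])
qed (auto intro: Psi_Ob)

end

section \<open>The pull-back functor is fully faithful\<close>

context gpair
begin

definition Im :: "'m set" where "Im = \<pi> ` carrier LA"

lemma Im_subgroup: "subgroup Im LB"
unfolding Im_def by (rule pi.img_is_subgroup)

lemma Im_carrier: "b : Im ==> b : carrier LB"
and Im_mult: "b : Im ==> c : Im ==> b *[LB] c : Im"
and Im_inv: "b : Im ==> inv[LB] b : Im"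
and Im_pi: "u : carrier LA ==> \<pi> u : Im"
using Im_subgroup by (auto simp: subgroup_def Im_def)

lemma Im_cancel: "c : carrier LB ==> b : Im ==> c *[LB] b : Im ==> c : Im"
using Im_mult[OF _ Im_inv, of "c *[LB] b" b] Im_carrier[of b] by (simp add: B.LG.m_assoc)

text \<open>By \<open>ideal\<close> every scalar of high degree is a sum of products
  \<open>s t\<close> with \<open>t\<close> leading from \<open>b\<close> into the image of \<pi>.
  Hence such a \<open>y\<close> is killed by all scalars of high degree, and
  \<open>torsion_bounded\<close> applies.\<close>

lemma sep:
assumes Y: "Y : Ob B.MC"
obtains n where "!!b y m. b : carrier LB ==> n <= dB b ==> y : dpart Y b ==>
 (!!c t. c : carrier LB ==> c *[LB] b : Im ==> m <= dB c ==> t : cmp B c ==> t .[Y] y = 0[Y]) ==> y = 0[Y]"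
proof -
have g: "B.gmod Y" "B.fg Y" using Y B.Ob_mod_cat by auto
interpret Y: module B Y using g B.gmod_module by blast
obtain n where n: "!!l m k. l : carrier LB ==> n <= dB l ==> m : dpart Y l ==>
 (!!a s. a : carrier LB ==> k <= dB a ==> s : cmp B a ==> s .[Y] m = 0[Y]) ==> m = 0[Y]"
 using B.torsion_bounded[OF g] by blast
show ?thesis
proof (rule that)
 fix b y m assume b: "b : carrier LB" "n <= dB b" "y : dpart Y b"
  and z: "!!c t. c : carrier LB ==> c *[LB] b : Im ==> m <= dB c ==> t : cmp B c ==> t .[Y] y = 0[Y]"
 have y: "y : carrier Y" using B.gmod_carrier[OF g(1) b(1,3)] .
 let ?Z = "%a. {s *[B] t | s t c d. c : carrier LB & d : carrier LB &
   c *[LB] b : Im & m <= dB c & 0 <= dB d & d *[LB] c = a & s : cmp B d & t : cmp B c}"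
 obtain k where k: "!!a. a : carrier LB ==> k <= dB a ==> cmp B a <= acl B (?Z a)"
  using ideal[OF b(1), of m] unfolding Im_def by blast
 show "y = 0[Y]"
 proof (rule n[OF b])
  fix a s assume a: "a : carrier LB" "k <= dB a" "s : cmp B a"
  \<comment> \<open>The closure of the empty set is zero alone, so \<open>smult_acl\<close> here
    proves vanishing.\<close>
  have "s .[Y] y : acl Y {}"
  proof (rule Y.smult_acl[OF subsetD[OF k[OF a(1,2)] a(3)] _ y])
   show "?Z a <= carrier B" using B.comp_carrier by blast
   fix z' assume "z' : ?Z a"
   then obtain s t c d where st: "z' = s *[B] t" "c : carrier LB" "d : carrier LB" "c *[LB] b : Im" "m <= dB c"
    "s : cmp B d" "t : cmp B c" by blast
   hence "z' .[Y] y = 0[Y]"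
    using y z[OF st(2,4,5,7)] B.comp_carrier by (simp add: Y.smult_assoc1 Y.smult_r_null)
   thus "z' .[Y] y : acl Y {}" by (simp add: acl.acl_zero)
  qed simp
  thus "s .[Y] y = 0[Y]" by (cases) auto
 qed
qed
qed

text \<open>Dual to \<open>sep\<close>: a scalar of high degree acting on a generator of degree
  \<open>l\<close> passes through a degree in the image of \<pi>. The bound \<open>m - dB l\<close>
  in \<open>?Z\<close> puts that intermediate degree above \<open>m\<close>, and finitely many
  generators allow a common \<open>n\<close>.\<close>

lemma gen:
assumes Y: "Y : Ob B.MC"
obtains n where "!!b. b : carrier LB ==> n <= dB b ==> dpart Y b<=
 acl Y {s .[Y] y | s y c d. d : carrier LB & 0 <= dB d & c : Im & m <= dB c & d *[LB] c = b &
  s : cmp B d & y : dpart Y c}"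
proof -
have g: "B.gmod Y" "B.fg Y" using Y B.Ob_mod_cat by auto
interpret Y: module B Y using g B.gmod_module by blast
obtain B0 where B0: "finite B0" "!!b c. (b, c) : B0 ==> c : carrier LB & b : dpart Y c"
 "!!l m. l : carrier LB ==> m : dpart Y l ==>
  m : acl Y {s .[Y] b | s b a c. (b, c) : B0 & a : carrier LB & s : cmp B a & a *[LB] c = l}"
 using B.fg_homog[OF g] by blast
let ?Z = "%l a. {s *[B] t | s t c d. c : carrier LB & d : carrier LB &
   c *[LB] l : Im & m - dB l <= dB c & 0 <= dB d & d *[LB] c = a & s : cmp B d & t : cmp B c}"
have "ALL l:carrier LB. EX k. ALL a:carrier LB. k <= dB a --> cmp B a <= acl B (?Z l a)"
 using ideal unfolding Im_def by simp
from bchoice[OF this] obtain k where k: "!!l a. l : carrier LB ==> a : carrier LB ==> k l <= dB a ==> cmp B a <= acl B (?Z l a)"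
 by auto
define n where "n = Max (insert 0 ((%(b, c). k c + dB c) ` B0))"
have n: "k c + dB c <= n" if "(b, c) : B0" for b c
 unfolding n_def using B0(1) imageI[OF that, of "%(b, c). k c + dB c"] by (intro Max_ge) auto
show ?thesis
proof (rule that[of n])
 fix b assume b: "b : carrier LB" "n <= dB b"
 let ?W = "{s .[Y] y | s y c d. d : carrier LB & 0 <= dB d & c : Im & m <= dB c & d *[LB] c = b &
  s : cmp B d & y : dpart Y c}"
 have "s .[Y] y : carrier Y" if "d : carrier LB" "c : Im" "s : cmp B d" "y : dpart Y c" for s y c d
  using B.comp_carrier[OF that(1,3)] B.gmod_carrier[OF g(1) Im_carrier[OF that(2)] that(4)] by simp
 hence W: "?W <= carrier Y" by blast
 have "acl Y {s .[Y] b' | s b' a c. (b', c) : B0 & a : carrier LB & s : cmp B a & a *[LB] c = b} <= acl Y ?W"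
 proof (rule Y.M.acl_subI[OF _ W], clarify)
  fix s b' a c assume b': "(b', c) : B0" and a: "a : carrier LB" "s : cmp B a" "b = a *[LB] c"
  note c = B0(2)[OF b']
  have bY: "b' : carrier Y" using c B.gmod_carrier[OF g(1)] by blast
  have ka: "k c <= dB a" using n[OF b'] b a c by (simp add: B.dg_add)
  show "s .[Y] b' : acl Y {s .[Y] y | s y ca d. d : carrier LB & 0 <= dB d & ca : Im & m <= dB ca &
   d *[LB] ca = a *[LB] c & s : cmp B d & y : dpart Y ca}"
   unfolding a(3)[symmetric]
  proof (rule Y.smult_acl[OF subsetD[OF k[OF conjunct1[OF c] a(1) ka] a(2)] _ bY W])
   show "?Z c a <= carrier B" using B.comp_carrier by blast
   fix z assume "z : ?Z c a"
   then obtain s t e d where st: "z = s *[B] t" "e : carrier LB" "d : carrier LB" "e *[LB] c : Im" "m - dB c <= dB e"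
    "0 <= dB d" "d *[LB] e = a" "s : cmp B d" "t : cmp B e" by blast
   have "z .[Y] b' = s .[Y] (t .[Y] b')" using st bY B.comp_carrier by (simp add: Y.smult_assoc1)
   moreover have "t .[Y] b' : dpart Y (e *[LB] c)" using B.gmod_act[OF g(1)] st c by blast
   moreover have "m <= dB (e *[LB] c)" "d *[LB] (e *[LB] c) = b" using st c a(3) by (simp_all add: B.dg_add flip: B.LG.m_assoc)
   ultimately have "z .[Y] b' : ?W" using st by blast
   thus "z .[Y] b' : acl Y ?W" by (rule Y.M.acl_base[OF W])
  qed
 qed
 thus "dpart Y b <= acl Y ?W" using B0(3)[OF b(1)] by blast
qed
qed

text \<open>Equality after pull-back gives equality in the degrees from the image of \<pi>. It
  spreads to all high degrees by \<open>sep\<close>, since the multiples of \<open>h y - k y\<close>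
  that land in the image vanish.\<close>

lemma faithful:
assumes Y: "Y : Ob B.MC" and Y': "Y' : Ob B.MC" and h: "B.germ Y Y' n h" and k: "B.germ Y Y' n k"
 and eq: "A.geq (PX Y) n (Ph Y Y' h) (Ph Y Y' k)"
shows "EX m. B.geq Y m h k"
proof -
note gY = ObB_gmod[OF Y] and gY' = ObB_gmod[OF Y']
interpret Y: module B Y using gY B.gmod_module by blast
interpret Y': module B Y' using gY' B.gmod_module by blast
obtain r where r: "!!b y m. b : carrier LB ==> r <= dB b ==> y : dpart Y' b ==>
 (!!c t. c : carrier LB ==> c *[LB] b : Im ==> m <= dB c ==> t : cmp B c ==> t .[Y'] y = 0[Y']) ==> y = 0[Y']"
 using sep[OF Y'] by blast
have e: "h y = k y" if b: "b : Im" "n <= dB b" "y : dpart Y b" for b y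
proof -
 obtain u where u: "u : carrier LA" "b = \<pi> u" using b by (auto simp: Im_def)
 have "PJ Y' u (h y) = PJ Y' u (k y)"
  using A.geqD[OF eq u(1), of "PJ Y u y"] b u dpi Ph_J[OF Y Y' h u(1)] Ph_J[OF Y Y' k u(1)] J_in[OF Y u(1)] by simp
 moreover have "h y : dpart Y' b" "k y : dpart Y' b"
  using B.germD(1)[OF h] B.germD(1)[OF k] b Im_carrier by auto
 ultimately show ?thesis using J_bij[OF Y' u(1)] u(2) by (auto simp: bij_betw_def inj_on_def)
qed
have "B.geq Y (max n r) h k"
 unfolding B.geq_def
proof (intro ballI impI)
 fix b y assume b: "b : carrier LB" "max n r <= dB b" "y : dpart Y b"
 have hk: "h y : dpart Y' b" "k y : dpart Y' b"
  using B.germD(1)[OF h b(1)] B.germD(1)[OF k b(1)] b by auto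
 hence c: "h y : carrier Y'" "k y : carrier Y'" using B.gmod_carrier[OF gY' b(1)] by auto
 have "h y -[Y'] k y = 0[Y']"
 proof (rule r[OF b(1)])
  show "r <= dB b" using b by simp
  show "h y -[Y'] k y : dpart Y' b" using B.part_facts[OF gY' b(1)] hk by (simp add: a_minus_def)
  fix d t assume d: "d : carrier LB" "d *[LB] b : Im" "0 <= dB d" "t : cmp B d"
  have "h (t .[Y] y) = k (t .[Y] y)"
   using d b by (intro e[OF d(2)] B.gmod_act[OF gY]) (auto simp: B.dg_add)
  hence "t .[Y'] h y = t .[Y'] k y"
   using B.germD(3)[OF h b(1) _ d(1,3,4)] B.germD(3)[OF k b(1) _ d(1,3,4)] b by simp
  thus "t .[Y'] (h y -[Y'] k y) = 0[Y']"
   using c B.comp_carrier[OF d(1,4)] by (simp add: a_minus_def Y'.smult_r_distr Y'.smult_r_minus Y'.M.r_neg)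
 qed
 thus "h y = k y" using Y'.M.diff_zero[OF c] by blast
qed
thus ?thesis by blast
qed

text \<open>The value at \<open>y\<close> is pinned down by its multiples that land in the image of
  \<pi>; this is the relation \<open>P b y y'\<close>. Existence holds because \<open>gen\<close>
  reaches \<open>y\<close> from such degrees, uniqueness by \<open>sep\<close>, and additivity and
  linearity follow from uniqueness.\<close>

lemma extend:
fixes Y Y' :: "('b, 'u, 'm) graded_module"
assumes Y: "Y : Ob B.MC" and Y': "Y' : Ob B.MC"
 and H_in: "!!b y. b : Im ==> m <= dB b ==> y : dpart Y b ==> H b y : dpart Y' b"
 and H_add: "!!b y z. b : Im ==> m <= dB b ==> y : dpart Y b ==> z : dpart Y b ==> H b (y +[Y] z) = H b y +[Y'] H b z"
 and H_smult: "!!b y e s. b : Im ==> m <= dB b ==> y : dpart Y b ==> e : Im ==> 0 <= dB e ==> s : cmp B e ==>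
  H (e *[LB] b) (s .[Y] y) = s .[Y'] H b y"
obtains n h where "m <= n" "B.germ Y Y' n h" "!!b y. b : Im ==> n <= dB b ==> y : dpart Y b ==> h y = H b y"
proof -
note gY = ObB_gmod[OF Y] and gY' = ObB_gmod[OF Y']
interpret Y: module B Y using gY B.gmod_module by blast
interpret Y': module B Y' using gY' B.gmod_module by blast
obtain r where r: "!!b y m. b : carrier LB ==> r <= dB b ==> y : dpart Y' b ==>
 (!!c t. c : carrier LB ==> c *[LB] b : Im ==> m <= dB c ==> t : cmp B c ==> t .[Y'] y = 0[Y']) ==> y = 0[Y']"
 using sep[OF Y'] by blast
let ?W = "%b. {s .[Y] y | s y c d. d : carrier LB & 0 <= dB d & c : Im & m <= dB c & d *[LB] c = b &
  s : cmp B d & y : dpart Y c}"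
obtain q where q: "!!b. b : carrier LB ==> q <= dB b ==> dpart Y b <= acl Y (?W b)"
 using gen[OF Y, of m] by blast
define n where "n = max m (max q r)"
define P where "P b y y' <-> y' : dpart Y' b & (ALL c:carrier LB. 0 <= dB c --> c *[LB] b : Im -->
  (ALL t:cmp B c. t .[Y'] y' = H (c *[LB] b) (t .[Y] y)))" for b y y'
have Yc: "y : carrier Y" if "b : carrier LB" "y : dpart Y b" for b y using B.gmod_carrier[OF gY that] .
have Yc': "y : carrier Y'" if "b : carrier LB" "y : dpart Y' b" for b y using B.gmod_carrier[OF gY' that] .
have H0: "H b 0[Y] = 0[Y']" if b: "b : Im" "m <= dB b" for b
proof -
 have z: "0[Y] : dpart Y b" using B.part_facts(2)[OF gY Im_carrier[OF b(1)]] .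
 show ?thesis using H_add[OF b z z] Yc'[OF Im_carrier[OF b(1)] H_in[OF b z]]
  by (intro Y'.M.double_zero) auto
qed
have P_add: "P b (y +[Y] z) (y' +[Y'] z')"
 if b: "b : carrier LB" "m <= dB b" and y: "y : dpart Y b" "z : dpart Y b" and p: "P b y y'" "P b z z'" for b y z y' z'
 unfolding P_def
proof (intro conjI ballI impI)
 have pp: "y' : dpart Y' b" "z' : dpart Y' b" using p by (auto simp: P_def)
 thus "y' +[Y'] z' : dpart Y' b" using B.part_facts(3)[OF gY' b(1)] by blast
 fix c t assume c: "c : carrier LB" "0 <= dB c" "c *[LB] b : Im" "t : cmp B c"
 have "t .[Y] y : dpart Y (c *[LB] b)" "t .[Y] z : dpart Y (c *[LB] b)"
  using B.gmod_act[OF gY c(1) b(1) c(4)] y by auto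
 thus "t .[Y'] (y' +[Y'] z') = H (c *[LB] b) (t .[Y] (y +[Y] z))"
  using p c b y B.comp_carrier[OF c(1,4)] Yc[OF b(1)] Yc'[OF b(1)] pp H_add[OF c(3)]
  by (simp add: P_def Y.smult_r_distr Y'.smult_r_distr B.dg_add)
qed
have P_ex: "EX y'. P b y y'" if b: "b : carrier LB" "n <= dB b" "y : dpart Y b" for b y
proof -
 have mb: "m <= dB b" using b by (simp add: n_def)
 have Wb: "x : dpart Y b" if "x : ?W b" for x using that B.gmod_act[OF gY] Im_carrier by blast
 have "y : acl Y (?W b)" using q[OF b(1)] b by (auto simp: n_def)
 hence "y : dpart Y b & (EX y'. P b y y')"
 proof induction
  case acl_zero
  have "P b 0[Y] 0[Y']"
   unfolding P_def using B.part_facts(2)[OF gY' b(1)] H0 mb B.comp_carrier by (simp add: B.dg_add b(1) Y.smult_r_null Y'.smult_r_null)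
  thus ?case using B.part_facts(2)[OF gY b(1)] by blast
 next
  case (acl_add x z)
  then obtain s y0 c d where x: "x = s .[Y] y0" "d : carrier LB" "0 <= dB d" "c : Im" "m <= dB c" "d *[LB] c = b"
   "s : cmp B d" "y0 : dpart Y c" by blast
  note cc = Im_carrier[OF x(4)] and h0 = H_in[OF x(4,5,8)]
  have "P b x (s .[Y'] H c y0)"
   unfolding P_def
  proof (intro conjI ballI impI)
   show "s .[Y'] H c y0 : dpart Y' b" using B.gmod_act[OF gY' x(2) cc x(7) h0] x(6) by simp
   fix e t assume e: "e : carrier LB" "0 <= dB e" "e *[LB] b : Im" "t : cmp B e"
   \<comment> \<open>Reassociating makes \<open>t s\<close> a scalar leading from one degree of the
     image to another, the only kind that \<open>H_smult\<close> covers.\<close>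
   have a: "e *[LB] b = (e *[LB] d) *[LB] c" using e x(2,6) cc by (simp add: B.LG.m_assoc)
   have ed: "e *[LB] d : Im" using Im_cancel[OF _ x(4), of "e *[LB] d"] a e x by simp
   have tc: "t : carrier B" "s : carrier B" using B.comp_carrier e x by auto
   have "t .[Y'] (s .[Y'] H c y0) = (t *[B] s) .[Y'] H c y0" using tc Yc'[OF cc h0] by (simp add: Y'.smult_assoc1)
   also have "... = H ((e *[LB] d) *[LB] c) ((t *[B] s) .[Y] y0)"
    using e x by (intro H_smult[OF x(4,5,8) ed, symmetric]) (auto simp: B.dg_add intro: B.comp_mult)
   also have "... = H (e *[LB] b) (t .[Y] x)" using tc Yc[OF cc x(8)] by (simp add: a x(1) Y.smult_assoc1)
   finally show "t .[Y'] (s .[Y'] H c y0) = H (e *[LB] b) (t .[Y] x)" .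
  qed
  thus ?case
   using acl_add.IH P_add[OF b(1) mb Wb[OF acl_add.hyps(1)]] B.part_facts(3)[OF gY b(1) Wb[OF acl_add.hyps(1)]] by blast
 qed
 thus ?thesis by blast
qed
have P_uniq: "y' = y''" if b: "b : carrier LB" "n <= dB b" and p: "P b y y'" "P b y y''" for b y y' y''
proof -
 have pp: "y' : dpart Y' b" "y'' : dpart Y' b" using p by (auto simp: P_def)
 note c = Yc'[OF b(1) pp(1)] Yc'[OF b(1) pp(2)]
 have "y' -[Y'] y'' = 0[Y']"
 proof (rule r[OF b(1)])
  show "r <= dB b" using b by (simp add: n_def)
  show "y' -[Y'] y'' : dpart Y' b" using B.part_facts[OF gY' b(1)] pp by (simp add: a_minus_def)
  fix d t assume d: "d : carrier LB" "d *[LB] b : Im" "0 <= dB d" "t : cmp B d"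
  hence "t .[Y'] y' = t .[Y'] y''" using p by (simp add: P_def)
  thus "t .[Y'] (y' -[Y'] y'') = 0[Y']"
   using c B.comp_carrier[OF d(1,4)] by (simp add: a_minus_def Y'.smult_r_distr Y'.smult_r_minus Y'.M.r_neg)
 qed
 thus ?thesis using Y'.M.diff_zero[OF c] by blast
qed
define K where "K b y = (THE y'. P b y y')" for b y
have K: "P b y (K b y)" if "b : carrier LB" "n <= dB b" "y : dpart Y b" for b y
 unfolding K_def using P_ex[OF that] P_uniq[OF that(1,2)] by (metis theI')
have K_eq: "K b y = y'" if "b : carrier LB" "n <= dB b" "y : dpart Y b" "P b y y'" for b y y'
 using P_uniq[OF that(1,2) K[OF that(1-3)] that(4)] .
have K_in: "K b y : dpart Y' b" if "b : carrier LB" "n <= dB b" "y : dpart Y b" for b y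
 using K[OF that] by (simp add: P_def)
have K_add: "K b (y +[Y] z) = K b y +[Y'] K b z"
 if "b : carrier LB" "n <= dB b" "y : dpart Y b" "z : dpart Y b" for b y z
 using that B.part_facts(3)[OF gY] by (intro K_eq P_add K) (auto simp: n_def)
have K0: "K b 0[Y] = 0[Y']" if b: "b : carrier LB" "n <= dB b" for b
proof -
 have z: "0[Y] : dpart Y b" using B.part_facts(2)[OF gY b(1)] .
 show ?thesis using K_add[OF b z z] Yc'[OF b(1) K_in[OF b z]]
  by (intro Y'.M.double_zero) auto
qed
define h where "h = B.glue Y Y' K"
have h: "h y = K b y" if "b : carrier LB" "n <= dB b" "y : dpart Y b" for b y
 unfolding h_def by (rule B.glue[where k = K and Y = Y', OF gY that(1,3) K0[OF that(1,2)]])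
show ?thesis
proof (rule that[of n h])
 show "m <= n" by (simp add: n_def)
 show "B.germ Y Y' n h"
 proof (rule B.germI)
  fix b y assume b: "b : carrier LB" "n <= dB b" "y : dpart Y b"
  show "h y : dpart Y' b" using K_in[OF b] by (simp add: h[OF b])
  show "h (y +[Y] z) = h y +[Y'] h z" if z: "z : dpart Y b" for z
   using K_add[OF b z] h[OF b(1,2)] b z B.part_facts(3)[OF gY b(1)] by simp
  fix a s assume a: "a : carrier LB" "0 <= dB a" "s : cmp B a"
  have ab: "a *[LB] b : carrier LB" "n <= dB (a *[LB] b)" "s .[Y] y : dpart Y (a *[LB] b)"
   using a b B.gmod_act[OF gY] by (auto simp: B.dg_add)
  have "P (a *[LB] b) (s .[Y] y) (s .[Y'] K b y)"
   unfolding P_def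
  proof (intro conjI ballI impI)
   show "s .[Y'] K b y : dpart Y' (a *[LB] b)" using B.gmod_act[OF gY' a(1) b(1) a(3) K_in[OF b]] .
   fix c t assume c: "c : carrier LB" "0 <= dB c" "c *[LB] (a *[LB] b) : Im" "t : cmp B c"
   have tc: "t : carrier B" "s : carrier B" using B.comp_carrier a c by auto
   have ts: "t *[B] s : cmp B (c *[LB] a)" using a c B.comp_mult by blast
   have "(t *[B] s) .[Y'] K b y = H (c *[LB] a *[LB] b) ((t *[B] s) .[Y] y)"
    using conjunct2[OF K[OF b, unfolded P_def], rule_format, of "c *[LB] a" "t *[B] s"] ts a c b(1)
    by (simp add: B.dg_add B.LG.m_assoc)
   thus "t .[Y'] (s .[Y'] K b y) = H (c *[LB] (a *[LB] b)) (t .[Y] (s .[Y] y))"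
    using tc Yc[OF b(1,3)] Yc'[OF b(1) K_in[OF b]] a c b(1) by (simp add: Y.smult_assoc1 Y'.smult_assoc1 B.LG.m_assoc)
  qed
  thus "h (s .[Y] y) = s .[Y'] h y" using K_eq[OF ab] h[OF ab] h[OF b] by simp
 qed
 fix b y assume b: "b : Im" "n <= dB b" "y : dpart Y b"
 have mb: "m <= dB b" using b by (simp add: n_def)
 note bc = Im_carrier[OF b(1)]
 have "P b y (H b y)"
  unfolding P_def using H_in[OF b(1) mb b(3)] H_smult[OF b(1) mb b(3)] Im_cancel[OF _ b(1)] by auto
 thus "h y = H b y" using K_eq[OF bc b(2,3)] h[OF bc b(2,3)] by simp
qed
qed

end

section \<open>Fullness and bijectivity on morphisms\<close>

context gpair
begin

text \<open>The map \<open>k u\<close> must depend on \<open>\<pi> u\<close> only, which is what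
  commuting with \<open>T\<close> says. This also makes \<open>k\<close> linear over all of
  \<open>B_(\<pi> v)\<close>, whose elements are sums of \<open>\<phi> a\<close> with
  \<open>a\<close> in different degrees over \<open>\<pi> v\<close>.\<close>

lemma full:
assumes Y: "Y : Ob B.MC" and Y': "Y' : Ob B.MC" and g: "A.germ (PX Y) (PX Y') n g"
 and eq: "!!x. x : N ==> A.geq (PX Y) n (%z. T Y' x (g z)) (%z. g (T Y x z))"
obtains m h where "B.germ Y Y' m h" "A.geq (PX Y) m (Ph Y Y' h) g"
proof -
note gY = ObB_gmod[OF Y] and gY' = ObB_gmod[OF Y']
interpret Y: module B Y using gY B.gmod_module by blast
interpret Y': module B Y' using gY' B.gmod_module by blast
define k where "k u y = inv_into (dpart Y' (\<pi> u)) (PJ Y' u) (g (PJ Y u y))" for u y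
have k: "k u y : dpart Y' (\<pi> u)" "PJ Y' u (k u y) = g (PJ Y u y)"
 if u: "u : carrier LA" "n <= dA u" "y : dpart Y (\<pi> u)" for u y
proof -
 have "g (PJ Y u y) : PJ Y' u ` dpart Y' (\<pi> u)"
  using A.germD(1)[OF g u(1,2) J_in[OF Y u(1,3)]] J_bij[OF Y' u(1)] by (simp add: bij_betw_def)
 thus "k u y : dpart Y' (\<pi> u)" "PJ Y' u (k u y) = g (PJ Y u y)"
  unfolding k_def by (rule inv_into_into, rule f_inv_into_f)
qed
have inj: "y = z" if "u : carrier LA" "y : dpart Y' (\<pi> u)" "z : dpart Y' (\<pi> u)" "PJ Y' u y = PJ Y' u z" for u y z
 using J_bij[OF Y' that(1)] that(2-) by (auto simp: bij_betw_def inj_on_def)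
have ind: "k u' y = k u y" if u: "u : carrier LA" "u' : carrier LA" "\<pi> u' = \<pi> u" "n <= dA u" "y : dpart Y (\<pi> u)" for u u' y
proof -
 \<comment> \<open>Two degrees with the same image differ by an element of the kernel, and
   \<open>T\<close> for this element moves degree \<open>u'\<close> to degree
   \<open>u\<close>.\<close>
 define x where "x = inv[LA] u *[LA] u'"
 have x: "x : N" using u by (intro N_I) (auto simp: x_def pi.hom_inv)
 have ux: "u' *[LA] inv[LA] x = u" using u by (simp add: x_def A.LG.inv_mult_group flip: A.LG.m_assoc)
 have n': "n <= dA u'" using u dpi[of u] dpi[of u'] by simp
 have y': "y : dpart Y (\<pi> u')" using u by simp
 note k' = k[OF u(2) n' y'] and kk = k[OF u(1,4,5)]
 have "PJ Y' u (k u' y) = T Y' x (PJ Y' u' (k u' y))" using T_J[OF Y' x u(2) k'(1)] ux by simp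
 also have "... = g (T Y x (PJ Y u' y))" using k'(2) A.geqD[OF eq[OF x] u(2) n' J_in[OF Y u(2) y']] by simp
 also have "... = PJ Y' u (k u y)" using T_J[OF Y x u(2) y'] ux kk by simp
 finally show ?thesis using k'(1) u kk by (elim inj[OF u(1), rotated -1]) auto
qed
have k_add: "k u (y +[Y] z) = k u y +[Y'] k u z"
 if u: "u : carrier LA" "n <= dA u" "y : dpart Y (\<pi> u)" "z : dpart Y (\<pi> u)" for u y z
proof (rule inj[OF u(1)])
 have yz: "y +[Y] z : dpart Y (\<pi> u)" using B.part_facts(3)[OF gY _ u(3,4)] u by simp
 thus "k u (y +[Y] z) : dpart Y' (\<pi> u)" using k u by simp
 show "k u y +[Y'] k u z : dpart Y' (\<pi> u)" using k u B.part_facts(3)[OF gY'] by simp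
 show "PJ Y' u (k u (y +[Y] z)) = PJ Y' u (k u y +[Y'] k u z)"
  using u k yz A.germD(2)[OF g u(1,2)] by (simp add: J_add[OF Y'] J_add[OF Y] J_in[OF Y])
qed
have k_phi: "k (v *[LA] u) (\<phi> a .[Y] y) = \<phi> a .[Y'] k u y"
 if u: "u : carrier LA" "n <= dA u" "y : dpart Y (\<pi> u)" and v: "v : carrier LA" "0 <= dA v" "a : cmp A v" for u v a y
proof (rule inj[of "v *[LA] u"])
 have ay: "\<phi> a .[Y] y : dpart Y (\<pi> (v *[LA] u))"
  using B.gmod_act[OF gY, of "\<pi> v" "\<pi> u" "\<phi> a" y] u v phi_comp by simp
 thus "k (v *[LA] u) (\<phi> a .[Y] y) : dpart Y' (\<pi> (v *[LA] u))" using u v by (intro k) (auto simp: A.dg_add)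
 show "\<phi> a .[Y'] k u y : dpart Y' (\<pi> (v *[LA] u))"
  using B.gmod_act[OF gY', of "\<pi> v" "\<pi> u" "\<phi> a" "k u y"] u v phi_comp k by simp
 have "PJ Y' (v *[LA] u) (k (v *[LA] u) (\<phi> a .[Y] y)) = g (PJ Y (v *[LA] u) (\<phi> a .[Y] y))"
  using u v ay by (intro k) (auto simp: A.dg_add)
 also have "... = a .[PX Y'] g (PJ Y u y)" using u v A.germD(3)[OF g u(1,2) v J_in[OF Y u(1,3)]] by (simp add: J_smult[OF Y])
 also have "... = PJ Y' (v *[LA] u) (\<phi> a .[Y'] k u y)" using u v k by (simp add: J_smult[OF Y'])
 finally show "PJ Y' (v *[LA] u) (k (v *[LA] u) (\<phi> a .[Y] y)) = PJ Y' (v *[LA] u) (\<phi> a .[Y'] k u y)" .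
qed (use u v in simp)
have k0: "k u 0[Y] = 0[Y']" if u: "u : carrier LA" "n <= dA u" for u
proof -
 have z: "0[Y] : dpart Y (\<pi> u)" using B.part_facts(2)[OF gY] u by simp
 show ?thesis using k_add[OF u z z] B.gmod_carrier[OF gY' pi.hom_closed[OF u(1)] k(1)[OF u z]] by (intro Y'.M.double_zero) auto
qed
have k_smult: "k (v *[LA] u) (s .[Y] y) = s .[Y'] k u y"
 if u: "u : carrier LA" "n <= dA u" "y : dpart Y (\<pi> u)" and v: "v : carrier LA" "0 <= dA v" "s : cmp B (\<pi> v)" for u v s y
proof -
 have vu: "v *[LA] u : carrier LA" "n <= dA (v *[LA] u)" using u v by (auto simp: A.dg_add)
 have yc: "y : carrier Y" "k u y : carrier Y'" using B.gmod_carrier[OF gY pi.hom_closed[OF u(1)] u(3)] B.gmod_carrier[OF gY' pi.hom_closed[OF u(1)] k(1)[OF u]] .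
 have "s : acl B {\<phi> a |a va. va : carrier LA & \<pi> va = \<pi> v & a : cmp A va}" using dec[OF v(1)] v(3) by blast
 hence "s : cmp B (\<pi> v) & k (v *[LA] u) (s .[Y] y) = s .[Y'] k u y"
 proof induction
  case acl_zero
  show ?case using yc k0[OF vu] additive_subgroup.zero_closed[OF B.comp_sub[of "\<pi> v"]] v by simp
 next
  case (acl_add x z)
  then obtain a w where w: "x = \<phi> a" "w : carrier LA" "\<pi> w = \<pi> v" "a : cmp A w" by blast
  have x: "x : cmp B (\<pi> v)" using phi_comp[OF w(2,4)] w by simp
  have c: "x : carrier B" "z : carrier B" using x acl_add.IH B.comp_carrier[OF pi.hom_closed[OF v(1)]] by auto
  have xy: "x .[Y] y : dpart Y (\<pi> (v *[LA] u))" "z .[Y] y : dpart Y (\<pi> (v *[LA] u))"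
   using B.gmod_act[OF gY, of "\<pi> v" "\<pi> u" _ y] u v x acl_add.IH by simp_all
  have w0: "0 <= dA w" using dpi[of w] dpi[of v] w v by simp
  have "k (v *[LA] u) (x .[Y] y) = k (w *[LA] u) (x .[Y] y)"
   using w u v xy w0 by (intro ind) (auto simp: A.dg_add)
  also have "... = x .[Y'] k u y" using k_phi[OF u w(2) w0 w(4)] w(1) by simp
  finally have "k (v *[LA] u) ((x +[B] z) .[Y] y) = (x +[B] z) .[Y'] k u y"
   using c yc k_add[OF vu xy] acl_add.IH by (simp add: Y.smult_l_distr Y'.smult_l_distr)
  thus ?case using x acl_add.IH additive_subgroup.a_closed[OF B.comp_sub[of "\<pi> v"]] v by simp
 qed
 thus ?thesis by blast
qed
\<comment> \<open>A set-theoretic section of \<pi>; by \<open>ind\<close> its choice does not affect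
  \<open>k\<close> in high degrees.\<close>
define S where "S b = (SOME u. u : carrier LA & \<pi> u = b)" for b
have S: "S b : carrier LA" "\<pi> (S b) = b" "dA (S b) = dB b" if b: "b : Im" for b
proof -
 have "EX u. u : carrier LA & \<pi> u = b" using b by (auto simp: Im_def)
 from someI_ex[OF this] show "S b : carrier LA" "\<pi> (S b) = b" by (auto simp: S_def)
 thus "dA (S b) = dB b" using dpi by metis
qed
obtain m h where h: "n <= m" "B.germ Y Y' m h" "!!b y. b : Im ==> m <= dB b ==> y : dpart Y b ==> h y = k (S b) y"
proof (rule extend[OF Y Y', of n "%b. k (S b)"])
 fix b y assume b: "b : Im" "n <= dB b" "y : dpart Y b"
 show "k (S b) y : dpart Y' b" using k(1)[of "S b" y] S[OF b(1)] b by simp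
 show "k (S b) (y +[Y] z) = k (S b) y +[Y'] k (S b) z" if "z : dpart Y b" for z
  using k_add[of "S b" y z] S[OF b(1)] b that by simp
 fix e s assume e: "e : Im" "0 <= dB e" "s : cmp B e"
 note be = Im_mult[OF e(1) b(1)]
 have "s .[Y] y : dpart Y (e *[LB] b)" using B.gmod_act[OF gY] e b Im_carrier by blast
 hence "k (S (e *[LB] b)) (s .[Y] y) = k (S e *[LA] S b) (s .[Y] y)"
  using S[OF be] S[OF e(1)] S[OF b(1)] e b by (intro ind) (auto simp: A.dg_add)
 thus "k (S (e *[LB] b)) (s .[Y] y) = s .[Y'] k (S b) y"
  using k_smult[of "S b" y "S e" s] S[OF e(1)] S[OF b(1)] e b by simp
qed (rule that, assumption+)
have "A.geq (PX Y) m (Ph Y Y' h) g"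
 unfolding A.geq_def
proof (intro ballI impI)
 fix u x assume u: "u : carrier LA" "m <= dA u" "x : dpart (PX Y) u"
 obtain y where y: "y : dpart Y (\<pi> u)" "x = PJ Y u y" using J_surj[OF Y u(1,3)] .
 note i = Im_pi[OF u(1)]
 have "h y = k (S (\<pi> u)) y" using h(3)[OF i _ y(1)] u dpi by simp
 also have "... = k u y" using S[OF i] y u h(1) by (intro ind) auto
 finally show "Ph Y Y' h x = g x" using Ph_J[OF Y Y' h(2) u(1,2) y(1)] k[OF u(1) _ y(1)] y u h(1) by simp
qed
thus ?thesis using that h(2) by blast
qed

lemma N_finite: "finite N"
using finite_ker by (simp add: N_def)

text \<open>Finiteness of the kernel replaces bounds depending on \<open>g\<close> by their
  maximum.\<close>

lemma uniform:
assumes "!!g. g : N ==> EX m. Q g m" "!!g m m'. Q g m ==> m <= m' ==> Q g (m' :: int)"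
obtains m where "!!g. g : N ==> Q g m" "n <= m"
proof -
have "ALL g:N. EX m. Q g m" using assms(1) by blast
from bchoice[OF this] obtain f where f: "!!g. g : N ==> Q g (f g)" by blast
have "Q g (Max (insert n (f ` N)))" if "g : N" for g
 by (rule assms(2)[OF f[OF that]]) (use that N_finite in auto)
thus ?thesis using that[of "Max (insert n (f ` N))"] N_finite by auto
qed

lemma Psi_bij:
assumes Y: "Y : Ob B.MC" and Y': "Y' : Ob B.MC"
shows "bij_betw (on_hom Psi Y Y') (Hom B.QC Y Y') (Hom act.EC (on_ob Psi Y) (on_ob Psi Y'))"
unfolding bij_betw_def
proof
note X = PX_Ob[OF Y] and X' = PX_Ob[OF Y']
show "inj_on (on_hom Psi Y Y') (Hom B.QC Y Y')"
proof (rule inj_onI)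
 fix f f' assume "f : Hom B.QC Y Y'" "f' : Hom B.QC Y Y'" and e: "on_hom Psi Y Y' f = on_hom Psi Y Y' f'"
 then obtain n h n' h' where h: "B.germ Y Y' n h" "f = B.R Y Y' h" "B.germ Y Y' n' h'" "f' = B.R Y Y' h'"
  unfolding B.QC_Hom[OF Y Y'] by blast
 obtain m where m: "A.geq (PX Y) m (Ph Y Y' h) (Ph Y Y' h')"
  using e A.R_eq_iff[OF X X' Ph_germ[OF Y Y' h(1)]] unfolding h(2,4) Psi_hom[OF Y Y' h(1)] Psi_hom[OF Y Y' h(3)] by blast
 let ?n = "max m (max n n')"
 have "EX r. B.geq Y r h h'"
  by (rule faithful[OF Y Y' B.germ_mono[OF h(1)] B.germ_mono[OF h(3)] A.geq_mono[OF m], of ?n]) auto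
 thus "f = f'" using B.geq_R[OF Y] h by auto
qed
show "on_hom Psi Y Y' ` Hom B.QC Y Y' = Hom act.EC (on_ob Psi Y) (on_ob Psi Y')"
proof
 show "on_hom Psi Y Y' ` Hom B.QC Y Y' <= Hom act.EC (on_ob Psi Y) (on_ob Psi Y')"
  using Psi_functor Y Y' unfolding is_functor_def by auto
 show "Hom act.EC (on_ob Psi Y) (on_ob Psi Y') <= on_hom Psi Y Y' ` Hom B.QC Y Y'"
 proof
  fix f assume f: "f : Hom act.EC (on_ob Psi Y) (on_ob Psi Y')"
  hence "f : Hom A.QC (PX Y) (PX Y')" by (simp add: Psi_ob act.EC_Hom)
  then obtain n g where g: "A.germ (PX Y) (PX Y') n g" "f = A.R (PX Y) (PX Y') g" using A.QC_Hom[OF X X'] by blast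
  have "EX m. A.geq (PX Y) m (%z. T Y' x (g z)) (%z. g (T Y x z))" if "x : N" for x
   using f that unfolding g(2) Psi_Hom_iff[OF Y Y' g(1)] by blast
  then obtain m where m: "!!x. x : N ==> A.geq (PX Y) m (%z. T Y' x (g z)) (%z. g (T Y x z))" "n <= m"
   using uniform[of "%x m. A.geq (PX Y) m (%z. T Y' x (g z)) (%z. g (T Y x z))"] A.geq_mono by blast
  obtain r h where h: "B.germ Y Y' r h" "A.geq (PX Y) r (Ph Y Y' h) g"
   using full[OF Y Y' A.germ_mono[OF g(1) m(2)] m(1)] by blast
  have "f = on_hom Psi Y Y' (B.R Y Y' h)"
   unfolding Psi_hom[OF Y Y' h(1)] g(2) using A.geq_R[OF X h(2)] by simp
  thus "f : on_hom Psi Y Y' ` Hom B.QC Y Y'" unfolding B.QC_Hom[OF Y Y'] using h(1) by blast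
 qed
qed
qed

end

section \<open>The pull-back functor is essentially surjective\<close>

text \<open>An equivariant object whose relations have all been made to hold from one common degree
  \<open>n\<close> on; \<open>Psi_surj\<close> supplies such an \<open>n\<close>.\<close>

locale equivariant = gpair A dA prA XA B dB prB XB \<pi> \<phi> \<psi> U
for A :: "('a, 'k::field, 'l) graded_algebra" and dA prA XA
 and B :: "('b, 'h::field, 'm) graded_algebra" and dB prB XB \<pi> \<phi> \<psi> and U :: "'u itself" +
fixes X :: "('a, 'u, 'l) graded_module" and a :: "'l => 'u => 'u" and n :: int
assumes X: "X : Ob (mod_cat A)"
 and a_germ: "g : N ==> A.germ X (sh g X) n (a g)"
 and a_comp: "g : N ==> h : N ==> A.geq X n (a (g *[gg A] h)) (%x. a h (a g x))"
 and a_one: "A.geq X n (a 1[gg A]) (%x. x)"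
begin

lemma gX: "A.gmod X"
using X ObA_gmod by blast

sublocale XM: module A X
using gX A.gmod_module by blast

abbreviation "X1 == A.tr n X"

lemma X1: "X1 : Ob A.MC" "A.gmod X1"
using A.tr_Ob X A.tr_gmod gX by auto

sublocale X1M: module A X1
using X1 A.gmod_module by blast

lemma X1_sub: "z : carrier X1 ==> z : carrier X"
by (simp add: A.tr_def)

lemma X1_part: "u : carrier LA ==> n <= dA u ==> dpart X1 u = dpart X u"
"u : carrier LA ==> x : dpart X1 u ==> x ~= 0[X] ==> n <= dA u & x : dpart X u"
using A.tr_part[OF gX] by (auto split: if_splits)

lemma X1_in: "u : carrier LA ==> n <= dA u ==> x : dpart X u ==> x : carrier X1"
using A.gmod_carrier[OF X1(2)] X1_part(1) by blast

lemma X1_smult: "s : carrier A ==> z : carrier X1 ==> s .[X] z : carrier X1"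
using X1M.smult_closed by (simp add: A.tr_sel)

lemma X1_add: "y : carrier X1 ==> z : carrier X1 ==> y +[X] z : carrier X1" and X1_zero: "0[X] : carrier X1"
using X1M.M.add.m_closed X1M.M.zero_closed by (simp_all add: A.tr_sel)

lemma sh_part: "g : N ==> u : carrier LA ==> dpart (sh g X) u = dpart X (u *[LA] inv[LA] g)"
by simp

lemma u_shift: "g : N ==> u : carrier LA ==> u *[LA] inv[LA] g : carrier LA & dA (u *[LA] inv[LA] g) = dA u"
using N(1)[of g] N_dA[of g] by (simp add: A.dg_add A.dg_inv)

lemma a_in:
assumes "g : N" "u : carrier LA" "n <= dA u" "x : dpart X u"
shows "a g x : dpart X (u *[LA] inv[LA] g)"
using A.germD(1)[OF a_germ[OF assms(1)] assms(2-4)] sh_part[OF assms(1,2)] by simp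

text \<open>The germs \<open>a g\<close> as honest homomorphisms on the truncation of
  \<open>X\<close>. Elements of the kernel have integer degree zero, so the truncation is preserved
  and a strict action results, see \<open>e_comp\<close>.\<close>

definition e :: "'l => 'u => 'u" where
"e g = (SOME f. f : gmhom A X1 (sh g X) & A.geq X n f (a g))"

lemma e:
assumes g: "g : N"
shows "e g : gmhom A X1 (sh g X)" "A.geq X n (e g) (a g)"
proof -
have "EX f. f : gmhom A X1 (sh g X) & A.geq X n f (a g)"
 using A.germ_ext[OF gX ObA_gmod[OF sh_Ob[OF g X]] a_germ[OF g]] by blast
from someI_ex[OF this] show "e g : gmhom A X1 (sh g X)" "A.geq X n (e g) (a g)"
 by (auto simp: e_def)
qed

lemma e_eq: "g : N ==> u : carrier LA ==> n <= dA u ==> x : dpart X u ==> e g x = a g x"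
using A.geqD[OF e(2)] .

lemma e_addmap: "g : N ==> addmap X1 X (e g)"
using A.hom_addmap[OF e(1), of g] by (simp add: addmap_def)

lemma e_smult: "g : N ==> s : carrier A ==> z : carrier X1 ==> e g (s .[X] z) = s .[X] e g z"
using A.hom_smult[OF e(1), of g s z] by (simp add: A.tr_sel)

lemma e_add: "g : N ==> y : carrier X1 ==> z : carrier X1 ==> e g (y +[X] z) = e g y +[X] e g z"
using addmap_add[OF e_addmap, of g y z] by (simp add: A.tr_sel)

lemma e_zero: "g : N ==> e g 0[X] = 0[X]"
using addmap_zero[OF e_addmap X1M.M.abelian_group_axioms XM.M.abelian_group_axioms] by (simp add: A.tr_sel)

lemma e_in: "g : N ==> z : carrier X1 ==> e g z : carrier X"
using addmap_closed[OF e_addmap] .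

lemma e_comp:
assumes h: "h : N" and z: "z : carrier X1"
shows "e h z : carrier X1 & (ALL g:N. e g (e h z) = e (h *[LA] g) z)"
using X1(2) z
proof (induction rule: A.homog_induct)
case zero
thus ?case using e_zero X1_zero h N subgroup.m_closed[OF N_subgroup] by (simp add: A.tr_sel)
next
case (add u x y)
have "e h x : carrier X1 & (ALL g:N. e g (e h x) = e (h *[LA] g) x)"
proof (cases "x = 0[X]")
 case True thus ?thesis using e_zero X1_zero h subgroup.m_closed[OF N_subgroup] by simp
next
 case False
 hence u: "u : carrier LA" "n <= dA u" "x : dpart X u" using X1_part(2)[OF add(1,2)] add(1) by auto
 have v: "u *[LA] inv[LA] h : carrier LA" "n <= dA (u *[LA] inv[LA] h)" using u_shift[OF h u(1)] u by auto
 note ah = a_in[OF h u]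
 show ?thesis
  using X1_in[OF v ah] e_eq[OF h u] e_eq[OF _ v ah] A.geqD[OF a_comp[OF h] u] e_eq[OF subgroup.m_closed[OF N_subgroup h] u]
  by simp
qed
moreover have "x : carrier X1" using A.gmod_carrier[OF X1(2) add(1,2)] .
ultimately show ?case using add h subgroup.m_closed[OF N_subgroup h] by (simp add: A.tr_sel e_add X1_add)
qed

text \<open>The trace of the action. It is invariant, and its component in the original degree gives back \<open>x\<close>.\<close>

definition E :: "'u => 'u" where "E z = finsum X (%g. e g z) N"

lemma E_in: "z : carrier X1 ==> E z : carrier X"
unfolding E_def using e_in by (intro XM.M.finsum_closed) auto

lemma E_add: "y : carrier X1 ==> z : carrier X1 ==> E (y +[X] z) = E y +[X] E z"
proof -
assume c: "y : carrier X1" "z : carrier X1"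
have "E (y +[X] z) = finsum X (%g. e g y +[X] e g z) N"
 unfolding E_def using c e_in by (intro XM.M.finsum_cong') (auto simp: e_add)
thus ?thesis unfolding E_def using c e_in N_finite by (simp add: XM.M.finsum_addf Pi_def)
qed

text \<open>Composing with \<open>e h\<close> only permutes the summands of the trace.\<close>

lemma E_inv:
assumes h: "h : N" and z: "z : carrier X1" shows "E (e h z) = E z"
proof -
have b: "(%g. h *[LA] g) ` N = N"
proof
 show "(%g. h *[LA] g) ` N <= N" using subgroup.m_closed[OF N_subgroup h] by blast
 show "N <= (%g. h *[LA] g) ` N"
 proof
  fix g assume g: "g : N"
  have "g = h *[LA] (inv[LA] h *[LA] g)" using A.LG_solve N g h by simp
  moreover have "inv[LA] h *[LA] g : N"
   using subgroup.m_closed[OF N_subgroup subgroup.m_inv_closed[OF N_subgroup h] g] .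
  ultimately show "g : (%g. h *[LA] g) ` N" by blast
 qed
qed
have i: "inj_on (%g. h *[LA] g) N" using N(1) h by (auto intro!: inj_onI)
have "E (e h z) = finsum X (%g. e (h *[LA] g) z) N"
 unfolding E_def using e_comp[OF h z] e_in z subgroup.m_closed[OF N_subgroup h]
 by (intro XM.M.finsum_cong') auto
also have "... = finsum X (%g. e g z) ((%g. h *[LA] g) ` N)"
 using i b e_in z by (subst XM.M.finsum_reindex) auto
finally show ?thesis unfolding b E_def .
qed

lemma one_N: "1[LA] : N"
using subgroup.one_closed[OF N_subgroup] .

text \<open>The summand \<open>e g x\<close> sits in degree \<open>u * inv g\<close>, which differs
  from \<open>u\<close> unless \<open>g\<close> is 1. The projection therefore returns
  \<open>x\<close> itself and not a multiple of it.\<close>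

lemma E_proj:
assumes u: "u : carrier LA" "n <= dA u" "x : dpart X u"
shows "A.cp X u (E x) = x"
proof -
have x: "x : carrier X1" using X1_in[OF u] .
have c: "A.cp X u (e g x) = (if g = 1[LA] then x else 0[X])" if g: "g : N" for g
proof -
 have gc: "g : carrier LA" using N(1)[OF g] .
 have "u = u *[LA] inv[LA] g <-> g = 1[LA]"
 proof
  assume "u = u *[LA] inv[LA] g"
  hence "inv[LA] g = 1[LA]" using u(1) gc A.LG.r_cancel_one'[OF u(1), of "inv[LA] g"] A.LG.l_cancel_one'[OF u(1), of "inv[LA] g"] by simp
  thus "g = 1[LA]" using gc by (simp add: A.LG.inv_eq_1_iff)
 qed (use u in simp)
 moreover have "a 1[LA] x = x" using A.geqD[OF a_one u] .
 ultimately show ?thesis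
  using A.cp_comp[OF gX u(1) conjunct1[OF u_shift[OF g u(1)]] a_in[OF g u]] e_eq[OF g u] by auto
qed
have xc: "x : carrier X" using X1_sub[OF x] .
have "A.cp X u (E x) = finsum X (%g. A.cp X u (e g x)) N"
 unfolding E_def
 by (rule addmap_finsum[OF A.cp_addmap[OF gX u(1)] XM.M.abelian_group_axioms XM.M.abelian_group_axioms N_finite])
  (use e_in x in auto)
also have "... = finsum X (%g. A.cp X u (e g x)) {1[LA]}"
 using N_finite one_N c xc by (intro XM.M.finsum_supp) auto
also have "... = x" using c[OF one_N] xc by (subst XM.M.finsum_insert) auto
finally show ?thesis .
qed

text \<open>The \<open>B\<close>-module that is to be mapped to \<open>X\<close> is generated inside the additive maps \<open>B \<rightarrow> X\<close>, on which \<open>B\<close> acts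
  by translation, by the maps \<open>\<Gamma> x\<close> for \<open>x\<close> of high degree, which send \<open>c\<close> to the trace of \<open>\<psi> c \<odot> x\<close>.\<close>

definition maps :: "('b, 'b => 'u) module" where
"maps = (|carrier = {f. addmap B X f & (ALL c. c ~: carrier B --> f c = 0[X])}, monoid.mult = undefined, one = undefined,
 zero = (%_. 0[X]), add = (%f g c. f c +[X] g c), smult = (%b f c. if c : carrier B then f (b *[B] c) else 0[X])|)"

lemma maps_sel: "f : carrier maps <-> addmap B X f & (ALL c. c ~: carrier B --> f c = 0[X])"
"0[maps] = (%_. 0[X])" "f +[maps] g = (%c. f c +[X] g c)"
"b .[maps] f = (%c. if c : carrier B then f (b *[B] c) else 0[X])"
by (auto simp: maps_def)

lemma maps_val: "f : carrier maps ==> f c : carrier X"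
by (cases "c : carrier B") (auto simp: maps_sel addmap_closed)

lemma maps_module: "module B maps"
proof (intro moduleI B.SR.is_cring abelian_groupI)
note v = maps_val
fix f g assume f: "f : carrier maps" and g: "g : carrier maps"
show "f +[maps] g : carrier maps"
 using f g v[OF f] v[OF g] by (auto simp: maps_sel addmap_def XM.M.a_ac)
show "f +[maps] g = g +[maps] f" using v[OF f] v[OF g] by (simp add: maps_sel XM.M.a_comm)
show "f +[maps] g +[maps] h = f +[maps] (g +[maps] h)" if h: "h : carrier maps" for h
 using v[OF f] v[OF g] v[OF h] by (simp add: maps_sel XM.M.a_assoc)
fix b assume b: "b : carrier B"
show "b .[maps] (f +[maps] g) = b .[maps] f +[maps] b .[maps] g"
 by (auto simp: maps_sel)
next
note v = maps_val
fix f assume f: "f : carrier maps"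
show "0[maps] +[maps] f = f" using v[OF f] by (simp add: maps_sel)
show "1[B] .[maps] f = f" using f by (auto simp: maps_sel)
have "(%c. -[X] f c) : carrier maps" using f v[OF f] by (auto simp: maps_sel addmap_def XM.M.minus_add)
thus "EX g:carrier maps. g +[maps] f = 0[maps]"
 by (rule bexI[rotated]) (use v[OF f] in "auto simp: maps_sel XM.M.l_neg")
fix b assume b: "b : carrier B"
show "b .[maps] f : carrier maps"
 using f b v[OF f] by (auto simp: maps_sel addmap_def B.SR.r_distr)
fix c assume c: "c : carrier B"
show "(b *[B] c) .[maps] f = b .[maps] (c .[maps] f)" using b c by (auto simp: maps_sel B.SR.m_ac)
show "(b +[B] c) .[maps] f = b .[maps] f +[maps] c .[maps] f"
 using b c f by (auto simp: maps_sel B.SR.l_distr addmap_add)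
qed (auto simp: maps_sel addmap_def)

sublocale mp: module B maps
by (rule maps_module)

definition \<Gamma> :: "'u => 'b => 'u" where
"\<Gamma> x c = (if c : carrier B then E (\<psi> c .[X] x) else 0[X])"

lemma \<Gamma>_in: "x : carrier X1 ==> \<Gamma> x : carrier maps"
using X1_sub[of x] unfolding maps_sel(1) addmap_def
by (auto simp: \<Gamma>_def addmap_add[OF psi_add] psi_closed XM.smult_l_distr E_add X1_smult intro!: E_in)

lemma \<Gamma>_add: "x : carrier X1 ==> y : carrier X1 ==> \<Gamma> (x +[X] y) = \<Gamma> x +[maps] \<Gamma> y"
using X1_sub[of x] X1_sub[of y] by (auto simp: maps_sel \<Gamma>_def psi_closed XM.smult_r_distr E_add X1_smult)

text \<open>Here the \<open>A\<close>-linearity of \<psi> enters: translating by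
  \<open>\<phi> s\<close> inside \<psi> amounts to multiplying by \<open>s\<close> outside.\<close>

lemma \<Gamma>_smult: "s : carrier A ==> x : carrier X1 ==> \<Gamma> (s .[X] x) = \<phi> s .[maps] \<Gamma> x"
using X1_sub[of x] by (auto simp: maps_sel \<Gamma>_def psi_closed phi_closed psi_mult A.SR.m_comm simp flip: XM.smult_assoc1)

lemma \<Gamma>_e: "g : N ==> x : carrier X1 ==> \<Gamma> (e g x) = \<Gamma> x"
by (auto simp: \<Gamma>_def psi_closed X1_smult E_inv simp flip: e_smult)

text \<open>Evaluation at 1 gives the trace of \<open>x\<close>, from which \<open>E_proj\<close>
  recovers \<open>x\<close>.\<close>

lemma \<Gamma>_inj:
assumes "u : carrier LA" "n <= dA u" "x : dpart X u" "y : dpart X u" "\<Gamma> x = \<Gamma> y"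
shows "x = y"
proof -
have c: "x : carrier X" "y : carrier X" using A.gmod_carrier[OF gX] assms by auto
have "E x = E y" using fun_cong[OF assms(5), of "1[B]"] c by (simp add: \<Gamma>_def psi_one)
thus ?thesis using E_proj assms by metis
qed

lemma \<Gamma>_zero: "\<Gamma> 0[X] = 0[maps]"
using \<Gamma>_add[OF X1_zero X1_zero] \<Gamma>_in[OF X1_zero] by (intro mp.M.double_zero) auto

text \<open>Several degrees \<open>u\<close> over one class may contribute to the same
  \<open>v\<close>; \<Gamma> places all of them in degree \<open>\<pi> u\<close>, which is where the
  grading is coarsened.\<close>

definition gens :: "'m => ('b => 'u) set" where
"gens v = {b .[maps] \<Gamma> x | b x u d. u : carrier LA & n <= dA u & x : dpart X u &
  d : carrier LB & b : cmp B d & d *[LB] \<pi> u = v}"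

definition P :: "'m => ('b => 'u) set" where "P v = acl maps (gens v)"

lemma gens_sub: "gens v <= carrier maps"
proof -
have "b .[maps] \<Gamma> x : carrier maps" if "u : carrier LA" "n <= dA u" "x : dpart X u" "d : carrier LB" "b : cmp B d" for b x u d
 using B.comp_carrier[OF that(4,5)] \<Gamma>_in[OF X1_in[OF that(1-3)]] by simp
thus ?thesis unfolding gens_def by blast
qed

lemma gens_P: "f : gens v ==> f : P v"
unfolding P_def by (rule mp.M.acl_base[OF gens_sub])

lemma gensI: "u : carrier LA ==> n <= dA u ==> x : dpart X u ==> d : carrier LB ==> b : cmp B d ==>
 d *[LB] \<pi> u = v ==> b .[maps] \<Gamma> x : gens v"
unfolding gens_def by blast

lemma gensE:
assumes "f : gens v"
obtains b x u d where "u : carrier LA" "n <= dA u" "x : dpart X u" "d : carrier LB" "b : cmp B d"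
 "d *[LB] \<pi> u = v" "f = b .[maps] \<Gamma> x"
using assms unfolding gens_def by blast

lemma \<Gamma>_P:
assumes "u : carrier LA" "n <= dA u" "x : dpart X u"
shows "\<Gamma> x : P (\<pi> u)"
using gensI[OF assms B.LG.one_closed B.one_comp, of "\<pi> u"] \<Gamma>_in[OF X1_in[OF assms]] assms(1)
by (intro gens_P) simp

sublocale ds: dsum B dB prB XB maps P
proof (rule dsum.intro[OF B.galg_axioms dsum_axioms.intro[OF maps_module]])
fix l assume l: "l : carrier LB"
show "additive_subgroup (P l) maps"
 unfolding P_def
proof (rule mp.M.acl_additive_subgroup[OF gens_sub])
 fix f assume "f : gens l"
 then obtain b x u d where f: "u : carrier LA" "n <= dA u" "x : dpart X u" "d : carrier LB" "b : cmp B d"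
  "d *[LB] \<pi> u = l" "f = b .[maps] \<Gamma> x" by (rule gensE)
 have "(-[B] b) .[maps] \<Gamma> x = -[maps] f"
  unfolding f(7) by (rule mp.smult_l_minus[OF B.comp_carrier[OF f(4,5)] \<Gamma>_in[OF X1_in[OF f(1-3)]]])
 moreover have "-[B] b : cmp B d" by (rule B.SR.subgroup_minus[OF B.comp_sub[OF f(4)] f(5)])
 ultimately show "-[maps] f : gens l" using gensI[OF f(1-4)] f(6) by metis
qed
fix a s y assume a: "a : carrier LB" "s : cmp B a" and y: "y : P l"
have sc: "s : carrier B" using B.comp_carrier[OF a] .
show "s .[maps] y : P (a *[LB] l)"
 using y unfolding P_def
proof induction
 case acl_zero thus ?case using mp.smult_r_null[OF sc] by (simp add: acl.acl_zero)
next
 case (acl_add f z)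
 obtain b x u d where f: "u : carrier LA" "n <= dA u" "x : dpart X u" "d : carrier LB" "b : cmp B d"
  "d *[LB] \<pi> u = l" "f = b .[maps] \<Gamma> x" using acl_add(1) by (rule gensE)
 have fc: "f : carrier maps" using acl_add gens_sub by blast
 have zc: "z : carrier maps" using acl_add mp.M.acl_closed[OF gens_sub] by blast
 have e: "s .[maps] f = (s *[B] b) .[maps] \<Gamma> x"
  unfolding f(7) by (rule mp.smult_assoc1[OF sc B.comp_carrier[OF f(4,5)] \<Gamma>_in[OF X1_in[OF f(1-3)]], symmetric])
 have "s .[maps] f : gens (a *[LB] l)"
  unfolding e by (rule gensI[OF f(1-3), of "a *[LB] d"]) (use a f B.comp_mult in "auto simp: B.LG.m_assoc")
 thus ?case using acl.acl_add[OF _ acl_add.IH] mp.smult_r_distr[OF sc fc zc] by simp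
qed
qed

lemma P_sub: "v : carrier LB ==> P v <= carrier maps"
using ds.P_facts(1) .

text \<open>For surjectivity, a coefficient \<open>b\<close> whose degree lies in the image of \<pi>
  is a sum of \<open>\<phi> s\<close>, and \<open>\<phi> s\<close> takes \<open>\<Gamma> x\<close>
  to \<open>\<Gamma> (s x)\<close>. The element \<open>s x\<close> may have another degree than
  \<open>u\<close> over \<open>\<pi> u\<close>; the action \<open>e h\<close> moves it to
  \<open>u\<close> without changing its \<Gamma>.\<close>

lemma \<Gamma>_bij:
assumes u: "u : carrier LA" "n <= dA u"
shows "bij_betw \<Gamma> (dpart X u) (P (\<pi> u))"
unfolding bij_betw_def
proof
show "inj_on \<Gamma> (dpart X u)" using \<Gamma>_inj[OF u] by (auto intro: inj_onI)
note pf = A.part_facts[OF gX u(1)]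
have c: "x : carrier X1" if "x : dpart X u" for x using X1_in[OF u that] .
have add: "f +[maps] g : \<Gamma> ` dpart X u" if fg: "f : \<Gamma> ` dpart X u" "g : \<Gamma> ` dpart X u" for f g
proof -
 obtain x y where xy: "f = \<Gamma> x" "x : dpart X u" "g = \<Gamma> y" "y : dpart X u" using fg by blast
 show ?thesis using \<Gamma>_add[OF c c, of x y] imageI[OF pf(3)[OF xy(2,4)], of \<Gamma>] xy by simp
qed
have zero: "0[maps] : \<Gamma> ` dpart X u" using \<Gamma>_zero pf(2) by (metis imageI)
have "gens (\<pi> u) <= \<Gamma> ` dpart X u"
proof
 fix f assume "f : gens (\<pi> u)"
 then obtain b x w d where f: "w : carrier LA" "n <= dA w" "x : dpart X w" "d : carrier LB" "b : cmp B d"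
  "d *[LB] \<pi> w = \<pi> u" "f = b .[maps] \<Gamma> x" by (rule gensE)
 have xc: "x : carrier X1" using X1_in[OF f(1-3)] .
 define t where "t = inv[LA] w *[LA] u"
 have t: "t : carrier LA" using f u by (simp add: t_def)
 have "\<pi> t = inv[LB] (\<pi> w) *[LB] (\<pi> w *[LB] d)" using f u by (simp add: t_def pi.hom_inv B.LG.m_comm flip: f(6))
 hence dt: "d = \<pi> t" using f by (simp flip: B.LG.m_assoc)
 have "b : acl B {\<phi> a |a v. v : carrier LA & \<pi> v = \<pi> t & a : cmp A v}" using dec[OF t] f(5) dt by blast
 hence "b : carrier B & b .[maps] \<Gamma> x : \<Gamma> ` dpart X u"
 proof induction
  case acl_zero thus ?case using zero mp.smult_l_null[OF \<Gamma>_in[OF xc]] by simp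
 next
  case (acl_add y z)
  then obtain s v where s: "y = \<phi> s" "v : carrier LA" "\<pi> v = \<pi> t" "s : cmp A v" by blast
  have sc: "s : carrier A" using A.comp_carrier[OF s(2,4)] .
  define r where "r = v *[LA] w"
  have pr: "\<pi> r = \<pi> u" using s f dt by (simp add: r_def)
  have r: "r : carrier LA" "n <= dA r" "s .[X] x : dpart X r"
   using s f A.gmod_act[OF gX] pr dpi[of r] dpi[OF u(1)] u by (auto simp: r_def)
  define h where "h = inv[LA] u *[LA] r"
  have h: "h : N" using u r pr by (intro N_I) (auto simp: h_def pi.hom_inv)
  have rh: "r *[LA] inv[LA] h = u" using u r by (simp add: h_def A.LG.inv_mult_group flip: A.LG.m_assoc)
  have "e h (s .[X] x) : dpart X u" using a_in[OF h r] e_eq[OF h r] rh by simp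
  moreover have "\<Gamma> (e h (s .[X] x)) = y .[maps] \<Gamma> x"
   using \<Gamma>_e[OF h X1_in[OF r]] \<Gamma>_smult[OF sc xc] s(1) by simp
  ultimately have "y .[maps] \<Gamma> x : \<Gamma> ` dpart X u" by (metis imageI)
  thus ?case
   using add acl_add.IH mp.smult_l_distr[OF phi_closed[OF sc] _ \<Gamma>_in[OF xc], of z] s(1) phi_closed[OF sc] by simp
 qed
 thus "f : \<Gamma> ` dpart X u" using f by simp
qed
hence "P (\<pi> u) <= \<Gamma> ` dpart X u"
 unfolding P_def by (intro acl_least zero add) auto
thus "\<Gamma> ` dpart X u = P (\<pi> u)" using \<Gamma>_P[OF u] by blast
qed

text \<open>The images under \<Gamma> of homogeneous generators of the truncation generate every
  \<open>gens l\<close>, so the direct sum of the \<open>P v\<close> is finitely generated and has a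
  copy in the universe.\<close>

lemma realization:
obtains Y :: "('b, 'u, 'm) graded_module" and K where "Y : Ob B.MC"
 "!!l. l : carrier LB ==> bij_betw (K l) (P l) (dpart Y l)"
 "!!l x y. l : carrier LB ==> x : P l ==> y : P l ==> K l (x +[maps] y) = K l x +[Y] K l y"
 "!!a l s y. a : carrier LB ==> l : carrier LB ==> s : cmp B a ==> y : P l ==>
  K (a *[LB] l) (s .[maps] y) = s .[Y] K l y"
proof -
have "A.fg X1" using X1 A.Ob_mod_cat by auto
then obtain H where H: "finite H" "!!b c. (b, c) : H ==> c : carrier LA & b : dpart X1 c"
 "!!l m. l : carrier LA ==> m : dpart X1 l ==>
  m : acl X1 {s .[X1] b | s b a c. (b, c) : H & a : carrier LA & s : cmp A a & a *[LA] c = l}"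
 using A.fg_homog[OF X1(2)] by blast
let ?G = "(%(x, u). (\<Gamma> x, \<pi> u)) ` H"
have G: "c : carrier LB & y : P c" if G: "(y, c) : ?G" for y c
proof -
 obtain x u where x: "(x, u) : H" "y = \<Gamma> x" "c = \<pi> u" using G by auto
 note xu = H(2)[OF x(1)]
 show ?thesis
 proof (cases "x = 0[X]")
  case True thus ?thesis using \<Gamma>_zero x xu ds.P_facts(2)[of c] by simp
 next
  case False thus ?thesis using X1_part(2)[of u x] xu \<Gamma>_P[of u x] x by simp
 qed
qed
show ?thesis
proof (rule ds.realize[OF finite_imageI[OF H(1)] G _ inf univ(2), of "%(x, u). (\<Gamma> x, \<pi> u)"])
 fix l y assume l: "l : carrier LB" and y: "y : P l"
 let ?W = "{s .[maps] b | s b a c. (b, c) : ?G & a : carrier LB & s : cmp B a & a *[LB] c = l}"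
 have "s .[maps] b : carrier maps" if "(b, c) : ?G" "a : carrier LB" "s : cmp B a" for s b a c
  using G[OF that(1)] P_sub[of c] B.comp_carrier[OF that(2,3)] by auto
 hence W: "?W <= carrier maps" by blast
 have "gens l <= acl maps ?W"
 proof
  fix f assume "f : gens l"
  then obtain b x u d where f: "u : carrier LA" "n <= dA u" "x : dpart X u" "d : carrier LB" "b : cmp B d"
   "d *[LB] \<pi> u = l" "f = b .[maps] \<Gamma> x" by (rule gensE)
  have bc: "b : carrier B" using B.comp_carrier[OF f(4,5)] .
  have "x : dpart X1 u" using X1_part(1) f by simp
  from H(3)[OF f(1) this] have "x : carrier X1 & b .[maps] \<Gamma> x : acl maps ?W"
  proof induction
   case acl_zero
   thus ?case using \<Gamma>_zero mp.smult_r_null[OF bc] X1_zero by (simp add: A.tr_sel acl.acl_zero)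
  next
   case (acl_add y z)
   then obtain s x' a c where s: "y = s .[X1] x'" "(x', c) : H" "a : carrier LA" "s : cmp A a" "a *[LA] c = u" by blast
   have x': "x' : carrier X1" "c : carrier LA" using H(2)[OF s(2)] A.gmod_carrier[OF X1(2)] by auto
   have sc: "s : carrier A" using A.comp_carrier[OF s(3,4)] .
   have yc: "y : carrier X1" using s(1) sc x' by simp
   have "b .[maps] \<Gamma> y = (b *[B] \<phi> s) .[maps] \<Gamma> x'"
    using \<Gamma>_smult[OF sc x'(1)] s(1) mp.smult_assoc1[OF bc phi_closed[OF sc] \<Gamma>_in[OF x'(1)]] by (simp add: A.tr_sel)
   moreover have "b *[B] \<phi> s : cmp B (d *[LB] \<pi> a)" using B.comp_mult f s phi_comp by simp
   moreover have "d *[LB] \<pi> a *[LB] \<pi> c = l" using B.LG.m_assoc[of d "\<pi> a" "\<pi> c"] f(4,6) s(3,5) x'(2) pi.hom_mult[of a c] by simp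
   moreover have "(\<Gamma> x', \<pi> c) : ?G" using s(2) by force
   ultimately have "b .[maps] \<Gamma> y = (b *[B] \<phi> s) .[maps] \<Gamma> x' & (\<Gamma> x', \<pi> c) : ?G & d *[LB] \<pi> a : carrier LB &
    b *[B] \<phi> s : cmp B (d *[LB] \<pi> a) & d *[LB] \<pi> a *[LB] \<pi> c = l"
    using f(4) s(3) by simp
   hence yW: "b .[maps] \<Gamma> y : ?W" by (rule_tac CollectI) (rule exI | assumption)+
   have zc: "z : carrier X1" using acl_add.IH by blast
   have "b .[maps] \<Gamma> (y +[X1] z) = b .[maps] \<Gamma> y +[maps] b .[maps] \<Gamma> z"
    using \<Gamma>_add[OF yc zc] mp.smult_r_distr[OF bc \<Gamma>_in[OF yc] \<Gamma>_in[OF zc]] by (simp add: A.tr_sel)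
   thus ?case using acl.acl_add[OF yW conjunct2[OF acl_add.IH]] X1M.M.add.m_closed[OF yc zc] by (simp only: simp_thms)
  qed
  thus "f : acl maps ?W" using f by simp
 qed
 thus "y : acl maps ?W" using y mp.M.acl_subI[OF _ W] unfolding P_def by blast
qed (assumption, rule that, assumption+)
qed

text \<open>In degree \<open>u\<close> the isomorphism is \<Gamma> followed by the identifications
  \<open>K\<close> and \<open>PJ\<close>. It is equivariant because \<Gamma> does not distinguish
  \<open>x\<close> from \<open>e g x\<close>.\<close>

lemma iso:
obtains Y \<theta> where "Y : Ob B.MC" "A.germ X (PX Y) n \<theta>" "A.bijhi n X (PX Y) \<theta>"
 "!!g. g : N ==> A.geq X n (%x. T Y g (\<theta> x)) (%x. \<theta> (a g x))"
proof -
obtain Y :: "('b, 'u, 'm) graded_module" and K where Y: "Y : Ob B.MC"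
 and K: "!!l. l : carrier LB ==> bij_betw (K l) (P l) (dpart Y l)"
 and K_add: "!!l x y. l : carrier LB ==> x : P l ==> y : P l ==> K l (x +[maps] y) = K l x +[Y] K l y"
 and K_smult: "!!a l s y. a : carrier LB ==> l : carrier LB ==> s : cmp B a ==> y : P l ==>
  K (a *[LB] l) (s .[maps] y) = s .[Y] K l y"
 using realization by blast
note gY = ObB_gmod[OF Y]
interpret Y: module B Y using gY B.gmod_module by blast
interpret PXM: module A "PX Y" using PX_gmod[OF Y] A.gmod_module by blast
define k where "k u x = PJ Y u (K (\<pi> u) (\<Gamma> x))" for u x
have K_in: "K (\<pi> u) (\<Gamma> x) : dpart Y (\<pi> u)" if "u : carrier LA" "n <= dA u" "x : dpart X u" for u x
 using bij_betw_apply[OF K[OF pi.hom_closed[OF that(1)]] \<Gamma>_P[OF that]] .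
have k_in: "k u x : dpart (PX Y) u" if "u : carrier LA" "n <= dA u" "x : dpart X u" for u x
 unfolding k_def by (rule J_in[OF Y that(1) K_in[OF that]])
have k_add: "k u (x +[X] y) = k u x +[PX Y] k u y"
 if "u : carrier LA" "n <= dA u" "x : dpart X u" "y : dpart X u" for u x y
 using that K_in X1_in \<Gamma>_P by (simp add: k_def \<Gamma>_add K_add J_add[OF Y])
have k_smult: "k (v *[LA] u) (s .[X] x) = s .[PX Y] k u x"
 if u: "u : carrier LA" "n <= dA u" "x : dpart X u" and v: "v : carrier LA" "s : cmp A v" for u v s x
proof -
 have "K (\<pi> (v *[LA] u)) (\<Gamma> (s .[X] x)) = \<phi> s .[Y] K (\<pi> u) (\<Gamma> x)"
  using u v K_smult[OF _ _ phi_comp[OF v] \<Gamma>_P[OF u]] \<Gamma>_smult[OF A.comp_carrier[OF v] X1_in[OF u]] by simp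
 thus ?thesis unfolding k_def using J_smult[OF Y v(1) u(1) v(2) K_in[OF u]] by simp
qed
have k0: "k u 0[X] = 0[PX Y]" if u: "u : carrier LA" "n <= dA u" for u
proof -
 have z: "0[X] : dpart X u" using A.part_facts(2)[OF gX u(1)] .
 show ?thesis using k_add[OF u z z] A.gmod_carrier[OF PX_gmod[OF Y] u(1) k_in[OF u z]]
  by (intro PXM.M.double_zero) auto
qed
define \<theta> where "\<theta> = A.glue X (PX Y) k"
have \<theta>: "\<theta> x = k u x" if "u : carrier LA" "n <= dA u" "x : dpart X u" for u x
 unfolding \<theta>_def by (rule A.glue[where k = k and Y = "PX Y", OF gX that(1,3) k0[OF that(1,2)]])
show ?thesis
proof (rule that[OF Y, of \<theta>])
 show "A.germ X (PX Y) n \<theta>"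
 proof (rule A.germI)
  fix u x assume u: "u : carrier LA" "n <= dA u" "x : dpart X u"
  show "\<theta> x : dpart (PX Y) u" using k_in[OF u] \<theta>[OF u] by simp
  show "\<theta> (x +[X] y) = \<theta> x +[PX Y] \<theta> y" if y: "y : dpart X u" for y
   using k_add[OF u y] \<theta>[OF u(1,2)] u y A.part_facts(3)[OF gX u(1)] by simp
  show "\<theta> (s .[X] x) = s .[PX Y] \<theta> x" if v: "v : carrier LA" "0 <= dA v" "s : cmp A v" for v s
  proof -
   have "\<theta> (s .[X] x) = k (v *[LA] u) (s .[X] x)"
    using u v A.gmod_act[OF gX v(1) u(1) v(3) u(3)] by (intro \<theta>) (auto simp: A.dg_add)
   thus ?thesis using k_smult[OF u v(1,3)] \<theta>[OF u] by simp
  qed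
 qed
 show "A.bijhi n X (PX Y) \<theta>"
  unfolding A.bijhi_def
 proof (intro ballI impI)
  fix u assume u: "u : carrier LA" "n <= dA u"
  have "bij_betw (PJ Y u \<circ> (K (\<pi> u) \<circ> \<Gamma>)) (dpart X u) (dpart (PX Y) u)"
   by (rule bij_betw_trans[OF bij_betw_trans[OF \<Gamma>_bij[OF u] K] J_bij[OF Y u(1)]]) (use u in simp)
  thus "bij_betw \<theta> (dpart X u) (dpart (PX Y) u)"
   by (subst bij_betw_cong[where g = "PJ Y u \<circ> (K (\<pi> u) \<circ> \<Gamma>)"]) (use \<theta>[OF u] in "auto simp: k_def")
 qed
 fix g assume g: "g : N"
 show "A.geq X n (%x. T Y g (\<theta> x)) (%x. \<theta> (a g x))"
  unfolding A.geq_def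
 proof (intro ballI impI)
  fix u x assume u: "u : carrier LA" "n <= dA u" "x : dpart X u"
  let ?v = "u *[LA] inv[LA] g"
  have v: "?v : carrier LA" "n <= dA ?v" using u_shift[OF g u(1)] u by auto
  have "\<theta> (a g x) = PJ Y ?v (K (\<pi> u) (\<Gamma> (e g x)))"
   using \<theta>[OF v a_in[OF g u]] e_eq[OF g u] pi_shift[OF g u(1)] by (simp add: k_def)
  thus "T Y g (\<theta> x) = \<theta> (a g x)"
   using T_J[OF Y g u(1) K_in[OF u]] \<theta>[OF u] \<Gamma>_e[OF g X1_in[OF u]] by (simp add: k_def)
 qed
qed
qed

end

section \<open>Essential surjectivity and the equivalence\<close>

context gpair
begin

lemma Psi_surj:
assumes X\<alpha>: "(X, \<alpha>) : Ob act.EC"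
shows "EX Y:Ob B.MC. Isos act.EC (on_ob Psi Y) (X, \<alpha>) ~= {}"
proof -
have X: "X : Ob A.MC" using act.EC_Ob[OF X\<alpha>] by simp
note gX = ObA_gmod[OF X]
have isos: "\<alpha> g : Isos A.QC X (sh g X)" if "g : N" for g
 using X\<alpha> that by (auto simp: equivariant_objects_def act_ob)
have "ALL g:N. EX an. A.germ X (sh g X) (snd an) (fst an) & \<alpha> g = A.R X (sh g X) (fst an)"
proof
 fix g assume g: "g : N"
 hence "\<alpha> g : Hom A.QC X (sh g X)" using isos by (auto simp: Isos_def)
 thus "EX an. A.germ X (sh g X) (snd an) (fst an) & \<alpha> g = A.R X (sh g X) (fst an)"
  unfolding A.QC_Hom[OF X sh_Ob[OF g X]] by force
qed
from bchoice[OF this] obtain an where an: "!!g. g : N ==> A.germ X (sh g X) (snd (an g)) (fst (an g)) & \<alpha> g = A.R X (sh g X) (fst (an g))"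
 by blast
define a where "a g = fst (an g)" for g
have "EX m. A.germ X (sh g X) m (a g)" if "g : N" for g using an[OF that] unfolding a_def by blast
then obtain n0 where n0: "!!g. g : N ==> A.germ X (sh g X) n0 (a g)"
 by (rule uniform[where Q = "%g m. A.germ X (sh g X) m (a g)"]) (assumption, erule A.germ_mono, assumption, rule that, assumption)
have a: "A.germ X (sh g X) n0 (a g) & \<alpha> g = A.R X (sh g X) (a g)" if "g : N" for g
 using n0[OF that] an[OF that] by (simp add: a_def)
have "EX m. ALL h:N. A.geq X m (a (g *[LA] h)) (%x. a h (a g x))" if "g : N" for g
proof -
 have "EX m. A.geq X m (a (g *[LA] h)) (%x. a h (a g x))" if "h : N" for h
  using X\<alpha> that \<open>g : N\<close> EC_Ob_iff[OF X a] by blast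
 then obtain m where "!!h. h : N ==> A.geq X m (a (g *[LA] h)) (%x. a h (a g x))"
  by (rule uniform[where Q = "%h m. A.geq X m (a (g *[LA] h)) (%x. a h (a g x))"])
   (assumption, erule A.geq_mono, assumption, rule that, assumption)
 thus ?thesis by blast
qed
then obtain n1 where n1: "!!g h. g : N ==> h : N ==> A.geq X n1 (a (g *[LA] h)) (%x. a h (a g x))" "n0 <= n1"
 by (rule uniform[where Q = "%g m. ALL h:N. A.geq X m (a (g *[LA] h)) (%x. a h (a g x))" and n = n0])
  (assumption, blast intro: A.geq_mono, rule that, blast, assumption)
have one: "1[LA] : N" using subgroup.one_closed[OF N_subgroup] .
obtain n2 where n2: "A.bijhi n2 X (sh 1[LA] X) (a 1[LA])"
 using A.Isos_bijhi[OF X sh_Ob[OF one X] n0[OF one]] isos[OF one] a[OF one] by auto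
define n where "n = max n1 n2"
\<comment> \<open>The cocycle condition makes \<open>a 1\<close> idempotent in high degrees. As an
  isomorphism it is also injective there, hence the identity.\<close>
have a1: "A.geq X n (a 1[LA]) (%x. x)"
 unfolding A.geq_def
proof (intro ballI impI)
 fix u x assume u: "u : carrier LA" "n <= dA u" "x : dpart X u"
 have "a 1[LA] x = a 1[LA] (a 1[LA] x)" using A.geqD[OF n1(1)[OF one one] u(1) _ u(3)] u(2) by (simp add: n_def)
 moreover have "a 1[LA] x : dpart X u" using A.germD(1)[OF n0[OF one] u(1) _ u(3)] u n1(2) by (simp add: n_def)
 moreover have "inj_on (a 1[LA]) (dpart X u)" using n2 u by (auto simp: A.bijhi_def bij_betw_def n_def)
 ultimately show "a 1[LA] x = x" using u(3) by (simp add: inj_on_def)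
qed
interpret q: equivariant A dA prA XA B dB prB XB \<pi> \<phi> \<psi> U X a n
 by (intro equivariant.intro gpair_axioms equivariant_axioms.intro X a1 A.germ_mono[OF n0] A.geq_mono[OF n1(1)])
  (use n1(2) in "auto simp: n_def")
obtain Y \<theta> where Y: "Y : Ob B.MC" and \<theta>: "A.germ X (PX Y) n \<theta>" "A.bijhi n X (PX Y) \<theta>"
 "!!g. g : N ==> A.geq X n (%x. T Y g (\<theta> x)) (%x. \<theta> (a g x))"
 using q.iso by blast
let ?\<beta> = "\<lambda>g\<in>N. A.R (PX Y) (sh g (PX Y)) (T Y g)"
have o: "(PX Y, ?\<beta>) : Ob act.EC" using Psi_Ob[OF Y] by (simp add: Psi_ob)
have h: "A.R X (PX Y) \<theta> : Hom act.EC (X, \<alpha>) (PX Y, ?\<beta>)"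
 by (subst EC_Hom_iff[OF X PX_Ob[OF Y] \<theta>(1), of a])
  (use \<theta>(3) A.germ_mono[OF n0] a n1(2) T_germ[OF Y] in "auto simp: n_def")
have "A.R X (PX Y) \<theta> : Isos act.EC (X, \<alpha>) (PX Y, ?\<beta>)"
 by (rule act.EC_IsosI[OF X\<alpha> o h A.QC_iso[OF X PX_Ob[OF Y] \<theta>(1,2)]])
\<comment> \<open>The isomorphism found leads from \<open>X\<close> to the pull-back; essential
  surjectivity is stated for the opposite direction.\<close>
hence "category.iv act.EC (X, \<alpha>) (PX Y, ?\<beta>) (A.R X (PX Y) \<theta>) : Isos act.EC (on_ob Psi Y) (X, \<alpha>)"
 unfolding Psi_ob by (rule category.inv_iso[OF category.intro[OF act.EC_category]])
thus ?thesis using Y by blast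
qed

theorem equivalence: "EX F. is_equivalence (coh_equivariant U A N) (coh U B) F"
proof -
have "EX F. is_equivalence act.EC (coh U B) F"
 unfolding coh_def
proof (rule equivalence_criterion[OF act.EC_category B.QC_category Psi_functor])
 show "EX Y:Ob B.QC. Isos act.EC (on_ob Psi Y) X ~= {}" if "X : Ob act.EC" for X
  using Psi_surj[of "fst X" "snd X"] that by simp
qed (use Psi_bij in auto)
thus ?thesis by (simp add: coh_equivariant_def coh_def[of U A])
qed

end

section \<open>Elements of string groups as integer vectors\<close>

locale weights =
fixes p :: "nat list"
assumes pos: "i : {1..length p} ==> 0 < weight p i" and nonempty: "p ~= []"
begin

declare One_nat_def [simp del]

abbreviation "I == {1..length p}"
abbreviation "FG == free_Abelian_group I"
abbreviation "L == string_group p"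

definition fr :: "(nat => int) => nat \<Rightarrow>\<^sub>0 int" where
"fr m = (SUM i:I. frag_cmul (m i) (frag_of i))"

definition el :: "(nat => int) => str" where
"el m = str_relations p #>\<^bsub>FG\<^esub> fr m"

lemma lookup_fr: "lookup (fr m) i = (if i : I then m i else 0)"
by (simp add: fr_def lookup_sum if_distrib[of "%x. _ * x"] cong: if_cong)

lemma fr_carrier: "fr m : carrier FG"
unfolding carrier_free_Abelian_group_iff using lookup_fr by (auto simp: in_keys_iff split: if_splits)

lemma fr_surj: "f : carrier FG ==> f = fr (lookup f)"
by (rule poly_mapping_eqI) (auto simp: lookup_fr in_keys_iff)

sublocale FGG: comm_group FG
by (rule abelian_free_Abelian_group)

lemma one_I: "1 : I"
using nonempty by (cases p) auto

lemma relations_subgroup: "subgroup (str_relations p) FG"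
unfolding str_relations_def
proof (rule FGG.generate_is_subgroup, clarify)
fix i j assume "i : I" "j : I"
hence "frag_cmul (int (weight p i)) (frag_of i) - frag_cmul (int (weight p j)) (frag_of j) =
 fr (%k. (if k = i then int (weight p i) else 0) - (if k = j then int (weight p j) else 0))"
 by (intro poly_mapping_eqI) (auto simp: lookup_fr lookup_minus)
thus "frag_cmul (int (weight p i)) (frag_of i) - frag_cmul (int (weight p j)) (frag_of j) : carrier FG"
 by (simp only: fr_carrier)
qed

text \<open>A relation moves copies of the canonical element between coordinates: \<open>e\<close>
  records the amounts, so their sum is zero. Conversely, such a vector is a combination of the
  differences between coordinate \<open>i\<close> and coordinate 1, and the entry at 1 balances
  because \<open>sum e\<close> vanishes.\<close>

lemma fr_relation:
"fr m : str_relations p <-> (EX e. (ALL i:I. m i = int (weight p i) * e i) & sum e I = 0)"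
proof
assume "fr m : str_relations p"
hence "EX e. (ALL i:I. lookup (fr m) i = int (weight p i) * e i) & sum e I = 0"
 unfolding str_relations_def
proof induction
 case one
 show ?case by (rule exI[of _ "%_. 0"]) simp
next
 case (incl h)
 then obtain i j where ij: "i : I" "j : I" "h = frag_cmul (int (weight p i)) (frag_of i) - frag_cmul (int (weight p j)) (frag_of j)" by blast
 show ?case
  by (rule exI[of _ "%k. (if k = i then 1 else 0) - (if k = j then 1 else 0)"])
   (use ij in "auto simp: lookup_minus sum_subtractf")
next
 case (inv h)
 then obtain i j where ij: "i : I" "j : I" "h = frag_cmul (int (weight p i)) (frag_of i) - frag_cmul (int (weight p j)) (frag_of j)" by blast
 have "keys h <= I" using ij by (auto simp: in_keys_iff lookup_minus split: if_splits)
 hence "inv[FG] h = - h" by simp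
 thus ?case
  by (intro exI[of _ "%k. (if k = j then 1 else 0) - (if k = i then 1 else 0)"])
   (use ij in "auto simp: lookup_minus sum_subtractf")
next
 case (eng h k)
 then obtain e e' where "ALL i:I. lookup h i = int (weight p i) * e i" "sum e I = 0"
  "ALL i:I. lookup k i = int (weight p i) * e' i" "sum e' I = 0" by blast
 thus ?case
  by (intro exI[of _ "%i. e i + e' i"]) (auto simp: lookup_add algebra_simps sum.distrib)
qed
thus "EX e. (ALL i:I. m i = int (weight p i) * e i) & sum e I = 0" by (simp add: lookup_fr cong: conj_cong)
next
assume "EX e. (ALL i:I. m i = int (weight p i) * e i) & sum e I = 0"
then obtain e where e: "!!i. i : I ==> m i = int (weight p i) * e i" "sum e I = 0" by blast
let ?r = "%i. frag_cmul (int (weight p i)) (frag_of i) - frag_cmul (int (weight p 1)) (frag_of 1)"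
have r: "frag_cmul (k :: int) (?r i) : str_relations p" if "i : I" for k i
proof -
 have ri: "?r i : str_relations p" unfolding str_relations_def by (rule generate.incl) (use that one_I in blast)
 thus ?thesis using FGG.subgroup_int_pow_closed[OF relations_subgroup ri, of k] subgroup.mem_carrier[OF relations_subgroup ri]
  by (simp only: int_pow_free_Abelian_group carrier_free_Abelian_group_iff)
qed
have "(SUM i:A. frag_cmul (e i) (?r i)) : str_relations p" if "A <= I" for A
 using finite_subset[OF that finite_atLeastAtMost] that
proof (induction A rule: finite_induct)
 case empty thus ?case using subgroup.one_closed[OF relations_subgroup] by simp
next
 case (insert i A)
 thus ?case using subgroup.m_closed[OF relations_subgroup r[of i "e i"], of "SUM i:A. frag_cmul (e i) (?r i)"] by simp
qed
hence s: "(SUM i:I. frag_cmul (e i) (?r i)) : str_relations p" by blast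
have "fr m = (SUM i:I. frag_cmul (e i) (?r i))"
proof (rule poly_mapping_eqI)
 fix k :: nat
 have "lookup (SUM i:I. frag_cmul (e i) (?r i)) k =
   (SUM i:I. (if k = i then e i * int (weight p i) else 0) - e i * (if k = 1 then int (weight p 1) else 0))"
  unfolding lookup_sum by (rule sum.cong) (auto simp: lookup_minus algebra_simps)
 also have "... = (if k : I then e k * int (weight p k) else 0)"
  using e(2) by (simp add: sum_subtractf flip: sum_distrib_right)
 finally show "lookup (fr m) k = lookup (SUM i:I. frag_cmul (e i) (?r i)) k"
  using e(1) by (simp add: lookup_fr mult.commute)
qed
thus "fr m : str_relations p" using s by simp
qed

sublocale nml: normal "str_relations p" FG
using FGG.normal_iff_subgroup relations_subgroup by blast

sublocale LL: comm_group L
unfolding string_group_def by (rule FGG.abelian_FactGroup[OF relations_subgroup])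

lemma carrier_L: "carrier L = range el"
proof -
have "x : range el" if "f : carrier FG" "x = str_relations p #>\<^bsub>FG\<^esub> f" for x f
 using fr_surj[OF that(1)] that(2) by (metis el_def rangeI)
thus ?thesis using fr_carrier by (auto simp: string_group_def carrier_FactGroup el_def)
qed

lemma el_in [simp]: "el m : carrier L"
by (simp add: carrier_L)

lemma el_surj: "x : carrier L ==> EX m. x = el m"
by (auto simp: carrier_L)

lemma fr_add: "fr m + fr m' = fr (%i. m i + m' i)" and fr_uminus: "- fr m = fr (%i. - m i)"
by (rule poly_mapping_eqI; simp add: lookup_fr lookup_add)+

lemma el_cong: "(!!i. i : I ==> m i = m' i) ==> el m = el m'"
unfolding el_def fr_def by (metis (no_types, lifting) sum.cong)

lemma el_mult: "el m *[L] el m' = el (%i. m i + m' i)"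
using nml.rcos_sum[OF fr_carrier fr_carrier, of m m'] by (simp add: el_def string_group_def fr_add)

lemma el_eq: "el m = el m' <-> (EX e. (ALL i:I. m i - m' i = int (weight p i) * e i) & sum e I = 0)"
proof -
have "el m = el m' <-> fr m : str_relations p #>\<^bsub>FG\<^esub> fr m'"
 unfolding el_def using FGG.repr_independence[OF _ fr_carrier relations_subgroup] FGG.rcos_self[OF fr_carrier relations_subgroup] by metis
also have "... <-> fr m *[FG] inv[FG] fr m' : str_relations p"
 by (rule subgroup.rcos_module[OF relations_subgroup FGG.group_axioms fr_carrier fr_carrier])
also have "fr m *[FG] inv[FG] fr m' = fr (%i. m i - m' i)"
 using fr_carrier[of m'] by (simp add: fr_uminus fr_add)
finally show ?thesis by (simp add: fr_relation)
qed

lemma el_one: "1[L] = el (%_. 0)"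
proof -
have "el (%_. 0) *[L] el (%_. 0) = el (%_. 0)" by (simp add: el_mult)
thus ?thesis by (metis LL.l_cancel_one' el_in)
qed

lemma el_inv: "inv[L] el m = el (%i. - m i)"
by (rule LL.inv_equality) (simp_all add: el_mult el_one)

lemma el_pow: "el m ^[L] (n :: nat) = el (%i. int n * m i)"
by (induction n) (simp_all add: el_one el_mult algebra_simps)

lemma el_int_pow: "el m ^[L] (n :: int) = el (%i. n * m i)"
by (cases n rule: int_cases2) (simp_all add: LL.int_pow_neg int_pow_int el_pow el_inv)

lemma el_finprod: "finite A ==> finprod L (%i. el (f i)) A = el (%j. SUM i:A. f i j)"
by (induction A rule: finite_induct) (simp_all add: el_one el_mult Pi_def)

lemma str_gen_el: "i : I ==> str_gen p i = el (%j. if j = i then 1 else 0)"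
unfolding str_gen_def el_def
by (rule arg_cong[of _ _ "r_coset FG (str_relations p)"], rule poly_mapping_eqI) (auto simp: lookup_fr)

lemma canonical_el: "canonical p = el (%j. if j = 1 then int (weight p 1) else 0)"
unfolding canonical_def str_gen_el[OF one_I] el_pow by (rule el_cong) auto

lemma gen_pow_finprod:
"finprod L (%i. str_gen p i ^[L] (a i :: nat)) I = el (%i. int (a i))"
proof -
have "finprod L (%i. str_gen p i ^[L] a i) I = finprod L (%i. el (%j. int (a i) * (if j = i then 1 else 0))) I"
 by (rule LL.finprod_cong') (simp_all add: str_gen_el el_pow Pi_def)
thus ?thesis by (auto simp: el_finprod if_distrib[of "%x. _ * x"] cong: if_cong intro!: el_cong)
qed

lemma mon_degree_el: "mon_degree p m = el (%i. int (lookup m i))"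
unfolding mon_degree_def by (rule gen_pow_finprod)

lemma dualizing_el: "dualizing p = el (%j. (if j = 1 then (int (length p) - 2) * int (weight p 1) else 0) - 1)"
proof -
have "finprod L (str_gen p) I = finprod L (%i. el (%j. if j = i then 1 else 0)) I"
 by (rule LL.finprod_cong') (simp_all add: str_gen_el)
hence "finprod L (str_gen p) I = el (%j. 1)" by (auto simp: el_finprod intro!: el_cong)
thus ?thesis unfolding dualizing_def canonical_el el_int_pow by (auto simp: el_inv el_mult intro!: el_cong)
qed

text \<open>Division with remainder in each coordinate; every quotient counts copies of the
  canonical element.\<close>

lemma normal_form_el: "normal_form_coeff p (el m) = (SUM i:I. m i div int (weight p i))"
unfolding normal_form_coeff_def
proof (rule the_equality)
have el: "canonical p ^[L] (l :: int) *[L] finprod L (%i. str_gen p i ^[L] (a i :: nat)) I =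
  el (%j. l * (if j = 1 then int (weight p 1) else 0) + int (a j))" for l a
 unfolding gen_pow_finprod canonical_el el_int_pow el_mult ..
have w: "0 < int (weight p i)" if "i : I" for i using pos[OF that] by simp
have s1: "(SUM i:I. f i + (if i = 1 then c else (0 :: int))) = sum f I + c" for f c
 using one_I by (simp add: sum.distrib)
show "EX a :: nat => nat. (ALL i:I. a i < weight p i) & el m = canonical p ^[L] (SUM i:I. m i div int (weight p i)) *[L]
  finprod L (%i. str_gen p i ^[L] a i) I"
proof (intro exI[of _ "%i. nat (m i mod int (weight p i))"] conjI ballI)
 fix i assume "i : I"
 thus "nat (m i mod int (weight p i)) < weight p i" using w[of i] by (simp add: nat_less_iff)
next
 let ?s = "SUM i:I. m i div int (weight p i)"
 show "el m = canonical p ^[L] ?s *[L] finprod L (%i. str_gen p i ^[L] nat (m i mod int (weight p i))) I"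
  unfolding el el_eq
 \<comment> \<open>The canonical element is represented in coordinate 1, so all quotients are
   collected there; the correction \<open>- ?s\<close> makes the witness sum to zero.\<close>
 proof (intro exI[of _ "%i. m i div int (weight p i) + (if i = 1 then - ?s else 0)"] conjI ballI)
  fix i assume i: "i : I"
  show "m i - (?s * (if i = 1 then int (weight p 1) else 0) + int (nat (m i mod int (weight p i)))) =
    int (weight p i) * (m i div int (weight p i) + (if i = 1 then - ?s else 0))"
   using w[OF i] mult_div_mod_eq[of "int (weight p i)" "m i"] by (auto simp: algebra_simps)
 qed (simp add: s1)
qed
fix l :: int assume "EX a :: nat => nat. (ALL i:I. a i < weight p i) & el m = canonical p ^[L] l *[L] finprod L (%i. str_gen p i ^[L] a i) I"
then obtain a e where a: "!!i. i : I ==> a i < weight p i"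
 and e: "!!i. i : I ==> m i - (l * (if i = 1 then int (weight p 1) else 0) + int (a i)) = int (weight p i) * e i" "sum e I = 0"
 unfolding el el_eq by blast
have "m i div int (weight p i) = e i + (if i = 1 then l else 0)" if i: "i : I" for i
proof -
 have "m i = int (a i) + int (weight p i) * (e i + (if i = 1 then l else 0))" using e(1)[OF i] by (auto simp: algebra_simps)
 thus ?thesis using a[OF i] by simp
qed
hence "(SUM i:I. m i div int (weight p i)) = (SUM i:I. e i + (if i = 1 then l else 0))" by (intro sum.cong) auto
thus "l = (SUM i:I. m i div int (weight p i))" using e(2) by (simp add: s1)
qed

text \<open>Induction over the number of coordinates kept: each new coordinate multiplies by a power
  of one generator.\<close>

lemma hom_determined:
assumes K: "group K" and f: "f : hom L K" and g: "g : hom L K"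
 and eq: "!!i. i : I ==> f (str_gen p i) = g (str_gen p i)" and x: "x : carrier L"
shows "f x = g x"
proof -
interpret f: group_hom L K f by (rule group_hom.intro[OF LL.group_axioms K group_hom_axioms.intro[OF f]])
interpret g: group_hom L K g by (rule group_hom.intro[OF LL.group_axioms K group_hom_axioms.intro[OF g]])
obtain m where m: "x = el m" using el_surj[OF x] by blast
have "f (el (%j. if j <= n then m j else 0)) = g (el (%j. if j <= n then m j else 0))" if "n <= length p" for n
 using that
proof (induction n)
 case 0
 have "el (%j. if j <= 0 then m j else 0) = 1[L]" unfolding el_one by (rule el_cong) auto
 thus ?case by simp
next
 case (Suc n)
 hence i: "Suc n : I" by simp
 have "el (%j. if j <= Suc n then m j else 0) = el (%j. if j <= n then m j else 0) *[L] str_gen p (Suc n) ^[L] m (Suc n)"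
  unfolding str_gen_el[OF i] el_int_pow el_mult by (rule el_cong) (auto simp: le_Suc_eq)
 thus ?case using Suc eq[OF i] str_gen_el[OF i] by (simp add: f.hom_int_pow g.hom_int_pow)
qed
from this[of "length p"] show ?thesis unfolding m using el_cong[of m "%j. if j <= length p then m j else 0"] by simp
qed

lemma lift_fun:
assumes "!!m m'. el m = el m' ==> g m = g m'"
obtains h where "h : extensional (carrier L)" "!!m. h (el m) = g m"
proof
show "(\<lambda>x\<in>carrier L. g (SOME m. el m = x)) : extensional (carrier L)" by simp
show "(\<lambda>x\<in>carrier L. g (SOME m. el m = x)) (el m) = g m" for m
 using assms[OF someI[of "%m'. el m' = el m", OF refl]] by simp
qed

text \<open>The bound on the weight makes 1 a residue, so that the values prescribed in
  \<open>str_proj\<close> are those of reduction modulo the weight.\<close>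

lemma str_proj_el:
assumes i: "i : I" and w: "1 < weight p i" shows "str_proj p i (el m) = m i mod int (weight p i)"
proof -
obtain h where h: "h : extensional (carrier L)" "!!m. h (el m) = m i mod int (weight p i)"
proof (rule lift_fun)
 fix m m' assume "el m = el m'"
 then obtain e where "m i - m' i = int (weight p i) * e" using i unfolding el_eq by blast
 hence "m i = m' i + int (weight p i) * e" by simp
 thus "m i mod int (weight p i) = m' i mod int (weight p i)" by simp
qed (rule that)
let ?Z = "integer_mod_group (weight p i)"
have hh: "h : hom L ?Z"
proof (rule homI)
 fix x y assume "x : carrier L" "y : carrier L"
 thus "h x : carrier ?Z" "h (x *[L] y) = h x *[?Z] h y"
  using w by (auto simp: carrier_L el_mult h(2) carrier_integer_mod_group mult_integer_mod_group mod_add_eq)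
qed
have "str_proj p i = h"
 unfolding str_proj_def
proof (rule the_equality)
 show "h : hom L ?Z & h : extensional (carrier L) & (ALL j:I. h (str_gen p j) = (if i = j then 1 else 0))"
  using hh h w by (auto simp: str_gen_el)
 fix f assume f: "f : hom L ?Z & f : extensional (carrier L) & (ALL j:I. f (str_gen p j) = (if i = j then 1 else 0))"
 show "f = h"
 proof (rule extensionalityI[of _ "carrier L"])
  fix x assume "x : carrier L"
  thus "f x = h x"
   by (rule hom_determined[OF group_integer_mod_group conjunct1[OF f] hh, rotated]) (use f h w in "auto simp: str_gen_el")
 qed (use f h in auto)
qed
thus ?thesis using h by simp
qed

end

section \<open>Coordinate algebras\<close>

lemma monomials_induct [consumes 1, case_names zero add]:
fixes P :: "'x \<Rightarrow>\<^sub>0 'k::comm_monoid_add"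
assumes "keys P <= K" "H 0"
 "!!m c Q. m : K ==> keys Q <= K ==> H Q ==> H (single m c + Q)"
shows "H P"
proof -
have "keys (SUM m:A. single m (lookup P m)) <= K &
  H (SUM m:A. single m (lookup P m))" if "finite A" "A <= K" for A
 using that
proof (induction A rule: finite_induct)
 case (insert m A)
 moreover have "keys (single m c + Q) <= K" if "keys Q <= K" for c :: 'k and Q
  by (rule subset_trans[OF Poly_Mapping.keys_add]) (use that insert.prems in auto)
 ultimately show ?case using assms(3) by simp
qed (use assms(2) in simp)
from this[of "keys P"]
have "H (SUM m:keys P. single m (lookup P m))" using assms(1) by simp
moreover have "(SUM m:keys P. single m (lookup P m)) = P"
 by (rule poly_mapping_eqI) (simp add: lookup_sum lookup_single when_def in_keys_iff)
ultimately show ?thesis by simp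
qed

text \<open>The integers \<open>w i\<close> are degrees of the variables. As \<open>w i\<close>
  times the weight is the same \<open>D\<close> for all \<open>i\<close>, the degree of the
  canonical element, they induce an integer degree on the string group.\<close>

locale coord = weights p for p +
fixes F :: "'k::field mpoly set" and w :: "nat => int" and D :: int
assumes w: "i : {1..length p} ==> 0 < w i & w i * int (weight p i) = D"
 and F_PR: "f : F ==> f : carrier (poly_ring (length p))"
 and F_homog: "f : F ==> EX l. ALL m:keys f. mon_degree p m = l"
begin

abbreviation "PR == poly_ring (length p) :: 'k mpoly ring"
abbreviation "J == Idl\<^bsub>PR\<^esub> F"
abbreviation "S == coord_algebra p F"
abbreviation "cl == poly_class p F"
abbreviation "mons == {m :: nat \<Rightarrow>\<^sub>0 nat. keys m <= I}"
abbreviation "mn == single :: (nat \<Rightarrow>\<^sub>0 nat) => 'k => 'k mpoly"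

lemma PR_sel [simp]: "monoid.mult PR = (*)" "1[PR] = 1" "0[PR] = 0" "add PR = (+)"
by (auto simp: poly_ring_def)

lemma PR_carrier: "P : carrier PR <-> keys P <= mons"
by (auto simp: poly_ring_def)

lemma mons_add: "m : mons ==> m' : mons ==> m + m' : mons"
using Poly_Mapping.keys_add[of m m'] by blast

lemma PR_add: "P : carrier PR ==> Q : carrier PR ==> P + Q : carrier PR"
using Poly_Mapping.keys_add[of P Q] unfolding PR_carrier by blast

lemma PR_uminus: "P : carrier PR ==> - P : carrier PR"
by (simp add: PR_carrier)

lemma PR_mult: "P : carrier PR ==> Q : carrier PR ==> P * Q : carrier PR"
unfolding PR_carrier using keys_mult[of P Q] mons_add by fast

lemma PR_mono: "m : mons ==> mn m c : carrier PR" and PR_one: "1 : carrier PR" and PR_zero: "0 : carrier PR"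
by (auto simp: PR_carrier)

lemma PR_cring: "cring PR"
by (intro cringI abelian_groupI comm_monoidI)
 (auto simp: PR_add PR_mult PR_one PR_zero algebra_simps intro!: bexI[of _ "- _"] PR_uminus)

sublocale PRR: cring PR by (rule PR_cring)

lemma PR_minus: "P : carrier PR ==> -[PR] P = - P"
by (rule PRR.minus_equality) (auto simp: PR_uminus)

lemma J_ideal: "ideal J PR"
using F_PR by (intro PRR.genideal_ideal) blast

sublocale JI: ideal J PR by (rule J_ideal)

lemma J_facts: "P : J ==> P : carrier PR" "P : J ==> Q : J ==> P + Q : J" "P : carrier PR ==> Q : J ==> P * Q : J"
"P : J ==> - P : J" "P : F ==> P : J" "0 : J"
using JI.Icarr JI.a_closed JI.I_l_closed JI.a_inv_closed[of P] PR_minus[of P] PRR.genideal_self[of F] F_PR JI.zero_closed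
by (auto simp: subset_iff)

text \<open>Multiples by monomials are enough, since together with sums they give all multiples and
  hence an ideal.\<close>

lemma J_induct [consumes 1, case_names zero add mult gen]:
assumes "P : J" "H 0" "!!P Q. P : carrier PR ==> Q : carrier PR ==> H P ==> H Q ==> H (P + Q)"
 "!!m c P. m : mons ==> P : carrier PR ==> H P ==> H (mn m c * P)" "!!f. f : F ==> H f"
shows "H P"
proof -
have mult: "H (Q * P)" if P: "P : carrier PR" "H P" and Q: "Q : carrier PR" for P Q
 using Q[unfolded PR_carrier]
proof (induction rule: monomials_induct)
 case (add m c Q)
 thus ?case using P assms(3)[OF PR_mult[OF PR_mono P(1)] PR_mult[OF _ P(1)], of m Q c] assms(4) by (simp add: distrib_right PR_carrier)
qed (use assms(2) in simp)
have minus: "H (- P)" if "P : carrier PR" "H P" for P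
 using mult[OF that, of "- 1"] PR_one PR_uminus by simp
have "ideal {P : carrier PR. H P} PR"
proof (rule idealI[OF PRR.ring_axioms])
 show "subgroup {P : carrier PR. H P} (add_monoid PR)"
  by (rule additive_subgroup.a_subgroup[OF PRR.subgroupI'])
   (auto simp: assms(2,3) minus PR_add PR_zero PR_uminus PR_minus)
qed (use mult PR_mult in "auto simp: mult.commute")
hence "J <= {P : carrier PR. H P}" by (rule PRR.genideal_minimal) (use F_PR assms(5) in auto)
thus ?thesis using assms(1) by blast
qed

lemma cl_eq: "P : carrier PR ==> Q : carrier PR ==> cl P = cl Q <-> P - Q : J"
unfolding poly_class_def
using JI.a_rcos_module[of Q P] JI.a_repr_independence'[of P Q] JI.a_rcos_self[of P] by (auto simp: PR_minus)

lemma S_sel: "carrier S = cl ` carrier PR" "0[S] = cl 0" "1[S] = cl 1"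
"smap S c = cl (Const c)" "gg S = L"
"cmp S x = cl ` {P : carrier PR. keys P <= {m : mons. mon_degree p m = x}}"
proof -
show "carrier S = cl ` carrier PR"
 by (auto simp: coord_algebra_def ring.defs graded_algebra.defs FactRing_def A_RCOSETS_def' poly_class_def)
show "0[S] = cl 0"
 using JI.a_rcos_const[OF J_facts(6)] by (simp add: coord_algebra_def ring.defs graded_algebra.defs FactRing_def poly_class_def)
show "cmp S x = cl ` {P : carrier PR. keys P <= {m : mons. mon_degree p m = x}}"
 by (auto simp: coord_algebra_def ring.defs graded_algebra.defs PR_carrier intro!: imageI)
qed (simp_all add: coord_algebra_def ring.defs graded_algebra.defs FactRing_def poly_class_def)

lemma S_op: "P : carrier PR ==> Q : carrier PR ==> cl P +[S] cl Q = cl (P + Q)"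
"P : carrier PR ==> Q : carrier PR ==> cl P *[S] cl Q = cl (P * Q)"
using JI.a_rcos_sum[of P Q] JI.rcoset_mult_add[of P Q]
by (simp_all add: coord_algebra_def ring.defs graded_algebra.defs FactRing_def poly_class_def)

lemma S_cring: "cring S"
proof -
have "EX y:carrier S. y +[S] x = 0[S]" if x: "x : carrier S" for x
proof -
 obtain P where "P : carrier PR" "x = cl P" using x by (auto simp: S_sel)
 thus ?thesis by (intro bexI[of _ "cl (- P)"]) (auto simp: S_sel S_op PR_uminus)
qed
thus ?thesis
 by (intro cringI abelian_groupI comm_monoidI)
  (auto simp: S_sel S_op PR_add PR_mult PR_one PR_zero algebra_simps)
qed

sublocale SS: cring S by (rule S_cring)

abbreviation "deg m == mon_degree p m"
abbreviation "homs l == {m : mons. deg m = l}"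

lemma deg_in [simp]: "deg m : carrier L"
by (simp add: mon_degree_el)

lemma deg_add: "deg (m + m') = deg m *[L] deg m'"
by (simp add: mon_degree_el el_mult lookup_add)

lemma deg_zero: "deg 0 = 1[L]"
by (simp add: mon_degree_el el_one)

lemma deg_var: "i : I ==> deg (single i 1) = str_gen p i"
unfolding mon_degree_el str_gen_el by (rule el_cong) (auto simp: lookup_single)

text \<open>The chosen representative does not matter, by \<open>dg_el\<close>: two of them differ
  by weights times some \<open>e\<close> with \<open>sum e\<close> zero, which contributes
  \<open>D * sum e\<close>.\<close>

definition dg :: "str => int" where "dg x = (SUM i:I. w i * (SOME m. el m = x) i)"

lemma dg_el: "dg (el m) = (SUM i:I. w i * m i)"
proof -
have "el (SOME m'. el m' = el m) = el m" by (rule someI[of "%m'. el m' = el m"]) simp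
then obtain e where e: "!!i. i : I ==> (SOME m'. el m' = el m) i - m i = int (weight p i) * e i" "sum e I = 0"
 unfolding el_eq by blast
have "(SUM i:I. w i * (SOME m'. el m' = el m) i) - (SUM i:I. w i * m i) = (SUM i:I. D * e i)"
 unfolding sum_subtractf[symmetric] right_diff_distrib[symmetric]
 by (rule sum.cong) (use e(1) w in "auto simp flip: mult.assoc")
thus ?thesis using e(2) by (simp add: dg_def flip: sum_distrib_left)
qed

lemma dg_mult: "x : carrier L ==> y : carrier L ==> dg (x *[L] y) = dg x + dg y"
by (auto simp: carrier_L el_mult dg_el distrib_left sum.distrib)

lemma dg_deg: "0 <= dg (deg m)" and dg_zero: "dg (deg m) = 0 ==> m : mons ==> m = 0"
proof -
have n: "0 <= w i * int (lookup m i)" if "i : I" for i using w[OF that] by simp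
show "0 <= dg (deg m)" unfolding mon_degree_el dg_el by (rule sum_nonneg) (use n in auto)
assume d: "dg (deg m) = 0" and m: "m : mons"
have "lookup m i = 0" if i: "i : I" for i
proof -
 have "w i * int (lookup m i) = 0"
  using d i n sum_nonneg_eq_0_iff[of I "%i. w i * int (lookup m i)"] unfolding mon_degree_el dg_el by auto
 thus ?thesis using w[OF i] by simp
qed
hence "i ~: keys m" for i using m by (cases "i : I") (auto simp: in_keys_iff)
thus "m = 0" by (metis all_not_in_conv keys_eq_empty)
qed

lemma keys_mn: "m : K ==> keys (mn m c) <= K"
by simp

lemma cl_mn: "m : homs l ==> cl (mn m c) : cmp S l"
using keys_mn[of m "homs l" c] PR_mono[of m c] unfolding S_sel by (intro imageI) simp

lemma comp_subgroup: "additive_subgroup (cmp S l) S"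
proof (rule SS.subgroupI')
have uminus: "-[S] cl P = cl (- P)" if "P : carrier PR" for P
 using that by (intro SS.minus_equality) (auto simp: S_sel S_op PR_uminus)
fix x y assume xy: "x : cmp S l"
then obtain P where P: "x = cl P" "P : carrier PR" "keys P <= homs l" unfolding S_sel(6) by blast
show "-[S] x : cmp S l"
 using P uminus[OF P(2)] PR_uminus[OF P(2)] unfolding S_sel by (intro image_eqI[of _ _ "- P"]) auto
assume "y : cmp S l"
then obtain Q where Q: "y = cl Q" "Q : carrier PR" "keys Q <= homs l" unfolding S_sel(6) by blast
have "keys (P + Q) <= homs l" using P(3) Q(3) Poly_Mapping.keys_add[of P Q] by blast
thus "x +[S] y : cmp S l"
 using P Q S_op(1)[OF P(2) Q(2)] PR_add[OF P(2) Q(2)] unfolding S_sel by (intro image_eqI[of _ _ "P + Q"]) auto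
next
show "0[S] : cmp S l" unfolding S_sel by (intro image_eqI[of _ _ 0]) (auto simp: PR_zero)
qed (auto simp: S_sel)

lemma comp_mons: "cmp S l <= acl S {cl (mn m c) | m c. m : homs l}"
proof
fix x assume "x : cmp S l"
then obtain P where P: "x = cl P" "keys P <= homs l" unfolding S_sel(6) by blast
show "x : acl S {cl (mn m c) | m c. m : homs l}"
 unfolding P(1) using P(2)
proof (induction rule: monomials_induct)
 case zero thus ?case using acl_zero[of S] by (simp add: S_sel)
next
 case (add m c Q)
 have "Q : carrier PR" using add(2) by (auto simp: PR_carrier)
 hence "cl (mn m c + Q) = cl (mn m c) +[S] cl Q" using add(1) PR_mono[of m c] by (simp add: S_op)
 moreover have "cl (mn m c) : {cl (mn m c) | m c. m : homs l}" using add(1) by blast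
 ultimately show ?case using acl.acl_add[OF _ add.IH] by simp
qed
qed

lemma carrier_mons: "carrier S <= acl S {cl (mn m c) | m c. m : mons}"
proof
fix x assume "x : carrier S"
then obtain P where P: "x = cl P" "P : carrier PR" unfolding S_sel(1) by blast
show "x : acl S {cl (mn m c) | m c. m : mons}"
 unfolding P(1) using P(2)[unfolded PR_carrier]
proof (induction rule: monomials_induct)
 case zero thus ?case using acl_zero[of S] by (simp add: S_sel)
next
 case (add m c Q)
 have "cl (mn m c + Q) = cl (mn m c) +[S] cl Q" using add(1,2) PR_mono[of m c] by (simp add: S_op PR_carrier)
 moreover have "cl (mn m c) : {cl (mn m c) | m c. m : mons}" using add(1) by blast
 ultimately show ?case using acl.acl_add[OF _ add.IH] by simp
qed
qed

definition hp :: "str => 'k mpoly => 'k mpoly" where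
"hp l P = (SUM m:keys P. if deg m = l then mn m (lookup P m) else 0)"

lemma lookup_hp: "lookup (hp l P) m = (if deg m = l then lookup P m else 0)"
proof -
have "lookup (hp l P) m = (SUM m':keys P. if m' = m then (if deg m = l then lookup P m else 0) else 0)"
 unfolding hp_def lookup_sum by (rule sum.cong) (auto simp: lookup_single)
thus ?thesis by (simp add: in_keys_iff)
qed

lemma hp_add: "hp l (P + Q) = hp l P + hp l Q" and hp_zero: "hp l 0 = 0"
and hp_mn: "hp l (mn m c) = (if deg m = l then mn m c else 0)"
by (rule poly_mapping_eqI; auto simp: lookup_hp lookup_add lookup_single when_def)+

lemma hp_eq: "keys P <= homs l' ==> hp l P = (if l = l' then P else 0)"
by (rule poly_mapping_eqI) (auto simp: lookup_hp subset_iff in_keys_iff)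

lemma hp_PR: "P : carrier PR ==> hp l P : carrier PR" and hp_keys: "P : carrier PR ==> keys (hp l P) <= homs l"
proof -
have "m : keys P & deg m = l" if "m : keys (hp l P)" for m
 using that by (simp add: in_keys_iff lookup_hp split: if_splits)
thus "P : carrier PR ==> hp l P : carrier PR" "P : carrier PR ==> keys (hp l P) <= homs l"
 unfolding PR_carrier by blast+
qed

lemma hp_mult:
assumes "m : mons" "P : carrier PR" "l : carrier L"
shows "hp l (mn m c * P) = mn m c * hp (inv[L] (deg m) *[L] l) P"
using assms(2)[unfolded PR_carrier]
proof (induction rule: monomials_induct)
case (add m' c' Q)
have "deg m *[L] deg m' = l <-> deg m' = inv[L] (deg m) *[L] l"
 using LL.inv_solve_left[of "deg m'" "deg m" l] assms(3) by auto
thus ?case using add(3) by (simp add: distrib_left hp_add mult_single hp_mn deg_add)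
qed (simp add: hp_zero)

text \<open>The ideal is homogeneous because its generators are; this is what makes
  \<open>pr\<close> well defined on classes.\<close>

lemma hp_J: "P : J ==> ALL l:carrier L. hp l P : J"
proof (induction rule: J_induct)
case (gen f)
obtain l' where l': "ALL m:keys f. deg m = l'" using F_homog[OF gen] by blast
have "keys f <= homs l'" using l' F_PR[OF gen] by (auto simp: PR_carrier)
thus ?case using hp_eq J_facts(5)[OF gen] J_facts(6) by simp
qed (auto simp: hp_zero hp_add hp_mult J_facts PR_mono)

definition pr :: "str => 'k mpoly set => 'k mpoly set" where
"pr l x = cl (hp l (SOME P. P : carrier PR & cl P = x))"

lemma pr_cl:
assumes "P : carrier PR" "l : carrier L" shows "pr l (cl P) = cl (hp l P)"
proof -
let ?Q = "SOME Q. Q : carrier PR & cl Q = cl P"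
have Q: "?Q : carrier PR & cl ?Q = cl P" by (rule someI[of "%Q. Q : carrier PR & cl Q = cl P" P]) (use assms in simp)
have "hp l (?Q - P) + hp l P = hp l ?Q" unfolding hp_add[symmetric] by simp
hence "hp l (?Q - P) = hp l ?Q - hp l P" by (simp add: eq_diff_eq)
hence "hp l ?Q - hp l P : J" using hp_J[of "?Q - P"] Q cl_eq[of ?Q P] assms by auto
thus ?thesis unfolding pr_def using cl_eq[OF hp_PR hp_PR, of ?Q P l l] Q assms by blast
qed

definition XS :: "('k mpoly set \<times> str) set" where "XS = (%i. (cl (Var i), str_gen p i)) ` I"

lemma Var_mn: "Var i = mn (single i 1) 1"
by (simp add: Var_def)

lemma S_galg: "galg S dg pr XS"
proof (rule galg.intro)
show "cring S" "comm_group (gg S)" by (simp_all add: S_cring S_sel LL.comm_group_axioms)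
show "additive_subgroup (cmp S l) S" for l by (rule comp_subgroup)
show "s *[S] t : cmp S (a *[gg S] b)" if st: "s : cmp S a" "t : cmp S b" for a b s t
proof -
 obtain P where P: "s = cl P" "P : carrier PR" "keys P <= homs a" using st(1) unfolding S_sel(6) by blast
 obtain Q where Q: "t = cl Q" "Q : carrier PR" "keys Q <= homs b" using st(2) unfolding S_sel(6) by blast
 have "keys (P * Q) <= homs (a *[L] b)"
 proof
  fix k assume "k : keys (P * Q)"
  then obtain m m' where "k = m + m'" "m : homs a" "m' : homs b" using keys_mult[of P Q] P(3) Q(3) by blast
  thus "k : homs (a *[L] b)" using mons_add by (auto simp: deg_add)
 qed
 thus ?thesis unfolding P(1) Q(1) S_op(2)[OF P(2) Q(2)] unfolding S_sel using PR_mult[OF P(2) Q(2)] by blast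
qed
show "pr l s : cmp S l" if "l : carrier (gg S)" "s : carrier S" for l s
 using that hp_PR hp_keys by (auto simp: S_sel pr_cl)
show "pr l (s +[S] t) = pr l s +[S] pr l t" if "l : carrier (gg S)" "s : carrier S" "t : carrier S" for l s t
 using that by (auto simp: S_sel S_op pr_cl PR_add hp_add hp_PR)
show "pr l s = (if l = a then s else 0[S])" if l: "l : carrier (gg S)" and s: "s : cmp S a" for l a s
proof -
 obtain P where P: "s = cl P" "P : carrier PR" "keys P <= homs a" using s unfolding S_sel(6) by blast
 show ?thesis using hp_eq[OF P(3), of l] pr_cl[OF P(2), of l] l by (cases "l = a") (simp_all add: P(1) S_sel)
qed
show "carrier S <= acl S (UN l:carrier (gg S). cmp S l)"
 by (rule subset_trans[OF carrier_mons acl_mono]) (use cl_mn S_sel(5) deg_in in fastforce)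
show "dg (a *[gg S] b) = dg a + dg b" if "a : carrier (gg S)" "b : carrier (gg S)" for a b
 using dg_mult that by (simp add: S_sel)
show "cmp S l = {0[S]}" if "dg l < 0" for l
proof -
 have e: "homs l = {}" using dg_deg that by (metis (mono_tags, lifting) Collect_empty_eq leD)
 show ?thesis unfolding S_sel(6,2) e by (auto simp: PR_zero intro!: image_eqI)
qed
show "finite XS" by (simp add: XS_def)
show "e : carrier (gg S) & x : cmp S e & 0 < dg e" if xe: "(x, e) : XS" for x e
proof -
 obtain i where i: "i : I" "x = cl (Var i)" "e = str_gen p i" using xe by (auto simp: XS_def)
 have "dg e = w i" using i by (simp add: str_gen_el dg_el if_distrib[of "%x. _ * x"] cong: if_cong)
 thus ?thesis
  using i w[OF i(1)] deg_in[of "single i 1"] cl_mn[of "single i 1" e 1] by (simp add: deg_var S_sel(5) Var_mn)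
qed
show "cmp S l <= acl S {x *[S] s | x e s. (x, e) : XS & s : cmp S (inv[gg S] e *[gg S] l)}"
 if l: "l : carrier (gg S)" "l ~= 1[gg S]" for l
proof (rule subset_trans[OF comp_mons acl_mono], clarify)
 fix m c assume m: "keys m <= I" "l = deg m"
 hence "m ~= 0" using l deg_zero by (auto simp: S_sel)
 \<comment> \<open>A monomial of nontrivial degree contains a variable; splitting off one factor
   gives the product required by \<open>comp_X\<close>.\<close>
 then obtain i where i: "i : keys m" by (metis all_not_in_conv keys_eq_empty)
 let ?x = "single i (1 :: nat)"
 define m' where "m' = m - ?x"
 have mm: "m = ?x + m'"
  by (rule poly_mapping_eqI) (use i in "auto simp: m'_def lookup_add lookup_minus lookup_single when_def in_keys_iff")
 have m': "m' : mons" using m(1) by (auto simp: m'_def in_keys_iff lookup_minus subset_iff)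
 have iI: "i : I" using i m by blast
 have "deg m' = inv[L] str_gen p i *[L] deg m"
  unfolding mm deg_add deg_var[OF iI] using deg_in[of ?x] by (simp add: deg_var[OF iI] flip: LL.m_assoc)
 hence "cl (mn m' c) : cmp S (inv[L] str_gen p i *[L] deg m)" using cl_mn[of m' "deg m'" c] m' by simp
 moreover have "cl (mn m c) = cl (Var i) *[S] cl (mn m' c)"
  using PR_mono[of ?x 1] PR_mono[OF m', of c] iI by (simp add: S_op Var_mn mult_single mm)
 ultimately show "EX x e s. cl (mn m c) = x *[S] s & (x, e) : XS & s : cmp S (inv[gg S] e *[gg S] deg m)"
  using iI unfolding S_sel(5) XS_def by blast
qed
show "cmp S 1[gg S] = range (smap S)"
proof
 show "cmp S 1[gg S] <= range (smap S)"
 proof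
  fix x assume "x : cmp S 1[gg S]"
  then obtain P where P: "x = cl P" "keys P <= homs 1[L]" unfolding S_sel(5,6) by blast
  have "m = 0" if "m : homs 1[L]" for m using that dg_zero[of m] by (simp add: el_one dg_el)
  hence "keys P <= {0}" using P(2) by blast
  hence "P = Const (lookup P 0)"
   by (intro poly_mapping_eqI) (auto simp: Const_def lookup_single when_def in_keys_iff)
  thus "x : range (smap S)" unfolding P(1) S_sel by (metis rangeI)
 qed
 show "range (smap S) <= cmp S 1[gg S]"
  using cl_mn[of 0 "1[L]"] by (auto simp: S_sel(4,5) Const_def deg_zero)
qed
have c: "Const c : carrier PR" for c using PR_mono[of 0 c] by (simp add: Const_def)
show "smap S 1 = 1[S]" by (simp add: S_sel Const_def)
show "smap S (c + d) = smap S c +[S] smap S d"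
 "smap S (c * d) = smap S c *[S] smap S d" for c d
 using c by (simp_all add: S_sel S_op) (simp_all add: Const_def single_add mult_single)
qed

text \<open>A monomial is coded by the number of its exponent list, so monomials with coefficients
  inject into \<open>nat \<times> 'k\<close>, and elements of the algebra are sums of lists of
  them.\<close>

lemma S_lepoll:
assumes "inj (e :: nat \<times> 'k => 'u)"
shows "infinite (UNIV :: 'u set)" "carrier S \<lesssim> (UNIV :: 'u set)"
proof -
show inf: "infinite (UNIV :: 'u set)"
 using finite_imageD[OF finite_subset[OF subset_UNIV] assms] by (auto simp: finite_prod infinite_UNIV_nat)
let ?Y = "{cl (mn m c) | m c. m : mons}"
\<comment> \<open>The index range must reach \<open>length p\<close>, because variables are numbered
  from 1.\<close>
define g where "g = (%(m :: nat \<Rightarrow>\<^sub>0 nat, c). e (to_nat (map (lookup m) [0..<Suc (length p)]), c :: 'k))"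
have "inj_on g (mons \<times> UNIV)"
proof (rule inj_onI, clarify)
 fix m c m' c' assume m: "keys m <= I" "keys m' <= I" and "g (m, c) = g (m', c')"
 hence e: "map (lookup m) [0..<Suc (length p)] = map (lookup m') [0..<Suc (length p)]" "c = c'"
  using assms by (auto simp: g_def dest!: injD simp del: upt_Suc)
 have "m = m'"
 proof (rule poly_mapping_eqI)
  fix i show "lookup m i = lookup m' i"
  proof (cases "i : I")
   case True thus ?thesis using e(1) by (simp del: upt_Suc add: map_eq_conv)
  next
   case False hence "i ~: keys m" "i ~: keys m'" using m by auto
   thus ?thesis by (simp add: in_keys_iff)
  qed
 qed
 thus "m = m' & c = c'" using e by simp
qed
hence "mons \<times> (UNIV :: 'k set) \<lesssim> (UNIV :: 'u set)" unfolding lepoll_def by blast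
moreover have "?Y = (%(m, c). cl (mn m c)) ` (mons \<times> UNIV)" by auto
ultimately have Y: "?Y \<lesssim> (UNIV :: 'u set)" by (simp only: lepoll_trans[OF image_lepoll])
have "carrier S \<lesssim> (%ys. foldr (add S) ys 0[S]) ` lists ?Y"
 by (rule subset_imp_lepoll[OF subset_trans[OF carrier_mons acl_lists]])
also have "... \<lesssim> lists ?Y" by (rule image_lepoll)
also have "... \<lesssim> lists (UNIV :: 'u set)" by (rule lists_lepoll_mono[OF Y])
also have "... \<lesssim> (UNIV :: 'u set)"
 using lists_infinite_bij_betw[OF inf] by (metis bij_betw_imp_inj_on lepoll_def subset_UNIV)
finally show "carrier S \<lesssim> (UNIV :: 'u set)" .
qed

end

lemma Var_power: "Var i ^ n = single (single i n) 1"
by (induction n) (auto simp: Var_def mult_single plus_1_eq_Suc simp flip: single_add)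

section \<open>Induction over polynomials and coarser gradings\<close>

context coord
begin

lemma PR_Const: "Const c : carrier PR" and PR_Var: "i : I ==> Var i : carrier PR"
by (auto simp: PR_carrier Const_def Var_def)

lemma PR_diff: "P : carrier PR ==> Q : carrier PR ==> P - Q : carrier PR"
using PR_add[OF _ PR_uminus, of P Q] by simp

lemma PR_power: "P : carrier PR ==> P ^ n : carrier PR"
by (induction n) (auto simp: PR_one PR_mult)

lemma PR_induct [consumes 1, case_names Const Var add mult]:
assumes "P : carrier PR" "!!c. H (Const c)" "!!i. i : I ==> H (Var i)"
 "!!P Q. P : carrier PR ==> Q : carrier PR ==> H P ==> H Q ==> H (P + Q)"
 "!!P Q. P : carrier PR ==> Q : carrier PR ==> H P ==> H Q ==> H (P * Q)"
shows "H P"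
proof -
have one: "H 1" using assms(2)[of 1] by (simp add: Const_def)
have pow: "H (Var i ^ n)" if "i : I" for i n
 by (induction n) (use one that assms(3,5) PR_Var PR_power in auto)
have mon: "H (mn m 1)" if "keys m <= I" for m
 using that
proof (induction rule: monomials_induct)
 case (add i n m)
 have "mn (single i n + m) 1 = Var i ^ n * mn m 1" by (simp add: Var_power mult_single)
 thus ?case using add assms(5)[OF PR_power[OF PR_Var] PR_mono pow] by simp
qed (use one in simp)
show ?thesis
 using assms(1)[unfolded PR_carrier]
proof (induction rule: monomials_induct)
 case zero thus ?case using assms(2)[of 0] by (simp add: Const_def)
next
 case (add m c Q)
 have "mn m c = Const c * mn m 1" by (simp add: Const_def mult_single)
 hence "H (mn m c)" using assms(5)[OF PR_Const PR_mono assms(2) mon] add by simp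
 thus ?case using assms(4)[OF PR_mono] add by (simp add: PR_carrier)
qed
qed

lemma cl_power: "P : carrier PR ==> cl P ^[S] (n :: nat) = cl (P ^ n)"
by (induction n) (simp_all add: S_sel S_op PR_power mult.commute)

lemma cl_J: "P : carrier PR ==> Q : carrier PR ==> P - Q : J ==> cl P = cl Q"
using cl_eq by blast

lemma lift_cl:
assumes "!!P Q. P : carrier PR ==> Q : carrier PR ==> P - Q : J ==> g P = g Q"
obtains h where "h : extensional (carrier S)" "!!P. P : carrier PR ==> h (cl P) = g P"
proof
let ?h = "\<lambda>x\<in>carrier S. g (SOME P. P : carrier PR & cl P = x)"
show "?h : extensional (carrier S)" by simp
fix P assume P: "P : carrier PR"
let ?Q = "SOME Q. Q : carrier PR & cl Q = cl P"
have "?Q : carrier PR & cl ?Q = cl P" using someI[of "%Q. Q : carrier PR & cl Q = cl P" P] P by simp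
thus "?h (cl P) = g P" using assms[of ?Q P] P cl_eq[of ?Q P] by (simp add: S_sel)
qed

text \<open>Polynomials that are homogeneous of degree \<open>x\<close> for the grading coarsened along \<open>f\<close>.\<close>

definition hdp :: "(str => 'x) => 'x => 'k mpoly => bool" where
"hdp f x P <-> keys P <= {m : mons. f (deg m) = x}"

lemma hdp_add: "hdp f x P ==> hdp f x Q ==> hdp f x (P + Q)" and hdp_uminus: "hdp f x P ==> hdp f x (- P)"
using Poly_Mapping.keys_add[of P Q] unfolding hdp_def by (blast, simp)

lemma hdp_diff: "hdp f x P ==> hdp f x Q ==> hdp f x (P - Q)"
using hdp_add[of f x P "- Q"] hdp_uminus[of f x Q] by simp

lemma hdp_mult:
assumes "f : hom L K" "hdp f x P" "hdp f y Q" shows "hdp f (x *[K] y) (P * Q)"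
unfolding hdp_def
proof
fix k assume "k : keys (P * Q)"
then obtain m m' where m: "k = m + m'" "m : keys P" "m' : keys Q" using keys_mult[of P Q] by blast
hence "m : mons" "f (deg m) = x" "m' : mons" "f (deg m') = y" using assms(2,3) unfolding hdp_def by auto
thus "k : {m : mons. f (deg m) = x *[K] y}" using m(1) mons_add hom_mult[OF assms(1) deg_in deg_in, of m m'] by (simp add: deg_add)
qed

lemma hdp_Const: "f : hom L K ==> group K ==> hdp f 1[K] (Const c)"
using hom_one[of f L K] by (simp add: hdp_def Const_def deg_zero LL.group_axioms)

lemma hdp_Var: "i : I ==> hdp f (f (str_gen p i)) (Var i)"
using deg_var[of i] by (simp add: hdp_def Var_def)

lemma hdp_power: "f : hom L K ==> group K ==> hdp f x P ==> hdp f (x ^[K] (n :: nat)) (P ^ n)"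
proof (induction n)
case 0 thus ?case using hdp_Const[of f K 1] by (simp add: Const_def)
next
case (Suc n) thus ?case using hdp_mult[of f K "x ^[K] n" "P ^ n" x P] by (simp add: mult.commute)
qed

lemma hdp_id: "hdp (%x. x) l P ==> cl P : cmp S l"
unfolding hdp_def S_sel(6) PR_carrier by blast

lemma hdp_cl: "hdp f x P ==> cl P : acl S {s | s v. v : carrier L & f v = x & s : cmp S v}"
unfolding hdp_def
proof (induction rule: monomials_induct)
case zero thus ?case using acl_zero[of S] by (simp add: S_sel)
next
case (add m c Q)
have "cl (mn m c + Q) = cl (mn m c) +[S] cl Q" using add(1,2) PR_mono[of m c] by (subst S_op) (auto simp: PR_carrier)
moreover have "cl (mn m c) : {s | s v. v : carrier L & f v = x & s : cmp S v}" using add(1) cl_mn[of m "deg m" c] deg_in[of m] by blast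
ultimately show ?case using acl.acl_add[OF _ add.IH] by simp
qed

end

text \<open>The \<open>k\<close>-linear extension of \<open>g\<close> from monomials. Both \<phi>
  and its retraction are given on polynomials in this way; the retraction is not multiplicative, so
  substitution would not describe it.\<close>

definition lin :: "((nat \<Rightarrow>\<^sub>0 nat) => 'k::field mpoly) => 'k mpoly => 'k mpoly" where
"lin g P = (SUM m:keys P. Const (lookup P m) * g m)"

lemma Const_add: "Const (c + d) = Const c + Const d" and Const_mult: "Const (c * d) = Const c * Const d"
and Const_0: "Const 0 = 0" and Const_1: "Const 1 = 1" and Const_diff: "Const (c - d) = Const c - Const d"
by (simp_all add: Const_def single_add mult_single single_diff)

lemma lin_sup:
assumes "finite K" "keys P <= K"
shows "lin g P = (SUM m:K. Const (lookup P m) * g m)"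
unfolding lin_def by (rule sum.mono_neutral_left) (use assms in "auto simp: in_keys_iff Const_0")

lemma lin_add: "lin g (P + Q) = lin g P + lin g Q"
proof -
let ?K = "keys P Un keys Q"
have "lin g (P + Q) = (SUM m:?K. Const (lookup (P + Q) m) * g m)"
 by (rule lin_sup) (use Poly_Mapping.keys_add[of P Q] in auto)
thus ?thesis using lin_sup[of ?K P g] lin_sup[of ?K Q g] by (simp add: lookup_add Const_add distrib_right sum.distrib)
qed

lemma lin_single: "lin g (single m c) = Const c * g m"
by (subst lin_sup[of "{m}"]) auto

lemma lin_zero: "lin g 0 = 0"
by (simp add: lin_def)

lemma lin_diff: "lin g (P - Q) = lin g P - lin g Q"
using lin_add[of g "P - Q" Q] by simp

lemma lin_mult_eq:
assumes "!!m. lin g (R * single m 1) = R' * g m"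
shows "lin g (R * Q) = R' * lin g Q"
proof -
have c: "lin g (Const c * P) = Const c * lin g P" for c P
proof (induction P rule: monomials_induct[OF subset_UNIV])
 case (2 m d P) thus ?case by (simp add: distrib_left lin_add lin_single Const_mult mult.assoc) (simp add: Const_def mult_single lin_single)
qed (simp add: lin_zero)
show ?thesis
proof (induction Q rule: monomials_induct[OF subset_UNIV])
 case (2 m d P)
 have "R * single m d = Const d * (R * single m 1)"
  unfolding mult.left_commute[of "Const d" R] by (simp add: Const_def mult_single)
 hence "lin g (R * single m d) = Const d * (R' * g m)" by (simp only: c assms)
 thus ?case using 2 by (simp add: distrib_left lin_add lin_single mult.left_commute)
qed (simp add: lin_zero)
qed

lemma (in coord) lin_induct:
assumes "P : carrier PR" "!!m. m : mons ==> H (g m)" "!!P Q. H P ==> H Q ==> H (P + Q)"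
 "!!c P. H P ==> H (Const c * P)" "H 0"
shows "H (lin g P)"
using assms(1)[unfolded PR_carrier]
by (induction rule: monomials_induct) (simp_all add: assms lin_zero lin_add lin_single)

section \<open>The groups \<open>L(6,3,2)\<close> and \<open>L(2,2,2,2)\<close>\<close>

abbreviation "L6 == string_group w632"
abbreviation "L2 == string_group w2222"

lemma I6: "{1..length w632} = {1, 2, 3}" and I2: "{1..length w2222} = {1, 2, 3, 4}"
by auto

interpretation G6: weights w632
by standard (auto simp: le_Suc_eq numeral_eq_Suc)

interpretation G2: weights w2222
by standard (auto simp: le_Suc_eq numeral_eq_Suc)

text \<open>\<open>U i j k\<close> is the element with coordinates \<open>i, j, k\<close> with respect to the generators, and similarly for \<open>V\<close>.\<close>

definition U :: "int => int => int => str" where "U i j k = G6.el (%n. [i, j, k] ! (n - 1))"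
definition V :: "int => int => int => int => str" where "V a b c d = G2.el (%n. [a, b, c, d] ! (n - 1))"

lemma el_cong6: "m 1 = m' 1 ==> m 2 = m' 2 ==> m 3 = m' 3 ==> G6.el m = G6.el m'"
by (rule G6.el_cong) (auto simp only: I6 insert_iff empty_iff)

lemma el_cong2: "m 1 = m' 1 ==> m 2 = m' 2 ==> m 3 = m' 3 ==> m 4 = m' 4 ==> G2.el m = G2.el m'"
by (rule G2.el_cong) (auto simp only: I2 insert_iff empty_iff)

lemma el6: "G6.el m = U (m 1) (m 2) (m 3)" and el2: "G2.el m = V (m 1) (m 2) (m 3) (m 4)"
unfolding U_def V_def by (rule el_cong6 el_cong2; simp)+

text \<open>The third quotient is \<open>- a - b\<close> because the amounts exchanged between
  coordinates sum to zero.\<close>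

lemma U_eq: "U i j k = U i' j' k' <-> (EX a b. i - i' = 6 * a & j - j' = 3 * b & k - k' = 2 * (- a - b))"
unfolding U_def G6.el_eq I6
proof
assume "EX a b. i - i' = 6 * a & j - j' = 3 * b & k - k' = 2 * (- a - b)"
then obtain a b where "i - i' = 6 * a" "j - j' = 3 * b" "k - k' = 2 * (- a - b)" by blast
thus "EX e. (ALL n:{1, 2, 3}. [i, j, k] ! (n - 1) - [i', j', k'] ! (n - 1) = int (weight w632 n) * e n) & sum e {1, 2, 3} = 0"
 by (intro exI[of _ "%n. [a, b, - a - b] ! (n - 1)"]) simp
next
assume "EX e. (ALL n:{1, 2, 3}. [i, j, k] ! (n - 1) - [i', j', k'] ! (n - 1) = int (weight w632 n) * e n) & sum e {1, 2, 3} = 0"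
then obtain e where "ALL n:{1, 2, 3}. [i, j, k] ! (n - 1) - [i', j', k'] ! (n - 1) = int (weight w632 n) * e n" "sum e {1, 2, 3} = 0" by blast
thus "EX a b. i - i' = 6 * a & j - j' = 3 * b & k - k' = 2 * (- a - b)"
 by (intro exI[of _ "e 1"] exI[of _ "e 2"]) simp
qed

lemma V_eq: "V a b c d = V a' b' c' d' <-> (EX x y z. a - a' = 2 * x & b - b' = 2 * y & c - c' = 2 * z & d - d' = 2 * (- x - y - z))"
unfolding V_def G2.el_eq I2
proof
assume "EX x y z. a - a' = 2 * x & b - b' = 2 * y & c - c' = 2 * z & d - d' = 2 * (- x - y - z)"
then obtain x y z where "a - a' = 2 * x" "b - b' = 2 * y" "c - c' = 2 * z" "d - d' = 2 * (- x - y - z)" by blast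
thus "EX e. (ALL n:{1, 2, 3, 4}. [a, b, c, d] ! (n - 1) - [a', b', c', d'] ! (n - 1) = int (weight w2222 n) * e n) & sum e {1, 2, 3, 4} = 0"
 by (intro exI[of _ "%n. [x, y, z, - x - y - z] ! (n - 1)"]) simp
next
assume "EX e. (ALL n:{1, 2, 3, 4}. [a, b, c, d] ! (n - 1) - [a', b', c', d'] ! (n - 1) = int (weight w2222 n) * e n) & sum e {1, 2, 3, 4} = 0"
then obtain e where "ALL n:{1, 2, 3, 4}. [a, b, c, d] ! (n - 1) - [a', b', c', d'] ! (n - 1) = int (weight w2222 n) * e n"
 "sum e {1, 2, 3, 4} = 0" by blast
thus "EX x y z. a - a' = 2 * x & b - b' = 2 * y & c - c' = 2 * z & d - d' = 2 * (- x - y - z)"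
 by (intro exI[of _ "e 1"] exI[of _ "e 2"] exI[of _ "e 3"]) simp
qed

lemma U_ops: "U i j k *[L6] U i' j' k' = U (i + i') (j + j') (k + k')" "inv[L6] U i j k = U (- i) (- j) (- k)"
"U i j k ^[L6] (n :: int) = U (n * i) (n * j) (n * k)" "1[L6] = U 0 0 0" "U i j k : carrier L6"
"U i j k ^[L6] (n' :: nat) = U (int n' * i) (int n' * j) (int n' * k)"
unfolding U_def G6.el_mult G6.el_inv G6.el_int_pow G6.el_pow G6.el_one by (rule el_cong6 G6.el_in; simp)+

lemma V_ops: "V a b c d *[L2] V a' b' c' d' = V (a + a') (b + b') (c + c') (d + d')" "inv[L2] V a b c d = V (- a) (- b) (- c) (- d)"
"1[L2] = V 0 0 0 0" "V a b c d : carrier L2"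
"V a b c d ^[L2] (n' :: nat) = V (int n' * a) (int n' * b) (int n' * c) (int n' * d)"
unfolding V_def G2.el_mult G2.el_inv G2.el_pow G2.el_one by (rule el_cong2 G2.el_in; simp)+

lemma U_ex: "x : carrier L6 ==> EX i j k. x = U i j k" and V_ex: "y : carrier L2 ==> EX a b c d. y = V a b c d"
using G6.el_surj el6 G2.el_surj el2 by metis+

lemma U_gen: "str_gen w632 1 = U 1 0 0" "str_gen w632 2 = U 0 1 0" "str_gen w632 3 = U 0 0 1"
using G6.str_gen_el[of 1] G6.str_gen_el[of 2] G6.str_gen_el[of 3] by (simp_all add: el6)

lemma V_gen: "str_gen w2222 1 = V 1 0 0 0" "str_gen w2222 2 = V 0 1 0 0" "str_gen w2222 3 = V 0 0 1 0" "str_gen w2222 4 = V 0 0 0 1"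
using G2.str_gen_el[of 1] G2.str_gen_el[of 2] G2.str_gen_el[of 3] G2.str_gen_el[of 4] by (simp_all add: el2)

lemma V_canonical: "canonical w2222 = V 2 0 0 0"
unfolding G2.canonical_el by (simp add: el2)

section \<open>The homomorphism \<pi>, its fibres and its kernel\<close>

lemma pi_iff:
"is_pi \<pi> <-> \<pi> : hom L6 L2 & \<pi> (U 1 0 0) = V 0 0 0 1 & \<pi> (U 0 1 0) = V 2 0 0 0 & \<pi> (U 0 0 1) = V 1 1 1 0"
unfolding is_pi_def U_gen V_gen V_canonical by (simp add: V_ops)

lemma pi_ex: "EX \<pi>:extensional (carrier L6). is_pi \<pi> & (ALL i j k. \<pi> (U i j k) = V (k + 2 * j) k k i)"
proof -
obtain h where h: "h : extensional (carrier L6)" "!!m. h (G6.el m) = V (m 3 + 2 * m 2) (m 3) (m 3) (m 1)"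
proof (rule G6.lift_fun)
 fix m m' assume "G6.el m = G6.el m'"
 then obtain a b where "m 1 - m' 1 = 6 * a" "m 2 - m' 2 = 3 * b" "m 3 - m' 3 = 2 * (- a - b)" unfolding el6 U_eq by blast
 \<comment> \<open>The first coordinate changes by \<open>2 (- a - b) + 6 b\<close> and the next two
   by \<open>2 (- a - b)\<close>. The witnesses are half of this, and the fourth coordinate then
   changes by \<open>6 a\<close> as it should.\<close>
 thus "V (m 3 + 2 * m 2) (m 3) (m 3) (m 1) = V (m' 3 + 2 * m' 2) (m' 3) (m' 3) (m' 1)"
  unfolding V_eq by (intro exI[of _ "- a - b + 3 * b"] exI[of _ "- a - b"]) auto
qed (rule that)
have hU: "h (U i j k) = V (k + 2 * j) k k i" for i j k unfolding U_def h(2) by simp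
have "h : hom L6 L2" by (rule homI) (auto dest!: U_ex simp: U_ops hU V_ops algebra_simps)
thus ?thesis using h(1) hU by (auto simp: pi_iff)
qed

lemma pi_U:
assumes "is_pi \<pi>" shows "\<pi> (U i j k) = V (k + 2 * j) k k i"
proof -
obtain \<pi>' where p: "is_pi \<pi>'" "!!i j k. \<pi>' (U i j k) = V (k + 2 * j) k k i" using pi_ex by blast
have h: "\<pi> : hom L6 L2" "\<pi>' : hom L6 L2" using assms p(1) by (auto simp: is_pi_def)
have "\<pi> (str_gen w632 n) = \<pi>' (str_gen w632 n)" if "n : {1..length w632}" for n
 using that[unfolded I6] assms p(1) unfolding is_pi_def by auto
hence "\<pi> (U i j k) = \<pi>' (U i j k)" by (rule G6.hom_determined[OF G2.LL.group_axioms h _ U_ops(5)])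
thus ?thesis by (simp add: p(2))
qed

lemma pi_unique: "EX! \<pi>. is_pi \<pi> & \<pi> : extensional (carrier L6)"
proof -
have "\<pi> = \<pi>'" if "is_pi \<pi>" "\<pi> : extensional (carrier L6)" "is_pi \<pi>'" "\<pi>' : extensional (carrier L6)" for \<pi> \<pi>'
proof (rule extensionalityI[OF that(2,4)])
 fix x assume "x : carrier L6"
 then obtain i j k where "x = U i j k" using U_ex by blast
 thus "\<pi> x = \<pi>' x" by (simp only: pi_U[OF that(1)] pi_U[OF that(3)])
qed
thus ?thesis using pi_ex by blast
qed

lemma mult6: "str_mult w632 (U i j k) = nat (i div 6 + j div 3 + k div 2 + 1)"
unfolding str_mult_def U_def G6.normal_form_el I6 by (simp add: max_def add.assoc)

lemma mult2: "str_mult w2222 (V a b c d) = nat (a div 2 + b div 2 + c div 2 + d div 2 + 1)"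
unfolding str_mult_def V_def G2.normal_form_el I2 by (simp add: max_def add.assoc)

lemma proj2: "n : {1, 2, 3, 4} ==> str_proj w2222 n (V a b c d) = [a, b, c, d] ! (n - 1) mod 2"
unfolding V_def using G2.str_proj_el[of n] I2 by auto

text \<open>The elements \<open>2 u_1\<close> and \<open>u_2\<close> have the same image, since
  \<open>2 x_4 = c\<close>. Exchanging them moves along a fibre, and three exchanges lead back to
  the start because \<open>6 u_1 = 3 u_2\<close>.\<close>

lemma pi_fibre:
assumes p: "is_pi \<pi>"
shows "{y : carrier L6. \<pi> y = \<pi> (U i j k)} = (%s. U (i + 2 * j - 2 * s) s k) ` {0, 1, 2}"
proof
show "(%s. U (i + 2 * j - 2 * s) s k) ` {0, 1, 2} <= {y : carrier L6. \<pi> y = \<pi> (U i j k)}"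
proof (rule image_subsetI)
 fix s
 have "V (k + 2 * s) k k (i + 2 * j - 2 * s) = V (k + 2 * j) k k i"
  unfolding V_eq by (rule exI[of _ "s - j"], rule exI[of _ 0], rule exI[of _ 0]) simp
 thus "U (i + 2 * j - 2 * s) s k : {y : carrier L6. \<pi> y = \<pi> (U i j k)}" by (simp add: pi_U[OF p] U_ops)
qed
show "{y : carrier L6. \<pi> y = \<pi> (U i j k)} <= (%s. U (i + 2 * j - 2 * s) s k) ` {0, 1, 2}"
proof clarify
 fix y assume "y : carrier L6" and e: "\<pi> y = \<pi> (U i j k)"
 then obtain i' j' k' where y: "y = U i' j' k'" using U_ex by blast
 obtain x z where x: "k' + 2 * j' - (k + 2 * j) = 2 * x" "k' - k = 2 * z" "i' - i = 2 * (- x - z - z)"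
  using e unfolding y pi_U[OF p] V_eq by auto
 define s where "s = j' mod 3"
 have s: "s : {0, 1, 2}" by (auto simp: s_def)
 obtain q where q: "j' = s + 3 * q" using mod_mult_div_eq[of j' 3] by (metis s_def)
 have "y = U (i + 2 * j - 2 * s) s k"
  unfolding y U_eq by (rule exI[of _ "- q - z"], rule exI[of _ q]) (use x q in "simp add: algebra_simps")
 thus "y : (%s. U (i + 2 * j - 2 * s) s k) ` {0, 1, 2}" using s by blast
qed
qed

text \<open>Condition (AH2) for the three elements of a fibre. Without truncation at zero this is
  Hermite's identity for the floors of \<open>n / 6\<close>, \<open>(n - 2) / 6\<close> and
  \<open>(n - 4) / 6\<close>. The three floors differ by at most 1, so the terms are all
  nonnegative, or all nonpositive together with the right side, and truncation does no harm.\<close>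

lemma three_terms:
"nat (n div 6 + K + 1) + nat ((n - 2) div 6 + K + 1) + nat ((n - 4) div 6 + K + 1) = nat (n div 2 + 3 * K + (1 :: int))"
proof -
define a r where "a = n div 6" and "r = n mod 6"
have n: "n = 6 * a + r" "0 <= r" "r < 6" by (simp_all add: a_def r_def)
have d: "n div 6 = a" by (simp add: a_def)
have d2: "(n - 2) div 6 = (if r < 2 then a - 1 else a)"
 using n int_div_pos_eq[of "n - 2" 6 "a - 1" "r + 4"] int_div_pos_eq[of "n - 2" 6 a "r - 2"] by auto
have d4: "(n - 4) div 6 = (if r < 4 then a - 1 else a)"
 using n int_div_pos_eq[of "n - 4" 6 "a - 1" "r + 2"] int_div_pos_eq[of "n - 4" 6 a "r - 4"] by auto
have h: "n div 2 = 3 * a + r div 2" using n by simp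
have c: "r = 0 | r = 1 | r = 2 | r = 3 | r = 4 | r = 5" using n by arith
have s: "(n div 6 + K + 1) + ((n - 2) div 6 + K + 1) + ((n - 4) div 6 + K + 1) = n div 2 + 3 * K + 1"
 unfolding d d2 d4 h using c by (elim disjE) simp_all
show ?thesis
proof (cases "0 <= a + K")
 case True
 hence "0 <= n div 6 + K + 1" "0 <= (n - 2) div 6 + K + 1" "0 <= (n - 4) div 6 + K + 1" unfolding d d2 d4 by auto
 thus ?thesis unfolding s[symmetric] by (simp only: nat_add_distrib add_nonneg_nonneg)
next
 case False
 have "r div 2 <= 2" using c by auto
 hence "n div 6 + K + 1 <= 0" "(n - 2) div 6 + K + 1 <= 0" "(n - 4) div 6 + K + 1 <= 0" "n div 2 + 3 * K + 1 <= 0"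
  using False unfolding d d2 d4 h by auto
 thus ?thesis by (simp only: nat_le_0 add_0)
qed
qed

lemma pi_admissible:
assumes p: "is_pi \<pi>" shows "admissible w632 w2222 \<pi>"
proof -
have h: "\<pi> : hom L6 L2" using p by (simp add: is_pi_def)
interpret p: group_hom L6 L2 \<pi> by (rule group_hom.intro[OF G6.LL.group_axioms G2.LL.group_axioms group_hom_axioms.intro[OF h]])
have "inj (%n. \<pi> (U n 0 0))" by (rule injI) (auto simp: pi_U[OF p] V_eq)
hence "infinite (range (%n. \<pi> (U n 0 0)))" using finite_imageD infinite_UNIV_int by blast
hence inf: "infinite (\<pi> ` carrier L6)" by (rule contrapos_nn) (rule finite_subset[rotated], auto simp: U_ops)
have pr: "str_proj w2222 n ` \<pi> ` carrier L6 = carrier (integer_mod_group (weight w2222 n))" if n: "n : {1..length w2222}" for n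
proof -
 have n: "n : {1, 2, 3, 4}" using n unfolding I2 .
 have w: "carrier (integer_mod_group (weight w2222 n)) = {0, 1}" using n by (auto simp: carrier_integer_mod_group)
 \<comment> \<open>The image of \<open>u_1 + u_3\<close> is \<open>x_1 + x_2 + x_3 + x_4\<close>,
   which all four projections send to 1.\<close>
 have "str_proj w2222 n (\<pi> (U 0 0 0)) = 0" "str_proj w2222 n (\<pi> (U 1 0 1)) = 1" using n by (auto simp: pi_U[OF p] proj2)
 hence "{0, 1} <= str_proj w2222 n ` \<pi> ` carrier L6" using U_ops(5) by (metis empty_subsetI imageI insert_subset)
 moreover have "str_proj w2222 n ` \<pi> ` carrier L6 <= {0, 1}" using n by (auto dest!: U_ex simp: pi_U[OF p] proj2)
 ultimately show ?thesis using w by blast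
qed
have "finite {y : carrier L6. \<pi> y = x & str_mult w632 y ~= 0} &
  (\<Sum>y | y : carrier L6 & \<pi> y = x & str_mult w632 y ~= 0. str_mult w632 y) = str_mult w2222 x" if hx: "x : \<pi> ` carrier L6" for x
proof -
 obtain i j k where x: "x = \<pi> (U i j k)" using hx U_ex by blast
 let ?f = "%s. U (i + 2 * j - 2 * s) s k"
 have f: "{y : carrier L6. \<pi> y = x} = ?f ` {0, 1, 2}" unfolding x by (rule pi_fibre[OF p])
 have inj: "inj_on ?f {0, 1, 2}" by (rule inj_onI) (auto simp: U_eq; presburger)
 have Y: "{y : carrier L6. \<pi> y = x & str_mult w632 y ~= 0} = {y : ?f ` {0, 1, 2}. str_mult w632 y ~= 0}" using f by blast
 have "(\<Sum>y | y : carrier L6 & \<pi> y = x & str_mult w632 y ~= 0. str_mult w632 y) = sum (str_mult w632) (?f ` {0, 1, 2})"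
  unfolding Y by (rule sum.mono_neutral_left) auto
 also have "... = (SUM s:{0, 1, 2}. str_mult w632 (?f s))" by (rule sum.reindex_cong[OF inj]) auto
 also have "... = str_mult w2222 x"
 proof -
  \<comment> \<open>Here \<open>n\<close> is \<open>i + 2 j\<close> and \<open>K\<close> is
    \<open>k div 2\<close>; the contribution \<open>s div 3\<close> vanishes for the three values of
    \<open>s\<close>.\<close>
  have "(SUM s:{0, 1, 2}. str_mult w632 (?f s)) = nat ((i + 2 * j) div 2 + 3 * (k div 2) + 1)"
   unfolding three_terms[symmetric] mult6 by (simp add: algebra_simps)
  also have "(i + 2 * j) div 2 + 3 * (k div 2) + 1 = (k + 2 * j) div 2 + k div 2 + k div 2 + i div 2 + 1" by simp
  also have "nat ... = str_mult w2222 x" unfolding x pi_U[OF p] mult2 ..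
  finally show ?thesis .
 qed
 finally show ?thesis unfolding Y by simp
qed
thus ?thesis unfolding admissible_def effective_def Let_def using h p.img_is_subgroup inf pr by blast
qed

lemma kernel_generated:
assumes p: "is_pi \<pi>"
shows "{u : carrier L6. \<pi> u = 1[L2]} = generate L6 {dualizing w632 ^[L6] (2::nat)}"
proof -
\<comment> \<open>\<omega> is \<open>c - u_1 - u_2 - u_3\<close> with \<open>c = 6 u_1\<close>, that
  is \<open>U 5 (-1) (-1)\<close>. Twice this equals \<open>u_2 - 2 u_1\<close>, the step along
  fibres in \<open>pi_fibre\<close>.\<close>
have om: "dualizing w632 ^[L6] (2::nat) = U 10 (-2) (-2)" unfolding G6.dualizing_el el6 U_ops by simp
have one: "1[L2] = \<pi> (U 0 0 0)" by (simp add: pi_U[OF p] V_ops)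
have "U (- 2 * s) s 0 = U 10 (-2) (-2) ^[L6] (s :: int)" for s
 unfolding U_ops U_eq by (intro exI[of _ "- 2 * s"] exI[of _ s]) auto
hence "{u : carrier L6. \<pi> u = 1[L2]} <= {U 10 (-2) (-2) ^[L6] (s :: int) | s. s : UNIV}"
 unfolding one pi_fibre[OF p] by (intro image_subsetI) auto
moreover have "\<pi> (U 10 (-2) (-2) ^[L6] (s :: int)) = 1[L2]" for s
 unfolding U_ops pi_U[OF p] V_ops V_eq by (intro exI[of _ "- 3 * s"] exI[of _ "- s"]) auto
ultimately show ?thesis unfolding om G6.LL.generate_pow[OF U_ops(5)] using U_ops(3,5) by auto
qed

lemma kernel_finite: "is_pi \<pi> ==> finite {u : carrier L6. \<pi> u = 1[L2]}"
using pi_fibre[of \<pi> 0 0 0] by (simp add: pi_U V_ops)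

section \<open>The algebras \<open>S(6,3,2)\<close> and \<open>S(2,2,2,2;\<epsilon>)\<close>\<close>

lemma keys_diff_subset: "keys P <= K ==> keys Q <= K ==> keys (P - Q) <= K"
and keys_single_subset: "m : K ==> keys (single m c) <= K"
by (rule order_trans[OF keys_diff]) auto

text \<open>With \<open>a\<close>, \<open>b\<close> the squares of \<open>x_1\<close>,
  \<open>x_2\<close>, the first identity is the relation of \<open>S(6,3,2)\<close> after \<phi>,
  where \<open>x_3^2\<close> is \<open>b - a\<close> and \<open>x_4^2\<close> is
  \<open>b - E * a\<close>. The second is its counterpart inside \<open>S(6,3,2)\<close>, with
  \<open>a = u_1^2\<close> and \<open>w\<close> the preimage \<open>q1\<close> of
  \<open>x_1^2\<close>.\<close>

lemma elliptic_identities: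
fixes a b w E :: "'r::comm_ring_1"
assumes "E ^ 2 = E - 1"
shows "(6 * E - 3) * a * b * (b - a) = (b + (E - 1) * a) ^ 3 - (b - E * a) ^ 3"
 and "(6 * E - 3) * (w * (a + E * w) * (a + E * w - w)) = (a + (2 * E - 1) * w) ^ 3 - a ^ 3"
proof -
have E1: "E * E = E - 1" using assms by (simp add: power2_eq_square)
have "E * (E * x) = E * x - x" for x unfolding mult.assoc[symmetric] E1 by (simp add: left_diff_distrib)
note E = E1 this
show "(6 * E - 3) * a * b * (b - a) = (b + (E - 1) * a) ^ 3 - (b - E * a) ^ 3"
 by (simp add: power3_eq_cube algebra_simps E)
show "(6 * E - 3) * (w * (a + E * w) * (a + E * w - w)) = (a + (2 * E - 1) * w) ^ 3 - a ^ 3"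
 by (simp add: power3_eq_cube algebra_simps E)
qed

locale elliptic =
fixes \<epsilon> \<Delta> :: "'k::field"
assumes eps: "\<epsilon> ^ 2 - \<epsilon> + 1 = 0" and Delta: "\<Delta> ~= 0" and Delta2: "\<Delta> ^ 2 = 6 * \<epsilon> - 3"
begin

declare list.size(4) [simp del] length_Cons [simp del] One_nat_def [simp del]

abbreviation "r == 2 * \<epsilon> - 1"
abbreviation "f0 == Var 3 ^ 2 - (Var 2 ^ 3 - Var 1 ^ 6) :: 'k mpoly"
abbreviation "f1 == Var 3 ^ 2 - (Var 2 ^ 2 - Var 1 ^ 2) :: 'k mpoly"
abbreviation "f2 == Var 4 ^ 2 - (Var 2 ^ 2 - Const \<epsilon> * Var 1 ^ 2)"

lemma r_nz: "r ~= 0"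
proof
assume "r = 0"
hence "3 * r = 0" by simp
hence "\<Delta> ^ 2 = 0" unfolding Delta2 by (simp add: algebra_simps)
thus False using Delta by simp
qed

text \<open>The degrees 1, 2, 3 match the degree 1 of all variables of \<open>B\<close>: \<pi> sends
  the three generators to elements of degree 1, 2 and 3.\<close>

sublocale A: coord w632 "relations632 :: 'k mpoly set" "%i. ([1, 2, 3] ! (i - 1) :: int)" 6
proof (rule coord.intro[OF G6.weights_axioms coord_axioms.intro])
fix i assume "i : {1..length w632}"
thus "0 < ([1, 2, 3] ! (i - 1) :: int) & [1, 2, 3] ! (i - 1) * int (weight w632 i) = 6" unfolding I6 by auto
next
fix f :: "'k mpoly" assume "f : relations632"
hence "f = f0" by (simp add: relations632_def)
hence K: "keys f <= {single 3 2, single 2 3, single 1 6}"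
 unfolding Var_power by (elim ssubst) (intro keys_diff_subset keys_single_subset; simp)
thus "f : carrier (poly_ring (length w632))" unfolding poly_ring_def I6 by (auto dest!: subsetD)
have d: "mon_degree w632 m = U 6 0 0" if "m : {single 3 2, single 2 3, single 1 6}" for m
 using that unfolding G6.mon_degree_el el6 U_eq by (auto simp: lookup_single intro: exI[of _ "- 1"] exI[of _ 0])
show "EX l. ALL m:keys f. mon_degree w632 m = l" by (intro exI ballI, rule d, rule subsetD[OF K])
qed

sublocale B: coord w2222 "relations2222 \<epsilon>" "%_. 1" 2
proof (rule coord.intro[OF G2.weights_axioms coord_axioms.intro])
fix i assume "i : {1..length w2222}"
thus "(0 :: int) < 1 & 1 * int (weight w2222 i) = 2" unfolding I2 by auto
next
fix f :: "'k mpoly" assume "f : relations2222 \<epsilon>"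
hence "f = f1 | f = f2" by (simp add: relations2222_def)
moreover have "Const \<epsilon> * Var 1 ^ 2 = single (single 1 2) \<epsilon>" by (simp add: Var_power Const_def mult_single)
ultimately have K: "keys f <= {single 4 2, single 3 2, single 2 2, single 1 2}"
 unfolding Var_power by (elim disjE) (simp only:, (rule keys_diff_subset keys_single_subset | simp)+)+
thus "f : carrier (poly_ring (length w2222))" unfolding poly_ring_def I2 by (auto dest!: subsetD)
have d: "mon_degree w2222 m = V 2 0 0 0"
 if "m : {single 4 2, single 3 2, single 2 2, single 1 2}" for m
 using that unfolding G2.mon_degree_el el2 V_eq by (auto simp: lookup_single intro: exI[of _ "- 1"] exI[of _ 0])
show "EX l. ALL m:keys f. mon_degree w2222 m = l" by (intro exI ballI, rule d, rule subsetD[OF K])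
qed

lemma f_J: "f0 : A.J" "f1 : B.J" "f2 : B.J"
by (rule A.J_facts(5) B.J_facts(5); simp add: relations632_def relations2222_def)+

lemma VarA: "Var 1 : carrier A.PR" "Var 2 : carrier A.PR" "Var 3 : carrier A.PR"
and VarB: "Var 1 : carrier B.PR" "Var 2 : carrier B.PR" "Var 3 : carrier B.PR" "Var 4 : carrier B.PR"
by (rule A.PR_Var B.PR_Var; simp add: I6 I2)+

lemmas PRA = VarA A.PR_Const A.PR_add A.PR_diff A.PR_mult A.PR_power A.PR_zero
lemmas PRB = VarB B.PR_Const B.PR_add B.PR_diff B.PR_mult B.PR_power B.PR_zero

abbreviation "lk == lookup :: (nat \<Rightarrow>\<^sub>0 nat) => nat => nat"
abbreviation "y2 == Var 2 ^ 2 + Const (\<epsilon> - 1) * Var 1 ^ 2"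
abbreviation "y3 == Const \<Delta> * (Var 1 * Var 2 * Var 3)"

section \<open>The homomorphism \<phi> and its retraction on polynomials\<close>

definition gp :: "(nat \<Rightarrow>\<^sub>0 nat) => 'k mpoly" where "gp m = Var 4 ^ lk m 1 * y2 ^ lk m 2 * y3 ^ lk m 3"

definition ph :: "'k mpoly => 'k mpoly" where "ph = lin gp"

lemma ph_mult: "ph (P * Q) = ph P * ph Q"
proof -
have 1: "lin gp (single m 1 * P) = gp m * lin gp P" for m P
 by (rule lin_mult_eq) (simp add: mult_single lin_single gp_def lookup_add power_add mult_ac Const_1)
show ?thesis unfolding ph_def by (rule lin_mult_eq) (metis 1 mult.commute)
qed

lemma ph_Const: "ph (Const c) = Const c"
by (simp add: ph_def Const_def[of c] lin_single gp_def)

lemma ph_power: "ph (P ^ n) = ph P ^ n"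
by (induction n) (use ph_Const[of 1] in "simp_all add: ph_mult Const_1")

lemma ph_Var: "ph (Var 1) = Var 4" "ph (Var 2) = y2" "ph (Var 3) = y3"
by (simp_all add: ph_def Var_def[of 1] Var_def[of 2] Var_def[of 3] lin_single gp_def Const_1 lookup_single)

lemma ph_diff: "ph (P - Q) = ph P - ph Q" and ph_add: "ph (P + Q) = ph P + ph Q"
by (simp_all add: ph_def lin_diff lin_add)

lemma ph_PR: "P : carrier A.PR ==> ph P : carrier B.PR"
unfolding ph_def by (erule A.lin_induct) (auto simp: gp_def PRB)

lemma Ceps: "Const \<epsilon> ^ 2 - Const \<epsilon> + 1 = 0" and Cr: "Const r = 2 * Const \<epsilon> - 1" and Ceps1: "Const (\<epsilon> - 1) = Const \<epsilon> - 1"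
and CD: "Const \<Delta> ^ 2 = 6 * Const \<epsilon> - 3"
proof -
have n: "Const (numeral n) = numeral n" for n by (simp add: Const_def)
show "Const r = 2 * Const \<epsilon> - 1" "Const (\<epsilon> - 1) = Const \<epsilon> - 1" by (simp_all add: Const_diff Const_mult n Const_1)
have "Const (\<epsilon> ^ 2 - \<epsilon> + 1) = 0" unfolding eps by (rule Const_0)
thus "Const \<epsilon> ^ 2 - Const \<epsilon> + 1 = 0" by (simp add: Const_diff Const_add Const_mult Const_1 power2_eq_square)
have "Const (\<Delta> ^ 2) = Const (6 * \<epsilon> - 3)" unfolding Delta2 ..
thus "Const \<Delta> ^ 2 = 6 * Const \<epsilon> - 3" by (simp add: Const_diff Const_mult n power2_eq_square)
qed

lemma ph_J: "P : A.J ==> ph P : B.J"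
proof (induction rule: A.J_induct)
case (gen f)
hence f: "f = f0" by (simp add: relations632_def)
define a b c d E D :: "'k mpoly" where "a = Var 1 ^ 2" "b = Var 2 ^ 2" "c = Var 3 ^ 2" "d = Var 4 ^ 2" "E = Const \<epsilon>" "D = Const \<Delta> ^ 2"
note defs = this
have E: "E ^ 2 = E - 1" using Ceps by (simp add: defs algebra_simps)
have "D * a * b * (b - a) - (b + (E - 1) * a) ^ 3 + (b - E * a) ^ 3 = 0"
 using elliptic_identities(1)[OF E, of a b] CD by (simp add: defs)
moreover have "ph f = D * a * b * c - (b + (E - 1) * a) ^ 3 + d ^ 3"
 unfolding f ph_diff ph_power ph_Var Ceps1 defs by (simp add: power_mult_distrib mult_ac flip: power_mult)
\<comment> \<open>Modulo the two relations of \<open>B\<close>, \<open>c\<close> is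
  \<open>b - a\<close> and \<open>d\<close> is \<open>b - E * a\<close>. Factoring the difference of
  cubes exhibits the error made in \<open>d\<close> as a multiple of a relation.\<close>
moreover have "d ^ 3 - (b - E * a) ^ 3 = (d ^ 2 + d * (b - E * a) + (b - E * a) ^ 2) * (d - (b - E * a))"
 by (simp add: algebra_simps power2_eq_square power3_eq_cube)
\<comment> \<open>Linear bookkeeping with opaque letters, which keeps the cubes from being
  expanded.\<close>
moreover have "x = y * (z - u) + t" if "y * u - v + v' = 0" "x = y * z - v + s" "s - v' = t" for x y z u v v' s t :: "'k mpoly"
proof -
 have v: "v = y * u + v'" and s: "s = t + v'" using that(1,3) by (simp_all add: algebra_simps)
 show ?thesis unfolding that(2) v s by (simp add: algebra_simps)
qed
ultimately have e: "ph f = (D * a * b) * (c - (b - a)) + (d ^ 2 + d * (b - E * a) + (b - E * a) ^ 2) * (d - (b - E * a))"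
 by blast
have "c - (b - a) : B.J" "d - (b - E * a) : B.J" using f_J(2,3) by (simp_all add: defs)
thus ?case unfolding e by (intro B.J_facts(2) B.J_facts(3)) (auto simp: defs PRB)
next
case (mult m c P) thus ?case unfolding ph_mult by (intro B.J_facts(3) ph_PR A.PR_mono) auto
qed (use ph_Const[of 0] in "simp_all add: ph_add B.J_facts Const_0")

text \<open>\<open>q1, q2, q3\<close> are the preimages under \<open>\<phi>\<close> of the squares of \<open>x\<^sub>1, x\<^sub>2, x\<^sub>3\<close>, and \<open>gs m\<close> is the preimage of the monomial \<open>m\<close>
if the exponents of \<open>x\<^sub>1, x\<^sub>2, x\<^sub>3\<close> have the same parity; \<open>r\<close> is nonzero since \<open>\<Delta>\<^sup>2 = 3 r\<close>.\<close>

abbreviation "q1 == Const (1 / r) * (Var 2 - Var 1 ^ 2)"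
abbreviation "q2 == Var 1 ^ 2 + Const \<epsilon> * q1"
abbreviation "q3 == q2 - q1"

definition base :: "(nat \<Rightarrow>\<^sub>0 nat) => 'k mpoly" where
"base m = q1 ^ (lk m 1 div 2) * q2 ^ (lk m 2 div 2) * q3 ^ (lk m 3 div 2) * Var 1 ^ lk m 4"

definition gs :: "(nat \<Rightarrow>\<^sub>0 nat) => 'k mpoly" where
"gs m = (if even (lk m 1) & even (lk m 2) & even (lk m 3) then base m
  else if odd (lk m 1) & odd (lk m 2) & odd (lk m 3) then base m * (Const (1 / \<Delta>) * Var 3) else 0)"

definition ps :: "'k mpoly => 'k mpoly" where "ps = lin gs"

lemma base_PR: "base m : carrier A.PR"
by (simp add: base_def PRA)

lemma ps_PR: "P : carrier B.PR ==> ps P : carrier A.PR"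
unfolding ps_def by (erule B.lin_induct) (auto simp: gs_def base_PR PRA)

lemma ps_Const: "ps (Const c * Q) = Const c * ps Q"
unfolding ps_def by (rule lin_mult_eq) (simp add: lin_single mult_single Const_def)

lemma ps_add: "ps (P + Q) = ps P + ps Q" and ps_diff: "ps (P - Q) = ps P - ps Q"
by (simp_all add: ps_def lin_diff lin_add)

lemma ps_sq: "ps (Var 1 ^ 2 * Q) = q1 * ps Q" "ps (Var 2 ^ 2 * Q) = q2 * ps Q" "ps (Var 3 ^ 2 * Q) = q3 * ps Q"
"ps (Var 4 ^ 2 * Q) = Var 1 ^ 2 * ps Q" "ps (Var 4 * Q) = Var 1 * ps Q"
proof -
have g: "gs (single 1 2 + m) = q1 * gs m" "gs (single 2 2 + m) = q2 * gs m"
 "gs (single 3 2 + m) = q3 * gs m" "gs (single 4 2 + m) = Var 1 ^ 2 * gs m"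
 "gs (single 4 1 + m) = Var 1 * gs m" for m
 unfolding gs_def base_def lookup_add lookup_single by (simp_all add: mult_ac power_add power2_eq_square)
show "ps (Var 1 ^ 2 * Q) = q1 * ps Q" "ps (Var 2 ^ 2 * Q) = q2 * ps Q" "ps (Var 3 ^ 2 * Q) = q3 * ps Q"
 "ps (Var 4 ^ 2 * Q) = Var 1 ^ 2 * ps Q"
 unfolding ps_def by (rule lin_mult_eq; subst Var_power; simp only: mult_single lin_single g mult_1 Const_1)+
show "ps (Var 4 * Q) = Var 1 * ps Q"
 unfolding ps_def by (rule lin_mult_eq; subst Var_def; simp only: mult_single lin_single g mult_1 Const_1)
qed

lemma C_inv: "Const r * Const (1 / r) = 1" "Const \<Delta> * Const (1 / \<Delta>) = 1"
using r_nz Delta by (simp_all add: Const_mult[symmetric] Const_1)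

lemma Var2_eq: "Var 2 = Var 1 ^ 2 + (2 * Const \<epsilon> - 1) * q1"
using C_inv(1) unfolding Cr by (metis (no_types, lifting) add_diff_cancel_left' diff_add_cancel mult.assoc mult_1)

lemma q_prod: "Const \<Delta> ^ 2 * (q1 * q2 * q3) = Var 2 ^ 3 - Var 1 ^ 6"
proof -
define s w E where "s = (Var 1 ^ 2 :: 'k mpoly)" "w = q1" "E = Const \<epsilon>"
note defs = this
have E: "E ^ 2 = E - 1" using Ceps by (simp add: defs algebra_simps)
have "Var 2 = s + (2 * E - 1) * w" using Var2_eq by (simp only: defs)
moreover have "s ^ 3 = Var 1 ^ 6" by (simp add: defs flip: power_mult)
ultimately have "(6 * E - 3) * (w * (s + E * w) * (s + E * w - w)) = Var 2 ^ 3 - Var 1 ^ 6"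
 using elliptic_identities(2)[OF E, of w s] by presburger
thus ?thesis unfolding CD by (simp only: defs)
qed

text \<open>Multiplication by \<open>y3\<close> flips the parities of the first three exponents.
  From even to odd the rule holds exactly. From odd to even a product \<open>q1 * q2 * q3\<close>
  appears, which \<open>q_prod\<close> turns into the value of \<open>u_3^2\<close> prescribed by
  the relation, so equality holds only modulo the ideal. For mixed parities both sides
  vanish.\<close>

lemma ps_y3: "ps (y3 * Q) - Var 3 * ps Q : A.J"
proof (induction Q rule: monomials_induct[OF subset_UNIV])
case 1 thus ?case using A.J_facts(6) by (simp add: ps_def lin_zero)
next
case (2 m d Q)
let ?e = "single 1 1 + single 2 1 + single 3 1 :: nat \<Rightarrow>\<^sub>0 nat"
have l: "lk (?e + m) 1 = Suc (lk m 1)" "lk (?e + m) 2 = Suc (lk m 2)" "lk (?e + m) 3 = Suc (lk m 3)" "lk (?e + m) 4 = lk m 4"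
 by (simp_all add: lookup_add lookup_single)
have "Const \<Delta> * gs (?e + m) - Var 3 * gs m : A.J"
proof -
 consider (ev) "even (lk m 1)" "even (lk m 2)" "even (lk m 3)" | (od) "odd (lk m 1)" "odd (lk m 2)" "odd (lk m 3)"
  | (mix) "gs m = 0" "gs (?e + m) = 0"
  unfolding gs_def l by (cases "even (lk m 1)"; cases "even (lk m 2)"; cases "even (lk m 3)") simp_all
 thus ?thesis
 proof cases
  case ev
  hence "gs (?e + m) = base m * (Const (1 / \<Delta>) * Var 3)" "gs m = base m" unfolding gs_def l base_def by simp_all
  hence "Const \<Delta> * gs (?e + m) - Var 3 * gs m = (Const \<Delta> * Const (1 / \<Delta>) - 1) * (base m * Var 3)" by (simp add: algebra_simps)
  thus ?thesis using C_inv(2) A.J_facts(6) by simp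
 next
  case od
  hence g: "gs (?e + m) = q1 * q2 * q3 * base m" "gs m = base m * (Const (1 / \<Delta>) * Var 3)" unfolding gs_def l base_def by (simp_all add: mult_ac)
  have "Const \<Delta> * gs (?e + m) = Const (1 / \<Delta>) * base m * (Const \<Delta> ^ 2 * (q1 * q2 * q3))"
  proof -
   have "x * (t * u) = y * u * (x ^ 2 * t)" if "x * y = 1" for x y t u :: "'k mpoly"
   proof -
    have "y * u * (x ^ 2 * t) = (x * y) * (x * (t * u))" by (simp add: power2_eq_square mult_ac)
    thus ?thesis unfolding that mult_1 by (rule sym)
   qed
   from this[OF C_inv(2)] show ?thesis unfolding g .
  qed
  hence "Const \<Delta> * gs (?e + m) - Var 3 * gs m = - (Const (1 / \<Delta>) * base m * f0)"
   unfolding q_prod g(2) by (simp add: algebra_simps power2_eq_square)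
  thus ?thesis using A.J_facts(4)[OF A.J_facts(3)[OF _ f_J(1)]] by (simp add: PRA base_PR)
 qed (use A.J_facts(6) in simp)
qed
hence "Const d * (Const \<Delta> * gs (?e + m) - Var 3 * gs m) : A.J" by (rule A.J_facts(3)[OF A.PR_Const])
moreover have "y3 * single m d = single (?e + m) (\<Delta> * d)" by (simp add: Var_def Const_def mult_single add_ac)
hence "ps (y3 * single m d) = Const d * (Const \<Delta> * gs (?e + m))" by (simp only: ps_def lin_single Const_mult mult_ac)
moreover have "ps (single m d) = Const d * gs m" by (simp add: ps_def lin_single)
ultimately have "ps (y3 * single m d) - Var 3 * ps (single m d) : A.J" by (simp add: right_diff_distrib mult_ac)
from A.J_facts(2)[OF this 2(3)] show ?case by (simp add: distrib_left ps_add algebra_simps)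
qed

text \<open>Vanishing is exact because the preimages of the squares satisfy the relations of
  \<open>B\<close> as polynomials: \<open>q3\<close> is \<open>q2 - q1\<close>, and
  \<open>u_1^2\<close> is \<open>q2 - \<epsilon> q1\<close>. The induction runs over all multiples
  \<open>P * Q\<close>, since \<open>ps\<close> is not multiplicative.\<close>

lemma ps_J: "P : B.J ==> ps P = 0"
proof -
assume "P : B.J"
hence "ALL Q. ps (P * Q) = 0"
proof (induction rule: B.J_induct)
 case (mult m c P) thus ?case by (metis mult.assoc mult.commute)
next
 case (gen f)
 have "ps (f1 * Q) = 0" "ps (f2 * Q) = 0" for Q
  by (simp_all only: left_diff_distrib ps_diff ps_sq mult.assoc[of "Const \<epsilon>"] ps_Const) (simp_all add: algebra_simps)
 thus ?case using gen by (auto simp: relations2222_def)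
qed (auto simp: ps_def lin_zero distrib_right lin_add)
from spec[OF this, of 1] show ?thesis by simp
qed

text \<open>The rule passes to sums and products of the first factor, so constants and the three
  variables suffice; the variable \<open>u_3\<close> is the case of \<open>ps_y3\<close>.\<close>

lemma ps_ph:
assumes "P : carrier A.PR" "Q : carrier B.PR" shows "ps (ph P * Q) - P * ps Q : A.J"
using assms
proof (induction P arbitrary: Q rule: A.PR_induct)
case (Const c) show ?case using A.J_facts(6) by (simp add: ph_Const ps_Const)
next
case (Var i)
have "ps (y2 * Q) = (q2 + Const (\<epsilon> - 1) * q1) * ps Q" by (simp only: distrib_right mult.assoc ps_add ps_Const ps_sq)
moreover have "q2 + Const (\<epsilon> - 1) * q1 = Var 2"
proof -
 define v where "v = q1"
 show ?thesis unfolding Ceps1 v_def[symmetric] unfolding Var2_eq[folded v_def] by (simp add: algebra_simps)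
qed
ultimately have "ps (y2 * Q) = Var 2 * ps Q" by simp
thus ?case using Var(1) unfolding I6 using A.J_facts(6) ps_y3[of Q] by (auto simp: ph_Var ps_sq)
next
case (add P P')
thus ?case using A.J_facts(2)[OF add(3)[OF add(5)] add(4)[OF add(5)]] by (simp add: ph_add distrib_right ps_add algebra_simps)
next
case (mult P P')
have "ps (ph P * (ph P' * Q)) - P * ps (ph P' * Q) : A.J" using mult by (intro mult(3)) (simp add: PRB ph_PR)
from A.J_facts(2)[OF this A.J_facts(3)[OF mult(1) mult(4)[OF mult(5)]]] show ?case by (simp add: ph_mult algebra_simps)
qed

end

section \<open>The homomorphism \<open>\<phi>\<close> and its inverse on \<open>\<pi>\<^sub>*S(6,3,2)\<close>\<close>

context elliptic
begin

sublocale GA: galg A.S A.dg A.pr A.XS by (rule A.S_galg)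
sublocale GB: galg B.S B.dg B.pr B.XS by (rule B.S_galg)

lemma S_ab: "abelian_group A.S" "abelian_group B.S"
using A.S_cring B.S_cring by (simp_all add: cring_def ring_def)

lemma S_eq: "S632 = A.S" "S2222 \<epsilon> = B.S" "u632 i = A.cl (Var i)" "x2222 \<epsilon> i = B.cl (Var i)"
by (simp_all add: S632_def S2222_def u632_def x2222_def)

lemma is_phi_cl: "is_phi \<epsilon> \<Delta> \<phi> <-> \<phi> : algebra_hom A.S B.S & \<phi> (A.cl (Var 1)) = B.cl (Var 4) &
 \<phi> (A.cl (Var 2)) = B.cl y2 & \<phi> (A.cl (Var 3)) = B.cl y3"
proof -
have "B.cl (Var 2) ^[B.S] (2 :: nat) +[B.S] smap B.S (\<epsilon> - 1) *[B.S] B.cl (Var 1) ^[B.S] (2 :: nat) = B.cl y2"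
 by (simp add: B.cl_power B.S_op B.S_sel(4) PRB)
moreover have "smap B.S \<Delta> *[B.S] B.cl (Var 1) *[B.S] B.cl (Var 2) *[B.S] B.cl (Var 3) = B.cl y3"
 by (simp add: B.S_op B.S_sel(4) PRB mult.assoc)
ultimately show ?thesis unfolding is_phi_def S_eq by simp
qed

lemma phi_ex: "EX \<phi>:extensional (carrier A.S). is_phi \<epsilon> \<Delta> \<phi>"
proof -
obtain h where h: "h : extensional (carrier A.S)" "!!P. P : carrier A.PR ==> h (A.cl P) = B.cl (ph P)"
proof (rule A.lift_cl[of "%P. B.cl (ph P)"])
 show "B.cl (ph P) = B.cl (ph Q)" if "P : carrier A.PR" "Q : carrier A.PR" "P - Q : A.J" for P Q
  using that by (intro B.cl_J ph_PR) (simp_all add: ph_J flip: ph_diff)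
qed auto
have "h : ring_hom A.S B.S"
proof (rule ring_hom_memI)
 fix x y assume "x : carrier A.S" "y : carrier A.S"
 then obtain P Q where P: "x = A.cl P" "P : carrier A.PR" "y = A.cl Q" "Q : carrier A.PR" unfolding A.S_sel by blast
 show "h x : carrier B.S" using P h(2) ph_PR by (simp add: B.S_sel)
 show "h (x *[A.S] y) = h x *[B.S] h y" using P h(2) by (simp add: A.S_op B.S_op ph_PR PRA ph_mult)
 show "h (x +[A.S] y) = h x +[B.S] h y" using P h(2) by (simp add: A.S_op B.S_op ph_PR PRA ph_add)
next
 show "h 1[A.S] = 1[B.S]" using h(2)[OF A.PR_Const[of 1]] ph_Const[of 1] by (simp add: Const_1 A.S_sel B.S_sel)
qed
hence "is_phi \<epsilon> \<Delta> h" unfolding is_phi_cl algebra_hom_def A.S_sel B.S_sel using h(2) by (simp add: VarA A.PR_Const ph_Const ph_Var)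
thus ?thesis using h(1) by blast
qed

lemma phi_cl:
assumes phi: "is_phi \<epsilon> \<Delta> \<phi>" and P: "P : carrier A.PR" shows "\<phi> (A.cl P) = B.cl (ph P)"
proof -
have h: "\<phi> : ring_hom A.S B.S" and s: "!!c. \<phi> (A.cl (Const c)) = B.cl (Const c)"
 using phi unfolding is_phi_cl algebra_hom_def A.S_sel B.S_sel by auto
show ?thesis using P
proof (induction rule: A.PR_induct)
 case (Const c) thus ?case by (simp add: s ph_Const)
next
 case (Var i) thus ?case using phi unfolding I6 is_phi_cl by (auto simp: ph_Var)
next
 case (add P Q)
 thus ?case using ring_hom_add[OF h, of "A.cl P" "A.cl Q"] by (simp add: A.S_sel A.S_op B.S_op ph_PR ph_add)
next
 case (mult P Q)
 thus ?case using ring_hom_mult[OF h, of "A.cl P" "A.cl Q"] by (simp add: A.S_sel A.S_op B.S_op ph_PR ph_mult)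
qed
qed

lemma phi_unique: "EX! \<phi>. is_phi \<epsilon> \<Delta> \<phi> & \<phi> : extensional (carrier A.S)"
proof -
have "\<phi> = \<phi>'" if "is_phi \<epsilon> \<Delta> \<phi>" "\<phi> : extensional (carrier A.S)" "is_phi \<epsilon> \<Delta> \<phi>'" "\<phi>' : extensional (carrier A.S)" for \<phi> \<phi>'
 using that by (intro extensionalityI) (auto simp: A.S_sel phi_cl)
thus ?thesis using phi_ex by blast
qed

definition psi :: "'k mpoly set => 'k mpoly set" where
"psi = (SOME h. ALL P:carrier B.PR. h (B.cl P) = A.cl (ps P))"

lemma psi_cl: "P : carrier B.PR ==> psi (B.cl P) = A.cl (ps P)"
proof -
have "A.cl (ps P) = A.cl (ps Q)" if "P - Q : B.J" for P Q
 using ps_J[OF that] by (simp add: ps_diff)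
hence "EX h. ALL P:carrier B.PR. h (B.cl P) = A.cl (ps P)" using B.lift_cl[of "%P. A.cl (ps P)"] by metis
from someI_ex[OF this] show "P : carrier B.PR ==> psi (B.cl P) = A.cl (ps P)" unfolding psi_def by blast
qed

lemma psi_addmap: "addmap B.S A.S psi"
unfolding addmap_def A.S_sel B.S_sel
by (auto simp: psi_cl B.S_op A.S_op ps_PR ps_add B.PR_add)

lemma psi_mult:
assumes "is_phi \<epsilon> \<Delta> \<phi>" "a : carrier A.S" "c : carrier B.S" shows "psi (\<phi> a *[B.S] c) = a *[A.S] psi c"
proof -
obtain P Q where P: "a = A.cl P" "P : carrier A.PR" "c = B.cl Q" "Q : carrier B.PR" using assms(2,3) unfolding A.S_sel B.S_sel by blast
thus ?thesis using A.cl_J[OF _ _ ps_ph[OF P(2,4)]]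
 by (simp add: phi_cl[OF assms(1)] B.S_op A.S_op psi_cl ps_PR ph_PR PRA PRB)
qed

lemma psi_one: "psi 1[B.S] = 1[A.S]"
proof -
have "ps 1 = 1" using lin_single[of gs 0 1] by (simp add: ps_def gs_def base_def Const_1)
thus ?thesis using psi_cl[OF B.PR_Const[of 1]] by (simp add: Const_1 A.S_sel B.S_sel)
qed

lemma psi_phi: "is_phi \<epsilon> \<Delta> \<phi> ==> a : carrier A.S ==> psi (\<phi> a) = a"
using psi_mult[of \<phi> a "1[B.S]"] psi_one by (auto simp: is_phi_cl algebra_hom_def ring_hom_closed)

lemma hdpB: "B.hdp (%x. x) (V 1 0 0 0) (Var 1)" "B.hdp (%x. x) (V 0 1 0 0) (Var 2)" "B.hdp (%x. x) (V 0 0 1 0) (Var 3)"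
 "B.hdp (%x. x) (V 0 0 0 1) (Var 4)" "B.hdp (%x. x) (V 0 0 0 0) (Const d)"
and hdpB_mult: "B.hdp (%x. x) (V a b c d') P ==> B.hdp (%x. x) (V a' b' c' e) Q ==> B.hdp (%x. x) (V (a + a') (b + b') (c + c') (d' + e)) (P * Q)"
and hdpB_power: "B.hdp (%x. x) (V a b c d') P ==> B.hdp (%x. x) (V (int n * a) (int n * b) (int n * c) (int n * d')) (P ^ n)"
proof -
have i: "(%x. x) : hom L2 L2" by (simp add: hom_def)
have g: "group L2" using G2.LL.group_axioms .
show "B.hdp (%x. x) (V 1 0 0 0) (Var 1)" "B.hdp (%x. x) (V 0 1 0 0) (Var 2)" "B.hdp (%x. x) (V 0 0 1 0) (Var 3)" "B.hdp (%x. x) (V 0 0 0 1) (Var 4)"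
 unfolding V_gen[symmetric] by (rule B.hdp_Var; simp add: I2)+
show "B.hdp (%x. x) (V 0 0 0 0) (Const d)" using B.hdp_Const[OF i g] by (simp add: V_ops)
show "B.hdp (%x. x) (V a b c d') P ==> B.hdp (%x. x) (V a' b' c' e) Q ==> B.hdp (%x. x) (V (a + a') (b + b') (c + c') (d' + e)) (P * Q)"
 using B.hdp_mult[OF i] by (metis V_ops(1))
show "B.hdp (%x. x) (V a b c d') P ==> B.hdp (%x. x) (V (int n * a) (int n * b) (int n * c) (int n * d')) (P ^ n)"
 using B.hdp_power[OF i g, of "V a b c d'" P n] by (simp add: V_ops)
qed

text \<open>Pairs of equal generators can be moved freely between coordinates, so an element of
  \<open>L(2,2,2,2)\<close> is determined by three parities and the coordinate sum.\<close>

lemma V_even: "even (a - a') ==> even (b - b') ==> even (c - c') ==> a + b + c + d = a' + b' + c' + d' ==> V a b c d = V a' b' c' d'"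
unfolding V_eq by (elim evenE, rule exI, rule exI, rule exI, intro conjI, assumption, assumption, assumption) (simp add: algebra_simps)

lemma y_hdp: "B.hdp (%x. x) (V 2 0 0 0) y2" "B.hdp (%x. x) (V 1 1 1 0) y3"
proof -
have "B.hdp (%x. x) (V 2 0 0 0) (Var 2 ^ 2)" using hdpB_power[OF hdpB(2), of 2] V_even[of 0 2 2 0 0 0 0 0] by simp
moreover have "B.hdp (%x. x) (V 2 0 0 0) (Const (\<epsilon> - 1) * Var 1 ^ 2)" using hdpB_mult[OF hdpB(5) hdpB_power[OF hdpB(1), of 2]] by simp
ultimately show "B.hdp (%x. x) (V 2 0 0 0) y2" by (rule B.hdp_add)
show "B.hdp (%x. x) (V 1 1 1 0) y3" using hdpB_mult[OF hdpB(5) hdpB_mult[OF hdpB_mult[OF hdpB(1) hdpB(2)] hdpB(3)]] by simp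
qed

lemma degA: "A.deg m = U (int (lk m 1)) (int (lk m 2)) (int (lk m 3))"
and degB: "B.deg m = V (int (lk m 1)) (int (lk m 2)) (int (lk m 3)) (int (lk m 4))"
unfolding G6.mon_degree_el G2.mon_degree_el el6 el2 by simp_all

lemma phi_comp:
assumes pi: "is_pi \<pi>" and phi: "is_phi \<epsilon> \<Delta> \<phi>" and u: "u : carrier L6" and a: "a : cmp A.S u"
shows "\<phi> a : cmp B.S (\<pi> u)"
proof -
have h: "\<phi> : ring_hom A.S B.S" using phi by (simp add: is_phi_cl algebra_hom_def)
have pu: "\<pi> u : carrier L2" using pi u unfolding pi_iff by (auto simp: hom_def)
interpret C: additive_subgroup "cmp B.S (\<pi> u)" B.S by (rule B.comp_subgroup)
have m: "\<phi> (A.cl (A.mn m c)) : cmp B.S (\<pi> u)" if "m : A.homs u" for m c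
proof -
 have "gp m = Var 4 ^ lk m 1 * y2 ^ lk m 2 * y3 ^ lk m 3" by (rule gp_def)
 moreover have "B.hdp (%x. x) (V (int (lk m 2) * 2 + int (lk m 3)) (int (lk m 3)) (int (lk m 3)) (int (lk m 1))) (Const c * (Var 4 ^ lk m 1 * y2 ^ lk m 2 * y3 ^ lk m 3))"
  using hdpB_mult[OF hdpB(5) hdpB_mult[OF hdpB_mult[OF hdpB_power[OF hdpB(4)] hdpB_power[OF y_hdp(1)]] hdpB_power[OF y_hdp(2)]], of "lk m 1" "lk m 2" "lk m 3" c]
  by (simp only: mult_zero_right add_0 add_0_right mult_1_right)
 moreover have "\<pi> u = V (int (lk m 2) * 2 + int (lk m 3)) (int (lk m 3)) (int (lk m 3)) (int (lk m 1))" using that pi_U[OF pi] by (auto simp: degA add.commute mult.commute)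
 moreover have "ph (A.mn m c) = Const c * gp m" by (simp add: ph_def lin_single)
 ultimately have "B.hdp (%x. x) (\<pi> u) (ph (A.mn m c))" by simp
 thus ?thesis using phi_cl[OF phi A.PR_mono] that by (simp add: B.hdp_id)
qed
have "addmap A.S B.S \<phi>" using h by (auto simp: addmap_def ring_hom_closed ring_hom_add)
moreover have "{A.cl (A.mn m c) | m c. m : A.homs u} <= carrier A.S" unfolding A.S_sel using A.PR_mono by blast
moreover have "a : acl A.S {A.cl (A.mn m c) | m c. m : A.homs u}" using a A.comp_mons by blast
ultimately have "\<phi> a : acl B.S (\<phi> ` {A.cl (A.mn m c) | m c. m : A.homs u})"
 by (rule addmap_acl[OF _ S_ab])
moreover have "acl B.S (\<phi> ` {A.cl (A.mn m c) | m c. m : A.homs u}) <= cmp B.S (\<pi> u)"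
proof (rule abelian_group.acl_subgroup[OF S_ab(2) B.comp_subgroup], rule image_subsetI)
 fix b assume "b : {A.cl (A.mn m c) | m c. m : A.homs u}"
 hence "EX m c. b = A.cl (A.mn m c) & m : A.homs u" by (rule CollectD)
 thus "\<phi> b : cmp B.S (\<pi> u)" using m by (elim exE conjE) (simp only:)
qed
ultimately show ?thesis by blast
qed

lemma cl_mult_cong: "B.cl P = B.cl P' ==> B.cl Q = B.cl Q' ==> P : carrier B.PR ==> P' : carrier B.PR ==> Q : carrier B.PR ==> Q' : carrier B.PR ==>
 B.cl (P * Q) = B.cl (P' * Q')"
by (simp flip: B.S_op)

lemma cl_power_cong: "B.cl P = B.cl P' ==> P : carrier B.PR ==> P' : carrier B.PR ==> B.cl (P ^ n) = B.cl (P' ^ n)"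
by (simp flip: B.cl_power)

lemma q_PR: "q1 : carrier A.PR" "q2 : carrier A.PR" "q3 : carrier A.PR"
by (simp_all add: PRA)

lemma ph_q: "B.cl (ph q1) = B.cl (Var 1 ^ 2)" "B.cl (ph q2) = B.cl (Var 2 ^ 2)" "B.cl (ph q3) = B.cl (Var 3 ^ 2)"
proof -
have J: "ph q1 - Var 1 ^ 2 : B.J" "ph q2 - Var 2 ^ 2 : B.J" "ph q3 - Var 3 ^ 2 : B.J"
proof -
 have p: "ph q1 = Const (1 / r) * (y2 - Var 4 ^ 2)" by (simp only: ph_mult ph_Const ph_diff ph_Var ph_power)
 \<comment> \<open>This is the origin of \<open>q1\<close>: the images of \<open>u_2\<close> and
   \<open>u_1^2\<close> differ by \<open>r x_1^2\<close> modulo a relation.\<close>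
 have "y2 - Var 4 ^ 2 = Const r * Var 1 ^ 2 - f2" unfolding Ceps1 Cr by (simp add: algebra_simps)
 hence "ph q1 = (Const r * Const (1 / r)) * Var 1 ^ 2 - Const (1 / r) * f2" unfolding p by (simp only: right_diff_distrib mult_ac)
 hence e1: "ph q1 - Var 1 ^ 2 = - (Const (1 / r) * f2)" unfolding C_inv by simp
 show 1: "ph q1 - Var 1 ^ 2 : B.J" unfolding e1 by (intro B.J_facts(4) B.J_facts(3) f_J PRB)
 have p2: "ph q2 = Var 4 ^ 2 + Const \<epsilon> * ph q1" by (simp only: ph_add ph_mult ph_Const ph_Var ph_power)
 have e2: "ph q2 - Var 2 ^ 2 = f2 + Const \<epsilon> * (ph q1 - Var 1 ^ 2)" unfolding p2 by (simp add: algebra_simps)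
 show 2: "ph q2 - Var 2 ^ 2 : B.J" unfolding e2 by (intro B.J_facts(2) B.J_facts(3) f_J PRB 1)
 have p3: "ph q3 = ph q2 - ph q1" by (simp only: ph_diff)
 have e3: "ph q3 - Var 3 ^ 2 = (ph q2 - Var 2 ^ 2) + - ((ph q1 - Var 1 ^ 2) + f1)" unfolding p3 by (simp add: algebra_simps)
 show "ph q3 - Var 3 ^ 2 : B.J" unfolding e3 by (intro B.J_facts(2) B.J_facts(4) f_J 1 2)
qed
show "B.cl (ph q1) = B.cl (Var 1 ^ 2)" "B.cl (ph q2) = B.cl (Var 2 ^ 2)" "B.cl (ph q3) = B.cl (Var 3 ^ 2)"
 by (rule B.cl_J[OF ph_PR[OF q_PR(1)] _ J(1)] B.cl_J[OF ph_PR[OF q_PR(2)] _ J(2)] B.cl_J[OF ph_PR[OF q_PR(3)] _ J(3)]; simp add: PRB)+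
qed

lemma mon_Var:
assumes "m : B.mons" shows "B.mn m c = Const c * (Var 1 ^ lk m 1 * Var 2 ^ lk m 2 * Var 3 ^ lk m 3 * Var 4 ^ lk m 4)"
proof -
have "m = single 1 (lk m 1) + single 2 (lk m 2) + single 3 (lk m 3) + single 4 (lk m 4)"
proof (rule poly_mapping_eqI)
 fix k show "lk m k = lk (single 1 (lk m 1) + single 2 (lk m 2) + single 3 (lk m 3) + single 4 (lk m 4)) k"
 proof (cases "k : {1, 2, 3, 4}")
  case True thus ?thesis by (auto simp: lookup_add lookup_single)
 next
  case False
  hence "lk m k = 0" using assms unfolding I2 by (auto simp: subset_iff in_keys_iff)
  thus ?thesis using False by (simp add: lookup_add lookup_single when_def)
 qed
qed
thus ?thesis unfolding Var_power Const_def mult_single by simp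
qed

text \<open>For equal parities the monomial is a product of squares, a power of \<open>x_4\<close>
  and possibly one factor \<open>x_1 x_2 x_3\<close>; each of these has its preimage by
  \<open>ph_q\<close> and the choice of \<open>1 / \<Delta>\<close>.\<close>

lemma ph_gs:
assumes m: "m : B.mons" and p: "even (lk m 1) = even (lk m 2)" "even (lk m 1) = even (lk m 3)"
shows "B.cl (ph (Const c * gs m)) = B.cl (B.mn m c)"
proof -
have b: "B.cl (ph (base m)) = B.cl ((Var 1 ^ 2) ^ (lk m 1 div 2) * (Var 2 ^ 2) ^ (lk m 2 div 2) * (Var 3 ^ 2) ^ (lk m 3 div 2) * Var 4 ^ lk m 4)"
 unfolding base_def ph_mult[of _ "_ ^ _"] ph_power[of _ "_ div _"] ph_power[of "Var 1" "lk m 4"] ph_Var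
 by (intro cl_mult_cong cl_power_cong ph_q refl B.PR_mult B.PR_power ph_PR q_PR VarB)
show ?thesis
proof (cases "even (lk m 1)")
 case True
 hence e: "even (lk m 1)" "even (lk m 2)" "even (lk m 3)" using p by auto
 have g: "gs m = base m" using e by (simp add: gs_def)
 have "B.cl (Const c * ph (base m)) = B.cl (Const c * ((Var 1 ^ 2) ^ (lk m 1 div 2) * (Var 2 ^ 2) ^ (lk m 2 div 2) * (Var 3 ^ 2) ^ (lk m 3 div 2) * Var 4 ^ lk m 4))"
  by (rule cl_mult_cong[OF refl b]) (intro B.PR_mult B.PR_power ph_PR base_PR PRB)+
 thus ?thesis unfolding mon_Var[OF m] g ph_mult ph_Const using e by (simp flip: power_mult)
next
 case False
 hence o: "odd (lk m 1)" "odd (lk m 2)" "odd (lk m 3)" using p by auto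
 have g: "gs m = base m * (Const (1 / \<Delta>) * Var 3)" using o by (simp add: gs_def)
 have "ph (Const (1 / \<Delta>) * Var 3) = (Const \<Delta> * Const (1 / \<Delta>)) * (Var 1 * Var 2 * Var 3)" unfolding ph_mult ph_Const ph_Var by (simp only: mult_ac)
 hence g': "ph (gs m) = ph (base m) * (Var 1 * Var 2 * Var 3)" unfolding g C_inv ph_mult[of "base m"] by simp
 have "B.cl (Const c * (ph (base m) * (Var 1 * Var 2 * Var 3))) = B.cl (Const c * (((Var 1 ^ 2) ^ (lk m 1 div 2) * (Var 2 ^ 2) ^ (lk m 2 div 2) * (Var 3 ^ 2) ^ (lk m 3 div 2) * Var 4 ^ lk m 4) * (Var 1 * Var 2 * Var 3)))"
  by (rule cl_mult_cong[OF refl cl_mult_cong[OF b refl]]) (intro B.PR_mult B.PR_power ph_PR base_PR PRB)+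
 moreover have "(x ^ 2) ^ (n div 2) * x = x ^ n" if "odd n" for n and x :: "'k mpoly"
  using that by (metis odd_two_times_div_two_succ power_add power_mult power_one_right)
 note pw = this[OF o(1), of "Var 1"] this[OF o(2), of "Var 2"] this[OF o(3), of "Var 3"]
 have "Const c * (((Var 1 ^ 2) ^ (lk m 1 div 2) * (Var 2 ^ 2) ^ (lk m 2 div 2) * (Var 3 ^ 2) ^ (lk m 3 div 2) * Var 4 ^ lk m 4) * (Var 1 * Var 2 * Var 3)) = B.mn m c"
  unfolding mon_Var[OF m] pw[symmetric] by (simp only: mult_ac)
 ultimately show ?thesis unfolding ph_mult[of "Const c"] ph_Const g' by simp
qed
qed

lemma hdpA:
assumes pi: "is_pi \<pi>"
shows "A.hdp \<pi> (V 0 0 0 1) (Var 1)" "A.hdp \<pi> (V 2 0 0 0) (Var 2)" "A.hdp \<pi> (V 1 1 1 0) (Var 3)" "A.hdp \<pi> (V 0 0 0 0) (Const d)"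
 "A.hdp \<pi> (V a b c d') P ==> A.hdp \<pi> (V a' b' c' e) Q ==> A.hdp \<pi> (V (a + a') (b + b') (c + c') (d' + e)) (P * Q)"
 "A.hdp \<pi> (V a b c d') P ==> A.hdp \<pi> (V (int n * a) (int n * b) (int n * c) (int n * d')) (P ^ n)"
proof -
have i: "\<pi> : hom L6 L2" and g: "group L2" using pi G2.LL.group_axioms unfolding pi_iff by auto
show "A.hdp \<pi> (V 0 0 0 1) (Var 1)" "A.hdp \<pi> (V 2 0 0 0) (Var 2)" "A.hdp \<pi> (V 1 1 1 0) (Var 3)"
 using A.hdp_Var[of 1 \<pi>] A.hdp_Var[of 2 \<pi>] A.hdp_Var[of 3 \<pi>] pi unfolding U_gen pi_iff I6 by auto
show "A.hdp \<pi> (V 0 0 0 0) (Const d)" using A.hdp_Const[OF i g] by (simp add: V_ops)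
show "A.hdp \<pi> (V a b c d') P ==> A.hdp \<pi> (V a' b' c' e) Q ==> A.hdp \<pi> (V (a + a') (b + b') (c + c') (d' + e)) (P * Q)"
 using A.hdp_mult[OF i] by (metis V_ops(1))
show "A.hdp \<pi> (V a b c d') P ==> A.hdp \<pi> (V (int n * a) (int n * b) (int n * c) (int n * d')) (P ^ n)"
 using A.hdp_power[OF i g, of "V a b c d'" P n] by (simp add: V_ops)
qed

lemma hdp_gs:
assumes pi: "is_pi \<pi>" and p: "even (lk m 1) = even (lk m 2)" "even (lk m 1) = even (lk m 3)"
shows "A.hdp \<pi> (B.deg m) (Const c * gs m)"
proof -
note h = hdpA[OF pi]
have "A.hdp \<pi> (V 2 0 0 0) (Var 1 ^ 2)" using h(6)[OF h(1), of 2] V_even[of 0 2 0 0 0 0 2 0] by simp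
note sq = this
have q1: "A.hdp \<pi> (V 2 0 0 0) q1" using h(5)[OF h(4) A.hdp_diff[OF h(2) sq]] by simp
have q2: "A.hdp \<pi> (V 2 0 0 0) q2" using A.hdp_add[OF sq h(5)[OF h(4) q1, simplified]] .
have q3: "A.hdp \<pi> (V 2 0 0 0) q3" using A.hdp_diff[OF q2 q1] .
have b: "A.hdp \<pi> (V (int (lk m 1 div 2) * 2 + int (lk m 2 div 2) * 2 + int (lk m 3 div 2) * 2) 0 0 (int (lk m 4))) (base m)"
 unfolding base_def using h(5)[OF h(5)[OF h(5)[OF h(6)[OF q1] h(6)[OF q2]] h(6)[OF q3]] h(6)[OF h(1)], of "lk m 1 div 2" "lk m 2 div 2" "lk m 3 div 2" "lk m 4"]
 by (simp only: mult_zero_right add_0 add_0_right mult_1_right)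
show ?thesis
proof (cases "even (lk m 1)")
 case True
 hence e: "even (lk m 1)" "even (lk m 2)" "even (lk m 3)" using p by auto
 hence "V (int (lk m 1 div 2) * 2 + int (lk m 2 div 2) * 2 + int (lk m 3 div 2) * 2) 0 0 (int (lk m 4)) = B.deg m"
  unfolding degB by (intro V_even) (auto elim!: evenE)
 thus ?thesis using h(5)[OF h(4) b] e by (simp add: gs_def)
next
 case False
 hence o: "odd (lk m 1)" "odd (lk m 2)" "odd (lk m 3)" using p by auto
 hence "V (int (lk m 1 div 2) * 2 + int (lk m 2 div 2) * 2 + int (lk m 3 div 2) * 2 + 1) 1 1 (int (lk m 4)) = B.deg m"
  unfolding degB by (intro V_even) (auto elim!: oddE)
 thus ?thesis using h(5)[OF h(4) h(5)[OF b h(5)[OF h(4) h(3)]]] o by (simp add: gs_def add_ac)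
qed
qed

lemma phi_dec:
assumes pi: "is_pi \<pi>" and phi: "is_phi \<epsilon> \<Delta> \<phi>" and u: "u : carrier L6"
shows "cmp B.S (\<pi> u) <= acl B.S {\<phi> a | a v. v : carrier L6 & \<pi> v = \<pi> u & a : cmp A.S v}" (is "_ <= acl B.S ?Z")
proof -
have h: "\<phi> : ring_hom A.S B.S" using phi by (simp add: is_phi_cl algebra_hom_def)
have ad: "addmap A.S B.S \<phi>" using h by (auto simp: addmap_def ring_hom_closed ring_hom_add)
have Z: "?Z <= carrier B.S" using ring_hom_closed[OF h] GA.comp_carrier A.S_sel(5) by auto
have "B.cl (B.mn m c) : acl B.S ?Z" if m: "m : B.homs (\<pi> u)" for m c
proof -
 obtain i j k where "u = U i j k" using U_ex[OF u] by blast
 hence "V (int (lk m 1)) (int (lk m 2)) (int (lk m 3)) (int (lk m 4)) = V (k + 2 * j) k k i" using m pi_U[OF pi] by (simp add: degB)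
 then obtain x y z where "int (lk m 1) - (k + 2 * j) = 2 * x" "int (lk m 2) - k = 2 * y" "int (lk m 3) - k = 2 * z" unfolding V_eq by blast
 \<comment> \<open>A degree in the image of \<pi> forces the first three exponents to share the
   parity of \<open>k\<close>, which is exactly the case where \<open>gs\<close> yields a
   preimage.\<close>
 hence "even (int (lk m 1)) = even k" "even (int (lk m 2)) = even k" "even (int (lk m 3)) = even k" by presburger+
 hence p: "even (lk m 1) = even (lk m 2)" "even (lk m 1) = even (lk m 3)" by simp_all
 have P: "Const c * gs m : carrier A.PR" by (simp add: gs_def PRA base_PR)
 have "A.cl (Const c * gs m) : acl A.S {s | s v. v : carrier L6 & \<pi> v = \<pi> u & s : cmp A.S v}" (is "_ : acl A.S ?Y")
  using A.hdp_cl[OF hdp_gs[OF pi p, of c]] m by simp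
 moreover have "?Y <= carrier A.S" using GA.comp_carrier A.S_sel(5) by auto
 ultimately have "\<phi> (A.cl (Const c * gs m)) : acl B.S (\<phi> ` ?Y)"
  using addmap_acl[OF ad S_ab] by blast
 moreover have "\<phi> ` ?Y <= ?Z" by blast
 ultimately show ?thesis using acl_mono[of "\<phi> ` ?Y" ?Z B.S] ph_gs[OF _ p, of c] m phi_cl[OF phi P] by auto
qed
hence "acl B.S {B.cl (B.mn m c) | m c. m : B.homs (\<pi> u)} <= acl B.S ?Z" by (intro abelian_group.acl_subI[OF S_ab(2)] Z) blast
thus ?thesis using B.comp_mons[of "\<pi> u"] by blast
qed

end

section \<open>Spanning sets for the components of \<open>S(2,2,2,2;\<epsilon>)\<close>\<close>

context elliptic
begin

definition M :: "nat => nat => nat => nat => 'k => 'k mpoly set" where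
"M a b c d s = B.cl (Const s * (Var 1 ^ a * Var 2 ^ b * Var 3 ^ c * Var 4 ^ d))"

abbreviation "VV a b c d == V (int a) (int b) (int c) (int d)"

lemma M_mult: "M a b c d s *[B.S] M a' b' c' d' s' = M (a + a') (b + b') (c + c') (d + d') (s * s')"
by (simp add: M_def B.S_op PRB power_add Const_mult mult_ac)

lemma M_comp: "M a b c d s : cmp B.S (VV a b c d)"
unfolding M_def using hdpB_mult[OF hdpB(5) hdpB_mult[OF hdpB_mult[OF hdpB_mult[OF hdpB_power[OF hdpB(1)] hdpB_power[OF hdpB(2)]] hdpB_power[OF hdpB(3)]] hdpB_power[OF hdpB(4)]]]
by (intro B.hdp_id) simp

lemma M_relations:
"M (a + 2) b c d s = M a (b + 2) c d s +[B.S] M a b (c + 2) d (- s)" (is ?A)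
"M a (b + 2) c d s = M (a + 2) b c d s +[B.S] M a b (c + 2) d s" (is ?B)
"M a b (c + 2) d s = M a (b + 2) c d s +[B.S] M (a + 2) b c d (- s)" (is ?C)
"M a b c (d + 2) s = M a (b + 2) c d s +[B.S] M (a + 2) b c d (- \<epsilon> * s)" (is ?D)
proof -
define X :: "'k mpoly" where "X = Var 1 ^ a * Var 2 ^ b * Var 3 ^ c * Var 4 ^ d"
have X: "Const e * (Var 1 ^ (a + 2) * Var 2 ^ b * Var 3 ^ c * Var 4 ^ d) = Const e * X * Var 1 ^ 2"
 "Const e * (Var 1 ^ a * Var 2 ^ (b + 2) * Var 3 ^ c * Var 4 ^ d) = Const e * X * Var 2 ^ 2"
 "Const e * (Var 1 ^ a * Var 2 ^ b * Var 3 ^ (c + 2) * Var 4 ^ d) = Const e * X * Var 3 ^ 2"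
 "Const e * (Var 1 ^ a * Var 2 ^ b * Var 3 ^ c * Var 4 ^ (d + 2)) = Const e * X * Var 4 ^ 2" for e
 unfolding X_def power_add by (simp_all only: mult_ac)
have neg: "Const (- e) = - Const e" for e :: 'k using Const_diff[of 0 e] by (simp add: Const_0)
have XP: "Const e * X * Q : carrier B.PR" if "Q : carrier B.PR" for e Q using that by (simp add: X_def PRB)
have J: "Const e * X * f1 : B.J" "Const e * X * f2 : B.J" for e by (intro B.J_facts(3) f_J; simp add: X_def PRB)+
have cl: "B.cl P = B.cl Q +[B.S] B.cl R" if "P : carrier B.PR" "Q : carrier B.PR" "R : carrier B.PR" "T : B.J" "P - (Q + R) = T" for P Q R T
 using that B.cl_J[of P "Q + R"] by (simp add: B.S_op PRB)
show ?A unfolding M_def X by (rule cl[OF _ _ _ J(1)[of s]]; (intro XP B.PR_power VarB | simp add: neg algebra_simps))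
show ?B unfolding M_def X by (rule cl[OF _ _ _ J(1)[of "- s"]]; (intro XP B.PR_power VarB | simp add: neg algebra_simps))
show ?C unfolding M_def X by (rule cl[OF _ _ _ J(1)[of s]]; (intro XP B.PR_power VarB | simp add: neg algebra_simps))
show ?D unfolding M_def X by (rule cl[OF _ _ _ J(2)[of s]]; (intro XP B.PR_power VarB | simp add: neg Const_mult algebra_simps))
qed

lemma comp_M: "cmp B.S x <= acl B.S {M a b c d s | a b c d s. VV a b c d = x}"
proof -
have "{B.cl (B.mn m s) | m s. m : B.homs x} <= {M a b c d s | a b c d s. VV a b c d = x}"
proof clarify
 fix m s assume "keys m <= {1..length w2222}" "x = B.deg m"
 thus "EX a b c d s'. B.cl (B.mn m s) = M a b c d s' & VV a b c d = B.deg m"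
  unfolding degB M_def
 proof (intro exI conjI)
  show "B.cl (B.mn m s) = B.cl (Const s * (Var 1 ^ lk m 1 * Var 2 ^ lk m 2 * Var 3 ^ lk m 3 * Var 4 ^ lk m 4))"
   using mon_Var[of m s] \<open>keys m <= _\<close> by simp
 qed (rule refl)
qed
thus ?thesis by (rule order_trans[OF B.comp_mons acl_mono])
qed

lemma M_carrier: "{M a b c d s | a b c d s. H a b c d s} <= carrier B.S"
proof clarify
show "M a b c d s : carrier B.S" for a b c d s by (rule GB.comp_carrier[unfolded B.S_sel(5), OF V_ops(4) M_comp])
qed

lemma subset_M: "(!!a b c d s. H a b c d s ==> M a b c d s : Y) ==> {M a b c d s | a b c d s. H a b c d s} <= Y"
by blast

text \<open>The squares of \<open>x_3\<close> and \<open>x_4\<close> are combinations of those of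
  \<open>x_1\<close> and \<open>x_2\<close>, so both exponents can be lowered below 2 without
  changing the degree.\<close>

lemma M_normal: "M a b c d s : acl B.S {M a' b' c' d' s' | a' b' c' d' s'. c' <= 1 & d' <= 1 & VV a' b' c' d' = VV a b c d}"
proof (induction "c + d" arbitrary: a b c d s rule: less_induct)
case less
let ?Z = "{M a' b' c' d' s' | a' b' c' d' s'. c' <= 1 & d' <= 1 & VV a' b' c' d' = VV a b c d}"
consider (n) "c <= 1" "d <= 1" | (d) e where "d = e + 2" | (c) e where "c = e + 2"
 by (metis add.commute le_add_diff_inverse nat_le_linear not_less_eq_eq numeral_2_eq_2 One_nat_def)
thus ?case
proof cases
 case n
 hence "M a b c d s : ?Z" by blast
 thus ?thesis by (rule abelian_group.acl_base[OF S_ab(2) M_carrier])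
next
 case d
 have "VV a (b + 2) c e = VV a b c d" "VV (a + 2) b c e = VV a b c d" unfolding d by (rule V_even; simp)+
 hence "M a (b + 2) c e s : acl B.S ?Z" "M (a + 2) b c e (- \<epsilon> * s) : acl B.S ?Z"
  using less[of c e a "b + 2" s] less[of c e "a + 2" b "- \<epsilon> * s"] unfolding d by simp_all
 thus ?thesis unfolding d M_relations(4) by (rule abelian_group.acl_plus[OF S_ab(2) M_carrier])
next
 case c
 have "VV a (b + 2) e d = VV a b c d" "VV (a + 2) b e d = VV a b c d" unfolding c by (rule V_even; simp)+
 hence "M a (b + 2) e d s : acl B.S ?Z" "M (a + 2) b e d (- s) : acl B.S ?Z"
  using less[of e d a "b + 2" s] less[of e d "a + 2" b "- s"] unfolding c by simp_all
 thus ?thesis unfolding c M_relations(3) by (rule abelian_group.acl_plus[OF S_ab(2) M_carrier])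
qed
qed

lemma pi_image:
assumes pi: "is_pi \<pi>" and "even (a - b)" "even (a - c)" shows "V a b c d : \<pi> ` carrier L6"
proof -
obtain x y where "a = b + 2 * x" "a = c + 2 * y" using assms(2,3) by (elim evenE) (metis add.commute diff_add_cancel)
\<comment> \<open>The entry \<open>2 * y - x\<close> is chosen so that the coordinate sums agree, as
  \<open>V_even\<close> demands.\<close>
hence "V a b c d = \<pi> (U d (2 * y - x) c)" unfolding pi_U[OF pi] by (intro V_even) presburger+
thus ?thesis using U_ops(5) by blast
qed

lemma dgB: "B.dg (V a b c d) = a + b + c + d"
unfolding V_def B.dg_el I2 by simp

text \<open>Splitting off the even powers of \<open>x_1\<close>, \<open>x_2\<close>,
  \<open>x_3\<close> and all of \<open>x_4\<close>, whose degree lies in the image of \<pi>, leaves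
  one of eight squarefree monomials.\<close>

lemma finite_generation:
assumes pi: "is_pi \<pi>"
shows "EX G. finite G & (ALL (g, d):G. d : carrier L2 & g : cmp B.S d) &
 (ALL x:carrier L2. cmp B.S x <= acl B.S {s *[B.S] g | s g d u. (g, d) : G &
  u : carrier L6 & \<pi> u *[L2] d = x & s : cmp B.S (\<pi> u)})"
proof (intro exI conjI ballI)
let ?G = "(%(a, b, c). (M a b c 0 1, VV a b c 0)) ` ({0, 1} \<times> {0, 1} \<times> {0, 1})"
show "finite ?G" by simp
show "case z of (g, d) => d : carrier L2 & g : cmp B.S d" if "z : ?G" for z
 using that M_comp[of _ _ _ 0 1] V_ops(4) by (auto simp del: of_nat_0 of_nat_1)
fix x assume x: "x : carrier L2"
let ?Z = "{s *[B.S] g | s g d u. (g, d) : ?G & u : carrier L6 & \<pi> u *[L2] d = x & s : cmp B.S (\<pi> u)}"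
have "M a b c d s : ?Z" if x: "VV a b c d = x" for a b c d s
proof -
 let ?h = "%n :: nat. 2 * (n div 2)"
 have h1: "?h n + n mod 2 = n" for n by simp
 have "int (?h n) + int (n mod 2) = int n" for n unfolding of_nat_add[symmetric] h1 ..
 note h = h1 this
 have e1: "M a b c d s = M (?h a) (?h b) (?h c) d s *[B.S] M (a mod 2) (b mod 2) (c mod 2) 0 1" unfolding M_mult h by simp
 have "VV (?h a) (?h b) (?h c) d : \<pi> ` carrier L6" by (rule pi_image[OF pi]) simp_all
 then obtain u where e3: "u : carrier L6" and u: "VV (?h a) (?h b) (?h c) d = \<pi> u" by (rule imageE)
 have b2: "n mod 2 : {0, 1}" for n :: nat by (simp add: mod2_eq_if)
 have e2: "(M (a mod 2) (b mod 2) (c mod 2) 0 1, VV (a mod 2) (b mod 2) (c mod 2) 0) : ?G"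
  by (rule image_eqI[of _ _ "(a mod 2, b mod 2, c mod 2)"]) (simp, intro SigmaI b2)
 have "VV (?h a) (?h b) (?h c) d *[L2] VV (a mod 2) (b mod 2) (c mod 2) 0 = x" unfolding V_ops(1) h x[symmetric] by simp
 note e4 = this[unfolded u]
 note e5 = M_comp[of "?h a" "?h b" "?h c" d s, unfolded u]
 show ?thesis by (intro CollectI exI conjI, rule e1, rule e2, rule e3, rule e4, rule e5)
qed
hence "{M a b c d s | a b c d s. VV a b c d = x} <= ?Z" by (rule subset_M)
thus "cmp B.S x <= acl B.S ?Z" by (rule order_trans[OF comp_M acl_mono])
qed

text \<open>It suffices that a divisor \<open>x_1^t1 x_2^t2 x_3^t3\<close> of large degree has
  prescribed parities. After reduction by \<open>M_normal\<close>, \<open>x_1\<close> or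
  \<open>x_2\<close> has a large exponent, and its powers alone realise two of the four parity
  patterns. For the other two a square is traded by \<open>x_1^2 = x_2^2 - x_3^2\<close> or
  \<open>x_2^2 = x_1^2 + x_3^2\<close>.\<close>

lemma ideal_generation:
assumes pi: "is_pi \<pi>" and l: "l : carrier L2"
shows "EX k. ALL x:carrier L2. k <= B.dg x --> cmp B.S x<=
  acl B.S {s *[B.S] t | s t c d. c : carrier L2 & d : carrier L2 &
   c *[L2] l : \<pi> ` carrier L6 & m <= B.dg c & 0 <= B.dg d &
   d *[L2] c = x & s : cmp B.S d & t : cmp B.S c}"
proof (intro exI ballI impI)
define n where "n = nat m"
have m: "m <= int n" by (simp add: n_def)
obtain l1 l2 l3 l4 where l: "l = V l1 l2 l3 l4" using V_ex[OF l] by blast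
\<comment> \<open>With \<open>c\<close> and \<open>d\<close> at most 1, one of \<open>a\<close> and
  \<open>b\<close> is at least \<open>2 n + 3\<close>: up to \<open>2 n + 1\<close> for the divisor
  and 2 for the traded square.\<close>
fix x assume x: "x : carrier L2" and k: "2 * (2 * int n + 3) + 2 <= B.dg x"
let ?Z = "{s *[B.S] t | s t c d. c : carrier L2 & d : carrier L2 &
   c *[L2] l : \<pi> ` carrier L6 & m <= B.dg c & 0 <= B.dg d &
   d *[L2] c = x & s : cmp B.S d & t : cmp B.S c}"
have Z: "?Z <= carrier B.S" using GB.comp_carrier B.S_sel(5) B.SS.m_closed by auto
have piece: "M a b c d s : acl B.S ?Z"
 if "t1 <= a" "t2 <= b" "t3 <= c" "n <= t1 + t2 + t3" "VV a b c d = x"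
  "even (int t1 - int t2 + (l1 - l2))" "even (int t1 - int t3 + (l1 - l3))" for t1 t2 t3 a b c d s
proof -
 have "M a b c d s = M (a - t1) (b - t2) (c - t3) d s *[B.S] M t1 t2 t3 0 1" unfolding M_mult using that(1-3) by simp
 moreover have "VV t1 t2 t3 0 *[L2] l : \<pi> ` carrier L6"
  unfolding l V_ops(1) using that(6,7) by (intro pi_image[OF pi]) (simp_all add: algebra_simps)
 moreover have "m <= B.dg (VV t1 t2 t3 0)" "0 <= B.dg (VV (a - t1) (b - t2) (c - t3) d)" unfolding dgB using m that(4) by linarith+
 moreover have "VV (a - t1) (b - t2) (c - t3) d *[L2] VV t1 t2 t3 0 = x"
  unfolding V_ops(1) that(5)[symmetric] using that(1-3) by (simp add: of_nat_diff)
 ultimately have "M a b c d s : ?Z"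
  using M_comp[of "a - t1" "b - t2" "c - t3" d s] M_comp[of t1 t2 t3 0 1] V_ops(4) by (intro CollectI exI conjI)
 thus ?thesis by (rule abelian_group.acl_base[OF S_ab(2) Z])
qed
have plus: "y +[B.S] z : acl B.S ?Z" if "y : acl B.S ?Z" "z : acl B.S ?Z" for y z
 using abelian_group.acl_plus[OF S_ab(2) Z that] .
have mem: "M a b c d s : acl B.S ?Z" if cd: "c <= 1" "d <= 1" and v: "VV a b c d = x" for a b c d s
proof -
 have "2 * (2 * int n + 3) + 2 <= int a + int b + int c + int d" using k unfolding v[symmetric] dgB .
 hence "2 * n + 3 <= a | 2 * n + 3 <= b" using cd by presburger
 then consider (a) e where "a = e + 2 * n + 1 + 2" | (b) e where "b = e + 2 * n + 1 + 2"
  by (metis add.assoc add.commute le_iff_add numeral_plus_one semiring_norm(5) one_plus_numeral)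
 thus ?thesis
 proof cases
  case a
  have V: "VV (e + 2 * n + 1) (b + 2) c d = x" "VV (e + 2 * n + 1) b (c + 2) d = x"
   unfolding v[symmetric] a by (rule V_even; simp)+
  consider "even (l1 - l2)" "even (l1 - l3)" | "odd (l1 - l2)" "odd (l1 - l3)" | "odd (l1 - l2)" "even (l1 - l3)" | "even (l1 - l2)" "odd (l1 - l3)" by blast
  thus ?thesis
  proof cases
   case 1 thus ?thesis by (intro piece[of "2 * n" a 0 b 0 c] v) (simp_all add: a)
  next
   case 2 thus ?thesis by (intro piece[of "2 * n + 1" a 0 b 0 c] v) (simp_all add: a)
  next
   case 3 thus ?thesis unfolding a M_relations(1)
    by (intro plus piece[OF _ _ _ _ V(1), of "2 * n" 1 0] piece[OF _ _ _ _ V(2), of "2 * n + 1" 0 1]) simp_all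
  next
   case 4 thus ?thesis unfolding a M_relations(1)
    by (intro plus piece[OF _ _ _ _ V(1), of "2 * n + 1" 1 0] piece[OF _ _ _ _ V(2), of "2 * n" 0 1]) simp_all
  qed
 next
  case b
  have V: "VV (a + 2) (e + 2 * n + 1) c d = x" "VV a (e + 2 * n + 1) (c + 2) d = x"
   unfolding v[symmetric] b by (rule V_even; simp)+
  consider "even (l1 - l2)" "even (l1 - l3)" | "odd (l1 - l2)" "odd (l1 - l3)" | "odd (l1 - l2)" "even (l1 - l3)" | "even (l1 - l2)" "odd (l1 - l3)" by blast
  thus ?thesis
  proof cases
   case 1 thus ?thesis by (intro piece[of 0 a "2 * n" b 0 c] v) (simp_all add: b)
  next
   case 3 thus ?thesis by (intro piece[of 0 a "2 * n + 1" b 0 c] v) (simp_all add: b)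
  next
   case 2 thus ?thesis unfolding b M_relations(2)
    by (intro plus piece[OF _ _ _ _ V(1), of 1 "2 * n" 0] piece[OF _ _ _ _ V(2), of 0 "2 * n + 1" 1]) simp_all
  next
   case 4 thus ?thesis unfolding b M_relations(2)
    by (intro plus piece[OF _ _ _ _ V(1), of 1 "2 * n + 1" 0] piece[OF _ _ _ _ V(2), of 0 "2 * n" 1]) simp_all
  qed
 qed
qed
have "M a b c d s : acl B.S ?Z" if "VV a b c d = x" for a b c d s
proof -
 have "{M a' b' c' d' s' | a' b' c' d' s'. c' <= 1 & d' <= 1 & VV a' b' c' d' = VV a b c d} <= acl B.S ?Z"
  unfolding that by (rule subset_M, elim conjE, rule mem)
 from abelian_group.acl_subI[OF S_ab(2) this Z] show ?thesis using M_normal[of a b c d s] by blast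
qed
hence "{M a b c d s | a b c d s. VV a b c d = x} <= acl B.S ?Z" by (rule subset_M)
from abelian_group.acl_subI[OF S_ab(2) this Z] show "cmp B.S x <= acl B.S ?Z" by (rule order_trans[OF comp_M])
qed

end

section \<open>Sums of components and the graded isomorphism\<close>

lemma image_acl:
assumes f: "addmap M N f" "abelian_group M" "abelian_group N" and Y: "Y <= carrier M"
shows "f ` acl M Y = acl N (f ` Y)"
proof
show "f ` acl M Y <= acl N (f ` Y)" using addmap_acl[OF f Y] by blast
have c: "acl M Y <= carrier M" by (rule abelian_group.acl_closed[OF f(2) Y])
show "acl N (f ` Y) <= f ` acl M Y"
proof (rule acl_least)
 show "0[N] : f ` acl M Y" using addmap_zero[OF f] acl_zero[of M Y] by (metis imageI)
 fix x y assume "x : f ` Y" "y : f ` acl M Y"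
 then obtain a b where "a : Y" "x = f a" "b : acl M Y" "y = f b" by blast
 moreover have "f (a +[M] b) = f a +[N] f b" using addmap_add[OF f(1)] calculation c Y by blast
 ultimately show "x +[N] y : f ` acl M Y" using acl_add[of a Y b M] by (metis imageI)
qed
qed

text \<open>\<open>sum_of_components\<close> allows one summand per degree, so a further summand is
  merged into the one already present in its degree.\<close>

lemma (in galg) sum_of_components_acl:
assumes Y: "Y <= carrier L" shows "sum_of_components S Y = acl S (UN y:Y. cmp S y)" (is "_ = acl S ?X")
proof
have X: "?X <= carrier S" using Y comp_carrier by blast
show "sum_of_components S Y <= acl S ?X"
proof
 fix x assume "x : sum_of_components S Y"
 then obtain f Y' where f: "x = finsum S f Y'" "finite Y'" "Y' <= Y" "ALL y:Y'. f y : cmp S y" unfolding sum_of_components_def by blast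
 show "x : acl S ?X" unfolding f(1) using f(2-4)
 proof (induction rule: finite_induct)
  case empty thus ?case using acl_zero[of S] by simp
 next
  case (insert y Y')
  hence "f y : ?X" "f : Y' \<rightarrow> carrier S" "f y : carrier S" using X by blast+
  thus ?case using insert acl_add[of "f y" ?X _ S] by simp
 qed
qed
show "acl S ?X <= sum_of_components S Y"
proof (rule acl_least)
 show "0[S] : sum_of_components S Y" unfolding sum_of_components_def by (rule CollectI, rule exI, rule exI[of _ "{}"]) simp
 fix x s assume "x : ?X" "s : sum_of_components S Y"
 then obtain f Y' y where f: "s = finsum S f Y'" "finite Y'" "Y' <= Y" "ALL y:Y'. f y : cmp S y" "y : Y" "x : cmp S y"
  unfolding sum_of_components_def by blast
 define g where "g z = (if z = y then x +[S] (if y : Y' then f y else 0[S]) else f z)" for z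
 have yL: "y : carrier L" using f Y by blast
 interpret C: additive_subgroup "cmp S y" S by (rule comp_sub[OF yL])
 have fc: "f z : carrier S" if "z : Y'" for z using that f Y comp_carrier by blast
 have xc: "x : carrier S" using f comp_carrier yL by blast
 have gy: "g y : cmp S y" unfolding g_def using f by simp
 have g: "ALL z:insert y Y'. g z : cmp S z" 
 proof
  fix z assume "z : insert y Y'"
  thus "g z : cmp S z" using gy f(4) by (cases "z = y") (simp_all add: g_def)
 qed
 have "finsum S g (insert y Y') = finsum S g (insert y (Y' - {y}))" by simp
 also have "... = g y +[S] finsum S g (Y' - {y})"
  using f(2) fc gy C.a_subset by (intro SR.finsum_insert) (auto simp: g_def)
 also have "finsum S g (Y' - {y}) = finsum S f (Y' - {y})" using fc by (intro SR.finsum_cong') (auto simp: g_def)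
 also have "g y +[S] finsum S f (Y' - {y}) = x +[S] finsum S f Y'"
 proof (cases "y : Y'")
  case True
  have "finsum S f Y' = finsum S f (insert y (Y' - {y}))" using True by (simp add: insert_absorb)
  also have "... = f y +[S] finsum S f (Y' - {y})" using f(2) fc True by (intro SR.finsum_insert) auto
  finally have fs: "finsum S f Y' = f y +[S] finsum S f (Y' - {y})" .
  have "finsum S f (Y' - {y}) : carrier S" using fc by (intro SR.finsum_closed) auto
  thus ?thesis unfolding fs g_def using True xc fc by (simp add: SR.a_assoc)
 next
  case False
  thus ?thesis using xc by (simp add: g_def)
 qed
 finally show "x +[S] s : sum_of_components S Y"
  unfolding sum_of_components_def f(1) using f(2,3,5) g by (intro CollectI exI[of _ g] exI[of _ "insert y Y'"]) simp
qed
qed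

lemma pushforward_algebra_sel:
"carrier (pushforward_algebra K \<pi> S) = carrier S" "monoid.mult (pushforward_algebra K \<pi> S) = monoid.mult S"
"one (pushforward_algebra K \<pi> S) = one S" "add (pushforward_algebra K \<pi> S) = add S"
"smap (pushforward_algebra K \<pi> S) = smap S"
"gg (pushforward_algebra K \<pi> S) = K(|carrier := \<pi> ` carrier (gg S)|)"
"cmp (pushforward_algebra K \<pi> S) x = sum_of_components S {y : carrier (gg S). \<pi> y = x}"
by (cases S; simp add: pushforward_algebra_def)+

lemma restrict_algebra_sel:
"carrier (restrict_algebra H S) = sum_of_components S H" "monoid.mult (restrict_algebra H S) = monoid.mult S"
"one (restrict_algebra H S) = one S" "add (restrict_algebra H S) = add S"
"smap (restrict_algebra H S) = smap S"
"gg (restrict_algebra H S) = (gg S)(|carrier := H|)"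
"cmp (restrict_algebra H S) = cmp S"
by (cases S; simp add: restrict_algebra_def)+

context elliptic
begin

lemma gpair:
fixes e :: "nat \<times> 'k => 'u"
assumes pi: "is_pi \<pi>" and phi: "is_phi \<epsilon> \<Delta> \<phi>" and e: "inj e"
shows "gpair TYPE('u) A.S A.dg A.pr A.XS B.S B.dg B.pr B.XS \<pi> \<phi> psi"
proof (rule gpair.intro[OF A.S_galg B.S_galg gpair_axioms.intro], unfold A.S_sel(5) B.S_sel(5))
show "\<pi> : hom L6 L2" using pi by (simp add: pi_iff)
show "B.dg (\<pi> u) = A.dg u" if uL: "u : carrier L6" for u
proof -
 obtain i j k where u: "u = U i j k" using U_ex[OF uL] by blast
 have "A.dg (U i j k) = i + 2 * j + 3 * k" unfolding U_def A.dg_el I6 by simp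
 thus ?thesis unfolding u pi_U[OF pi] dgB by simp
qed
show "\<phi> : ring_hom A.S B.S" using phi by (simp add: is_phi_cl algebra_hom_def)
qed (fact phi_comp[OF pi phi] psi_addmap psi_mult[OF phi] psi_one phi_dec[OF pi phi] kernel_finite[OF pi]
ideal_generation[OF pi] finite_generation[OF pi] A.S_lepoll[OF e] B.S_lepoll[OF e])+

lemma phi_component:
assumes pi: "is_pi \<pi>" and phi: "is_phi \<epsilon> \<Delta> \<phi>" and u: "u : carrier L6"
shows "\<phi> ` sum_of_components A.S {v : carrier L6. \<pi> v = \<pi> u} = cmp B.S (\<pi> u)"
 and "cmp B.S (\<pi> u) <= \<phi> ` carrier A.S"
proof -
have h: "\<phi> : ring_hom A.S B.S" using phi by (simp add: is_phi_cl algebra_hom_def)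
have ad: "addmap A.S B.S \<phi>" using h by (auto simp: addmap_def ring_hom_closed ring_hom_add)
let ?Y = "UN v:{v : carrier L6. \<pi> v = \<pi> u}. cmp A.S v"
have Y: "?Y <= carrier A.S" using GA.comp_carrier A.S_sel(5) by auto
have s: "sum_of_components A.S {v : carrier L6. \<pi> v = \<pi> u} = acl A.S ?Y"
 by (rule GA.sum_of_components_acl) (auto simp: A.S_sel(5))
have i: "\<phi> ` acl A.S ?Y = acl B.S (\<phi> ` ?Y)" by (rule image_acl[OF ad S_ab Y])
show 1: "\<phi> ` sum_of_components A.S {v : carrier L6. \<pi> v = \<pi> u} = cmp B.S (\<pi> u)"
 unfolding s i
proof
 show "acl B.S (\<phi> ` ?Y) <= cmp B.S (\<pi> u)"
  by (rule abelian_group.acl_subgroup[OF S_ab(2) B.comp_subgroup]) (use phi_comp[OF pi phi] in force)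
 have "{\<phi> a | a v. v : carrier L6 & \<pi> v = \<pi> u & a : cmp A.S v} = \<phi> ` ?Y" by blast
 thus "cmp B.S (\<pi> u) <= acl B.S (\<phi> ` ?Y)" using phi_dec[OF pi phi u] by simp
qed
show "cmp B.S (\<pi> u) <= \<phi> ` carrier A.S"
 unfolding 1[symmetric] s using abelian_group.acl_closed[OF S_ab(1) Y] by (rule image_mono)
qed

lemma phi_carrier:
assumes pi: "is_pi \<pi>" and phi: "is_phi \<epsilon> \<Delta> \<phi>"
shows "\<phi> ` carrier A.S = sum_of_components B.S (\<pi> ` carrier L6)"
proof -
have h: "\<phi> : ring_hom A.S B.S" using phi by (simp add: is_phi_cl algebra_hom_def)
have ad: "addmap A.S B.S \<phi>" using h by (auto simp: addmap_def ring_hom_closed ring_hom_add)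
have p: "\<pi> ` carrier L6 <= carrier L2" using pi by (auto simp: pi_iff hom_def)
have s: "sum_of_components B.S (\<pi> ` carrier L6) = acl B.S (UN x:\<pi> ` carrier L6. cmp B.S x)"
 using GB.sum_of_components_acl p B.S_sel(5) by simp
let ?Y = "UN u:carrier L6. cmp A.S u"
have Y: "?Y <= carrier A.S" using GA.comp_carrier A.S_sel(5) by auto
have "carrier A.S = acl A.S ?Y"
 using GA.comp_gen abelian_group.acl_closed[OF S_ab(1) Y] A.S_sel(5) by (intro equalityI) simp_all
hence i: "\<phi> ` carrier A.S = acl B.S (\<phi> ` ?Y)" using image_acl[OF ad S_ab Y] by simp
show ?thesis unfolding s
proof
 have "\<phi> ` ?Y <= (UN x:\<pi> ` carrier L6. cmp B.S x)" using phi_comp[OF pi phi] by blast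
 thus "\<phi> ` carrier A.S <= acl B.S (UN x:\<pi> ` carrier L6. cmp B.S x)" unfolding i by (rule acl_mono)
 have fY: "\<phi> ` ?Y <= carrier B.S" using Y addmap_closed[OF ad] by blast
 have "(UN x:\<pi> ` carrier L6. cmp B.S x) <= acl B.S (\<phi> ` ?Y)"
  using phi_component(2)[OF pi phi] unfolding i by blast
 thus "acl B.S (UN x:\<pi> ` carrier L6. cmp B.S x) <= \<phi> ` carrier A.S"
  unfolding i by (rule abelian_group.acl_subI[OF S_ab(2) _ fY])
qed
qed

lemma phi_iso:
assumes pi: "is_pi \<pi>" and phi: "is_phi \<epsilon> \<Delta> \<phi>"
shows "\<phi> : graded_algebra_iso (pushforward_algebra L2 \<pi> A.S) (restrict_algebra (\<pi> ` carrier L6) B.S)"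
proof -
have h: "\<phi> : ring_hom A.S B.S" "!!c. \<phi> (smap A.S c) = smap B.S c" using phi by (simp_all add: is_phi_cl algebra_hom_def)
have inj: "inj_on \<phi> (carrier A.S)" by (rule inj_on_inverseI[of _ psi]) (rule psi_phi[OF phi])
have im: "\<phi> ` carrier A.S = sum_of_components B.S (\<pi> ` carrier L6)" by (rule phi_carrier[OF pi phi])
show ?thesis
 unfolding graded_algebra_iso_def algebra_hom_def ring_hom_def pushforward_algebra_sel restrict_algebra_sel A.S_sel(5) B.S_sel(5)
 using h inj im phi_component(1)[OF pi phi] by (auto simp: bij_betw_def ring_hom_def)
qed

end

theorem proposition3p4:
  fixes \<epsilon> \<Delta> :: "'k::field"
  assumes "\<epsilon> ^ 2 - \<epsilon> + 1 = 0"
    and "\<Delta> \<noteq> 0"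
    and "\<Delta> ^ 2 = 6 * \<epsilon> - 3"
    and universe: "\<exists>e :: nat \<times> 'k \<Rightarrow> 'u. inj e"
  shows "(\<exists>!\<pi>. is_pi \<pi> \<and> \<pi> \<in> extensional (carrier (string_group w632))) \<and>
    (\<exists>!\<phi>. is_phi \<epsilon> \<Delta> \<phi> \<and> \<phi> \<in> extensional (carrier S632)) \<and>
    (\<forall>\<pi> \<phi>. is_pi \<pi> \<longrightarrow> is_phi \<epsilon> \<Delta> \<phi> \<longrightarrow>
       admissible w632 w2222 \<pi> \<and>
       (\<forall>u \<in> carrier (string_group w632).
          \<phi> ` component S632 u \<subseteq> component (S2222 \<epsilon>) (\<pi> u)) \<and>
       \<phi> ` carrier (pushforward_algebra (string_group w2222) \<pi> S632) =
         carrier (restrict_algebra (\<pi> ` carrier (string_group w632)) (S2222 \<epsilon>)) \<and>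
       \<phi> \<in> graded_algebra_iso
         (pushforward_algebra (string_group w2222) \<pi> S632)
         (restrict_algebra (\<pi> ` carrier (string_group w632)) (S2222 \<epsilon>))) \<and>
    (\<exists>F. is_equivalence
       (coh_equivariant TYPE('u) (S632 :: ('k mpoly set, 'k, str) graded_algebra)
          (generate (string_group w632) {dualizing w632 [^]\<^bsub>string_group w632\<^esub> (2::nat)}))
       (coh TYPE('u) (S2222 \<epsilon>)) F)"
proof -
interpret elliptic \<epsilon> \<Delta> by (rule elliptic.intro[OF assms(1-3)])
obtain e :: "nat \<times> 'k => 'u" where e: "inj e" using universe by (rule exE)
obtain \<pi> where pi: "is_pi \<pi>" using pi_ex by (elim bexE conjE)
obtain \<phi> where phi: "is_phi \<epsilon> \<Delta> \<phi>" using phi_ex by (rule bexE)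
note g = gpair[OF pi phi e]
\<comment> \<open>The acting group of the theorem is the full kernel of the chosen \<pi>, which is
  the group to which the general equivalence applies.\<close>
have N: "gpair.N A.S B.S \<pi> = generate L6 {dualizing w632 ^[L6] (2::nat)}"
 unfolding gpair.N_def[OF g] A.S_sel(5) B.S_sel(5) by (rule kernel_generated[OF pi])
show ?thesis unfolding S_eq
proof (intro conjI allI impI ballI)
 fix \<pi> \<phi> assume p: "is_pi \<pi>" and f: "is_phi \<epsilon> \<Delta> \<phi>"
 show "\<phi> ` cmp A.S u <= cmp B.S (\<pi> u)" if "u : carrier L6" for u
  using phi_comp[OF p f that] by (rule image_subsetI)
 show "\<phi> ` carrier (pushforward_algebra L2 \<pi> A.S) = carrier (restrict_algebra (\<pi> ` carrier L6) B.S)"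
  unfolding pushforward_algebra_sel restrict_algebra_sel by (rule phi_carrier[OF p f])
 show "admissible w632 w2222 \<pi>" by (rule pi_admissible[OF p])
 show "\<phi> : graded_algebra_iso (pushforward_algebra L2 \<pi> A.S) (restrict_algebra (\<pi> ` carrier L6) B.S)"
  by (rule phi_iso[OF p f])
next
 show "EX F. is_equivalence (coh_equivariant TYPE('u) A.S (generate L6 {dualizing w632 ^[L6] (2::nat)})) (coh TYPE('u) B.S) F"
  using gpair.equivalence[OF g] unfolding N .
qed (fact pi_unique phi_unique)+
qed

end
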